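(* Let $a:=\max_{\ell\ge1}a_\ell>0$, $\Lambda:=\{\ell\in\mathbb{N}:a_\ell=a\}$ and $\kappa^*:=2/a$. Suppose there exist a nonempty subset $\Lambda'\subseteq\Lambda$, $\delta>0$ and a non-trivial $C^1$ branch of bifurcating solutions $(\underline p(s),\kappa(s))$ locally around $\kappa^*$ of the form $$\underline p(s)=s\sum_{i\in\Lambda'}y_ie_i+O(s^2),\qquad\underline p'(s)=\sum_{i\in\Lambda'}y_ie_i+O(s),\qquad\kappa(s)\in(0,\kappa^* )\ \text{ for all } s\in(0,\delta),$$ where $y_i\ne0$ for all $i\in\Lambda'$. Then the transition point $\kappa_c$ satisfies $\kappa_c<\kappa^*$ and $\kappa_c$ is a discontinuous transition point. Moreover, there exists $\epsilon>0$ such that for any potential $\tilde W(\theta)=\sum_{\ell=1}^\infty\tilde a_\ell\cos\ell\theta$ with $\sum_{\ell=1}^\infty|a_\ell-\tilde a_\ell|<\epsilon$, one has $\tilde a:=\max_{\ell\ge1}\tilde a_\ell>0$, and the free energy of the McKean-Vlasov equation with potential $\tilde W$ has a discontinuous transition point $\tilde\kappa_c<2/\tilde a$.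
   Context: $\mathbb{S}^1=[0,2\pi)$. The potential $W(\theta)=\sum_{\ell\ge1}a_\ell\cos\ell\theta$ is even and square integrable. Densities are with respect to $d\theta/2\pi$. The stationary McKean-Vlasov equation is $p''=\kappa(p(W\star p)')'$ with $(W\star p)(\theta)=\frac1{2\pi}\int_0^{2\pi}W(\theta-\phi)p(\phi)d\phi$, $\kappa>0$. An even probability density $p\in H^1(\mathbb{S}^1)$ is identified with its Fourier modes $\underline p=(p_\ell)_{\ell\ge1}$, $p_\ell=\frac1{2\pi}\int_0^{2\pi}p\cos\ell\theta\,d\theta$, in $\ell^2_w=\{\underline x:\sum(1+\ell^2)x_\ell^2<\infty\}$; $\{e_j\}$ is the canonical basis, and $O(\cdot)$ terms and derivatives are in the $\ell^2_w$ norm. A non-trivial branch of bifurcating solutions around $\kappa^*$ is a continuous curve $s\mapsto(\underline p(s),\kappa(s))$ from $(-\delta,\delta)$ to $\ell^2_w\times(0,\infty)$ of (modes of) stationary solutions with $(\underline p(0),\kappa(0))=(\underline0,\kappa^* )$, meeting the axis $\{(\underline 0,\kappa)\}$ at at most one $s$. Let $\mathcal{P}^+_{ac}(\mathbb{S}^1)$ be the set of absolutely continuous probability measures with strictly positive density. The free energy is $$\mathcal{F}(\rho,\kappa)=\frac1{2\pi}\int_0^{2\pi}\rho\log\rho\,d\theta-\frac{\kappa}{8\pi^2}\int_0^{2\pi}\!\!\int_0^{2\pi}W(\theta-\phi)\rho(\theta)\rho(\phi)\,d\theta d\phi,\quad\rho\in\mathcal{P}^+_{ac}(\mathbb{S}^1).$$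 Let $p_0\equiv1$ be the uniform density. $\kappa_c>0$ is a transition point if (i) for $\kappa<\kappa_c$, $p_0$ is the unique global minimizer of $\mathcal{F}(\cdot,\kappa)$; (ii) at $\kappa=\kappa_c$, $p_0$ is a global minimizer; (iii) for $\kappa>\kappa_c$ there is a global minimizer $\rho_\kappa\in\mathcal{P}^+_{ac}(\mathbb{S}^1)$ with $\rho_\kappa\neq p_0$. It is a continuous transition point if $p_0$ is the unique minimizer at $\kappa_c$ and, for any family of minimizers $\{\rho_\kappa:\kappa>\kappa_c\}$, $\lim_{\kappa\downarrow\kappa_c}\|\rho_\kappa-p_0\|_{H^1}=0$, where $\|p\|_{H^1}^2=\int_0^{2\pi}(p^2+|p'|^2)d\theta$; it is discontinuous if at least one of these two conditions is violated.
   Formalization: The existence of a transition point for W itself is assumed; for merely square integrable W it can fail (e.g. a_ℓ = ℓ^(-2/3), where the free energy is unbounded below for every κ > 0). For the perturbed potentials existence is proved. *)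

theory Defs
  imports "HOL-Analysis.Analysis" "HOL-Library.Landau_Symbols"
begin

section \<open>The circle and its function spaces\<close>

text \<open>
  A function on the circle is a function on the reals of which only the values on
  \<open>[0, 2\<pi>)\<close> matter (up to null sets). Only the potential \<open>W\<close>, which is evaluated at
  differences of angles, is required to be periodic on the whole line.
\<close>

definition circ :: "real measure" where
  "circ = restrict_space lborel {0..<2*pi}"

definition smooth_periodic :: "(real \<Rightarrow> real) \<Rightarrow> bool" where
  "smooth_periodic \<phi> \<longleftrightarrow> (\<forall>x. \<phi> (x + 2*pi) = \<phi> x) \<and>
     (\<forall>n x. ((deriv ^^ n) \<phi>) field_differentiable (at x))"

definition L2 :: "(real \<Rightarrow> real) \<Rightarrow> bool" where
  "L2 f \<longleftrightarrow> f \<in> borel_measurable circ \<and> integrable circ (\<lambda>\<theta>. (f \<theta>)\<^sup>2)"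

text \<open>\<open>weak_deriv p g\<close>: \<open>p\<close> lies in the Sobolev space \<open>H\<^sup>1\<close> of the circle, with weak derivative \<open>g\<close>.\<close>

definition weak_deriv :: "(real \<Rightarrow> real) \<Rightarrow> (real \<Rightarrow> real) \<Rightarrow> bool" where
  "weak_deriv p g \<longleftrightarrow> L2 p \<and> L2 g \<and>
     (\<forall>\<phi>. smooth_periodic \<phi> \<longrightarrow>
        (\<integral>\<theta>. p \<theta> * deriv \<phi> \<theta> \<partial>circ) = - (\<integral>\<theta>. g \<theta> * \<phi> \<theta> \<partial>circ))"

text \<open>
  The weak derivative is unique up to null sets, so the infimum runs over at most one value.
  It is \<open>\<infinity>\<close> exactly when \<open>p\<close> is not in \<open>H\<^sup>1\<close>.
\<close>

definition H1_norm :: "(real \<Rightarrow> real) \<Rightarrow> ennreal" where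
  "H1_norm p = (INF g\<in>{g. weak_deriv p g}.
     ennreal (sqrt (\<integral>\<theta>. ((p \<theta>)\<^sup>2 + (g \<theta>)\<^sup>2) \<partial>circ)))"

text \<open>Densities are taken with respect to \<open>d\<theta>/2\<pi>\<close>.\<close>

definition prob_density :: "(real \<Rightarrow> real) \<Rightarrow> bool" where
  "prob_density p \<longleftrightarrow> integrable circ p \<and> (AE \<theta> in circ. 0 \<le> p \<theta>) \<and>
     1 / (2*pi) * (\<integral>\<theta>. p \<theta> \<partial>circ) = 1"

definition Pac_plus :: "(real \<Rightarrow> real) set" where
  "Pac_plus = {\<rho>. prob_density \<rho> \<and> (AE \<theta> in circ. 0 < \<rho> \<theta>)}"

section \<open>Potentials and stationary solutions\<close>

text \<open>
  \<open>W\<close> is an even periodic representative of the \<open>L\<^sup>2\<close> function whose cosine series, converging in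
  \<open>L\<^sup>2\<close>, has the coefficients \<open>a l\<close>, \<open>l \<ge> 1\<close>. The value \<open>a 0\<close> is never used.
\<close>

definition potential :: "(nat \<Rightarrow> real) \<Rightarrow> (real \<Rightarrow> real) \<Rightarrow> bool" where
  "potential a W \<longleftrightarrow> W \<in> borel_measurable borel \<and>
     (\<forall>\<theta>. W (\<theta> + 2*pi) = W \<theta>) \<and> (\<forall>\<theta>. W (- \<theta>) = W \<theta>) \<and>
     integrable circ (\<lambda>\<theta>. (W \<theta>)\<^sup>2) \<and>
     (\<lambda>n. \<integral>\<theta>. (W \<theta> - (\<Sum>l=1..n. a l * cos (real l * \<theta>)))\<^sup>2 \<partial>circ) \<longlonglongrightarrow> 0"

definition is_max :: "real set \<Rightarrow> real \<Rightarrow> bool" where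
  "is_max S m \<longleftrightarrow> m \<in> S \<and> (\<forall>x\<in>S. x \<le> m)"

definition conv :: "(real \<Rightarrow> real) \<Rightarrow> (real \<Rightarrow> real) \<Rightarrow> real \<Rightarrow> real" where
  "conv W p \<theta> = 1 / (2*pi) * (\<integral>\<phi>. W (\<theta> - \<phi>) * p \<phi> \<partial>circ)"

text \<open>
  The equation \<open>p'' = \<kappa> (p (W \<star> p)')'\<close> for \<open>p\<close> in \<open>H\<^sup>1\<close>, in its weak form:
  \<open>g\<close> is \<open>p'\<close> and \<open>h\<close> is \<open>(W \<star> p)'\<close>.
\<close>

definition stationary :: "(real \<Rightarrow> real) \<Rightarrow> real \<Rightarrow> (real \<Rightarrow> real) \<Rightarrow> bool" where
  "stationary W \<kappa> p \<longleftrightarrow> (\<exists>g h. weak_deriv p g \<and> weak_deriv (conv W p) h \<and>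
     (\<forall>\<phi>. smooth_periodic \<phi> \<longrightarrow>
        (\<integral>\<theta>. g \<theta> * deriv \<phi> \<theta> \<partial>circ) = \<kappa> * (\<integral>\<theta>. p \<theta> * h \<theta> * deriv \<phi> \<theta> \<partial>circ)))"

text \<open>On \<open>[0, 2\<pi>)\<close> the reflection of the circle is \<open>\<theta> \<mapsto> 2\<pi> - \<theta>\<close>, apart from \<open>\<theta> = 0\<close>.\<close>

definition even_on_circ :: "(real \<Rightarrow> real) \<Rightarrow> bool" where
  "even_on_circ p \<longleftrightarrow> (AE \<theta> in circ. p (2*pi - \<theta>) = p \<theta>)"

definition mode :: "(real \<Rightarrow> real) \<Rightarrow> nat \<Rightarrow> real" where
  "mode p l = 1 / (2*pi) * (\<integral>\<theta>. p \<theta> * cos (real l * \<theta>) \<partial>circ)"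

section \<open>Branches of solutions in the weighted sequence space\<close>

text \<open>A sequence \<open>(x l)\<close>, \<open>l \<ge> 1\<close>, is a function on \<open>nat\<close> whose value at \<open>0\<close> is ignored.\<close>

definition l2w :: "(nat \<Rightarrow> real) set" where
  "l2w = {x. (\<lambda>l. (1 + (real l)\<^sup>2) * (x l)\<^sup>2) summable_on {1..}}"

definition l2w_norm :: "(nat \<Rightarrow> real) \<Rightarrow> real" where
  "l2w_norm x = sqrt (infsum (\<lambda>l. (1 + (real l)\<^sup>2) * (x l)\<^sup>2) {1..})"

definition unit_seq :: "nat \<Rightarrow> nat \<Rightarrow> real" where
  "unit_seq j = (\<lambda>l. if l = j then 1 else 0)"

definition nontrivial_branch ::
  "(real \<Rightarrow> real) \<Rightarrow> real \<Rightarrow> real \<Rightarrow> (real \<Rightarrow> nat \<Rightarrow> real) \<Rightarrow> (real \<Rightarrow> real) \<Rightarrow> bool" where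
  "nontrivial_branch W \<kappa>s \<delta> P K \<longleftrightarrow>
     (\<forall>s\<in>{-\<delta><..<\<delta>}. P s \<in> l2w \<and> 0 < K s) \<and>
     (\<forall>s\<in>{-\<delta><..<\<delta>}. ((\<lambda>t. l2w_norm (\<lambda>l. P t l - P s l)) \<longlongrightarrow> 0) (at s)) \<and>
     continuous_on {-\<delta><..<\<delta>} K \<and>
     (\<forall>s\<in>{-\<delta><..<\<delta>}. \<exists>p. prob_density p \<and> even_on_circ p \<and> stationary W (K s) p \<and>
        (\<forall>l\<ge>1. mode p l = P s l)) \<and>
     (\<forall>l\<ge>1. P 0 l = 0) \<and> K 0 = \<kappa>s \<and>
     (\<forall>s\<in>{-\<delta><..<\<delta>}. \<forall>t\<in>{-\<delta><..<\<delta>}.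
        (\<forall>l\<ge>1. P s l = 0) \<and> (\<forall>l\<ge>1. P t l = 0) \<longrightarrow> s = t)"

text \<open>\<open>P'\<close> is the derivative of \<open>P\<close> in the \<open>l2w\<close> norm, and \<open>(P, K)\<close> is continuously differentiable.\<close>

definition C1_curve ::
  "real \<Rightarrow> (real \<Rightarrow> nat \<Rightarrow> real) \<Rightarrow> (real \<Rightarrow> nat \<Rightarrow> real) \<Rightarrow> (real \<Rightarrow> real) \<Rightarrow> bool" where
  "C1_curve \<delta> P P' K \<longleftrightarrow>
     (\<forall>s\<in>{-\<delta><..<\<delta>}. P' s \<in> l2w \<and>
        ((\<lambda>t. l2w_norm (\<lambda>l. (P t l - P s l) / (t - s) - P' s l)) \<longlongrightarrow> 0) (at s) \<and>
        ((\<lambda>t. l2w_norm (\<lambda>l. P' t l - P' s l)) \<longlongrightarrow> 0) (at s)) \<and>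
     (\<exists>K'. (\<forall>s\<in>{-\<delta><..<\<delta>}. (K has_real_derivative K' s) (at s)) \<and>
        continuous_on {-\<delta><..<\<delta>} K')"

section \<open>Free energy and transition points\<close>

text \<open>
  The integral of a function as an extended real. Since \<open>\<infinity> - \<infinity> = \<infinity>\<close> in \<open>ereal\<close>, it is \<open>\<infinity>\<close>
  whenever the positive part has infinite integral, whatever the negative part.
\<close>

definition ext_integral :: "'a measure \<Rightarrow> ('a \<Rightarrow> real) \<Rightarrow> ereal" where
  "ext_integral M f =
     enn2ereal (\<integral>\<^sup>+x. ennreal (f x) \<partial>M) - enn2ereal (\<integral>\<^sup>+x. ennreal (- f x) \<partial>M)"

text \<open>
  The free energy is extended-real valued, because the entropy of a density may be infinite and
  \<open>W (\<theta> - \<phi>) \<rho>(\<theta>) \<rho>(\<phi>)\<close> need not be integrable. Where the entropy is \<open>\<infinity>\<close> the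
  free energy is \<open>\<infinity>\<close>, again by \<open>\<infinity> - \<infinity> = \<infinity>\<close>; where the entropy is finite and the
  positive part of the interaction has infinite integral it is \<open>-\<infinity>\<close>.
\<close>

definition free_energy :: "(real \<Rightarrow> real) \<Rightarrow> (real \<Rightarrow> real) \<Rightarrow> real \<Rightarrow> ereal" where
  "free_energy W \<rho> \<kappa> =
     ereal (1 / (2*pi)) * ext_integral circ (\<lambda>\<theta>. \<rho> \<theta> * ln (\<rho> \<theta>))
     - ereal (\<kappa> / (8 * pi\<^sup>2)) *
       ext_integral (circ \<Otimes>\<^sub>M circ) (\<lambda>(\<theta>, \<phi>). W (\<theta> - \<phi>) * \<rho> \<theta> * \<rho> \<phi>)"

definition uniform_density :: "real \<Rightarrow> real" where
  "uniform_density = (\<lambda>_. 1)"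

definition global_minimizer :: "(real \<Rightarrow> real) \<Rightarrow> real \<Rightarrow> (real \<Rightarrow> real) \<Rightarrow> bool" where
  "global_minimizer W \<kappa> \<rho> \<longleftrightarrow> \<rho> \<in> Pac_plus \<and>
     (\<forall>\<sigma>\<in>Pac_plus. free_energy W \<rho> \<kappa> \<le> free_energy W \<sigma> \<kappa>)"

definition unique_global_minimizer :: "(real \<Rightarrow> real) \<Rightarrow> real \<Rightarrow> (real \<Rightarrow> real) \<Rightarrow> bool" where
  "unique_global_minimizer W \<kappa> \<rho> \<longleftrightarrow> global_minimizer W \<kappa> \<rho> \<and>
     (\<forall>\<sigma>. global_minimizer W \<kappa> \<sigma> \<longrightarrow> (AE \<theta> in circ. \<sigma> \<theta> = \<rho> \<theta>))"

definition transition_point :: "(real \<Rightarrow> real) \<Rightarrow> real \<Rightarrow> bool" where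
  "transition_point W \<kappa>c \<longleftrightarrow> 0 < \<kappa>c \<and>
     (\<forall>\<kappa>. 0 < \<kappa> \<and> \<kappa> < \<kappa>c \<longrightarrow> unique_global_minimizer W \<kappa> uniform_density) \<and>
     global_minimizer W \<kappa>c uniform_density \<and>
     (\<forall>\<kappa>>\<kappa>c. \<exists>\<rho>. global_minimizer W \<kappa> \<rho> \<and> \<not> (AE \<theta> in circ. \<rho> \<theta> = uniform_density \<theta>))"

definition continuous_transition_point :: "(real \<Rightarrow> real) \<Rightarrow> real \<Rightarrow> bool" where
  "continuous_transition_point W \<kappa>c \<longleftrightarrow> transition_point W \<kappa>c \<and>
     unique_global_minimizer W \<kappa>c uniform_density \<and>
     (\<forall>\<rho>. (\<forall>\<kappa>>\<kappa>c. global_minimizer W \<kappa> (\<rho> \<kappa>)) \<longrightarrow>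
        ((\<lambda>\<kappa>. H1_norm (\<lambda>\<theta>. \<rho> \<kappa> \<theta> - uniform_density \<theta>)) \<longlongrightarrow> 0) (at_right \<kappa>c))"

definition discontinuous_transition_point :: "(real \<Rightarrow> real) \<Rightarrow> real \<Rightarrow> bool" where
  "discontinuous_transition_point W \<kappa>c \<longleftrightarrow>
     transition_point W \<kappa>c \<and> \<not> continuous_transition_point W \<kappa>c"

end

theory Submission
  imports Defs "HOL-Library.Diagonal_Subsequence"
begin

text \<open>
  The free energy of a density of finite energy is
  \<open>E \<kappa> \<rho> = S \<rho> - \<kappa> / 2 * Q \<rho>\<close>, with the entropy \<open>S \<ge> 0\<close> and the quadratic interaction
  \<open>Q\<close>; both vanish at the uniform density. As \<open>E \<kappa> \<rho>\<close> is affine in \<open>\<kappa>\<close> and \<open>S \<ge> 0\<close>, the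
  \<open>\<kappa>\<close> at which the uniform density is a minimizer form an interval whose right end is the
  transition point. The proof has three parts.

  A transition below \<open>2 / A\<close>, where \<open>A\<close> is the largest coefficient of the potential, is
  discontinuous (\<open>early_transition_discontinuous\<close>). Near the uniform density \<open>S\<close> is at least
  almost half the mean of \<open>(\<rho> - 1)\<^sup>2\<close>, and \<open>Q\<close> is at most \<open>A / 2\<close> times that mean, by Bessel's
  inequality. So for \<open>\<kappa> < 2 / A\<close> the uniform density is a strict minimizer on a fixed uniform
  neighbourhood. By Sobolev's inequality non-uniform minimizers for \<open>\<kappa>\<close> just above
  \<open>\<kappa>\<^sub>c\<close> cannot approach it in \<open>H\<^sup>1\<close>.

  The branch forces the transition below \<open>2 / A\<close> (\<open>branch_lowers_energy\<close>). A stationary solution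
  \<open>p\<close> close to the uniform density satisfies \<open>ln p = \<kappa> * (W \<star> p) + const\<close>
  (\<open>stationary_log_coefficients\<close>), which determines the derivative of the entropy along
  the branch. The energy at the fixed parameter \<open>2 / A\<close> then has the derivative
  \<open>(\<kappa>(s) - 2 / A) * \<Sum>l. a l * p\<^sub>l(s) * p\<^sub>l'(s)\<close>. For small \<open>s > 0\<close> the first factor is negative
  by hypothesis, and the sum is positive because it is asymptotic to
  \<open>s * A * \<Sum>i. (y i)\<^sup>2\<close>. So the energy becomes negative, and the uniform density is no minimizer
  at \<open>2 / A\<close>.

  Negativity of the energy is an open condition on the potential. A change of the coefficients
  that is small in \<open>\<ell>\<^sup>1\<close> changes \<open>W\<close> by a bounded small function, so that the same density has
  negative energy for the new potential at some \<open>\<kappa>\<^sub>1 < 2 / A'\<close>, where \<open>A'\<close> is the new largest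
  coefficient. By Pinsker's inequality the change of
  \<open>Q\<close> is at most a multiple of \<open>S\<close>, so that the uniform density still minimizes for small
  \<open>\<kappa>\<close>. The supremum of these \<open>\<kappa>\<close> is the new transition point, provided that minimizers exist for
  every \<open>\<kappa>\<close> (\<open>transition_point_exists\<close>, \<open>perturbed_transition\<close>).

  Existence (\<open>minimizer_exists\<close>) is the longest step, as a square integrable \<open>W\<close> makes \<open>Q\<close> neither
  bounded nor weakly continuous on densities. What is available is a lower bound of the energy for
  every \<open>\<kappa>\<close>: for the original potential it comes with the transition point, and a bounded change of
  the potential preserves it. The bound at \<open>2 * \<kappa>\<close> makes minimizing sequences at \<open>\<kappa>\<close> have bounded
  entropy, hence weakly compact (\<open>entropy_compactness\<close>). The bound at \<open>\<kappa>\<close>, applied to the normalised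
  part of a density above a high level, shows that this part contributes little to \<open>Q\<close>; the
  rest passes to the limit through its Fourier coefficients, and \<open>Q\<close> is upper semicontinuous along
  the sequence (\<open>interaction_upper_semicontinuous\<close>).
\<close>

section \<open>Square integrable functions\<close>

text \<open>
  The measure is arbitrary because the weak compactness argument works on the product of the circle
  with a discrete set of truncation levels.
\<close>

definition sqint :: "'a measure \<Rightarrow> ('a \<Rightarrow> real) \<Rightarrow> bool" where
  "sqint M f \<longleftrightarrow> f \<in> borel_measurable M \<and> integrable M (\<lambda>x. (f x)\<^sup>2)"

lemma L2_iff_sqint: "L2 f \<longleftrightarrow> sqint circ f"
  by (simp add: L2_def sqint_def)

lemma sqint_measurable: "sqint M f \<Longrightarrow> f \<in> borel_measurable M"
  by (simp add: sqint_def)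

lemma sqint_square: "sqint M f \<Longrightarrow> integrable M (\<lambda>x. (f x)\<^sup>2)"
  by (simp add: sqint_def)

lemma sqint_mult:
  assumes "sqint M f" "sqint M g"
  shows "integrable M (\<lambda>x. f x * g x)"
proof (rule Bochner_Integration.integrable_bound)
  show "integrable M (\<lambda>x. (f x)\<^sup>2 + (g x)\<^sup>2)"
    using assms by (auto simp: sqint_def)
  show "(\<lambda>x. f x * g x) \<in> borel_measurable M"
    using assms by (auto simp: sqint_def)
  show "AE x in M. norm (f x * g x) \<le> norm ((f x)\<^sup>2 + (g x)\<^sup>2)"
  proof (rule AE_I2)
    fix x
    have "2 * \<bar>f x * g x\<bar> \<le> (f x)\<^sup>2 + (g x)\<^sup>2"
      using sum_squares_bound[of "\<bar>f x\<bar>" "\<bar>g x\<bar>"] by (simp add: abs_mult)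
    then show "norm (f x * g x) \<le> norm ((f x)\<^sup>2 + (g x)\<^sup>2)"
      using abs_ge_zero[of "f x * g x"] by simp
  qed
qed

lemma sqint_cmult: "sqint M f \<Longrightarrow> sqint M (\<lambda>x. c * f x)"
  by (auto simp: sqint_def power_mult_distrib)

lemma sqint_add: "sqint M f \<Longrightarrow> sqint M g \<Longrightarrow> sqint M (\<lambda>x. f x + g x)"
  using sqint_mult[of M f g] by (auto simp: sqint_def power2_sum mult.assoc)

lemma sqint_diff: "sqint M f \<Longrightarrow> sqint M g \<Longrightarrow> sqint M (\<lambda>x. f x - g x)"
  using sqint_add[OF _ sqint_cmult[of M g "-1"], of f] by simp

lemma sqint_sum: "(\<And>i. i \<in> I \<Longrightarrow> sqint M (f i)) \<Longrightarrow> sqint M (\<lambda>x. \<Sum>i\<in>I. f i x)"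
proof (induction I rule: infinite_finite_induct)
  case (insert i I)
  then show ?case using sqint_add[of M "f i" "\<lambda>x. \<Sum>i\<in>I. f i x"] by simp
qed (auto simp: sqint_def)

lemma sqint_bounded:
  assumes "finite_measure M" "f \<in> borel_measurable M" "AE x in M. \<bar>f x\<bar> \<le> B"
  shows "sqint M f"
proof -
  have "integrable M (\<lambda>x. (f x)\<^sup>2)"
  proof (rule finite_measure.integrable_const_bound[OF assms(1)])
    show "AE x in M. norm ((f x)\<^sup>2) \<le> B\<^sup>2"
      using assms(3) by eventually_elim (auto simp: abs_le_square_iff[symmetric])
    show "(\<lambda>x. (f x)\<^sup>2) \<in> borel_measurable M" using assms by measurable
  qed
  then show ?thesis using assms by (auto simp: sqint_def)
qed

lemma sqint_bounded_mult:
  assumes "sqint M f" "g \<in> borel_measurable M" "AE x in M. \<bar>g x\<bar> \<le> B"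
  shows "sqint M (\<lambda>x. g x * f x)"
proof -
  have "integrable M (\<lambda>x. (g x * f x)\<^sup>2)"
  proof (rule Bochner_Integration.integrable_bound)
    show "integrable M (\<lambda>x. B\<^sup>2 * (f x)\<^sup>2)" using assms by (auto simp: sqint_def)
    show "(\<lambda>x. (g x * f x)\<^sup>2) \<in> borel_measurable M" using assms by (auto simp: sqint_def)
    show "AE x in M. norm ((g x * f x)\<^sup>2) \<le> norm (B\<^sup>2 * (f x)\<^sup>2)"
      using assms(3) by eventually_elim
        (auto simp: power_mult_distrib abs_le_square_iff[symmetric] intro!: mult_right_mono)
  qed
  then show ?thesis using assms by (auto simp: sqint_def)
qed

lemma sqint_integrable:
  assumes "finite_measure M" "sqint M f"
  shows "integrable M f"
  using sqint_mult[OF assms(2) sqint_bounded[OF assms(1), of "\<lambda>_. 1" 1]] by simp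

lemma sqint_Cauchy_Schwarz:
  assumes "sqint M f" "sqint M g"
  shows "(\<integral>x. \<bar>f x * g x\<bar> \<partial>M)\<^sup>2 \<le> (\<integral>x. (f x)\<^sup>2 \<partial>M) * (\<integral>x. (g x)\<^sup>2 \<partial>M)"
proof -
  have [measurable]: "f \<in> borel_measurable M" "g \<in> borel_measurable M"
    using assms by (auto simp: sqint_def)
  have 1: "(\<integral>\<^sup>+x. ennreal \<bar>f x\<bar> * ennreal \<bar>g x\<bar> \<partial>M) = ennreal (\<integral>x. \<bar>f x * g x\<bar> \<partial>M)"
    using nn_integral_eq_integral[OF integrable_abs[OF sqint_mult[OF assms]]]
    by (simp add: ennreal_mult' abs_mult)
  have 2: "(\<integral>\<^sup>+x. (ennreal \<bar>h x\<bar>)\<^sup>2 \<partial>M) = ennreal (\<integral>x. (h x)\<^sup>2 \<partial>M)" if "sqint M h" for h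
    using nn_integral_eq_integral[OF sqint_square[OF that]] by (simp add: ennreal_power)
  show ?thesis
    using Cauchy_Schwarz_nn_integral[of "\<lambda>x. ennreal \<bar>f x\<bar>" M "\<lambda>x. ennreal \<bar>g x\<bar>"]
    unfolding 1 2[OF assms(1)] 2[OF assms(2)]
    by (simp add: ennreal_power ennreal_mult[symmetric])
qed

lemma sqint_Cauchy_Schwarz':
  assumes "sqint M f" "sqint M g"
  shows "\<bar>\<integral>x. f x * g x \<partial>M\<bar> \<le> sqrt (\<integral>x. (f x)\<^sup>2 \<partial>M) * sqrt (\<integral>x. (g x)\<^sup>2 \<partial>M)"
proof -
  have "\<bar>\<integral>x. f x * g x \<partial>M\<bar> \<le> (\<integral>x. \<bar>f x * g x\<bar> \<partial>M)"
    by (rule integral_abs_bound)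
  also have "\<dots> \<le> sqrt ((\<integral>x. (f x)\<^sup>2 \<partial>M) * (\<integral>x. (g x)\<^sup>2 \<partial>M))"
    using sqint_Cauchy_Schwarz[OF assms] by (rule real_le_rsqrt)
  finally show ?thesis by (simp add: real_sqrt_mult)
qed

lemma sqint_L1_bound:
  assumes "finite_measure M" "sqint M f"
  shows "(\<integral>x. \<bar>f x\<bar> \<partial>M) \<le> sqrt (measure M (space M)) * sqrt (\<integral>x. (f x)\<^sup>2 \<partial>M)"
proof -
  have "sqint M (\<lambda>_. 1)" by (rule sqint_bounded[OF assms(1), of _ 1]) auto
  from sqint_Cauchy_Schwarz[OF assms(2) this]
  have "(\<integral>x. \<bar>f x\<bar> \<partial>M)\<^sup>2 \<le> measure M (space M) * (\<integral>x. (f x)\<^sup>2 \<partial>M)" by (simp add: mult.commute)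
  then show ?thesis by (metis real_le_rsqrt real_sqrt_mult)
qed

text \<open>
  Riesz and Fischer: on a finite measure space a sequence that is Cauchy in the mean square is Cauchy
  in \<open>L\<^sup>1\<close>, so a subsequence converges almost everywhere, and Fatou's lemma turns its pointwise
  limit into the mean-square limit.
\<close>

lemma sqint_complete:
  fixes f :: "nat \<Rightarrow> 'a \<Rightarrow> real"
  assumes fin: "finite_measure M" and f: "\<And>n. sqint M (f n)"
    and Cau: "\<And>e. 0 < e \<Longrightarrow> \<exists>N. \<forall>i\<ge>N. \<forall>j\<ge>N. (\<integral>x. (f i x - f j x)\<^sup>2 \<partial>M) < e"
  obtains g r where "sqint M g" "(\<lambda>n. \<integral>x. (f n x - g x)\<^sup>2 \<partial>M) \<longlonglongrightarrow> 0"
    "strict_mono (r :: nat \<Rightarrow> nat)" "AE x in M. (\<lambda>n. f (r n) x) \<longlonglongrightarrow> g x"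
proof -
  have meas[measurable]: "f n \<in> borel_measurable M" for n using f[of n] by (simp add: sqint_def)
  have df: "sqint M (\<lambda>x. f i x - f j x)" for i j using f by (intro sqint_diff)
  obtain r :: "nat \<Rightarrow> nat" where r: "strict_mono r" "AE x in M. Cauchy (\<lambda>i. f (r i) x)"
  proof (rule cauchy_L1_AE_cauchy_subseq[of M f])
    show "integrable M (f n)" for n using sqint_integrable[OF fin f] .
    fix e :: real assume e: "0 < e"
    let ?m = "measure M (space M) + 1"
    have m: "?m > 0" using measure_nonneg[of M "space M"] by linarith
    obtain N where N: "\<forall>i\<ge>N. \<forall>j\<ge>N. (\<integral>x. (f i x - f j x)\<^sup>2 \<partial>M) < e\<^sup>2 / ?m"
      using Cau[of "e\<^sup>2 / ?m"] e m by auto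
    have "(\<integral>x. norm (f i x - f j x) \<partial>M) < e" if "i \<ge> N" "j \<ge> N" for i j
    proof -
      have "(\<integral>x. norm (f i x - f j x) \<partial>M) \<le> sqrt (measure M (space M)) * sqrt (\<integral>x. (f i x - f j x)\<^sup>2 \<partial>M)"
        using sqint_L1_bound[OF fin df[of i j]] by simp
      also have "\<dots> \<le> sqrt ?m * sqrt (\<integral>x. (f i x - f j x)\<^sup>2 \<partial>M)"
        by (intro mult_right_mono) auto
      also have "\<dots> < sqrt ?m * sqrt (e\<^sup>2 / ?m)"
        using N that m by (intro mult_strict_left_mono) auto
      also have "\<dots> = e" using m e by (simp add: real_sqrt_divide)
      finally show ?thesis .
    qed
    then show "\<exists>N. \<forall>i\<ge>N. \<forall>j\<ge>N. (\<integral>x. norm (f i x - f j x) \<partial>M) < e" by blast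
  qed auto
  define g where "g x = lim (\<lambda>i. f (r i) x)" for x
  have gm[measurable]: "g \<in> borel_measurable M" unfolding g_def by measurable
  have lim: "AE x in M. (\<lambda>n. f (r n) x) \<longlonglongrightarrow> g x"
    using r(2) by eventually_elim (simp add: g_def Cauchy_convergent convergent_LIMSEQ_iff[symmetric])
  have small: "integrable M (\<lambda>x. (f n x - g x)\<^sup>2) \<and> (\<integral>x. (f n x - g x)\<^sup>2 \<partial>M) \<le> e"
    if e: "0 < e" and N: "\<forall>i\<ge>N. \<forall>j\<ge>N. (\<integral>x. (f i x - f j x)\<^sup>2 \<partial>M) < e" and n: "n \<ge> N" for n N e
  proof -
    have "(\<integral>\<^sup>+x. ennreal ((f n x - g x)\<^sup>2) \<partial>M)
        = (\<integral>\<^sup>+x. liminf (\<lambda>j. ennreal ((f n x - f (r j) x)\<^sup>2)) \<partial>M)"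
    proof (rule nn_integral_cong_AE)
      show "AE x in M. ennreal ((f n x - g x)\<^sup>2) = liminf (\<lambda>j. ennreal ((f n x - f (r j) x)\<^sup>2))"
        using lim
      proof eventually_elim
        case (elim x)
        then have "(\<lambda>j. ennreal ((f n x - f (r j) x)\<^sup>2)) \<longlonglongrightarrow> ennreal ((f n x - g x)\<^sup>2)"
          by (intro tendsto_intros tendsto_ennrealI)
        from lim_imp_Liminf[OF _ this] show ?case by simp
      qed
    qed
    also have "\<dots> \<le> liminf (\<lambda>j. \<integral>\<^sup>+x. ennreal ((f n x - f (r j) x)\<^sup>2) \<partial>M)"
      by (rule nn_integral_liminf) auto
    also have "\<dots> \<le> liminf (\<lambda>j::nat. ennreal e)"
    proof (rule Liminf_mono, rule eventually_sequentiallyI[of N])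
      fix j assume "j \<ge> N"
      then have "r j \<ge> N" using seq_suble[OF r(1), of j] by linarith
      then show "(\<integral>\<^sup>+x. ennreal ((f n x - f (r j) x)\<^sup>2) \<partial>M) \<le> ennreal e"
        using N n e df[of n "r j"]
        by (subst nn_integral_eq_integral) (auto simp: sqint_def intro!: ennreal_leI less_imp_le)
    qed
    finally have le: "(\<integral>\<^sup>+x. ennreal ((f n x - g x)\<^sup>2) \<partial>M) \<le> ennreal e"
      by (simp add: Liminf_const)
    have "integrable M (\<lambda>x. (f n x - g x)\<^sup>2)"
    proof (rule integrableI_nonneg)
      show "(\<integral>\<^sup>+x. ennreal ((f n x - g x)\<^sup>2) \<partial>M) < \<infinity>" using le by (simp add: order_le_less_trans)
    qed auto
    moreover from this le have "(\<integral>x. (f n x - g x)\<^sup>2 \<partial>M) \<le> e"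
      using e by (subst (asm) nn_integral_eq_integral) auto
    ultimately show ?thesis by simp
  qed
  have "sqint M g"
  proof -
    obtain N where N: "\<forall>i\<ge>N. \<forall>j\<ge>N. (\<integral>x. (f i x - f j x)\<^sup>2 \<partial>M) < 1" using Cau[of 1] by auto
    have "sqint M (\<lambda>x. f N x - g x)"
      using small[OF _ N, of N] by (simp add: sqint_def)
    from sqint_diff[OF f[of N] this] show ?thesis by simp
  qed
  moreover have "(\<lambda>n. \<integral>x. (f n x - g x)\<^sup>2 \<partial>M) \<longlonglongrightarrow> 0"
  proof (rule LIMSEQ_I)
    fix e :: real assume e: "0 < e"
    then obtain N where N: "\<forall>i\<ge>N. \<forall>j\<ge>N. (\<integral>x. (f i x - f j x)\<^sup>2 \<partial>M) < e/2" using Cau[of "e/2"] by auto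
    have "norm ((\<integral>x. (f n x - g x)\<^sup>2 \<partial>M) - 0) < e" if "n \<ge> N" for n
      using small[OF _ N that] e by simp
    then show "\<exists>N. \<forall>n\<ge>N. norm ((\<integral>x. (f n x - g x)\<^sup>2 \<partial>M) - 0) < e" by blast
  qed
  ultimately show thesis using that r(1) lim by blast
qed

lemma sqint_limit_AE_subseq:
  fixes f :: "nat \<Rightarrow> 'a \<Rightarrow> real"
  assumes fin: "finite_measure M" and f: "\<And>n. sqint M (f n)" and g: "sqint M g"
    and lim: "(\<lambda>n. \<integral>x. (f n x - g x)\<^sup>2 \<partial>M) \<longlonglongrightarrow> 0"
  obtains r where "strict_mono (r :: nat \<Rightarrow> nat)" "AE x in M. (\<lambda>n. f (r n) x) \<longlonglongrightarrow> g x"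
proof -
  have d: "sqint M (\<lambda>x. f n x - g x)" for n using f g by (intro sqint_diff)
  have "(\<lambda>n. sqrt (measure M (space M)) * sqrt (\<integral>x. (f n x - g x)\<^sup>2 \<partial>M)) \<longlonglongrightarrow> sqrt (measure M (space M)) * sqrt 0"
    using lim by (intro tendsto_intros)
  then have "(\<lambda>n. \<integral>x. norm (f n x - g x) \<partial>M) \<longlonglongrightarrow> 0"
    using sqint_L1_bound[OF fin d]
    by (rule_tac Lim_null_comparison[OF always_eventually]) auto
  from tendsto_L1_AE_subseq[OF _ this] obtain r where
    "strict_mono r" "AE x in M. (\<lambda>n. f (r n) x - g x) \<longlonglongrightarrow> 0"
    using sqint_integrable[OF fin d] by auto
  then show thesis using that
    by (auto simp: LIM_zero_iff)
qed

lemma sqint_limit_mult: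
  assumes f: "\<And>n. sqint M (f n)" and g: "sqint M g" and h: "sqint M h"
    and lim: "(\<lambda>n::nat. \<integral>x. (f n x - g x)\<^sup>2 \<partial>M) \<longlonglongrightarrow> 0"
  shows "(\<lambda>n. \<integral>x. f n x * h x \<partial>M) \<longlonglongrightarrow> (\<integral>x. g x * h x \<partial>M)"
proof -
  have d: "sqint M (\<lambda>x. f n x - g x)" for n using f g by (intro sqint_diff)
  have "(\<lambda>n. sqrt (\<integral>x. (f n x - g x)\<^sup>2 \<partial>M) * sqrt (\<integral>x. (h x)\<^sup>2 \<partial>M)) \<longlonglongrightarrow> sqrt 0 * sqrt (\<integral>x. (h x)\<^sup>2 \<partial>M)"
    using lim by (intro tendsto_intros)
  then have "(\<lambda>n. \<integral>x. (f n x - g x) * h x \<partial>M) \<longlonglongrightarrow> 0"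
    using sqint_Cauchy_Schwarz'[OF d h]
    by (rule_tac Lim_null_comparison[OF always_eventually]) auto
  moreover have "(\<integral>x. (f n x - g x) * h x \<partial>M) = (\<integral>x. f n x * h x \<partial>M) - (\<integral>x. g x * h x \<partial>M)" for n
    using sqint_mult[OF f h] sqint_mult[OF g h] by (simp add: left_diff_distrib)
  ultimately show ?thesis by (simp add: LIM_zero_iff)
qed

section \<open>The Hartley basis of the circle\<close>

lemma space_circ[simp]: "space circ = {0..<2*pi}"
  by (simp add: circ_def)

lemma measurable_circ[measurable (raw)]: "f \<in> borel_measurable borel \<Longrightarrow> f \<in> borel_measurable circ"
  by (simp add: circ_def measurable_restrict_space1)

lemma nn_integral_circ:
  "(\<integral>\<^sup>+x. f x \<partial>circ) = (\<integral>\<^sup>+x. f x * indicator {0..<2*pi} x \<partial>lborel)"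
  by (simp add: circ_def nn_integral_restrict_space)

lemma emeasure_circ[simp]: "emeasure circ {0..<2*pi} = ennreal (2*pi)"
  by (simp add: circ_def emeasure_restrict_space)

interpretation circ: finite_measure circ
  by (rule finite_measureI) simp

lemma measure_circ[simp]: "measure circ {0..<2*pi} = 2*pi"
  by (simp add: measure_def)

lemma finite_measure_circ[simp, intro]: "finite_measure circ"
  by (rule circ.finite_measure_axioms)

interpretation circ2: pair_sigma_finite circ circ ..

lemma AE_circ_iff: "(AE x in circ. P x) \<longleftrightarrow> (AE x in lborel. x \<in> {0..<2*pi} \<longrightarrow> P x)"
  unfolding circ_def by (subst AE_restrict_space_iff) auto

text \<open>
  The Hartley functions. They are a real orthogonal family with a single index set, the integers,
  and a single formula; cosines and sines of the same frequency are recovered from \<open>k\<close> and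
  \<open>- k\<close>, and differentiation takes \<open>cas k\<close> to \<open>k * cas (- k)\<close>.
\<close>

definition cas :: "int \<Rightarrow> real \<Rightarrow> real" where
  "cas k x = cos (of_int k * x) + sin (of_int k * x)"

lemma cas_measurable[measurable]: "cas k \<in> borel_measurable borel"
  by (simp add: cas_def[abs_def])

lemma cas_bound: "\<bar>cas k x\<bar> \<le> 2"
  using abs_cos_le_one[of "of_int k * x"] abs_sin_le_one[of "of_int k * x"] unfolding cas_def by linarith

lemma cas_0[simp]: "cas 0 x = 1"
  by (simp add: cas_def)

lemma sqint_cas: "sqint circ (cas k)"
  by (rule sqint_bounded[of _ _ 2]) (auto simp: cas_bound)

lemma cas_has_derivative: "(cas k has_real_derivative of_int k * cas (-k) x) (at x within S)"
  unfolding cas_def[abs_def] by (auto intro!: derivative_eq_intros simp: algebra_simps)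

lemma cas_periodic: "cas k (x + 2*pi) = cas k x"
proof -
  have "cos (of_int k * (x + 2*pi)) = cos (of_int k * x)" "sin (of_int k * (x + 2*pi)) = sin (of_int k * x)"
    using cos.plus_of_int[of "of_int k * x" k] sin.plus_of_int[of "of_int k * x" k]
    by (simp_all add: algebra_simps)
  then show ?thesis by (simp add: cas_def)
qed

lemma cas_times_cos: "cas k x * cos x = (cas (k+1) x + cas (k-1) x) / 2"
  by (simp add: cas_def algebra_simps cos_add sin_add cos_diff sin_diff)

lemma cas_times_sin: "cas k x * sin x = (cas (1-k) x - cas (-1-k) x) / 2"
proof -
  have "cas (1-k) x = cos (x - of_int k * x) + sin (x - of_int k * x)"
    "cas (-1-k) x = cos (- x - of_int k * x) + sin (- x - of_int k * x)"
    by (simp_all add: cas_def algebra_simps)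
  then show ?thesis
    by (simp add: cas_def algebra_simps cos_diff sin_diff)
qed

text \<open>
  The convolution kernel \<open>cos (l * (x - y))\<close> is diagonal in the Hartley basis; this is what turns
  the interaction into a diagonal quadratic form of coefficients.
\<close>

lemma cos_difference_cas: 
  "cos (real l * (x - y)) = (cas (int l) x * cas (int l) y + cas (- int l) x * cas (- int l) y) / 2"
  by (simp add: cas_def algebra_simps cos_diff)

lemma integral_circ_FTC:
  assumes F: "\<And>x. (F has_real_derivative f x) (at x)" and f: "continuous_on UNIV f"
  shows "(\<integral>x. f x \<partial>circ) = F (2*pi) - F 0"
proof -
  have "(\<integral>x. f x \<partial>circ) = (\<integral>x. indicator {0..<2*pi} x * f x \<partial>lborel)"
    by (simp add: circ_def integral_restrict_space)
  also have "\<dots> = (\<integral>x. f x * indicator {0..2*pi} x \<partial>lborel)"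
  proof (rule integral_cong_AE)
    have [measurable]: "f \<in> borel_measurable borel" using f by (rule borel_measurable_continuous_onI)
    show "(\<lambda>x. indicator {0..<2*pi} x * f x) \<in> borel_measurable lborel"
      "(\<lambda>x. f x * indicator {0..2*pi} x) \<in> borel_measurable lborel" by measurable
    show "AE x in lborel. indicator {0..<2*pi} x * f x = f x * indicator {0..2*pi} x"
      using AE_lborel_singleton[of "2*pi"] by eventually_elim (auto simp: indicator_def)
  qed
  also have "\<dots> = F (2*pi) - F 0"
    by (rule integral_FTC_Icc_real) (use F f in \<open>auto simp: continuous_on_eq_continuous_at\<close>)
  finally show ?thesis .
qed

lemma integral_circ_cos: "k \<noteq> 0 \<Longrightarrow> (\<integral>x. cos (of_int k * x) \<partial>circ) = 0"
proof -
  assume k: "k \<noteq> 0"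
  have "(\<integral>x. cos (of_int k * x) \<partial>circ) = sin (of_int k * (2*pi)) / of_int k - sin (of_int k * 0) / of_int k"
    by (rule integral_circ_FTC[of "\<lambda>x. sin (of_int k * x) / of_int k"])
      (use k in \<open>auto intro!: derivative_eq_intros continuous_intros\<close>)
  also have "sin (of_int k * (2*pi)) = 0" using sin.plus_of_int[of "0::real" k] by simp
  finally show ?thesis by simp
qed

lemma integral_circ_sin: "(\<integral>x. sin (of_int k * x) \<partial>circ) = 0"
proof (cases "k = 0")
  case k: False
  have "(\<integral>x. sin (of_int k * x) \<partial>circ) = - cos (of_int k * (2*pi)) / of_int k - (- cos (of_int k * 0) / of_int k)"
    by (rule integral_circ_FTC[of "\<lambda>x. - cos (of_int k * x) / of_int k"])
      (use k in \<open>auto intro!: derivative_eq_intros continuous_intros\<close>)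
  also have "cos (of_int k * (2*pi)) = 1" using cos.plus_of_int[of "0::real" k] by simp
  finally show ?thesis by simp
qed auto

lemma cas_orthogonal: "(\<integral>x. cas k x * cas m x \<partial>circ) = (if k = m then 2*pi else 0)"
proof -
  have i: "integrable circ (\<lambda>x. cos (of_int j * x))" "integrable circ (\<lambda>x. sin (of_int j * x))" for j
    by (auto intro!: circ.integrable_const_bound[of _ 1])
  have "cas k x * cas m x = cos (of_int (k - m) * x) + sin (of_int (k + m) * x)" for x
    by (simp add: cas_def algebra_simps cos_diff sin_add)
  then have "(\<integral>x. cas k x * cas m x \<partial>circ) = (\<integral>x. cos (of_int (k - m) * x) \<partial>circ) + (\<integral>x. sin (of_int (k + m) * x) \<partial>circ)"
    using i[of "k-m"] i[of "k+m"] by (simp del: of_int_diff of_int_add)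
  also have "\<dots> = (\<integral>x. cos (of_int (k - m) * x) \<partial>circ)" by (simp add: integral_circ_sin del: of_int_diff of_int_add)
  also have "\<dots> = (if k = m then 2*pi else 0)"
    using integral_circ_cos[of "k-m"] by (auto simp del: of_int_diff)
  finally show ?thesis .
qed

text \<open>
  The Hartley functions have mean square \<open>1\<close>, so coefficients are means against them; coefficient
  \<open>0\<close> is the mean value.
\<close>

definition hcoef :: "(real \<Rightarrow> real) \<Rightarrow> int \<Rightarrow> real" where
  "hcoef f k = 1 / (2*pi) * (\<integral>x. f x * cas k x \<partial>circ)"

definition hsum :: "(real \<Rightarrow> real) \<Rightarrow> nat \<Rightarrow> real \<Rightarrow> real" where
  "hsum f N x = (\<Sum>k\<in>{- int N..int N}. hcoef f k * cas k x)"

lemma integrable_mult_cas: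
  assumes "integrable circ f"
  shows "integrable circ (\<lambda>x. f x * cas k x)"
proof (rule Bochner_Integration.integrable_bound[OF integrable_mult_right[OF integrable_abs[OF assms], of 2]])
  show "(\<lambda>x. f x * cas k x) \<in> borel_measurable circ" using assms by measurable
  have "\<bar>f x\<bar> * \<bar>cas k x\<bar> \<le> \<bar>f x\<bar> * 2" for x
    by (intro mult_left_mono cas_bound) auto
  then show "AE x in circ. norm (f x * cas k x) \<le> norm (2 * \<bar>f x\<bar>)"
    by (intro AE_I2) (simp add: abs_mult mult.commute)
qed

lemma L2_integrable: "sqint circ f \<Longrightarrow> integrable circ f"
  by (rule sqint_integrable) auto

lemma hcoef_add: "integrable circ f \<Longrightarrow> integrable circ g \<Longrightarrow> hcoef (\<lambda>x. f x + g x) k = hcoef f k + hcoef g k"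
  using integrable_mult_cas[of f k] integrable_mult_cas[of g k] by (simp add: hcoef_def algebra_simps)

lemma hcoef_diff: "integrable circ f \<Longrightarrow> integrable circ g \<Longrightarrow> hcoef (\<lambda>x. f x - g x) k = hcoef f k - hcoef g k"
  using integrable_mult_cas[of f k] integrable_mult_cas[of g k] by (simp add: hcoef_def algebra_simps)

lemma hcoef_cmult: "hcoef (\<lambda>x. c * f x) k = c * hcoef f k"
  by (simp add: hcoef_def mult.assoc)

lemma hcoef_cong_AE:
  assumes "AE x in circ. f x = g x" "f \<in> borel_measurable circ" "g \<in> borel_measurable circ"
  shows "hcoef f k = hcoef g k"
  unfolding hcoef_def using assms by (intro arg_cong[where f="\<lambda>x. _ * x"] integral_cong_AE) auto

lemma hcoef_cas: "hcoef (cas j) k = (if j = k then 1 else 0)"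
  by (simp add: hcoef_def cas_orthogonal)

lemma hcoef_1: "hcoef (\<lambda>_. 1) k = (if k = 0 then 1 else 0)"
  using hcoef_cas[of 0 k] by (simp add: cas_def[abs_def])

lemma hcoef_sum:
  assumes "\<And>i. i \<in> I \<Longrightarrow> integrable circ (f i)"
  shows "hcoef (\<lambda>x. \<Sum>i\<in>I. f i x) k = (\<Sum>i\<in>I. hcoef (f i) k)"
  using integrable_mult_cas[OF assms] by (simp add: hcoef_def sum_distrib_right sum_distrib_left)

lemma abs_hcoef_le:
  assumes "integrable circ f"
  shows "\<bar>hcoef f k\<bar> \<le> 1 / pi * (\<integral>x. \<bar>f x\<bar> \<partial>circ)"
proof -
  have "\<bar>\<integral>x. f x * cas k x \<partial>circ\<bar> \<le> (\<integral>x. \<bar>f x * cas k x\<bar> \<partial>circ)" by (rule integral_abs_bound)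
  also have "\<dots> \<le> (\<integral>x. 2 * \<bar>f x\<bar> \<partial>circ)"
  proof (rule integral_mono)
    show "\<bar>f x * cas k x\<bar> \<le> 2 * \<bar>f x\<bar>" for x
      using mult_left_mono[OF cas_bound[of k x] abs_ge_zero[of "f x"]] by (simp add: abs_mult)
  qed (use integrable_mult_cas[OF assms, of k] assms in auto)
  finally have "\<bar>\<integral>x. f x * cas k x \<partial>circ\<bar> \<le> 2 * (\<integral>x. \<bar>f x\<bar> \<partial>circ)" by simp
  then show ?thesis by (simp add: hcoef_def abs_mult field_simps)
qed

lemma sqint_hsum: "sqint circ (hsum f N)"
  unfolding hsum_def[abs_def] by (intro sqint_sum sqint_cmult sqint_cas)

lemma sqint_trig: "sqint circ (\<lambda>x. \<Sum>k\<in>I. c k * cas k x)"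
  by (intro sqint_sum sqint_cmult sqint_cas)

lemma hcoef_trig: "finite I \<Longrightarrow> hcoef (\<lambda>x. \<Sum>k\<in>I. c k * cas k x) k = (if k \<in> I then c k else 0)"
  by (subst hcoef_sum)
    (auto simp: hcoef_cmult hcoef_cas if_distrib sum.delta cong: if_cong
      intro!: integrable_mult_right L2_integrable sqint_cas)

lemma integral_mult_trig:
  assumes "sqint circ f"
  shows "(\<integral>x. f x * (\<Sum>k\<in>I. c k * cas k x) \<partial>circ) = 2*pi * (\<Sum>k\<in>I. c k * hcoef f k)"
proof -
  have "(\<integral>x. f x * (\<Sum>k\<in>I. c k * cas k x) \<partial>circ) = (\<integral>x. (\<Sum>k\<in>I. c k * (f x * cas k x)) \<partial>circ)"
    by (simp add: sum_distrib_left algebra_simps)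
  also have "\<dots> = (\<Sum>k\<in>I. c k * (\<integral>x. f x * cas k x \<partial>circ))"
    using integrable_mult_cas[OF L2_integrable[OF assms]]
    by (subst Bochner_Integration.integral_sum) auto
  finally show ?thesis by (simp add: hcoef_def sum_distrib_left)
qed

lemma integral_trig_square:
  assumes "finite I"
  shows "(\<integral>x. (\<Sum>k\<in>I. c k * cas k x)\<^sup>2 \<partial>circ) = 2*pi * (\<Sum>k\<in>I. (c k)\<^sup>2)"
  using integral_mult_trig[OF sqint_trig[of c I], of c I] assms
  by (simp add: hcoef_trig power2_eq_square)

text \<open>
  The distance to an arbitrary trigonometric polynomial splits into the distance to the span
  and a distance of coefficients. The first part is what remains when the coefficients agree, and its
  nonnegativity is Bessel's inequality.
\<close>

lemma integral_diff_trig_square: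
  assumes "sqint circ f" "finite I"
  shows "(\<integral>x. (f x - (\<Sum>k\<in>I. c k * cas k x))\<^sup>2 \<partial>circ)
    = (\<integral>x. (f x)\<^sup>2 \<partial>circ) - 2*pi * (\<Sum>k\<in>I. (hcoef f k)\<^sup>2) + 2*pi * (\<Sum>k\<in>I. (hcoef f k - c k)\<^sup>2)"
proof -
  let ?t = "\<lambda>x. \<Sum>k\<in>I. c k * cas k x"
  have "(f x - ?t x)\<^sup>2 = (f x)\<^sup>2 - 2 * (f x * ?t x) + (?t x)\<^sup>2" for x
    by (simp add: power2_diff)
  then have "(\<integral>x. (f x - ?t x)\<^sup>2 \<partial>circ) = (\<integral>x. (f x)\<^sup>2 - 2 * (f x * ?t x) + (?t x)\<^sup>2 \<partial>circ)"
    by presburger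
  also have "\<dots> = (\<integral>x. (f x)\<^sup>2 \<partial>circ) - 2 * (\<integral>x. f x * ?t x \<partial>circ) + (\<integral>x. (?t x)\<^sup>2 \<partial>circ)"
    using sqint_square[OF assms(1)] sqint_square[OF sqint_trig[of c I]] sqint_mult[OF assms(1) sqint_trig[of c I]]
    by simp
  also have "\<dots> = (\<integral>x. (f x)\<^sup>2 \<partial>circ) - 2 * (2*pi * (\<Sum>k\<in>I. c k * hcoef f k)) + 2*pi * (\<Sum>k\<in>I. (c k)\<^sup>2)"
    by (simp only: integral_mult_trig[OF assms(1)] integral_trig_square[OF assms(2)])
  also have "\<dots> = (\<integral>x. (f x)\<^sup>2 \<partial>circ) - 2*pi * (\<Sum>k\<in>I. (hcoef f k)\<^sup>2)
      + 2*pi * ((\<Sum>k\<in>I. (hcoef f k)\<^sup>2) - 2 * (\<Sum>k\<in>I. c k * hcoef f k) + (\<Sum>k\<in>I. (c k)\<^sup>2))"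
    by (simp add: algebra_simps)
  also have "(\<Sum>k\<in>I. (hcoef f k)\<^sup>2) - 2 * (\<Sum>k\<in>I. c k * hcoef f k) + (\<Sum>k\<in>I. (c k)\<^sup>2)
      = (\<Sum>k\<in>I. (hcoef f k - c k)\<^sup>2)"
    by (simp add: power2_diff sum.distrib sum_subtractf sum_distrib_left mult.commute mult.left_commute)
  finally show ?thesis .
qed

lemma Bessel:
  assumes "sqint circ f" "finite I"
  shows "2*pi * (\<Sum>k\<in>I. (hcoef f k)\<^sup>2) \<le> (\<integral>x. (f x)\<^sup>2 \<partial>circ)"
proof -
  have "0 \<le> (\<integral>x. (f x - (\<Sum>k\<in>I. hcoef f k * cas k x))\<^sup>2 \<partial>circ)" by (intro integral_nonneg_AE) auto
  then show ?thesis using integral_diff_trig_square[OF assms, of "hcoef f"] by simp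
qed

section \<open>Completeness of the Hartley basis and mean-square convergence\<close>

text \<open>
  Multiplication by \<open>cos\<close> and by \<open>sin\<close> only shifts and reflects coefficients, so a function
  without coefficients keeps that property.
\<close>

lemma hcoef_times_cos_sin_zero:
  assumes f: "integrable circ f" and z: "\<forall>k. hcoef f k = 0"
  shows "integrable circ (\<lambda>x. f x * cos x)" "\<forall>k. hcoef (\<lambda>x. f x * cos x) k = 0"
    "integrable circ (\<lambda>x. f x * sin x)" "\<forall>k. hcoef (\<lambda>x. f x * sin x) k = 0"
proof -
  have fm[measurable]: "f \<in> borel_measurable circ" using f by auto
  have b: "\<bar>f x\<bar> * \<bar>t\<bar> \<le> \<bar>f x\<bar>" if "\<bar>t\<bar> \<le> 1" for x t
    using mult_left_mono[OF that abs_ge_zero[of "f x"]] by simp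
  show "integrable circ (\<lambda>x. f x * cos x)" "integrable circ (\<lambda>x. f x * sin x)"
    by (auto intro!: Bochner_Integration.integrable_bound[OF f] AE_I2 b simp: abs_mult)
  have "f x * cos x * cas k x = f x * cas (k+1) x / 2 + f x * cas (k-1) x / 2" for k x
    using arg_cong[OF cas_times_cos[of k x], of "\<lambda>t. f x * t"] by (simp add: field_simps)
  then have "hcoef (\<lambda>x. f x * cos x) k = (hcoef f (k+1) + hcoef f (k-1)) / 2" for k
    using integrable_mult_cas[OF f] by (simp add: hcoef_def add_divide_distrib)
  then show "\<forall>k. hcoef (\<lambda>x. f x * cos x) k = 0" using z by simp
  have "f x * sin x * cas k x = f x * cas (1-k) x / 2 - f x * cas (-1-k) x / 2" for k x
    using arg_cong[OF cas_times_sin[of k x], of "\<lambda>t. f x * t"] by (simp add: field_simps)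
  then have "hcoef (\<lambda>x. f x * sin x) k = (hcoef f (1-k) - hcoef f (-1-k)) / 2" for k
    using integrable_mult_cas[OF f] by (simp add: hcoef_def diff_divide_distrib)
  then show "\<forall>k. hcoef (\<lambda>x. f x * sin x) k = 0" using z by simp
qed

lemma hcoef_times_polynomial_zero:
  fixes q :: "real \<times> real \<Rightarrow> real"
  assumes "real_polynomial_function q" "integrable circ f" "\<forall>k. hcoef f k = 0"
  shows "integrable circ (\<lambda>x. f x * q (cos x, sin x)) \<and> (\<forall>k. hcoef (\<lambda>x. f x * q (cos x, sin x)) k = 0)"
  using assms
proof (induction q arbitrary: f rule: real_polynomial_function.induct)
  case (linear q)
  have qq: "q (u, v) = u * q (1, 0) + v * q (0, 1)" for u v
  proof -
    have q: "linear q" using linear(1) by (rule bounded_linear.linear)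
    have "q (u, v) = q (u *\<^sub>R (1, 0) + v *\<^sub>R (0, 1))" by simp
    also have "\<dots> = u *\<^sub>R q (1, 0) + v *\<^sub>R q (0, 1)"
      by (simp only: linear_add[OF q] linear_scale[OF q])
    finally show ?thesis by simp
  qed
  have "f x * q (cos x, sin x) = q (1,0) * (f x * cos x) + q (0,1) * (f x * sin x)" for x
    by (subst qq[of "cos x" "sin x"]) (simp add: algebra_simps)
  then show ?case
    using hcoef_times_cos_sin_zero[OF linear(2,3)] by (simp add: hcoef_add hcoef_cmult)
next
  case (const c)
  then show ?case using hcoef_cmult[of c f] by (simp add: mult.commute)
next
  case (add q r)
  then show ?case by (auto simp: distrib_left hcoef_add)
next
  case (mult q r)
  show ?case using mult.IH(2)[of "\<lambda>x. f x * q (cos x, sin x)"] mult.IH(1)[of f] mult.prems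
    by (simp add: mult.assoc)
qed

text \<open>
  By Stone and Weierstrass \<open>h\<close> is a uniform limit of polynomials on the unit circle of the plane,
  and the integral of \<open>f\<close> against a polynomial in \<open>(cos, sin)\<close> is coefficient \<open>0\<close> of a function
  without coefficients.
\<close>

lemma hcoef_zero_continuous:
  fixes h :: "real \<times> real \<Rightarrow> real"
  assumes f: "integrable circ f" "\<forall>k. hcoef f k = 0" and h: "continuous_on (sphere 0 1) h"
  shows "(\<integral>x. f x * h (cos x, sin x) \<partial>circ) = 0"
proof (rule ccontr)
  let ?I = "\<integral>x. f x * h (cos x, sin x) \<partial>circ"
  assume nz: "?I \<noteq> 0"
  let ?n = "(\<integral>x. \<bar>f x\<bar> \<partial>circ) + 1"
  have n: "0 < ?n" using integral_nonneg_AE[of "\<lambda>x. \<bar>f x\<bar>" circ] by (smt (verit) AE_I2 abs_ge_zero)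
  obtain q where q: "real_polynomial_function q" "\<And>z. z \<in> sphere 0 1 \<Longrightarrow> \<bar>h z - q z\<bar> < \<bar>?I\<bar> / ?n"
    using Stone_Weierstrass_real_polynomial_function[OF _ h, of "\<bar>?I\<bar> / ?n"] nz n by auto
  have cs: "(cos x, sin x) \<in> sphere (0::real\<times>real) 1" for x by (simp add: norm_Pair)
  have qi: "integrable circ (\<lambda>x. f x * q (cos x, sin x))"
    and q0: "(\<integral>x. f x * q (cos x, sin x) \<partial>circ) = 0"
    using hcoef_times_polynomial_zero[OF q(1) f] unfolding hcoef_def
    by (blast, drule_tac conjunct2, drule_tac x=0 in spec, simp)
  have hc: "continuous_on UNIV (\<lambda>x::real. h (cos x, sin x))"
    by (rule continuous_on_compose2[OF h]) (use cs in \<open>auto intro!: continuous_intros\<close>)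
  have hm[measurable]: "(\<lambda>x. h (cos x, sin x)) \<in> borel_measurable borel"
    using hc by (rule borel_measurable_continuous_onI)
  have di: "integrable circ (\<lambda>x. f x * (h (cos x, sin x) - q (cos x, sin x)))"
  proof (rule Bochner_Integration.integrable_bound[OF integrable_mult_right[OF f(1), of "\<bar>?I\<bar> / ?n"]])
    have "(\<lambda>x. f x * h (cos x, sin x) - f x * q (cos x, sin x)) \<in> borel_measurable circ"
      using borel_measurable_integrable[OF f(1)] borel_measurable_integrable[OF qi] by measurable
    then show "(\<lambda>x. f x * (h (cos x, sin x) - q (cos x, sin x))) \<in> borel_measurable circ"
      by (simp add: right_diff_distrib)
    have "\<bar>f x\<bar> * \<bar>h (cos x, sin x) - q (cos x, sin x)\<bar> \<le> \<bar>f x\<bar> * (\<bar>?I\<bar> / ?n)" for x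
      using less_imp_le[OF q(2)[OF cs[of x]]] by (rule mult_left_mono) auto
    then show "AE x in circ. norm (f x * (h (cos x, sin x) - q (cos x, sin x))) \<le> norm (\<bar>?I\<bar> / ?n * f x)"
      using n by (intro AE_I2) (simp add: abs_mult mult.commute)
  qed
  have "?I = (\<integral>x. f x * (h (cos x, sin x) - q (cos x, sin x)) + f x * q (cos x, sin x) \<partial>circ)"
    by (simp add: right_diff_distrib)
  also have "\<dots> = (\<integral>x. f x * (h (cos x, sin x) - q (cos x, sin x)) \<partial>circ)" using di qi q0 by simp
  finally have "\<bar>?I\<bar> = \<bar>\<integral>x. f x * (h (cos x, sin x) - q (cos x, sin x)) \<partial>circ\<bar>" by (rule arg_cong)
  also have "\<dots> \<le> (\<integral>x. \<bar>f x * (h (cos x, sin x) - q (cos x, sin x))\<bar> \<partial>circ)"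
    by (rule integral_abs_bound)
  also have "\<dots> \<le> (\<integral>x. \<bar>?I\<bar> / ?n * \<bar>f x\<bar> \<partial>circ)"
  proof (rule integral_mono)
    show "\<bar>f x * (h (cos x, sin x) - q (cos x, sin x))\<bar> \<le> \<bar>?I\<bar> / ?n * \<bar>f x\<bar>" for x
      using mult_left_mono[OF less_imp_le[OF q(2)[OF cs[of x]]] abs_ge_zero[of "f x"]] by (simp add: abs_mult mult.commute)
  qed (use di f in auto)
  also have "\<dots> = \<bar>?I\<bar> / ?n * (?n - 1)" by simp
  also have "\<dots> < \<bar>?I\<bar>" using n nz by (simp add: field_simps)
  finally show False by simp
qed

lemma unit_circle_inj:
  assumes "x \<in> {0..<2*pi}" "y \<in> {0..<2*pi}" "cos x = cos y" "sin x = sin y"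
  shows "x = y"
proof -
  obtain n :: int where n: "x = y + 2 * pi * n"
    using assms(3,4) sin_cos_eq_iff[of x y] by (metis mult.commute mult.left_commute)
  have "\<bar>2 * pi * n\<bar> < 2*pi" using assms(1,2) n by auto
  then have "\<bar>real_of_int n\<bar> < 1" using pi_gt_zero by (simp add: abs_mult)
  then have "n = 0" by linarith
  then show ?thesis using n by simp
qed

text \<open>
  The indicator of the arc \<open>[0, b]\<close> is the pointwise limit of \<open>max 0 (1 - n * dist)\<close>, continuous
  functions on the plane, where \<open>dist\<close> is the distance to the image of the arc. Working on the plane
  circle makes periodicity automatic.
\<close>

lemma hcoef_zero_interval:
  assumes f: "integrable circ f" "\<forall>k. hcoef f k = 0" and b: "b \<in> {0..<2*pi}"
  shows "(\<integral>x. f x * indicator {0..b} x \<partial>circ) = 0"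
proof -
  have [measurable]: "f \<in> borel_measurable circ" using f by auto
  let ?g = "\<lambda>x::real. (cos x, sin x)"
  define C where "C = ?g ` {0..b}"
  have C: "compact C" unfolding C_def
    by (intro compact_continuous_image continuous_intros) auto
  have C_ne: "C \<noteq> {}" using b by (auto simp: C_def)
  define h where "h n z = max 0 (1 - real n * infdist z C)" for n :: nat and z
  have h_cont: "continuous_on S (h n)" for n S
    unfolding h_def by (intro continuous_intros)
  have hm[measurable]: "(\<lambda>x. h n (?g x)) \<in> borel_measurable borel" for n
  proof (rule borel_measurable_continuous_onI)
    show "continuous_on UNIV (\<lambda>x. h n (?g x))"
      by (rule continuous_on_compose2[OF h_cont[of UNIV n]]) (auto intro!: continuous_intros)
  qed
  have lim: "(\<lambda>n. h n (?g x)) \<longlonglongrightarrow> indicator {0..b} x" if x: "x \<in> {0..<2*pi}" for x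
  proof (cases "x \<in> {0..b}")
    case True
    then have "?g x \<in> C" by (auto simp: C_def)
    then show ?thesis using True by (simp add: h_def)
  next
    case False
    have "?g x \<notin> C"
    proof
      assume "?g x \<in> C"
      then obtain y where "y \<in> {0..b}" "cos x = cos y" "sin x = sin y" by (auto simp: C_def)
      then show False using unit_circle_inj[OF x, of y] b False by auto
    qed
    then have d: "0 < infdist (?g x) C"
      using C C_ne compact_imp_closed in_closed_iff_infdist_zero infdist_nonneg
      by (metis less_eq_real_def)
    obtain N :: nat where N: "1 < real N * infdist (?g x) C" using reals_Archimedean3[OF d] by auto
    have "h n (?g x) = 0" if "n \<ge> N" for n
    proof -
      have "real N * infdist (?g x) C \<le> real n * infdist (?g x) C"
        using that d by (intro mult_right_mono) auto
      then show ?thesis using N by (simp add: h_def)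
    qed
    then have "(\<lambda>n. h n (?g x)) \<longlonglongrightarrow> 0"
      by (intro tendsto_eventually eventually_sequentiallyI[of N])
    then show ?thesis using False by simp
  qed
  have "(\<lambda>n. \<integral>x. f x * h n (?g x) \<partial>circ) \<longlonglongrightarrow> (\<integral>x. f x * indicator {0..b} x \<partial>circ)"
  proof (rule integral_dominated_convergence[where w="\<lambda>x. \<bar>f x\<bar>"])
    show "AE x in circ. (\<lambda>n. f x * h n (?g x)) \<longlonglongrightarrow> f x * indicator {0..b} x"
      by (intro AE_I2 tendsto_intros lim) auto
    show "AE x in circ. norm (f x * h n (?g x)) \<le> \<bar>f x\<bar>" for n
    proof (rule AE_I2)
      fix x
      have "0 \<le> real n * infdist (?g x) C" by (simp add: infdist_nonneg)
      then have "\<bar>h n (?g x)\<bar> \<le> 1" by (auto simp: h_def)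
      from mult_left_mono[OF this abs_ge_zero[of "f x"]]
      show "norm (f x * h n (?g x)) \<le> \<bar>f x\<bar>" by (simp add: abs_mult)
    qed
  qed (use f in auto)
  moreover have "(\<integral>x. f x * h n (?g x) \<partial>circ) = 0" for n
    by (rule hcoef_zero_continuous[OF f h_cont])
  ultimately show ?thesis using LIMSEQ_unique[OF _ tendsto_const] by simp
qed

text \<open>
  The positive and the negative part of \<open>f\<close> are densities of measures that agree on all half-lines,
  so the measures are equal, and so are the densities.
\<close>

theorem hcoef_zero_imp_zero:
  assumes f: "integrable circ f" "\<forall>k. hcoef f k = 0"
  shows "AE x in circ. f x = 0"
proof -
  define F where "F x = indicator {0..<2*pi} x * f x" for x
  have Fi: "integrable lborel F"
    using f(1) by (simp add: circ_def integrable_restrict_space F_def[abs_def])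
  have Fm[measurable]: "F \<in> borel_measurable borel" using Fi by simp
  have circF: "(\<integral>x. f x * u x \<partial>circ) = (\<integral>x. F x * u x \<partial>lborel)" for u :: "real \<Rightarrow> real"
    by (simp add: circ_def integral_restrict_space F_def mult.assoc)
  have zero: "(\<integral>x. F x * indicator {t<..} x \<partial>lborel) = 0" for t
  proof (cases "0 \<le> t \<and> t < 2*pi")
    case True
    have Fi': "integrable lborel (\<lambda>x. F x * indicator {0..t} x)"
      using integrable_mult_indicator[OF _ Fi, of "{0..t}"] by (simp add: mult.commute)
    have "(\<integral>x. F x * indicator {t<..} x \<partial>lborel) = (\<integral>x. F x - F x * indicator {0..t} x \<partial>lborel)"
      by (intro Bochner_Integration.integral_cong) (auto simp: F_def indicator_def)
    also have "\<dots> = (\<integral>x. F x * 1 \<partial>lborel) - (\<integral>x. F x * indicator {0..t} x \<partial>lborel)"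
      using Fi Fi' by simp
    also have "\<dots> = (\<integral>x. f x * 1 \<partial>circ) - (\<integral>x. f x * indicator {0..t} x \<partial>circ)"
      by (simp only: circF)
    also have "\<dots> = 0" using hcoef_zero_interval[OF f, of t] True spec[OF f(2), of 0]
      by (simp add: hcoef_def)
    finally show ?thesis .
  next
    case False
    then consider "t < 0" | "2*pi \<le> t" by linarith
    then show ?thesis
    proof cases
      case 1
      then have "(\<integral>x. F x * indicator {t<..} x \<partial>lborel) = (\<integral>x. F x * 1 \<partial>lborel)"
        by (intro Bochner_Integration.integral_cong) (auto simp: F_def indicator_def)
      also have "\<dots> = (\<integral>x. f x * 1 \<partial>circ)" by (simp only: circF)
      finally show ?thesis using spec[OF f(2), of 0] by (simp add: hcoef_def)
    next
      case 2
      then have "(\<lambda>x. F x * indicator {t<..} x) = (\<lambda>_. 0)" by (auto simp: F_def indicator_def)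
      then show ?thesis by simp
    qed
  qed
  have part: "emeasure (density lborel (\<lambda>x. ennreal (s * F x))) {t<..} = ennreal (\<integral>x. max 0 (s * F x) * indicator {t<..} x \<partial>lborel)"
    for s t
  proof -
    have "integrable lborel (\<lambda>x. max 0 (s * F x) * indicator {t<..} x)"
      using integrable_mult_indicator[OF _ integrable_max[OF integrable_zero integrable_mult_right[OF Fi, of s]], of "{t<..}"]
      by (simp add: mult.commute)
    note i = nn_integral_eq_integral[OF this]
    have "emeasure (density lborel (\<lambda>x. ennreal (s * F x))) {t<..} = (\<integral>\<^sup>+x. ennreal (s * F x) * indicator {t<..} x \<partial>lborel)"
      by (rule emeasure_density) auto
    also have "\<dots> = (\<integral>\<^sup>+x. ennreal (max 0 (s * F x) * indicator {t<..} x) \<partial>lborel)"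
      by (intro nn_integral_cong) (auto simp: indicator_def max_def ennreal_neg)
    finally show ?thesis by (subst (asm) i) auto
  qed
  have eq: "(\<integral>x. max 0 (1 * F x) * indicator {t<..} x \<partial>lborel) = (\<integral>x. max 0 (-1 * F x) * indicator {t<..} x \<partial>lborel)" for t
  proof -
    have i: "integrable lborel (\<lambda>x. max 0 (s * F x) * indicator {t<..} x)" for s
      using integrable_mult_indicator[OF _ integrable_max[OF integrable_zero integrable_mult_right[OF Fi, of s]], of "{t<..}"]
      by (simp add: mult.commute)
    have "(\<integral>x. max 0 (1 * F x) * indicator {t<..} x \<partial>lborel) - (\<integral>x. max 0 (-1 * F x) * indicator {t<..} x \<partial>lborel)
      = (\<integral>x. max 0 (1 * F x) * indicator {t<..} x - max 0 (-1 * F x) * indicator {t<..} x \<partial>lborel)"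
      by (rule Bochner_Integration.integral_diff[OF i i, symmetric])
    also have "\<dots> = (\<integral>x. F x * indicator {t<..} x \<partial>lborel)"
      by (intro Bochner_Integration.integral_cong) (auto simp: indicator_def)
    finally show ?thesis using zero[of t] by linarith
  qed
  have "density lborel (\<lambda>x. ennreal (1 * F x)) = density lborel (\<lambda>x. ennreal (-1 * F x))"
    by (rule measure_eqI_lessThan) (simp_all only: part eq, auto)
  then have "AE x in lborel. ennreal (1 * F x) = ennreal (-1 * F x)"
    by (intro sigma_finite_measure.density_unique[OF sigma_finite_lborel]) auto
  then have "AE x in lborel. F x = 0"
  proof eventually_elim
    case (elim x)
    then show ?case by (cases "F x \<ge> 0") (auto simp: ennreal_neg)
  qed
  then show ?thesis unfolding AE_circ_iff by eventually_elim (auto simp: F_def)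
qed

lemma hcoef_hsum: "hcoef (hsum f N) k = (if \<bar>k\<bar> \<le> int N then hcoef f k else 0)"
  unfolding hsum_def[abs_def] by (subst hcoef_trig) auto

text \<open>
  The partial sums are Cauchy by Bessel's inequality. Their limit has the same coefficients as
  \<open>f\<close>, and coefficients determine a function.
\<close>

lemma hsum_L2_convergence:
  assumes f: "sqint circ f"
  shows "(\<lambda>N. \<integral>x. (hsum f N x - f x)\<^sup>2 \<partial>circ) \<longlonglongrightarrow> 0"
proof -
  define B where "B N = 2*pi * (\<Sum>k\<in>{- int N..int N}. (hcoef f k)\<^sup>2)" for N :: nat
  have Bmono: "incseq B"
    unfolding B_def incseq_def by (auto intro!: mult_left_mono sum_mono2)
  have "B N \<le> (\<integral>x. (f x)\<^sup>2 \<partial>circ)" for N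
    unfolding B_def by (rule Bessel[OF f]) auto
  from incseq_convergent[OF Bmono] this obtain l where "B \<longlonglongrightarrow> l" by blast
  then have CB: "Cauchy B" by (rule LIMSEQ_imp_Cauchy)
  have diff: "(\<integral>x. (hsum f M x - hsum f N x)\<^sup>2 \<partial>circ) = B M - B N" if "N \<le> M" for M N
  proof -
    have sub: "{- int N..int N} \<subseteq> {- int M..int M}" using that by auto
    have "hsum f M x - hsum f N x = (\<Sum>k\<in>{- int M..int M} - {- int N..int N}. hcoef f k * cas k x)" for x
      unfolding hsum_def using sub by (subst sum_diff) auto
    then have "(\<integral>x. (hsum f M x - hsum f N x)\<^sup>2 \<partial>circ)
        = 2*pi * (\<Sum>k\<in>{- int M..int M} - {- int N..int N}. (hcoef f k)\<^sup>2)"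
      by (simp add: integral_trig_square)
    also have "\<dots> = B M - B N"
      unfolding B_def using sub by (subst sum_diff) (auto simp: algebra_simps)
    finally show ?thesis .
  qed
  have "\<exists>N. \<forall>i\<ge>N. \<forall>j\<ge>N. (\<integral>x. (hsum f i x - hsum f j x)\<^sup>2 \<partial>circ) < e" if "0 < e" for e
  proof -
    from CB that have "\<exists>N. \<forall>i\<ge>N. \<forall>j\<ge>N. norm (B i - B j) < e" unfolding Cauchy_iff by blast
    then obtain N where N: "\<forall>i\<ge>N. \<forall>j\<ge>N. norm (B i - B j) < e" by blast
    have "(\<integral>x. (hsum f i x - hsum f j x)\<^sup>2 \<partial>circ) < e" if "i \<ge> N" "j \<ge> N" for i j
    proof (cases "j \<le> i")
      case True
      then show ?thesis using diff[OF True] N that by (metis abs_ge_self order_le_less_trans real_norm_def)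
    next
      case False
      have "(\<integral>x. (hsum f i x - hsum f j x)\<^sup>2 \<partial>circ) = (\<integral>x. (hsum f j x - hsum f i x)\<^sup>2 \<partial>circ)"
        by (simp add: power2_commute)
      also have "\<dots> < e" using diff[of i j] False N that by (metis abs_ge_self order_le_less_trans real_norm_def nat_le_linear)
      finally show ?thesis .
    qed
    then show ?thesis by blast
  qed
  then obtain g where g: "sqint circ g" "(\<lambda>N. \<integral>x. (hsum f N x - g x)\<^sup>2 \<partial>circ) \<longlonglongrightarrow> 0"
    by (rule sqint_complete[OF finite_measure_circ sqint_hsum]) auto
  have "hcoef g k = hcoef f k" for k
  proof -
    have "(\<lambda>N. hcoef (hsum f N) k) \<longlonglongrightarrow> hcoef g k"
      unfolding hcoef_def by (intro tendsto_intros sqint_limit_mult sqint_hsum sqint_cas g)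
    moreover have "(\<lambda>N. hcoef (hsum f N) k) \<longlonglongrightarrow> hcoef f k"
      by (rule tendsto_eventually, rule eventually_sequentiallyI[of "nat \<bar>k\<bar>"]) (auto simp: hcoef_hsum)
    ultimately show ?thesis by (rule LIMSEQ_unique)
  qed
  then have "AE x in circ. g x - f x = 0"
    using f g by (intro hcoef_zero_imp_zero) (auto simp: hcoef_diff L2_integrable)
  then have "AE x in circ. (hsum f N x - g x)\<^sup>2 = (hsum f N x - f x)\<^sup>2" for N
    by eventually_elim auto
  then have "(\<integral>x. (hsum f N x - g x)\<^sup>2 \<partial>circ) = (\<integral>x. (hsum f N x - f x)\<^sup>2 \<partial>circ)" for N
    using sqint_measurable[OF f] sqint_measurable[OF g(1)] sqint_measurable[OF sqint_hsum[of f N]]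
    by (intro integral_cong_AE) auto
  then show ?thesis using g(2) by simp
qed

lemma Parseval:
  assumes f: "sqint circ f" and g: "sqint circ g"
  shows "(\<lambda>N. 2*pi * (\<Sum>k\<in>{- int N..int N}. hcoef f k * hcoef g k)) \<longlonglongrightarrow> (\<integral>x. f x * g x \<partial>circ)"
proof -
  have "(\<lambda>N. \<integral>x. hsum f N x * g x \<partial>circ) \<longlonglongrightarrow> (\<integral>x. f x * g x \<partial>circ)"
    by (rule sqint_limit_mult[OF sqint_hsum f g hsum_L2_convergence[OF f]])
  moreover have "(\<integral>x. hsum f N x * g x \<partial>circ) = 2*pi * (\<Sum>k\<in>{- int N..int N}. hcoef f k * hcoef g k)" for N
    using integral_mult_trig[OF g, of "hcoef f"] by (simp add: hsum_def[abs_def] mult.commute)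
  ultimately show ?thesis by simp
qed

lemma AE_bound_L2_limit:
  assumes f: "\<And>n. sqint circ (f n)" and g: "sqint circ g"
    and lim: "(\<lambda>n::nat. \<integral>x. (f n x - g x)\<^sup>2 \<partial>circ) \<longlonglongrightarrow> 0"
    and b: "\<And>n x. \<bar>f n x\<bar> \<le> B"
  shows "AE x in circ. \<bar>g x\<bar> \<le> B"
proof -
  obtain r where "AE x in circ. (\<lambda>n. f (r n) x) \<longlonglongrightarrow> g x"
    using sqint_limit_AE_subseq[OF _ f g lim] by auto
  then show ?thesis
  proof eventually_elim
    case (elim x)
    then have "(\<lambda>n. \<bar>f (r n) x\<bar>) \<longlonglongrightarrow> \<bar>g x\<bar>" by (rule tendsto_rabs)
    then show ?case by (rule LIMSEQ_le_const2) (use b in auto)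
  qed
qed

section \<open>Weak derivatives and uniform bounds\<close>

lemma smooth_periodic_cas: "smooth_periodic (cas k)"
proof -
  have d: "\<exists>\<alpha> \<beta>. (deriv ^^ n) (cas k) = (\<lambda>x. \<alpha> * cos (of_int k * x) + \<beta> * sin (of_int k * x))" for n
  proof (induction n)
    case 0
    show ?case by (rule exI[of _ 1], rule exI[of _ 1]) (auto simp: cas_def[abs_def])
  next
    case (Suc n)
    then obtain \<alpha> \<beta> where 1: "(deriv ^^ n) (cas k) = (\<lambda>x. \<alpha> * cos (of_int k * x) + \<beta> * sin (of_int k * x))" by blast
    have "deriv (\<lambda>x. \<alpha> * cos (of_int k * x) + \<beta> * sin (of_int k * x)) x =
      (\<beta> * of_int k) * cos (of_int k * x) + (- \<alpha> * of_int k) * sin (of_int k * x)" for x :: real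
      by (rule DERIV_imp_deriv) (auto intro!: derivative_eq_intros simp: algebra_simps)
    then show ?case unfolding funpow.simps o_def 1 by blast
  qed
  have "(deriv ^^ n) (cas k) field_differentiable (at x)" for n x
  proof -
    obtain \<alpha> \<beta> where 1: "(deriv ^^ n) (cas k) = (\<lambda>x. \<alpha> * cos (of_int k * x) + \<beta> * sin (of_int k * x))"
      using d by blast
    have "((deriv ^^ n) (cas k) has_field_derivative
      (\<beta> * of_int k) * cos (of_int k * x) + (- \<alpha> * of_int k) * sin (of_int k * x)) (at x)"
      unfolding 1 by (auto intro!: derivative_eq_intros simp: algebra_simps)
    then show ?thesis by (auto simp: field_differentiable_def)
  qed
  then show ?thesis by (auto simp: smooth_periodic_def cas_periodic)
qed

lemma deriv_cas: "deriv (cas k) = (\<lambda>x. of_int k * cas (-k) x)"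
  using cas_has_derivative by (intro ext DERIV_imp_deriv)

text \<open>
  The trace of weak differentiability on coefficients. All that is used of a weak derivative is
  its coefficients, obtained with the Hartley functions as test functions.
\<close>

definition hderiv :: "(real \<Rightarrow> real) \<Rightarrow> (real \<Rightarrow> real) \<Rightarrow> bool" where
  "hderiv p g \<longleftrightarrow> sqint circ p \<and> sqint circ g \<and> (\<forall>k. hcoef g k = - of_int k * hcoef p (-k))"

lemma weak_deriv_imp_hderiv:
  assumes "weak_deriv p g"
  shows "hderiv p g"
proof -
  have "hcoef g k = - of_int k * hcoef p (-k)" for k
  proof -
    have "(\<integral>x. p x * deriv (cas k) x \<partial>circ) = - (\<integral>x. g x * cas k x \<partial>circ)"
      using assms smooth_periodic_cas by (auto simp: weak_deriv_def)
    moreover have "(\<integral>x. p x * deriv (cas k) x \<partial>circ) = of_int k * (\<integral>x. p x * cas (-k) x \<partial>circ)"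
      by (simp add: deriv_cas mult.left_commute)
    ultimately show ?thesis by (simp add: hcoef_def field_simps)
  qed
  then show ?thesis using assms by (simp add: hderiv_def weak_deriv_def L2_iff_sqint)
qed

lemma sum_inverse_squares_le: "(\<Sum>k=1..N. 1 / (real k)\<^sup>2) \<le> 2"
proof -
  have "(\<Sum>k=1..N. 1 / (real k)\<^sup>2) \<le> 2 - 1 / real N" if "N \<ge> 1" for N :: nat
    using that
  proof (induction N rule: nat_induct_at_least)
    case (Suc n)
    have "1 / (real (Suc n))\<^sup>2 \<le> 1 / (real n * real (Suc n))"
      using Suc.hyps by (intro divide_left_mono) (auto simp: power2_eq_square intro!: mult_right_mono)
    also have "\<dots> = 1 / real n - 1 / real (Suc n)" using Suc.hyps by (simp add: field_simps)
    finally show ?case using Suc by simp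
  qed auto
  from this[of N] show ?thesis by (cases "N = 0") (auto intro: order_trans)
qed

lemma sum_int_split:
  fixes F :: "int \<Rightarrow> 'a::comm_monoid_add"
  shows "(\<Sum>k\<in>{- int N..int N} - {0}. F k) = (\<Sum>l=1..N. F (int l) + F (- int l))"
proof -
  have e: "{- int N..int N} - {0} = int ` {1..N} \<union> (\<lambda>l. - int l) ` {1..N}"
  proof (intro set_eqI iffI)
    fix k assume k: "k \<in> {- int N..int N} - {0}"
    show "k \<in> int ` {1..N} \<union> (\<lambda>l. - int l) ` {1..N}"
    proof (cases "k > 0")
      case True
      then have "k = int (nat k)" "nat k \<in> {1..N}" using k by auto
      then show ?thesis by blast
    next
      case False
      then have "k = - int (nat (-k))" "nat (-k) \<in> {1..N}" using k by auto
      then show ?thesis by blast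
    qed
  qed auto
  show ?thesis unfolding e
    by (subst sum.union_disjoint) (auto simp: sum.reindex inj_on_def sum.distrib)
qed

text \<open>
  Cauchy and Schwarz with the weights \<open>1 / k\<close>, whose squares are summable: the coefficients of a
  function in \<open>H\<^sup>1\<close> are absolutely summable.
\<close>

lemma hderiv_sum_bound:
  assumes pg: "hderiv p g"
  shows "(\<Sum>k\<in>{- int N..int N} - {0}. \<bar>hcoef p k\<bar>) \<le> 2 * sqrt (\<integral>x. (g x)\<^sup>2 \<partial>circ)"
proof -
  let ?I = "{- int N..int N} - {0}"
  have "(\<Sum>k\<in>?I. \<bar>hcoef p k\<bar>) = (\<Sum>k\<in>?I. (1 / \<bar>real_of_int k\<bar>) * (\<bar>real_of_int k\<bar> * \<bar>hcoef p k\<bar>))"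
    by (intro sum.cong) auto
  also have "(\<dots>)\<^sup>2 \<le> (\<Sum>k\<in>?I. (1 / \<bar>real_of_int k\<bar>)\<^sup>2) * (\<Sum>k\<in>?I. (\<bar>real_of_int k\<bar> * \<bar>hcoef p k\<bar>)\<^sup>2)"
    by (rule Cauchy_Schwarz_ineq_sum)
  also have "(\<Sum>k\<in>?I. (1 / \<bar>real_of_int k\<bar>)\<^sup>2) = 2 * (\<Sum>k=1..N. 1 / (real k)\<^sup>2)"
    by (simp add: sum_int_split power_divide sum_distrib_left)
  also have "(\<Sum>k\<in>?I. (\<bar>real_of_int k\<bar> * \<bar>hcoef p k\<bar>)\<^sup>2) = (\<Sum>k\<in>?I. (hcoef g (-k))\<^sup>2)"
    using pg by (intro sum.cong) (auto simp: hderiv_def power_mult_distrib)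
  also have "\<dots> = (\<Sum>k\<in>?I. (hcoef g k)\<^sup>2)"
    by (simp add: sum_int_split add.commute)
  also have "2 * (\<Sum>k=1..N. 1 / (real k)\<^sup>2) * (\<Sum>k\<in>?I. (hcoef g k)\<^sup>2) \<le> 4 * (\<integral>x. (g x)\<^sup>2 \<partial>circ)"
  proof (rule mult_mono)
    have g: "sqint circ g" using pg by (simp add: hderiv_def)
    have "(\<Sum>k\<in>?I. (hcoef g k)\<^sup>2) * 1 \<le> (\<Sum>k\<in>?I. (hcoef g k)\<^sup>2) * (2*pi)"
      using pi_ge_two by (intro mult_left_mono sum_nonneg) auto
    also have "\<dots> \<le> (\<integral>x. (g x)\<^sup>2 \<partial>circ)" using Bessel[OF g, of ?I] by (simp add: mult.commute)
    finally show "(\<Sum>k\<in>?I. (hcoef g k)\<^sup>2) \<le> (\<integral>x. (g x)\<^sup>2 \<partial>circ)" by simp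
  qed (use sum_inverse_squares_le[of N] in \<open>auto intro: sum_nonneg\<close>)
  finally have "(\<Sum>k\<in>?I. \<bar>hcoef p k\<bar>) \<le> sqrt (4 * (\<integral>x. (g x)\<^sup>2 \<partial>circ))"
    by (rule real_le_rsqrt)
  then show ?thesis by (simp add: real_sqrt_mult)
qed

lemma hsum_minus_mean_bound:
  shows "\<bar>hsum p N x - hcoef p 0\<bar> \<le> 2 * (\<Sum>k\<in>{- int N..int N} - {0}. \<bar>hcoef p k\<bar>)"
proof -
  have "hsum p N x = hcoef p 0 * cas 0 x + (\<Sum>k\<in>{- int N..int N} - {0}. hcoef p k * cas k x)"
    unfolding hsum_def by (rule sum.remove) auto
  then have "\<bar>hsum p N x - hcoef p 0\<bar> = \<bar>\<Sum>k\<in>{- int N..int N} - {0}. hcoef p k * cas k x\<bar>" by simp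
  also have "\<dots> \<le> (\<Sum>k\<in>{- int N..int N} - {0}. \<bar>hcoef p k * cas k x\<bar>)" by (rule sum_abs)
  also have "\<dots> \<le> (\<Sum>k\<in>{- int N..int N} - {0}. 2 * \<bar>hcoef p k\<bar>)"
  proof (rule sum_mono)
    fix k
    show "\<bar>hcoef p k * cas k x\<bar> \<le> 2 * \<bar>hcoef p k\<bar>"
      using mult_left_mono[OF cas_bound[of k x] abs_ge_zero[of "hcoef p k"]] by (simp add: abs_mult)
  qed
  finally show ?thesis by (simp add: sum_distrib_left)
qed

lemma hcoef_sum_sup_bound:
  assumes p: "sqint circ p" and b: "\<And>N. (\<Sum>k\<in>{- int N..int N} - {0}. \<bar>hcoef p k\<bar>) \<le> B"
  shows "AE x in circ. \<bar>p x - hcoef p 0\<bar> \<le> 2 * B"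
proof (rule AE_bound_L2_limit[where f="\<lambda>N x. hsum p N x - hcoef p 0"])
  have c: "sqint circ (\<lambda>x. hcoef p 0)" by (rule sqint_bounded[of _ _ "\<bar>hcoef p 0\<bar>"]) auto
  show "sqint circ (\<lambda>x. hsum p N x - hcoef p 0)" for N by (intro sqint_diff sqint_hsum c)
  show "sqint circ (\<lambda>x. p x - hcoef p 0)" by (intro sqint_diff p c)
  show "(\<lambda>n. \<integral>x. (hsum p n x - hcoef p 0 - (p x - hcoef p 0))\<^sup>2 \<partial>circ) \<longlonglongrightarrow> 0"
    using hsum_L2_convergence[OF p] by simp
  show "\<bar>hsum p n x - hcoef p 0\<bar> \<le> 2 * B" for n x
    using hsum_minus_mean_bound[of p n x] b[of n] by linarith
qed

text \<open>
  The Sobolev embedding of \<open>H\<^sup>1\<close> into bounded functions in dimension one.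
\<close>

lemma hderiv_sup_bound:
  assumes pg: "hderiv p g"
  shows "AE x in circ. \<bar>p x - hcoef p 0\<bar> \<le> 4 * sqrt (\<integral>x. (g x)\<^sup>2 \<partial>circ)"
  using hcoef_sum_sup_bound[OF _ hderiv_sum_bound[OF pg]] pg by (simp add: hderiv_def)

lemma nn_integral_circ_shift:
  fixes f :: "real \<Rightarrow> ennreal"
  assumes [measurable]: "f \<in> borel_measurable borel" and per: "\<And>x. f (x + 2*pi) = f x"
    and y: "y \<in> {0..<2*pi}"
  shows "(\<integral>\<^sup>+x. f (x - y) \<partial>circ) = (\<integral>\<^sup>+x. f x \<partial>circ)"
proof -
  have "(\<integral>\<^sup>+x. f (x - y) \<partial>circ) = (\<integral>\<^sup>+x. f (x - y) * indicator {0..<2*pi} x \<partial>lborel)"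
    by (rule nn_integral_circ)
  also have "\<dots> = (\<integral>\<^sup>+x. f x * indicator {0..<2*pi} (x + y) \<partial>lborel)"
    by (subst nn_integral_real_affine[where c=1 and t=y]) (auto simp: add.commute)
  also have "\<dots> = (\<integral>\<^sup>+x. f x * indicator {-y..<0} x + f x * indicator {0..<2*pi-y} x \<partial>lborel)"
    using y by (intro nn_integral_cong) (auto simp: indicator_def)
  also have "\<dots> = (\<integral>\<^sup>+x. f x * indicator {-y..<0} x \<partial>lborel) + (\<integral>\<^sup>+x. f x * indicator {0..<2*pi-y} x \<partial>lborel)"
    by (rule nn_integral_add) auto
  also have "(\<integral>\<^sup>+x. f x * indicator {-y..<0} x \<partial>lborel) = (\<integral>\<^sup>+x. f (x - 2*pi) * indicator {-y..<0} (x - 2*pi) \<partial>lborel)"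
    by (subst nn_integral_real_affine[where c=1 and t="-2*pi"]) auto
  also have "\<dots> = (\<integral>\<^sup>+x. f x * indicator {2*pi-y..<2*pi} x \<partial>lborel)"
  proof (intro nn_integral_cong)
    fix x show "f (x - 2*pi) * indicator {-y..<0} (x - 2*pi) = f x * indicator {2*pi-y..<2*pi} x"
      using per[of "x - 2*pi"] by (auto simp: indicator_def)
  qed
  also have "\<dots> + (\<integral>\<^sup>+x. f x * indicator {0..<2*pi-y} x \<partial>lborel)
      = (\<integral>\<^sup>+x. f x * indicator {2*pi-y..<2*pi} x + f x * indicator {0..<2*pi-y} x \<partial>lborel)"
    by (rule nn_integral_add[symmetric]) auto
  also have "\<dots> = (\<integral>\<^sup>+x. f x * indicator {0..<2*pi} x \<partial>lborel)"
    using y by (intro nn_integral_cong) (auto simp: indicator_def)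
  finally show ?thesis by (simp add: nn_integral_circ)
qed

text \<open>
  Reflection changes the sign of the sine part, so for an even function only the cosine part
  contributes.
\<close>

lemma hcoef_even:
  assumes p: "integrable circ p" and ev: "even_on_circ p"
  shows "hcoef p (-k) = hcoef p k"
proof -
  have [measurable]: "p \<in> borel_measurable circ" using p by auto
  define G where "G x = indicator {0..<2*pi} x * (p x * sin (of_int k * x))" for x
  have i: "integrable circ (\<lambda>x. p x * cos (of_int k * x))" "integrable circ (\<lambda>x. p x * sin (of_int k * x))"
    using mult_left_mono[OF abs_cos_le_one abs_ge_zero] mult_left_mono[OF abs_sin_le_one abs_ge_zero]
    by (auto intro!: Bochner_Integration.integrable_bound[OF p] AE_I2 simp: abs_mult)
  have [measurable]: "G \<in> borel_measurable borel"
    using i(2) by (simp add: circ_def integrable_restrict_space G_def[abs_def])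
  have "(\<integral>x. G x \<partial>lborel) = (\<integral>x. G (2*pi - x) \<partial>lborel)"
    using lborel_integral_real_affine[of "-1" G "2*pi"] by simp
  also have "\<dots> = (\<integral>x. - G x \<partial>lborel)"
  proof (rule integral_cong_AE)
    have "AE x in lborel. x \<in> {0..<2*pi} \<longrightarrow> p (2*pi - x) = p x"
      using ev by (simp add: even_on_circ_def AE_circ_iff)
    then show "AE x in lborel. G (2*pi - x) = - G x"
      using AE_lborel_singleton[of 0] AE_lborel_singleton[of "2*pi"]
    proof eventually_elim
      case (elim x)
      have "sin (of_int k * (2*pi - x)) = - sin (of_int k * x)"
        using sin.plus_of_int[of "- of_int k * x" k] by (simp add: algebra_simps)
      then show ?case using elim by (auto simp: G_def indicator_def)
    qed
  qed auto
  finally have "(\<integral>x. G x \<partial>lborel) = 0" by simp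
  then have "(\<integral>x. p x * sin (of_int k * x) \<partial>circ) = 0"
    by (simp add: circ_def integral_restrict_space G_def)
  then show ?thesis using i by (simp add: hcoef_def cas_def distrib_left right_diff_distrib)
qed

lemma mode_eq_hcoef:
  assumes p: "integrable circ p" "even_on_circ p" and k: "nat \<bar>k\<bar> = l"
  shows "hcoef p k = mode p l"
proof -
  have "hcoef p k = hcoef p (int l)" using hcoef_even[OF p, of k] k by (cases "k \<ge> 0") auto
  also have "\<dots> = (hcoef p (int l) + hcoef p (- int l)) / 2" using hcoef_even[OF p, of "int l"] by simp
  also have "\<dots> = mode p l"
  proof -
    have "(\<integral>x. p x * cas (int l) x \<partial>circ) + (\<integral>x. p x * cas (- int l) x \<partial>circ)
      = (\<integral>x. p x * cas (int l) x + p x * cas (- int l) x \<partial>circ)"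
      by (rule Bochner_Integration.integral_add[symmetric]) (intro integrable_mult_cas p)+
    also have "\<dots> = (\<integral>x. 2 * (p x * cos (real l * x)) \<partial>circ)"
      by (simp add: cas_def algebra_simps)
    also have "\<dots> = 2 * (\<integral>x. p x * cos (real l * x) \<partial>circ)" by simp
    finally show ?thesis by (simp add: hcoef_def mode_def field_simps)
  qed
  finally show ?thesis .
qed

section \<open>The interaction form\<close>

text \<open>
  What is needed of a potential to define its interaction; unlike \<open>potential\<close> it does not mention
  coefficients.
\<close>

definition kernel_ok :: "(real \<Rightarrow> real) \<Rightarrow> bool" where
  "kernel_ok W \<longleftrightarrow> W \<in> borel_measurable borel \<and> (\<forall>x. W (x + 2*pi) = W x) \<and> (\<forall>x. W (- x) = W x) \<and> sqint circ W"

definition interaction :: "(real \<Rightarrow> real) \<Rightarrow> (real \<Rightarrow> real) \<Rightarrow> (real \<Rightarrow> real) \<Rightarrow> real" where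
  "interaction W u r = 1 / (4*pi\<^sup>2) * (\<integral>(x, y). W (x - y) * u x * r y \<partial>(circ \<Otimes>\<^sub>M circ))"

definition L2norm :: "(real \<Rightarrow> real) \<Rightarrow> real" where
  "L2norm f = sqrt (\<integral>x. (f x)\<^sup>2 \<partial>circ)"

lemma potential_kernel_ok: "potential a W \<Longrightarrow> kernel_ok W"
  by (auto simp: potential_def kernel_ok_def sqint_def)

lemma circ_id_measurable[measurable]: "(\<lambda>x. x) \<in> borel_measurable circ"
  by (rule measurable_circ) simp

lemma kernel_measurable[measurable]:
  assumes [measurable]: "W \<in> borel_measurable borel"
  shows "(\<lambda>z. W (fst z - snd z)) \<in> borel_measurable (circ \<Otimes>\<^sub>M circ)"
proof -
  have "(\<lambda>z::real\<times>real. fst z - snd z) \<in> borel_measurable (circ \<Otimes>\<^sub>M circ)"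
    using measurable_compose[OF measurable_fst circ_id_measurable]
      measurable_compose[OF measurable_snd circ_id_measurable] by measurable
  from measurable_compose[OF this assms] show ?thesis .
qed

lemma interaction_integrand_measurable:
  fixes W u r :: "real \<Rightarrow> real"
  assumes W: "W \<in> borel_measurable borel" and u: "u \<in> borel_measurable circ" and r: "r \<in> borel_measurable circ"
  shows "(\<lambda>(x, y). W (x - y) * u x * r y) \<in> borel_measurable (circ \<Otimes>\<^sub>M circ)"
proof -
  have "(\<lambda>z. u (fst z)) \<in> borel_measurable (circ \<Otimes>\<^sub>M circ)" "(\<lambda>z. r (snd z)) \<in> borel_measurable (circ \<Otimes>\<^sub>M circ)"
    using measurable_compose[OF measurable_fst u] measurable_compose[OF measurable_snd r] .
  then show ?thesis
    unfolding case_prod_beta' by (simp add: borel_measurable_times kernel_measurable[OF W])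
qed

lemma kernel_shift:
  assumes W: "kernel_ok W" and y: "y \<in> {0..<2*pi}"
  shows "sqint circ (\<lambda>x. W (x - y))" "(\<integral>x. (W (x - y))\<^sup>2 \<partial>circ) = (\<integral>x. (W x)\<^sup>2 \<partial>circ)"
proof -
  have [measurable]: "W \<in> borel_measurable borel" using W by (simp add: kernel_ok_def)
  have per: "W (x + 2*pi) = W x" for x using W by (simp add: kernel_ok_def)
  have "(\<integral>\<^sup>+x. ennreal ((W (x - y))\<^sup>2) \<partial>circ) = (\<integral>\<^sup>+x. ennreal ((W x)\<^sup>2) \<partial>circ)"
    by (rule nn_integral_circ_shift[OF _ _ y]) (auto simp: per)
  moreover have "integrable circ (\<lambda>x. (W x)\<^sup>2)" using W by (simp add: kernel_ok_def sqint_def)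
  ultimately have e: "(\<integral>\<^sup>+x. ennreal ((W (x - y))\<^sup>2) \<partial>circ) = ennreal (\<integral>x. (W x)\<^sup>2 \<partial>circ)"
    by (simp add: nn_integral_eq_integral)
  have "has_bochner_integral circ (\<lambda>x. (W (x - y))\<^sup>2) (\<integral>x. (W x)\<^sup>2 \<partial>circ)"
    by (rule has_bochner_integral_nn_integral[OF _ _ _ e]) auto
  then show "sqint circ (\<lambda>x. W (x - y))" "(\<integral>x. (W (x - y))\<^sup>2 \<partial>circ) = (\<integral>x. (W x)\<^sup>2 \<partial>circ)"
    by (auto simp: sqint_def has_bochner_integral_iff)
qed

lemma kernel_shift_abs_le:
  assumes W: "kernel_ok W" and u: "sqint circ u" and y: "y \<in> {0..<2*pi}"
  shows "(\<integral>x. \<bar>W (x - y) * u x\<bar> \<partial>circ) \<le> L2norm W * L2norm u"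
proof -
  have "(\<integral>x. \<bar>W (x - y) * u x\<bar> \<partial>circ)\<^sup>2 \<le> (\<integral>x. (W x)\<^sup>2 \<partial>circ) * (\<integral>x. (u x)\<^sup>2 \<partial>circ)"
    using sqint_Cauchy_Schwarz[OF kernel_shift(1)[OF W y] u] kernel_shift(2)[OF W y] by simp
  from real_le_rsqrt[OF this] show ?thesis by (simp add: L2norm_def real_sqrt_mult)
qed

text \<open>
  Young's inequality: by translation invariance the inner integral over \<open>x\<close> is at most the
  product of the mean-square norms for every \<open>y\<close>, and what remains is the \<open>L\<^sup>1\<close> norm of \<open>r\<close>.
  One argument may thus be a mere integrable function, such as a density of finite entropy.
\<close>

lemma interaction_nn_integral_le:
  assumes W: "kernel_ok W" and u: "sqint circ u" and r: "integrable circ r"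
  shows "(\<integral>\<^sup>+(x, y). ennreal \<bar>W (x - y) * u x * r y\<bar> \<partial>(circ \<Otimes>\<^sub>M circ))
    \<le> ennreal (L2norm W * L2norm u * (\<integral>y. \<bar>r y\<bar> \<partial>circ))"
proof -
  have Wm[measurable]: "W \<in> borel_measurable borel" using W by (simp add: kernel_ok_def)
  have rm[measurable]: "r \<in> borel_measurable circ" using r by auto
  have m[measurable]: "(\<lambda>(x, y). W (x - y) * u x * r y) \<in> borel_measurable (circ \<Otimes>\<^sub>M circ)"
    by (rule interaction_integrand_measurable) (use u r W in \<open>auto simp: sqint_def kernel_ok_def\<close>)
  have m': "(\<lambda>(x, y). ennreal \<bar>W (x - y) * u x * r y\<bar>) \<in> borel_measurable (circ \<Otimes>\<^sub>M circ)"
    using measurable_compose[OF m, of "\<lambda>t. ennreal \<bar>t\<bar>" borel] by (simp add: case_prod_beta)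
  have "(\<integral>\<^sup>+(x, y). ennreal \<bar>W (x - y) * u x * r y\<bar> \<partial>(circ \<Otimes>\<^sub>M circ))
    = (\<integral>\<^sup>+y. (\<integral>\<^sup>+x. ennreal \<bar>W (x - y) * u x * r y\<bar> \<partial>circ) \<partial>circ)"
    using circ2.nn_integral_snd[OF m'] by simp
  also have "\<dots> \<le> (\<integral>\<^sup>+y. ennreal (L2norm W * L2norm u) * ennreal \<bar>r y\<bar> \<partial>circ)"
  proof (rule nn_integral_mono)
    fix y assume "y \<in> space circ"
    then have y: "y \<in> {0..<2*pi}" by simp
    have s: "integrable circ (\<lambda>x. W (x - y) * u x)" by (rule sqint_mult[OF kernel_shift(1)[OF W y] u])
    have "(\<integral>\<^sup>+x. ennreal \<bar>W (x - y) * u x * r y\<bar> \<partial>circ) = (\<integral>\<^sup>+x. ennreal \<bar>W (x - y) * u x\<bar> * ennreal \<bar>r y\<bar> \<partial>circ)"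
      by (simp add: abs_mult ennreal_mult')
    also have "\<dots> = (\<integral>\<^sup>+x. ennreal \<bar>W (x - y) * u x\<bar> \<partial>circ) * ennreal \<bar>r y\<bar>"
      using s by (intro nn_integral_multc) auto
    also have "(\<integral>\<^sup>+x. ennreal \<bar>W (x - y) * u x\<bar> \<partial>circ) = ennreal (\<integral>x. \<bar>W (x - y) * u x\<bar> \<partial>circ)"
      using s by (intro nn_integral_eq_integral) auto
    also have "\<dots> * ennreal \<bar>r y\<bar> \<le> ennreal (L2norm W * L2norm u) * ennreal \<bar>r y\<bar>"
      by (intro mult_right_mono ennreal_leI kernel_shift_abs_le[OF W u y]) auto
    finally show "(\<integral>\<^sup>+x. ennreal \<bar>W (x - y) * u x * r y\<bar> \<partial>circ) \<le> ennreal (L2norm W * L2norm u) * ennreal \<bar>r y\<bar>" .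
  qed
  also have "\<dots> = ennreal (L2norm W * L2norm u) * (\<integral>\<^sup>+y. ennreal \<bar>r y\<bar> \<partial>circ)"
    by (rule nn_integral_cmult) auto
  also have "(\<integral>\<^sup>+y. ennreal \<bar>r y\<bar> \<partial>circ) = ennreal (\<integral>y. \<bar>r y\<bar> \<partial>circ)"
    using r by (intro nn_integral_eq_integral) auto
  finally show ?thesis by (simp add: ennreal_mult' L2norm_def)
qed

lemma interaction_integrable:
  assumes W: "kernel_ok W" and u: "sqint circ u" and r: "integrable circ r"
  shows "integrable (circ \<Otimes>\<^sub>M circ) (\<lambda>(x, y). W (x - y) * u x * r y)"
proof (rule integrableI_bounded)
  show "(\<lambda>(x, y). W (x - y) * u x * r y) \<in> borel_measurable (circ \<Otimes>\<^sub>M circ)"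
    by (rule interaction_integrand_measurable) (use u r W in \<open>auto simp: sqint_def kernel_ok_def\<close>)
  show "(\<integral>\<^sup>+z. ennreal (norm (case z of (x, y) \<Rightarrow> W (x - y) * u x * r y)) \<partial>(circ \<Otimes>\<^sub>M circ)) < \<infinity>"
    using interaction_nn_integral_le[OF assms] by (simp add: case_prod_beta' order_le_less_trans)
qed

lemma interaction_abs_le:
  assumes W: "kernel_ok W" and u: "sqint circ u" and r: "integrable circ r"
  shows "\<bar>interaction W u r\<bar> \<le> 1 / (4*pi\<^sup>2) * (L2norm W * L2norm u * (\<integral>y. \<bar>r y\<bar> \<partial>circ))"
proof -
  have "ennreal \<bar>\<integral>(x, y). W (x - y) * u x * r y \<partial>(circ \<Otimes>\<^sub>M circ)\<bar>
     \<le> (\<integral>\<^sup>+z. ennreal (norm (case z of (x, y) \<Rightarrow> W (x - y) * u x * r y)) \<partial>(circ \<Otimes>\<^sub>M circ))"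
    using integral_norm_bound_ennreal[OF interaction_integrable[OF assms]] by simp
  also have "\<dots> \<le> ennreal (L2norm W * L2norm u * (\<integral>y. \<bar>r y\<bar> \<partial>circ))"
    using interaction_nn_integral_le[OF assms] by (simp add: case_prod_beta')
  finally have "\<bar>\<integral>(x, y). W (x - y) * u x * r y \<partial>(circ \<Otimes>\<^sub>M circ)\<bar> \<le> L2norm W * L2norm u * (\<integral>y. \<bar>r y\<bar> \<partial>circ)"
    by (subst (asm) ennreal_le_iff) (auto simp: L2norm_def intro!: mult_nonneg_nonneg integral_nonneg_AE)
  then show ?thesis by (simp add: interaction_def abs_mult divide_right_mono)
qed

text \<open>
  The interaction in coordinates: \<open>interaction_sum_limit\<close> identifies its limit for \<open>N \<rightarrow> \<infinity>\<close>. The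
  indices \<open>k\<close> and \<open>- k\<close> share the cosine coefficient of \<open>W\<close>, which explains the factor \<open>1/2\<close>.
\<close>

definition interaction_sum :: "(nat \<Rightarrow> real) \<Rightarrow> nat \<Rightarrow> (real \<Rightarrow> real) \<Rightarrow> (real \<Rightarrow> real) \<Rightarrow> real" where
  "interaction_sum a N u r = 1/2 * (\<Sum>k\<in>{- int N..int N} - {0}. a (nat \<bar>k\<bar>) * hcoef u k * hcoef r k)"

definition trunc_kernel :: "(nat \<Rightarrow> real) \<Rightarrow> nat \<Rightarrow> real \<Rightarrow> real" where
  "trunc_kernel a N x = (\<Sum>l=1..N. a l * cos (real l * x))"

lemma cos_eq_cas: "cos (real l * x) = (cas (int l) x + cas (- int l) x) / 2"
  by (simp add: cas_def)

lemma trunc_kernel_cas: "trunc_kernel a N x = (\<Sum>k\<in>{- int N..int N} - {0}. a (nat \<bar>k\<bar>) / 2 * cas k x)"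
  unfolding trunc_kernel_def sum_int_split cos_eq_cas by (intro sum.cong) (auto simp: algebra_simps)

lemma trunc_kernel_diff:
  "trunc_kernel a N (x - y) = (\<Sum>k\<in>{- int N..int N} - {0}. a (nat \<bar>k\<bar>) / 2 * (cas k x * cas k y))"
  unfolding trunc_kernel_def sum_int_split cos_difference_cas by (intro sum.cong) (auto simp: algebra_simps)

lemma kernel_ok_trunc: "kernel_ok (trunc_kernel a N)"
proof -
  have "trunc_kernel a N (x + 2*pi) = trunc_kernel a N x" for x
    by (simp add: trunc_kernel_cas cas_periodic)
  moreover have "sqint circ (trunc_kernel a N)"
    unfolding trunc_kernel_cas[abs_def] by (rule sqint_trig)
  ultimately show ?thesis by (auto simp: kernel_ok_def trunc_kernel_def[abs_def])
qed

lemma integrable_product_circ: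
  assumes f: "integrable circ f" and g: "integrable circ g"
  shows "integrable (circ \<Otimes>\<^sub>M circ) (\<lambda>(x, y). f x * g y :: real)"
    "(\<integral>(x, y). f x * g y \<partial>(circ \<Otimes>\<^sub>M circ)) = (\<integral>x. f x \<partial>circ) * (\<integral>y. g y \<partial>circ)"
proof -
  have [measurable]: "f \<in> borel_measurable circ" "g \<in> borel_measurable circ" using f g by auto
  show i: "integrable (circ \<Otimes>\<^sub>M circ) (\<lambda>(x, y). f x * g y :: real)"
  proof (rule circ2.Fubini_integrable)
    show "integrable circ (\<lambda>x. \<integral>y. norm (case (x, y) of (x, y) \<Rightarrow> f x * g y) \<partial>circ)"
      using f by (simp add: abs_mult)
  qed (use g in auto)
  show "(\<integral>(x, y). f x * g y \<partial>(circ \<Otimes>\<^sub>M circ)) = (\<integral>x. f x \<partial>circ) * (\<integral>y. g y \<partial>circ)"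
    using circ2.integral_fst'[OF i] by simp
qed

lemma interaction_trunc_kernel:
  assumes u: "integrable circ u" and r: "integrable circ r"
  shows "interaction (trunc_kernel a N) u r = interaction_sum a N u r"
proof -
  let ?I = "{- int N..int N} - {0}"
  have "(\<integral>(x, y). trunc_kernel a N (x - y) * u x * r y \<partial>(circ \<Otimes>\<^sub>M circ))
     = (\<integral>z. (\<Sum>k\<in>?I. a (nat \<bar>k\<bar>) / 2 * (case z of (x, y) \<Rightarrow> (u x * cas k x) * (r y * cas k y))) \<partial>(circ \<Otimes>\<^sub>M circ))"
    by (intro Bochner_Integration.integral_cong)
      (auto simp: trunc_kernel_diff sum_distrib_left sum_distrib_right algebra_simps)
  also have "\<dots> = (\<Sum>k\<in>?I. a (nat \<bar>k\<bar>) / 2 * ((\<integral>x. u x * cas k x \<partial>circ) * (\<integral>y. r y * cas k y \<partial>circ)))"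
    using integrable_product_circ[OF integrable_mult_cas[OF u] integrable_mult_cas[OF r]]
    by (subst Bochner_Integration.integral_sum) auto
  finally show ?thesis
    by (simp add: interaction_def interaction_sum_def hcoef_def sum_distrib_left power2_eq_square field_simps)
qed

lemma interaction_kernel_diff:
  assumes "integrable (circ \<Otimes>\<^sub>M circ) (\<lambda>(x, y). W (x - y) * u x * r y)"
    "integrable (circ \<Otimes>\<^sub>M circ) (\<lambda>(x, y). V (x - y) * u x * r y)"
  shows "interaction (\<lambda>x. W x - V x) u r = interaction W u r - interaction V u r"
proof -
  have "(\<integral>(x, y). (W (x - y) - V (x - y)) * u x * r y \<partial>(circ \<Otimes>\<^sub>M circ))
    = (\<integral>z. (case z of (x, y) \<Rightarrow> W (x - y) * u x * r y) - (case z of (x, y) \<Rightarrow> V (x - y) * u x * r y) \<partial>(circ \<Otimes>\<^sub>M circ))"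
    by (intro Bochner_Integration.integral_cong) (auto simp: algebra_simps)
  also have "\<dots> = (\<integral>(x, y). W (x - y) * u x * r y \<partial>(circ \<Otimes>\<^sub>M circ)) - (\<integral>(x, y). V (x - y) * u x * r y \<partial>(circ \<Otimes>\<^sub>M circ))"
    by (rule Bochner_Integration.integral_diff[OF assms])
  finally show ?thesis by (simp add: interaction_def right_diff_distrib)
qed

lemma kernel_ok_diff: "kernel_ok W \<Longrightarrow> kernel_ok V \<Longrightarrow> kernel_ok (\<lambda>x. W x - V x)"
  by (auto simp: kernel_ok_def intro: sqint_diff)

text \<open>
  The truncated interaction is the interaction of the truncated potential, so Young's inequality
  applies to the difference. The error depends on \<open>u\<close> and \<open>r\<close> only through their norms; this
  uniformity is what makes limits of sequences of arguments possible.
\<close>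

lemma interaction_sum_error:
  assumes W: "kernel_ok W" and u: "sqint circ u" and r: "integrable circ r"
  shows "\<bar>interaction W u r - interaction_sum a N u r\<bar>
    \<le> 1 / (4*pi\<^sup>2) * (L2norm (\<lambda>x. W x - trunc_kernel a N x) * L2norm u * (\<integral>y. \<bar>r y\<bar> \<partial>circ))"
proof -
  have "interaction W u r - interaction_sum a N u r = interaction (\<lambda>x. W x - trunc_kernel a N x) u r"
    using interaction_kernel_diff[OF interaction_integrable[OF W u r] interaction_integrable[OF kernel_ok_trunc u r], of a N]
      interaction_trunc_kernel[OF L2_integrable[OF u] r, of a N] by simp
  then show ?thesis
    using interaction_abs_le[OF kernel_ok_diff[OF W kernel_ok_trunc] u r, of a N] by simp
qed

lemma potential_trunc_limit:
  assumes "potential a W"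
  shows "(\<lambda>N. L2norm (\<lambda>x. W x - trunc_kernel a N x)) \<longlonglongrightarrow> 0"
proof -
  have "(\<lambda>N. \<integral>x. (W x - trunc_kernel a N x)\<^sup>2 \<partial>circ) \<longlonglongrightarrow> 0"
    using assms by (simp add: potential_def trunc_kernel_def)
  then have "(\<lambda>N. sqrt (\<integral>x. (W x - trunc_kernel a N x)\<^sup>2 \<partial>circ)) \<longlonglongrightarrow> sqrt 0" by (rule tendsto_real_sqrt)
  then show ?thesis by (simp add: L2norm_def)
qed

lemma interaction_sum_limit:
  assumes W: "potential a W" and u: "sqint circ u" and r: "integrable circ r"
  shows "(\<lambda>N. interaction_sum a N u r) \<longlonglongrightarrow> interaction W u r"
proof -
  have "(\<lambda>N. 1 / (4*pi\<^sup>2) * (L2norm (\<lambda>x. W x - trunc_kernel a N x) * L2norm u * (\<integral>y. \<bar>r y\<bar> \<partial>circ)))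
    \<longlonglongrightarrow> 1 / (4*pi\<^sup>2) * (0 * L2norm u * (\<integral>y. \<bar>r y\<bar> \<partial>circ))"
    by (intro tendsto_mult tendsto_const potential_trunc_limit[OF W])
  then have "(\<lambda>N. 1 / (4*pi\<^sup>2) * (L2norm (\<lambda>x. W x - trunc_kernel a N x) * L2norm u * (\<integral>y. \<bar>r y\<bar> \<partial>circ))) \<longlonglongrightarrow> 0"
    by simp
  then have "(\<lambda>N. interaction_sum a N u r - interaction W u r) \<longlonglongrightarrow> 0"
  proof (rule Lim_null_comparison[rotated], intro always_eventually allI)
    show "norm (interaction_sum a N u r - interaction W u r)
      \<le> 1 / (4*pi\<^sup>2) * (L2norm (\<lambda>x. W x - trunc_kernel a N x) * L2norm u * (\<integral>y. \<bar>r y\<bar> \<partial>circ))" for N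
      using interaction_sum_error[OF potential_kernel_ok[OF W] u r, of a N] by (simp add: abs_minus_commute)
  qed
  then show ?thesis by (simp add: LIM_zero_iff)
qed

lemma sqint_const: "sqint circ (\<lambda>_. c)"
  by (rule sqint_bounded[of _ _ "\<bar>c\<bar>"]) auto

text \<open>
  The potential has no constant term, so the uniform density does not interact with anything.
\<close>

lemma interaction_uniform_left:
  assumes W: "potential a W" and r: "integrable circ r"
  shows "interaction W (\<lambda>_. 1) r = 0"
proof -
  have "interaction_sum a N (\<lambda>_. 1) r = 0" for N by (simp add: interaction_sum_def hcoef_1)
  then show ?thesis using interaction_sum_limit[OF W sqint_const r, of 1] LIMSEQ_unique[OF _ tendsto_const] by simp
qed

lemma interaction_commute:
  assumes W: "kernel_ok W" and u: "u \<in> borel_measurable circ" and r: "r \<in> borel_measurable circ"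
  shows "interaction W u r = interaction W r u"
proof -
  have m: "(\<lambda>(x, y). W (x - y) * u x * r y) \<in> borel_measurable (circ \<Otimes>\<^sub>M circ)"
    by (rule interaction_integrand_measurable) (use u r W in \<open>auto simp: kernel_ok_def\<close>)
  have ev: "W (y - x) = W (x - y)" for x y using W by (metis kernel_ok_def minus_diff_eq)
  have "(\<integral>(x, y). W (x - y) * u x * r y \<partial>(circ \<Otimes>\<^sub>M circ)) = (\<integral>(x, y). W (y - x) * u y * r x \<partial>(circ \<Otimes>\<^sub>M circ))"
    using circ2.integral_product_swap[OF m] by simp
  also have "\<dots> = (\<integral>(x, y). W (x - y) * r x * u y \<partial>(circ \<Otimes>\<^sub>M circ))"
    by (simp add: ev mult.assoc mult.commute mult.left_commute)
  finally show ?thesis by (simp add: interaction_def)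
qed

text \<open>
  The coefficient at \<open>k\<close> is the interaction of \<open>cas k\<close> with \<open>p\<close>, of which the interaction sum
  keeps a single term.
\<close>

lemma hcoef_conv:
  assumes W: "potential a W" and p: "integrable circ p"
  shows "hcoef (conv W p) k = (if k = 0 then 0 else a (nat \<bar>k\<bar>) / 2 * hcoef p k)"
proof -
  note Wk = potential_kernel_ok[OF W]
  have i: "integrable (circ \<Otimes>\<^sub>M circ) (\<lambda>(x, y). W (x - y) * cas k x * p y)"
    by (rule interaction_integrable[OF Wk sqint_cas p])
  have "(\<integral>x. conv W p x * cas k x \<partial>circ) = (\<integral>x. 1/(2*pi) * (\<integral>y. W (x - y) * cas k x * p y \<partial>circ) \<partial>circ)"
  proof (intro Bochner_Integration.integral_cong refl)
    fix x
    have "(\<integral>y. W (x - y) * cas k x * p y \<partial>circ) = (\<integral>y. cas k x * (W (x - y) * p y) \<partial>circ)"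
      by (simp add: mult.commute mult.left_commute)
    also have "\<dots> = cas k x * (\<integral>y. W (x - y) * p y \<partial>circ)" by (rule integral_mult_right_zero)
    finally show "conv W p x * cas k x = 1/(2*pi) * (\<integral>y. W (x - y) * cas k x * p y \<partial>circ)"
      by (simp add: conv_def)
  qed
  also have "\<dots> = 1/(2*pi) * (\<integral>(x, y). W (x - y) * cas k x * p y \<partial>(circ \<Otimes>\<^sub>M circ))"
    using circ2.integral_fst'[OF i] by simp
  finally have e: "hcoef (conv W p) k = interaction W (cas k) p"
    by (simp add: hcoef_def interaction_def power2_eq_square)
  have q: "interaction_sum a N (cas k) p = (if k = 0 then 0 else a (nat \<bar>k\<bar>) / 2 * hcoef p k)" if "nat \<bar>k\<bar> \<le> N" for N
  proof -
    have "(\<Sum>j\<in>{- int N..int N} - {0}. a (nat \<bar>j\<bar>) * hcoef (cas k) j * hcoef p j)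
      = (\<Sum>j\<in>{- int N..int N} - {0}. if k = j then a (nat \<bar>k\<bar>) * hcoef p k else 0)"
      by (intro sum.cong) (auto simp: hcoef_cas)
    then show ?thesis using that by (auto simp: interaction_sum_def)
  qed
  have "(\<lambda>N. interaction_sum a N (cas k) p) \<longlonglongrightarrow> (if k = 0 then 0 else a (nat \<bar>k\<bar>) / 2 * hcoef p k)"
    by (rule tendsto_eventually, rule eventually_sequentiallyI[of "nat \<bar>k\<bar>"]) (rule q)
  from LIMSEQ_unique[OF interaction_sum_limit[OF W sqint_cas p] this] e show ?thesis by simp
qed

lemma hcoef_potential:
  assumes W: "potential a W" and k: "k \<noteq> 0"
  shows "hcoef W k = a (nat \<bar>k\<bar>) / 2"
proof -
  have "(\<lambda>N. \<integral>x. (trunc_kernel a N x - W x)\<^sup>2 \<partial>circ) \<longlonglongrightarrow> 0"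
    using W by (simp add: potential_def trunc_kernel_def power2_commute)
  then have "(\<lambda>N. hcoef (trunc_kernel a N) k) \<longlonglongrightarrow> hcoef W k"
    unfolding hcoef_def using potential_kernel_ok[OF W] kernel_ok_trunc
    by (intro tendsto_intros sqint_limit_mult sqint_cas) (auto simp: kernel_ok_def)
  moreover have "hcoef (trunc_kernel a N) k = a (nat \<bar>k\<bar>) / 2" if "nat \<bar>k\<bar> \<le> N" for N
    unfolding trunc_kernel_cas[abs_def] using that k by (subst hcoef_trig) auto
  then have "(\<lambda>N. hcoef (trunc_kernel a N) k) \<longlonglongrightarrow> a (nat \<bar>k\<bar>) / 2"
    by (intro tendsto_eventually eventually_sequentiallyI[of "nat \<bar>k\<bar>"])
  ultimately show ?thesis by (rule LIMSEQ_unique)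
qed

text \<open>The coefficients are square summable by Bessel's inequality for \<open>W\<close>.\<close>

lemma potential_tendsto_0:
  assumes W: "potential a W"
  shows "a \<longlonglongrightarrow> 0"
proof -
  have s: "sqint circ W" using potential_kernel_ok[OF W] by (simp add: kernel_ok_def)
  have "(\<Sum>l<n. (hcoef W (int (Suc l)))\<^sup>2) \<le> (\<integral>x. (W x)\<^sup>2 \<partial>circ) / (2*pi)" for n
  proof -
    have "(\<Sum>l<n. (hcoef W (int (Suc l)))\<^sup>2) = (\<Sum>k\<in>(\<lambda>l. int (Suc l)) ` {..<n}. (hcoef W k)\<^sup>2)"
      by (subst sum.reindex) (auto simp: inj_on_def)
    then show ?thesis using Bessel[OF s, of "(\<lambda>l. int (Suc l)) ` {..<n}"] by (simp add: field_simps)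
  qed
  then have "summable (\<lambda>l. (hcoef W (int (Suc l)))\<^sup>2)"
    by (intro summableI_nonneg_bounded) auto
  then have "(\<lambda>l. (hcoef W (int (Suc l)))\<^sup>2) \<longlonglongrightarrow> 0" by (rule summable_LIMSEQ_zero)
  then have "(\<lambda>l. 2 * sqrt ((hcoef W (int (Suc l)))\<^sup>2)) \<longlonglongrightarrow> 2 * sqrt 0"
    by (intro tendsto_intros)
  moreover have "sqrt ((hcoef W (int (Suc l)))\<^sup>2) = \<bar>a (Suc l)\<bar> / 2" for l
    using hcoef_potential[OF W, of "int (Suc l)"] by (simp del: of_nat_Suc)
  then have "(\<lambda>l. 2 * sqrt ((hcoef W (int (Suc l)))\<^sup>2)) = (\<lambda>l. \<bar>a (Suc l)\<bar>)" by (intro ext) (simp del: of_nat_Suc add: mult.commute)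
  ultimately have "(\<lambda>l. \<bar>a (Suc l)\<bar>) \<longlonglongrightarrow> 0" by (simp only: real_sqrt_zero mult_zero_right)
  then have "(\<lambda>l. a (Suc l)) \<longlonglongrightarrow> 0" by (rule tendsto_rabs_zero_cancel)
  then show ?thesis by (simp add: filterlim_sequentially_Suc)
qed

text \<open>
  The constant part of \<open>u\<close> does not interact, and the largest coefficient bounds the diagonal form on
  \<open>u - 1\<close> through Bessel's inequality. This is the quadratic bound that competes with the
  entropy near the uniform density.
\<close>

lemma interaction_self_le:
  assumes W: "potential a W" and u: "sqint circ u" and A: "\<And>l. 1 \<le> l \<Longrightarrow> a l \<le> A" "0 \<le> A"
  shows "interaction W u u \<le> A / 2 * ((\<integral>x. (u x - 1)\<^sup>2 \<partial>circ) / (2*pi))"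
proof (rule LIMSEQ_le_const2[OF interaction_sum_limit[OF W u L2_integrable[OF u]]], intro exI allI impI)
  fix N :: nat
  let ?I = "{- int N..int N} - {0}"
  have u1: "sqint circ (\<lambda>x. u x - 1)" by (intro sqint_diff u sqint_const)
  have h: "hcoef (\<lambda>x. u x - 1) k = hcoef u k" if "k \<noteq> 0" for k
    using that by (subst hcoef_diff) (auto simp: hcoef_1 L2_integrable u sqint_const)
  have "(\<Sum>k\<in>?I. a (nat \<bar>k\<bar>) * hcoef u k * hcoef u k) \<le> (\<Sum>k\<in>?I. A * (hcoef (\<lambda>x. u x - 1) k)\<^sup>2)"
    using A by (intro sum_mono) (auto simp: h power2_eq_square mult.assoc intro!: mult_right_mono)
  also have "\<dots> = A * (\<Sum>k\<in>?I. (hcoef (\<lambda>x. u x - 1) k)\<^sup>2)" by (simp add: sum_distrib_left)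
  also have "\<dots> \<le> A * ((\<integral>x. (u x - 1)\<^sup>2 \<partial>circ) / (2*pi))"
    using Bessel[OF u1, of ?I] A by (intro mult_left_mono) (auto simp: field_simps)
  finally show "interaction_sum a N u u \<le> A / 2 * ((\<integral>x. (u x - 1)\<^sup>2 \<partial>circ) / (2*pi))"
    by (simp add: interaction_sum_def)
qed

section \<open>Entropy\<close>

text \<open>
  Adding the affine function \<open>1 - x\<close> to \<open>x * ln x\<close> makes it nonnegative with its minimum at
  \<open>1\<close>. On probability densities the added term has mean zero, so \<open>psi\<close> and \<open>x * ln x\<close> give the same
  entropy.
\<close>

definition psi :: "real \<Rightarrow> real" where
  "psi x = x * ln x - x + 1"

lemma psi_measurable[measurable]: "psi \<in> borel_measurable borel"
  by (simp add: psi_def[abs_def])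

lemma psi_1[simp]: "psi 1 = 0" and psi_0[simp]: "psi 0 = 1"
  by (auto simp: psi_def)

text \<open>
  The elementary bound \<open>ln y \<le> y - 1\<close> at \<open>y = 1 / sqrt x\<close>. From this Hellinger type bound come
  nonnegativity and, with \<open>x - 1 = (sqrt x - 1) * (sqrt x + 1)\<close>, Pinsker's inequality.
\<close>

lemma psi_ge_sqrt:
  assumes "0 \<le> x"
  shows "(sqrt x - 1)\<^sup>2 \<le> psi x"
proof (cases "x = 0")
  case False
  then have x: "0 < x" using assms by simp
  have "ln (1 / sqrt x) \<le> 1 / sqrt x - 1" using x by (intro ln_le_minus_one) auto
  then have "1 - 1 / sqrt x \<le> ln x / 2" using x by (simp add: ln_div ln_sqrt)
  then have "x * (1 - 1 / sqrt x) \<le> x * (ln x / 2)" using x by (intro mult_left_mono) auto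
  moreover have "x * (1 - 1 / sqrt x) = x - sqrt x" using x by (simp add: right_diff_distrib real_div_sqrt)
  ultimately show ?thesis using x by (simp add: psi_def power2_diff)
qed simp

lemma psi_nonneg: "0 \<le> x \<Longrightarrow> 0 \<le> psi x"
  using psi_ge_sqrt[of x] by (smt (verit) zero_le_power2)

lemma square_le_psi:
  assumes "0 \<le> x"
  shows "(x - 1)\<^sup>2 \<le> 2 * (x + 1) * psi x"
proof -
  have e: "x - 1 = (sqrt x - 1) * (sqrt x + 1)" using assms by (simp add: algebra_simps)
  have "(sqrt x + 1)\<^sup>2 \<le> 2 * (x + 1)"
    using assms zero_le_power2[of "sqrt x - 1"] by (simp add: power2_eq_square algebra_simps)
  then have "(sqrt x - 1)\<^sup>2 * (sqrt x + 1)\<^sup>2 \<le> psi x * (2 * (x + 1))"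
    using psi_ge_sqrt[OF assms] psi_nonneg[OF assms] by (intro mult_mono) auto
  then show ?thesis by (subst e) (simp add: power_mult_distrib mult.commute mult.left_commute)
qed

lemma psi_eq_0: "0 \<le> x \<Longrightarrow> psi x = 0 \<Longrightarrow> x = 1"
  using square_le_psi[of x] by simp

text \<open>
  The gap between \<open>psi\<close> and its tangent at \<open>a\<close> is \<open>a * psi (x / a)\<close>.
\<close>

lemma psi_tangent:
  assumes "0 < a" "0 \<le> x"
  shows "psi a + ln a * (x - a) \<le> psi x"
proof (cases "x = 0")
  case False
  then have x: "0 < x" using assms by simp
  have "0 \<le> a * psi (x / a)" using assms by (intro mult_nonneg_nonneg psi_nonneg) auto
  also have "\<dots> = psi x - (psi a + ln a * (x - a))"
    using assms x by (simp add: psi_def ln_div algebra_simps)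
  finally show ?thesis by simp
qed (use assms in \<open>simp add: psi_def algebra_simps\<close>)

lemma psi_convex:
  assumes "0 \<le> x" "0 \<le> y" "0 \<le> t" "t \<le> 1"
  shows "psi ((1 - t) * x + t * y) \<le> (1 - t) * psi x + t * psi y"
proof (cases "(1 - t) * x + t * y = 0")
  case True
  then have "(1 - t) * x = 0" "t * y = 0" using assms by (smt (verit) mult_nonneg_nonneg)+
  then consider "t = 1" "y = 0" | "t = 0" "x = 0" | "x = 0" "y = 0" by (auto simp: mult_eq_0_iff)
  then show ?thesis by cases auto
next
  case False
  define c where "c = (1 - t) * x + t * y"
  have c: "0 < c" using False assms by (simp add: c_def add_nonneg_nonneg less_le)
  have "(1 - t) * (psi c + ln c * (x - c)) + t * (psi c + ln c * (y - c)) \<le> (1 - t) * psi x + t * psi y"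
    using assms psi_tangent[OF c] by (intro add_mono mult_left_mono) auto
  moreover have "(1 - t) * (psi c + ln c * (x - c)) + t * (psi c + ln c * (y - c))
    = psi c + ln c * ((1 - t) * x + t * y - c)" by (simp add: algebra_simps)
  ultimately show ?thesis by (simp add: c_def)
qed

text \<open>
  The second derivative \<open>1 / x\<close> of \<open>psi\<close> is at least \<open>1 / (1 + t)\<close> on the interval considered.
\<close>

lemma psi_local_quadratic:
  assumes t: "0 < t" "t < 1" and x: "\<bar>x - 1\<bar> \<le> t"
  shows "(x - 1)\<^sup>2 / (2 * (1 + t)) \<le> psi x"
proof -
  define h where "h y = psi y - (y - 1)\<^sup>2 / (2 * (1 + t))" for y
  have d: "(h has_real_derivative (ln y - (y - 1) / (1 + t))) (at y)" if "0 < y" for y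
  proof -
    have "((\<lambda>y. y * ln y - y + 1 - (y - 1)\<^sup>2 * (1 / (2 * (1 + t)))) has_real_derivative
      (ln y - 2 * (y - 1) * (1 / (2 * (1 + t))))) (at y)"
      using that t by (auto intro!: derivative_eq_intros)
    moreover have "2 * (y - 1) * (1 / (2 * (1 + t))) = (y - 1) / (1 + t)" using t by (simp add: field_simps)
    ultimately show ?thesis by (simp only: h_def[abs_def] psi_def) simp
  qed
  have x0: "0 < x" using t x by linarith
  have h1: "h 1 = 0" by (simp add: h_def)
  have "0 \<le> h x"
  proof (cases x "1::real" rule: linorder_cases)
    case less
    then obtain z where z: "z > x" "z < 1" "h 1 - h x = (1 - x) * (ln z - (z - 1) / (1 + t))"
      using MVT2[of x 1 h "\<lambda>y. ln y - (y - 1) / (1 + t)"] d x0 by fastforce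
    have "ln z \<le> z - 1" using z x0 by (intro ln_le_minus_one) auto
    also have "z - 1 \<le> (z - 1) / (1 + t)" using z t by (simp add: field_simps mult_le_0_iff)
    finally have "(1 - x) * (ln z - (z - 1) / (1 + t)) \<le> 0" using less by (intro mult_nonneg_nonpos) auto
    then show ?thesis using z h1 by linarith
  next
    case greater
    then obtain z where z: "z > 1" "z < x" "h x - h 1 = (x - 1) * (ln z - (z - 1) / (1 + t))"
      using MVT2[of 1 x h "\<lambda>y. ln y - (y - 1) / (1 + t)"] d by fastforce
    have "ln (1 / z) \<le> 1 / z - 1" using z by (intro ln_le_minus_one) auto
    then have "(z - 1) / z \<le> ln z" using z by (simp add: ln_div field_simps)
    moreover have "(z - 1) / (1 + t) \<le> (z - 1) / z" using z x t by (intro divide_left_mono) auto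
    ultimately have "0 \<le> (x - 1) * (ln z - (z - 1) / (1 + t))" using greater by (intro mult_nonneg_nonneg) auto
    then show ?thesis using z h1 by linarith
  qed (simp add: h1)
  then show ?thesis by (simp add: h_def)
qed

definition entropy :: "(real \<Rightarrow> real) \<Rightarrow> real" where
  "entropy \<rho> = 1 / (2*pi) * (\<integral>x. \<rho> x * ln (\<rho> x) \<partial>circ)"

lemma prob_density_integral: "prob_density \<rho> \<Longrightarrow> (\<integral>x. \<rho> x \<partial>circ) = 2*pi"
  by (simp add: prob_density_def field_simps)

lemma prob_density_hcoef_0: "prob_density \<rho> \<Longrightarrow> hcoef \<rho> 0 = 1"
  by (simp add: hcoef_def prob_density_integral)

lemma Pac_plusD:
  assumes "\<rho> \<in> Pac_plus"
  shows "prob_density \<rho>" "integrable circ \<rho>" "\<rho> \<in> borel_measurable circ" "AE x in circ. 0 < \<rho> x"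
  using assms by (auto simp: Pac_plus_def prob_density_def)

text \<open>The difference \<open>1 - x\<close> of the two integrands is integrable.\<close>

lemma integrable_psi_iff:
  assumes "integrable circ \<rho>"
  shows "integrable circ (\<lambda>x. psi (\<rho> x)) \<longleftrightarrow> integrable circ (\<lambda>x. \<rho> x * ln (\<rho> x))"
proof
  assume "integrable circ (\<lambda>x. psi (\<rho> x))"
  from Bochner_Integration.integrable_add[OF this Bochner_Integration.integrable_diff[OF assms, of "\<lambda>_. 1"]]
  show "integrable circ (\<lambda>x. \<rho> x * ln (\<rho> x))" by (simp add: psi_def)
next
  assume "integrable circ (\<lambda>x. \<rho> x * ln (\<rho> x))"
  then show "integrable circ (\<lambda>x. psi (\<rho> x))" using assms by (simp add: psi_def)
qed

lemma entropy_psi: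
  assumes "prob_density \<rho>" "integrable circ (\<lambda>x. \<rho> x * ln (\<rho> x))"
  shows "entropy \<rho> = 1 / (2*pi) * (\<integral>x. psi (\<rho> x) \<partial>circ)"
proof -
  have "integrable circ \<rho>" using assms by (simp add: prob_density_def)
  then have "(\<integral>x. psi (\<rho> x) \<partial>circ) = (\<integral>x. \<rho> x * ln (\<rho> x) \<partial>circ) - (\<integral>x. \<rho> x \<partial>circ) + 2*pi"
    using assms(2) by (simp add: psi_def)
  then show ?thesis using prob_density_integral[OF assms(1)] by (simp add: entropy_def)
qed

lemma entropy_nonneg:
  assumes "prob_density \<rho>" "integrable circ (\<lambda>x. \<rho> x * ln (\<rho> x))"
  shows "0 \<le> entropy \<rho>"
proof -
  have "AE x in circ. 0 \<le> psi (\<rho> x)" using assms(1) unfolding prob_density_def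
    by (auto elim!: eventually_mono simp: psi_nonneg)
  then show ?thesis unfolding entropy_psi[OF assms] by (intro mult_nonneg_nonneg integral_nonneg_AE) auto
qed

lemma entropy_eq_0:
  assumes "prob_density \<rho>" "integrable circ (\<lambda>x. \<rho> x * ln (\<rho> x))" "entropy \<rho> = 0"
  shows "AE x in circ. \<rho> x = 1"
proof -
  have nn: "AE x in circ. 0 \<le> \<rho> x" using assms(1) unfolding prob_density_def by auto
  then have "AE x in circ. 0 \<le> psi (\<rho> x)" by eventually_elim (rule psi_nonneg)
  moreover have i: "integrable circ \<rho>" using assms by (simp add: prob_density_def)
  moreover have "(\<integral>x. psi (\<rho> x) \<partial>circ) = 0" using assms(3) unfolding entropy_psi[OF assms(1,2)] by simp
  ultimately have "AE x in circ. psi (\<rho> x) = 0"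
    using integral_nonneg_eq_0_iff_AE[of circ "\<lambda>x. psi (\<rho> x)"] assms(2) integrable_psi_iff[OF i] by simp
  then show ?thesis using nn by eventually_elim (auto intro: psi_eq_0)
qed

text \<open>
  Cauchy and Schwarz applied to \<open>\<bar>\<rho> - 1\<bar> \<le> sqrt (2 * (\<rho> + 1)) * sqrt (psi \<rho>)\<close>, where the
  first factor has a mean square that the mass of \<open>\<rho>\<close> determines. The constant is not the optimal
  one.
\<close>

lemma Pinsker:
  assumes "prob_density \<rho>" "integrable circ (\<lambda>x. \<rho> x * ln (\<rho> x))"
  shows "(\<integral>x. \<bar>\<rho> x - 1\<bar> \<partial>circ)\<^sup>2 \<le> 16 * pi\<^sup>2 * entropy \<rho>"
proof -
  have i: "integrable circ \<rho>" and nn: "AE x in circ. 0 \<le> \<rho> x"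
    using assms(1) by (auto simp: prob_density_def)
  then have m[measurable]: "\<rho> \<in> borel_measurable circ" by auto
  have pi: "integrable circ (\<lambda>x. psi (\<rho> x))" using integrable_psi_iff[OF i] assms(2) by simp
  let ?f = "\<lambda>x. sqrt (max 0 (2 * (\<rho> x + 1)))" and ?g = "\<lambda>x. sqrt (max 0 (psi (\<rho> x)))"
  have f2: "AE x in circ. (?f x)\<^sup>2 = 2 * (\<rho> x + 1)" and g2: "AE x in circ. (?g x)\<^sup>2 = psi (\<rho> x)"
    using nn by (eventually_elim, simp add: psi_nonneg)+
  have f: "sqint circ ?f" "(\<integral>x. (?f x)\<^sup>2 \<partial>circ) = 8*pi"
  proof -
    have "integrable circ (\<lambda>x. (?f x)\<^sup>2) = integrable circ (\<lambda>x. 2 * (\<rho> x + 1))"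
      by (rule integrable_cong_AE[OF _ _ f2]) measurable
    then show "sqint circ ?f" using i by (simp add: sqint_def)
    have "(\<integral>x. (?f x)\<^sup>2 \<partial>circ) = (\<integral>x. 2 * (\<rho> x + 1) \<partial>circ)"
      by (rule integral_cong_AE[OF _ _ f2]) measurable
    then show "(\<integral>x. (?f x)\<^sup>2 \<partial>circ) = 8*pi" using i prob_density_integral[OF assms(1)] by simp
  qed
  have g: "sqint circ ?g" "(\<integral>x. (?g x)\<^sup>2 \<partial>circ) = 2*pi*entropy \<rho>"
  proof -
    have "integrable circ (\<lambda>x. (?g x)\<^sup>2) = integrable circ (\<lambda>x. psi (\<rho> x))"
      by (rule integrable_cong_AE[OF _ _ g2]) measurable
    then show "sqint circ ?g" using pi by (simp add: sqint_def)
    have "(\<integral>x. (?g x)\<^sup>2 \<partial>circ) = (\<integral>x. psi (\<rho> x) \<partial>circ)"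
      by (rule integral_cong_AE[OF _ _ g2]) measurable
    then show "(\<integral>x. (?g x)\<^sup>2 \<partial>circ) = 2*pi*entropy \<rho>" using entropy_psi[OF assms] by simp
  qed
  have "(\<integral>x. \<bar>\<rho> x - 1\<bar> \<partial>circ) \<le> (\<integral>x. \<bar>?f x * ?g x\<bar> \<partial>circ)"
  proof (rule integral_mono_AE)
    show "AE x in circ. \<bar>\<rho> x - 1\<bar> \<le> \<bar>?f x * ?g x\<bar>"
      using nn
    proof eventually_elim
      case (elim x)
      have "\<bar>\<rho> x - 1\<bar> \<le> sqrt (2 * (\<rho> x + 1) * psi (\<rho> x))"
        using square_le_psi[OF elim] by (intro real_le_rsqrt) simp
      then show ?case using elim psi_nonneg[OF elim] by (simp add: real_sqrt_mult abs_mult)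
    qed
  qed (use i sqint_mult[OF f(1) g(1)] in auto)
  then have "(\<integral>x. \<bar>\<rho> x - 1\<bar> \<partial>circ)\<^sup>2 \<le> (\<integral>x. \<bar>?f x * ?g x\<bar> \<partial>circ)\<^sup>2"
    by (intro power_mono integral_nonneg_AE) auto
  also have "\<dots> \<le> (8*pi) * (2*pi*entropy \<rho>)" using sqint_Cauchy_Schwarz[OF f(1) g(1)] f g by simp
  finally show ?thesis by (simp add: power2_eq_square mult.assoc)
qed

section \<open>The free energy\<close>

lemma ext_integral_integrable:
  assumes "integrable M f"
  shows "ext_integral M f = ereal (\<integral>x. f x \<partial>M)"
proof -
  have "(\<integral>\<^sup>+x. ennreal (f x) \<partial>M) < top" "(\<integral>\<^sup>+x. ennreal (- f x) \<partial>M) < top"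
    using assms by (auto simp: real_integrable_def less_top)
  then show ?thesis unfolding ext_integral_def real_lebesgue_integral_def[OF assms]
    by (cases "\<integral>\<^sup>+x. ennreal (f x) \<partial>M"; cases "\<integral>\<^sup>+x. ennreal (- f x) \<partial>M") (auto simp: enn2ereal_ennreal)
qed

lemma ext_integral_infinite:
  assumes "(\<integral>\<^sup>+x. ennreal (f x) \<partial>M) = top"
  shows "ext_integral M f = \<infinity>"
  unfolding ext_integral_def assms by simp

lemma ext_integral_minus_infinite:
  assumes "(\<integral>\<^sup>+x. ennreal (f x) \<partial>M) < top" "(\<integral>\<^sup>+x. ennreal (- f x) \<partial>M) = top"
  shows "ext_integral M f = -\<infinity>"
  using assms unfolding ext_integral_def
  by (cases "\<integral>\<^sup>+x. ennreal (f x) \<partial>M") (auto simp: enn2ereal_ennreal)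

text \<open>The densities on which every term of the free energy is an ordinary integral.\<close>

definition finite_energy :: "(real \<Rightarrow> real) \<Rightarrow> (real \<Rightarrow> real) \<Rightarrow> bool" where
  "finite_energy W \<rho> \<longleftrightarrow> \<rho> \<in> Pac_plus \<and> integrable circ (\<lambda>x. \<rho> x * ln (\<rho> x)) \<and>
     integrable (circ \<Otimes>\<^sub>M circ) (\<lambda>(x, y). W (x - y) * \<rho> x * \<rho> y)"

definition energy :: "(real \<Rightarrow> real) \<Rightarrow> real \<Rightarrow> (real \<Rightarrow> real) \<Rightarrow> real" where
  "energy W \<kappa> \<rho> = entropy \<rho> - \<kappa> / 2 * interaction W \<rho> \<rho>"

lemma free_energy_finite:
  assumes "finite_energy W \<rho>"
  shows "free_energy W \<rho> \<kappa> = ereal (energy W \<kappa> \<rho>)"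
  using assms unfolding finite_energy_def free_energy_def
  by (simp add: ext_integral_integrable energy_def entropy_def interaction_def)

text \<open>
  The only way for the free energy to be \<open>-\<infinity>\<close> when \<open>\<kappa> > 0\<close>. The condition is independent of \<open>\<kappa>\<close>, so that
  one \<open>\<kappa>\<close> with a finite minimum excludes it for all.
\<close>

definition infinite_attraction :: "(real \<Rightarrow> real) \<Rightarrow> (real \<Rightarrow> real) \<Rightarrow> bool" where
  "infinite_attraction W \<rho> \<longleftrightarrow> integrable circ (\<lambda>x. \<rho> x * ln (\<rho> x)) \<and>
     (\<integral>\<^sup>+z. ennreal (case z of (x, y) \<Rightarrow> W (x - y) * \<rho> x * \<rho> y) \<partial>(circ \<Otimes>\<^sub>M circ)) = top"

lemma neg_entropy_finite:
  assumes "\<rho> \<in> Pac_plus"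
  shows "(\<integral>\<^sup>+x. ennreal (- (\<rho> x * ln (\<rho> x))) \<partial>circ) < top"
proof -
  have "(\<integral>\<^sup>+x. ennreal (- (\<rho> x * ln (\<rho> x))) \<partial>circ) \<le> (\<integral>\<^sup>+x. ennreal 1 \<partial>circ)"
  proof (rule nn_integral_mono_AE)
    show "AE x in circ. ennreal (- (\<rho> x * ln (\<rho> x))) \<le> ennreal 1"
      using Pac_plusD(4)[OF assms]
    proof eventually_elim
      case (elim x)
      then show ?case using psi_nonneg[of "\<rho> x"] by (intro ennreal_leI) (simp add: psi_def)
    qed
  qed
  also have "\<dots> < top" by (simp add: ennreal_mult_less_top)
  finally show ?thesis .
qed

lemma free_energy_infinite_attraction:
  assumes "infinite_attraction W \<rho>" "0 < \<kappa>"
  shows "free_energy W \<rho> \<kappa> = -\<infinity>"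
  using assms unfolding infinite_attraction_def free_energy_def
  by (simp add: ext_integral_integrable ext_integral_infinite)

text \<open>
  Either the entropy is infinite, or the entropy is finite and the negative part of the interaction
  has infinite integral while the positive part does not.
\<close>

lemma free_energy_not_finite:
  assumes W: "W \<in> borel_measurable borel" and "\<rho> \<in> Pac_plus" "\<not> finite_energy W \<rho>" "\<not> infinite_attraction W \<rho>" "0 < \<kappa>"
  shows "free_energy W \<rho> \<kappa> = \<infinity>"
proof (cases "integrable circ (\<lambda>x. \<rho> x * ln (\<rho> x))")
  case False
  have [measurable]: "\<rho> \<in> borel_measurable circ" using Pac_plusD[OF assms(2)] by simp
  have "(\<integral>\<^sup>+x. ennreal (\<rho> x * ln (\<rho> x)) \<partial>circ) = top"
    using False neg_entropy_finite[OF assms(2)] by (auto simp: real_integrable_def)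
  then show ?thesis unfolding free_energy_def by (simp add: ext_integral_infinite)
next
  case True
  let ?h = "\<lambda>z. case z of (x, y) \<Rightarrow> W (x - y) * \<rho> x * \<rho> y"
  have m: "?h \<in> borel_measurable (circ \<Otimes>\<^sub>M circ)"
    using interaction_integrand_measurable[OF W] Pac_plusD[OF assms(2)] by simp
  have 1: "(\<integral>\<^sup>+z. ennreal (?h z) \<partial>(circ \<Otimes>\<^sub>M circ)) < top"
    using assms(4) True by (simp add: infinite_attraction_def less_top)
  moreover have "(\<integral>\<^sup>+z. ennreal (- ?h z) \<partial>(circ \<Otimes>\<^sub>M circ)) = top"
  proof (rule ccontr)
    assume "\<not> ?thesis"
    then have "integrable (circ \<Otimes>\<^sub>M circ) ?h" unfolding real_integrable_def using m 1 by auto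
    then show False using assms(2,3) True by (simp add: finite_energy_def)
  qed
  ultimately show ?thesis
    using True assms(5) unfolding free_energy_def
    by (simp add: ext_integral_integrable ext_integral_minus_infinite)
qed

text \<open>
  The potentials whose free energy does not take the value \<open>-\<infinity>\<close> for \<open>\<kappa> > 0\<close>.
\<close>

definition tame :: "(real \<Rightarrow> real) \<Rightarrow> bool" where
  "tame W \<longleftrightarrow> (\<forall>\<rho>\<in>Pac_plus. \<not> infinite_attraction W \<rho>)"

lemma bounded_finite_energy:
  assumes W: "kernel_ok W" and \<rho>: "\<rho> \<in> Pac_plus" and b: "AE x in circ. \<rho> x \<le> B"
  shows "finite_energy W \<rho>" "sqint circ \<rho>"
proof -
  note P = Pac_plusD[OF \<rho>]
  have [measurable]: "\<rho> \<in> borel_measurable circ" by (rule P)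
  show s: "sqint circ \<rho>"
    by (rule sqint_bounded[of _ _ B]) (use P(4) b in auto)
  have "integrable circ (\<lambda>x. \<rho> x * ln (\<rho> x))"
  proof (rule circ.integrable_const_bound[of _ "1 + B\<^sup>2"])
    show "AE x in circ. norm (\<rho> x * ln (\<rho> x)) \<le> 1 + B\<^sup>2"
      using P(4) b
    proof eventually_elim
      case (elim x)
      have "\<rho> x * ln (\<rho> x) \<le> \<rho> x * \<rho> x" using elim(1) ln_bound[of "\<rho> x"] by (intro mult_left_mono) auto
      also have "\<dots> \<le> B\<^sup>2" using elim by (simp add: power2_eq_square mult_mono)
      finally have "\<rho> x * ln (\<rho> x) \<le> B\<^sup>2" .
      moreover have "- (\<rho> x * ln (\<rho> x)) \<le> 1" using psi_nonneg[of "\<rho> x"] elim by (simp add: psi_def)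
      ultimately show ?case using zero_le_power2[of B] unfolding real_norm_def by linarith
    qed
  qed measurable
  then show "finite_energy W \<rho>"
    using \<rho> interaction_integrable[OF W s P(2)] by (simp add: finite_energy_def)
qed

lemma uniform_Pac_plus: "uniform_density \<in> Pac_plus"
  by (simp add: Pac_plus_def prob_density_def uniform_density_def)

lemma uniform_finite_energy:
  assumes "potential a W"
  shows "finite_energy W uniform_density" "energy W \<kappa> uniform_density = 0"
proof -
  show "finite_energy W uniform_density"
    by (rule bounded_finite_energy[OF potential_kernel_ok[OF assms] uniform_Pac_plus, of 1])
      (simp add: uniform_density_def)
  have "interaction W uniform_density uniform_density = 0"
    unfolding uniform_density_def by (rule interaction_uniform_left[OF assms]) auto
  then show "energy W \<kappa> uniform_density = 0"
    by (simp add: energy_def entropy_def) (simp add: uniform_density_def)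
qed

lemma interaction_AE_1:
  assumes W: "potential a W" and u: "u \<in> borel_measurable circ" and ae: "AE x in circ. u x = 1"
  shows "interaction W u u = 0"
proof -
  have s: "sqint circ u" using ae by (intro sqint_bounded[of _ _ 1] u) auto
  have "hcoef u k = hcoef (\<lambda>_. 1) k" for k by (rule hcoef_cong_AE[OF ae u]) simp
  then have "interaction_sum a N u u = 0" for N by (simp add: interaction_sum_def hcoef_1)
  then show ?thesis using interaction_sum_limit[OF W s L2_integrable[OF s]] LIMSEQ_unique[OF _ tendsto_const] by simp
qed

text \<open>
  For tame potentials all densities that do not have finite energy have energy \<open>\<infinity>\<close>, whereas the
  uniform density has energy \<open>0\<close>; minimization is a problem about real numbers.
\<close>

lemma minimizer_iff:
  assumes W: "potential a W" and t: "tame W" and \<kappa>: "0 < \<kappa>"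
  shows "global_minimizer W \<kappa> \<rho> \<longleftrightarrow> finite_energy W \<rho> \<and> (\<forall>\<sigma>. finite_energy W \<sigma> \<longrightarrow> energy W \<kappa> \<rho> \<le> energy W \<kappa> \<sigma>)"
proof -
  have Wm: "W \<in> borel_measurable borel" using potential_kernel_ok[OF W] by (simp add: kernel_ok_def)
  have inf: "free_energy W \<sigma> \<kappa> = \<infinity>" if "\<sigma> \<in> Pac_plus" "\<not> finite_energy W \<sigma>" for \<sigma>
    using free_energy_not_finite[OF Wm that _ \<kappa>] t that by (simp add: tame_def)
  show ?thesis
  proof
    assume g: "global_minimizer W \<kappa> \<rho>"
    then have "free_energy W \<rho> \<kappa> \<le> free_energy W uniform_density \<kappa>"
      using uniform_Pac_plus by (auto simp: global_minimizer_def)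
    also have "\<dots> = 0" using uniform_finite_energy[OF W] by (simp add: free_energy_finite)
    finally have "free_energy W \<rho> \<kappa> \<noteq> \<infinity>" by auto
    then have f: "finite_energy W \<rho>" using inf g by (auto simp: global_minimizer_def)
    moreover have "energy W \<kappa> \<rho> \<le> energy W \<kappa> \<sigma>" if "finite_energy W \<sigma>" for \<sigma>
    proof -
      have "\<sigma> \<in> Pac_plus" using that by (simp add: finite_energy_def)
      then have "free_energy W \<rho> \<kappa> \<le> free_energy W \<sigma> \<kappa>" using g by (auto simp: global_minimizer_def)
      then show ?thesis using f that by (simp add: free_energy_finite)
    qed
    ultimately show "finite_energy W \<rho> \<and> (\<forall>\<sigma>. finite_energy W \<sigma> \<longrightarrow> energy W \<kappa> \<rho> \<le> energy W \<kappa> \<sigma>)" by blast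
  next
    assume r: "finite_energy W \<rho> \<and> (\<forall>\<sigma>. finite_energy W \<sigma> \<longrightarrow> energy W \<kappa> \<rho> \<le> energy W \<kappa> \<sigma>)"
    have "free_energy W \<rho> \<kappa> \<le> free_energy W \<sigma> \<kappa>" if "\<sigma> \<in> Pac_plus" for \<sigma>
      using r inf[OF that] by (cases "finite_energy W \<sigma>") (auto simp: free_energy_finite)
    then show "global_minimizer W \<kappa> \<rho>" using r by (simp add: global_minimizer_def finite_energy_def)
  qed
qed

section \<open>Transition points\<close>

text \<open>
  For \<open>\<kappa> \<le> \<kappa>'\<close> this is a convex combination of the entropy and the energy at \<open>\<kappa>'\<close>. It
  transports nonnegativity of the energy from \<open>\<kappa>'\<close> down to \<open>\<kappa>\<close>.
\<close>

lemma energy_interpolate: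
  assumes "0 < \<kappa>'"
  shows "energy W \<kappa> \<sigma> = (1 - \<kappa> / \<kappa>') * entropy \<sigma> + \<kappa> / \<kappa>' * energy W \<kappa>' \<sigma>"
  using assms by (simp add: energy_def field_simps)

text \<open>
  The transition point is the supremum of the \<open>\<kappa>\<close> at which the energy is nonnegative. The set is
  bounded by \<open>\<kappa>1\<close>, and it contains its supremum because the energy is continuous in \<open>\<kappa>\<close>. Below the
  supremum a minimizer has zero entropy by interpolation, hence is uniform; above it a
  minimizer has negative energy.
\<close>

theorem transition_point_exists:
  assumes W: "potential a W" and t: "tame W"
    and ex: "\<And>\<kappa>. 0 < \<kappa> \<Longrightarrow> \<exists>\<rho>. global_minimizer W \<kappa> \<rho>"
    and \<kappa>0: "0 < \<kappa>0" "\<And>\<sigma>. finite_energy W \<sigma> \<Longrightarrow> 0 \<le> energy W \<kappa>0 \<sigma>"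
    and \<sigma>1: "0 < \<kappa>1" "finite_energy W \<sigma>1" "energy W \<kappa>1 \<sigma>1 < 0"
  shows "\<exists>\<kappa>c. transition_point W \<kappa>c \<and> \<kappa>c \<le> \<kappa>1"
proof -
  note u = uniform_finite_energy[OF W]
  define T where "T = {\<kappa>. 0 < \<kappa> \<and> (\<forall>\<sigma>. finite_energy W \<sigma> \<longrightarrow> 0 \<le> energy W \<kappa> \<sigma>)}"
  define \<kappa>c where "\<kappa>c = Sup T"
  have ent0: "0 \<le> entropy \<sigma>" if "finite_energy W \<sigma>" for \<sigma>
    using that Pac_plusD(1) by (intro entropy_nonneg) (auto simp: finite_energy_def)
  have T0: "\<kappa>0 \<in> T" using \<kappa>0 by (simp add: T_def)
  have Tb: "\<kappa> \<le> \<kappa>1" if "\<kappa> \<in> T" for \<kappa>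
  proof (rule ccontr)
    assume "\<not> \<kappa> \<le> \<kappa>1"
    then have \<kappa>: "\<kappa>1 < \<kappa>" "0 < \<kappa>" using \<sigma>1 by auto
    have "0 \<le> (1 - \<kappa>1 / \<kappa>) * entropy \<sigma>1 + \<kappa>1 / \<kappa> * energy W \<kappa> \<sigma>1"
      using that \<sigma>1 \<kappa> ent0 by (intro add_nonneg_nonneg mult_nonneg_nonneg) (auto simp: T_def)
    then show False using energy_interpolate[OF \<kappa>(2), of W \<kappa>1 \<sigma>1] \<sigma>1 by simp
  qed
  have bdd: "bdd_above T" by (rule bdd_aboveI[of T \<kappa>1]) (rule Tb)
  have \<kappa>c: "\<kappa>0 \<le> \<kappa>c" "\<kappa>c \<le> \<kappa>1"
    unfolding \<kappa>c_def using cSup_upper[OF T0 bdd] cSup_least[of T \<kappa>1] Tb T0 by auto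
  have pos: "0 < \<kappa>c" using \<kappa>c \<kappa>0 by simp
  have cT: "0 \<le> energy W \<kappa>c \<sigma>" if f: "finite_energy W \<sigma>" for \<sigma>
  proof (rule ccontr)
    assume neg: "\<not> 0 \<le> energy W \<kappa>c \<sigma>"
    let ?Q = "interaction W \<sigma> \<sigma>"
    have Q: "entropy \<sigma> < \<kappa>c / 2 * ?Q" using neg by (simp add: energy_def)
    have Qp: "0 < ?Q"
    proof (rule ccontr)
      assume "\<not> 0 < ?Q"
      then have "\<kappa>c / 2 * ?Q \<le> 0" using pos by (intro mult_nonneg_nonpos) auto
      then show False using Q ent0[OF f] by linarith
    qed
    have "2 * entropy \<sigma> / ?Q < \<kappa>c" using Q Qp by (simp add: field_simps)
    then obtain \<kappa> where \<kappa>: "\<kappa> \<in> T" "2 * entropy \<sigma> / ?Q < \<kappa>"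
      unfolding \<kappa>c_def using less_cSup_iff[OF _ bdd] T0 by blast
    then have "energy W \<kappa> \<sigma> < 0" using Qp by (simp add: energy_def field_simps)
    then show False using \<kappa>(1) f unfolding T_def by fastforce
  qed
  have gm: "global_minimizer W \<kappa> uniform_density" if "0 < \<kappa>" "\<kappa> \<le> \<kappa>c" for \<kappa>
  proof -
    have "0 \<le> energy W \<kappa> \<sigma>" if f: "finite_energy W \<sigma>" for \<sigma>
      unfolding energy_interpolate[OF pos, of W \<kappa> \<sigma>]
      using \<open>0 < \<kappa>\<close> \<open>\<kappa> \<le> \<kappa>c\<close> pos ent0[OF f] cT[OF f] by (intro add_nonneg_nonneg mult_nonneg_nonneg) auto
    then show ?thesis using minimizer_iff[OF W t that(1)] u by simp
  qed
  have "transition_point W \<kappa>c"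
    unfolding transition_point_def
  proof (intro conjI allI impI)
    show "0 < \<kappa>c" by (rule pos)
    show "global_minimizer W \<kappa>c uniform_density" by (rule gm[OF pos order_refl])
  next
    fix \<kappa> assume \<kappa>: "0 < \<kappa> \<and> \<kappa> < \<kappa>c"
    show "unique_global_minimizer W \<kappa> uniform_density"
      unfolding unique_global_minimizer_def
    proof (intro conjI allI impI)
      show "global_minimizer W \<kappa> uniform_density" using gm \<kappa> by simp
      fix \<sigma> assume g: "global_minimizer W \<kappa> \<sigma>"
      then have f: "finite_energy W \<sigma>" and le: "energy W \<kappa> \<sigma> \<le> 0"
        using minimizer_iff[OF W t] \<kappa> u by (auto simp: u(2) dest: spec[of _ uniform_density])
      have "0 \<le> \<kappa> / \<kappa>c * energy W \<kappa>c \<sigma>" using cT[OF f] \<kappa> pos by simp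
      then have "(1 - \<kappa> / \<kappa>c) * entropy \<sigma> \<le> 0"
        using le energy_interpolate[OF pos, of W \<kappa> \<sigma>] by linarith
      moreover have "0 < 1 - \<kappa> / \<kappa>c" using \<kappa> pos by simp
      ultimately have "entropy \<sigma> = 0" using ent0[OF f] by (simp add: mult_le_0_iff)
      then show "AE \<theta> in circ. \<sigma> \<theta> = uniform_density \<theta>"
        using entropy_eq_0[of \<sigma>] f Pac_plusD(1) by (auto simp: uniform_density_def finite_energy_def)
    qed
  next
    fix \<kappa> assume \<kappa>: "\<kappa>c < \<kappa>"
    then have k0: "0 < \<kappa>" using pos by simp
    obtain \<rho> where g: "global_minimizer W \<kappa> \<rho>" using ex[OF k0] by blast
    have "\<not> (AE \<theta> in circ. \<rho> \<theta> = uniform_density \<theta>)"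
    proof
      assume "AE \<theta> in circ. \<rho> \<theta> = uniform_density \<theta>"
      then have one: "AE x in circ. \<rho> x = 1" by (simp add: uniform_density_def)
      have f: "finite_energy W \<rho>" using g minimizer_iff[OF W t k0] by simp
      have m: "\<rho> \<in> borel_measurable circ" using f Pac_plusD(3) by (simp add: finite_energy_def)
      have "interaction W \<rho> \<rho> = 0" by (rule interaction_AE_1[OF W m one])
      then have "0 \<le> energy W \<kappa> \<rho>" using ent0[OF f] by (simp add: energy_def)
      then have "\<kappa> \<in> T" using g minimizer_iff[OF W t k0] k0 by (force simp: T_def)
      then show False using cSup_upper[OF _ bdd, of \<kappa>] \<kappa> by (simp add: \<kappa>c_def)
    qed
    then show "\<exists>\<rho>. global_minimizer W \<kappa> \<rho> \<and> \<not> (AE \<theta> in circ. \<rho> \<theta> = uniform_density \<theta>)" using g by blast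
  qed
  then show ?thesis using \<kappa>c by blast
qed

text \<open>
  If the transition were continuous, non-uniform minimizers \<open>r\<close> with \<open>\<kappa>\<close> just above \<open>\<kappa>c\<close> would be
  uniformly close to \<open>1\<close>. There the entropy is at least \<open>n / (2 * (1 + t))\<close>, where \<open>n\<close> is the mean
  of \<open>(r - 1)\<^sup>2\<close>, and the interaction term is at most \<open>\<kappa> * A * n / 4\<close>, which is less. So the energy
  of \<open>r\<close> would be positive, and the uniform density, with energy \<open>0\<close>, better.
\<close>

theorem early_transition_discontinuous:
  assumes W: "potential a W" and A: "\<And>l. 1 \<le> l \<Longrightarrow> a l \<le> A" "0 < A"
    and tp: "transition_point W \<kappa>c" and lt: "\<kappa>c < 2 / A"
  shows "discontinuous_transition_point W \<kappa>c"
  unfolding discontinuous_transition_point_def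
proof (intro conjI notI)
  show "transition_point W \<kappa>c" by (rule tp)
  assume cont: "continuous_transition_point W \<kappa>c"
  have pos: "0 < \<kappa>c" using tp by (simp add: transition_point_def)
  obtain \<kappa>1 where \<kappa>1: "\<kappa>c < \<kappa>1" "\<kappa>1 < 2 / A" using dense[OF lt] by blast
  have q: "0 < \<kappa>1 * A / 2" "\<kappa>1 * A / 2 < 1" using \<kappa>1 A pos by (auto simp: field_simps)
  \<comment> \<open>Small enough for \<open>1 / (1 + t)\<close> to lie between \<open>\<kappa>1 * A / 2\<close> and \<open>1\<close>.\<close>
  define t where "t = min (1/2) ((1 / (\<kappa>1 * A / 2) - 1) / 2)"
  have t: "0 < t" "t < 1" using q by (auto simp: t_def field_simps)
  have "1 + t < 1 / (\<kappa>1 * A / 2)"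
  proof -
    have "0 < 1 / (\<kappa>1 * A / 2) - 1" using q by (simp add: field_simps)
    moreover have "t \<le> (1 / (\<kappa>1 * A / 2) - 1) / 2" unfolding t_def by (rule min.cobounded2)
    ultimately show ?thesis by argo
  qed
  then have tq: "\<kappa>1 * A / 2 < 1 / (1 + t)" using q t by (simp add: field_simps)
  have "\<forall>\<kappa>. \<exists>\<rho>. \<kappa>c < \<kappa> \<longrightarrow> global_minimizer W \<kappa> \<rho> \<and> \<not> (AE \<theta> in circ. \<rho> \<theta> = uniform_density \<theta>)"
    using tp by (auto simp: transition_point_def)
  then obtain \<rho> where \<rho>: "\<And>\<kappa>. \<kappa>c < \<kappa> \<Longrightarrow> global_minimizer W \<kappa> (\<rho> \<kappa>)"
    "\<And>\<kappa>. \<kappa>c < \<kappa> \<Longrightarrow> \<not> (AE \<theta> in circ. \<rho> \<kappa> \<theta> = uniform_density \<theta>)" by metis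
  have "((\<lambda>\<kappa>. H1_norm (\<lambda>\<theta>. \<rho> \<kappa> \<theta> - uniform_density \<theta>)) \<longlongrightarrow> 0) (at_right \<kappa>c)"
    using cont \<rho>(1) by (auto simp: continuous_transition_point_def)
  then have "eventually (\<lambda>\<kappa>. H1_norm (\<lambda>\<theta>. \<rho> \<kappa> \<theta> - uniform_density \<theta>) < ennreal (t / 8)) (at_right \<kappa>c)"
    by (rule order_tendstoD) (use t in simp)
  moreover have "eventually (\<lambda>\<kappa>. \<kappa> \<in> {\<kappa>c<..<\<kappa>1}) (at_right \<kappa>c)"
    by (rule eventually_at_right_real[OF \<kappa>1(1)])
  ultimately have "eventually (\<lambda>\<kappa>. H1_norm (\<lambda>\<theta>. \<rho> \<kappa> \<theta> - uniform_density \<theta>) < ennreal (t / 8) \<and> \<kappa> \<in> {\<kappa>c<..<\<kappa>1}) (at_right \<kappa>c)"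
    by eventually_elim simp
  then obtain \<kappa> where \<kappa>: "H1_norm (\<lambda>\<theta>. \<rho> \<kappa> \<theta> - uniform_density \<theta>) < ennreal (t / 8)" "\<kappa>c < \<kappa>" "\<kappa> < \<kappa>1"
    using eventually_happens[of _ "at_right \<kappa>c"] by (auto simp: trivial_limit_at_right_real)
  define r where "r = \<rho> \<kappa>"
  have gm: "global_minimizer W \<kappa> r" using \<rho>(1) \<kappa> by (simp add: r_def)
  then have rP: "r \<in> Pac_plus" by (simp add: global_minimizer_def)
  note P = Pac_plusD[OF rP]
  obtain g where g: "weak_deriv (\<lambda>x. r x - 1) g" and gs: "sqrt (\<integral>x. (r x - 1)\<^sup>2 + (g x)\<^sup>2 \<partial>circ) < t / 8"
  proof -
    from \<kappa>(1) obtain g where "weak_deriv (\<lambda>x. r x - 1) g" "ennreal (sqrt (\<integral>x. (r x - 1)\<^sup>2 + (g x)\<^sup>2 \<partial>circ)) < ennreal (t / 8)"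
      unfolding H1_norm_def INF_less_iff by (auto simp: r_def uniform_density_def)
    then show thesis using that t by (auto simp: ennreal_less_iff)
  qed
  have hd: "hderiv (\<lambda>x. r x - 1) g" by (rule weak_deriv_imp_hderiv[OF g])
  then have s1: "sqint circ (\<lambda>x. r x - 1)" and sg: "sqint circ g" by (auto simp: hderiv_def)
  have "sqrt (\<integral>x. (g x)\<^sup>2 \<partial>circ) \<le> sqrt (\<integral>x. (r x - 1)\<^sup>2 + (g x)\<^sup>2 \<partial>circ)"
    using sqint_square[OF s1] sqint_square[OF sg] by (intro real_sqrt_le_mono integral_mono) auto
  then have gt: "4 * sqrt (\<integral>x. (g x)\<^sup>2 \<partial>circ) \<le> t" using gs t by linarith
  have h0: "hcoef (\<lambda>x. r x - 1) 0 = 0"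
    using prob_density_hcoef_0[OF P(1)] P(2) by (subst hcoef_diff) (auto simp: hcoef_1)
  have rt: "AE x in circ. \<bar>r x - 1\<bar> \<le> t"
    using hderiv_sup_bound[OF hd] by eventually_elim (use gt h0 in simp)
  then have "AE x in circ. r x \<le> 2" by eventually_elim (use t in auto)
  from bounded_finite_energy[OF potential_kernel_ok[OF W] rP this]
  have f: "finite_energy W r" and sr: "sqint circ r" by auto
  define n where "n = (\<integral>x. (r x - 1)\<^sup>2 \<partial>circ) / (2*pi)"
  have n0: "0 < n"
  proof (rule ccontr)
    assume "\<not> 0 < n"
    moreover have "0 \<le> (\<integral>x. (r x - 1)\<^sup>2 \<partial>circ)" by (intro integral_nonneg_AE) auto
    ultimately have "(\<integral>x. (r x - 1)\<^sup>2 \<partial>circ) = 0" by (simp add: n_def zero_less_divide_iff)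
    then have "AE x in circ. (r x - 1)\<^sup>2 = 0"
      using integral_nonneg_eq_0_iff_AE[OF sqint_square[OF s1]] by simp
    then have "AE x in circ. r x = uniform_density x" by eventually_elim (simp add: uniform_density_def)
    then show False using \<rho>(2)[OF \<kappa>(2)] by (simp add: r_def)
  qed
  have lf: "integrable circ (\<lambda>x. r x * ln (r x))" using f by (simp add: finite_energy_def)
  have "(\<integral>x. (r x - 1)\<^sup>2 / (2 * (1 + t)) \<partial>circ) \<le> (\<integral>x. psi (r x) \<partial>circ)"
  proof (rule integral_mono_AE)
    show "integrable circ (\<lambda>x. psi (r x))" using integrable_psi_iff[OF P(2)] lf by simp
    show "AE x in circ. (r x - 1)\<^sup>2 / (2 * (1 + t)) \<le> psi (r x)"
      using rt by eventually_elim (rule psi_local_quadratic[OF t])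
  qed (use sqint_square[OF s1] in simp)
  then have "1 / (2*pi) * (\<integral>x. (r x - 1)\<^sup>2 / (2 * (1 + t)) \<partial>circ) \<le> entropy r"
    unfolding entropy_psi[OF P(1) lf] by (rule mult_left_mono) simp
  moreover have "1 / (2*pi) * (\<integral>x. (r x - 1)\<^sup>2 / (2 * (1 + t)) \<partial>circ) = n / (2 * (1 + t))"
    by (simp add: n_def)
  ultimately have "n / (2 * (1 + t)) \<le> entropy r" by simp
  moreover have "interaction W r r \<le> A / 2 * n"
    unfolding n_def by (rule interaction_self_le[OF W sr]) (use A in auto)
  then have "\<kappa> / 2 * interaction W r r \<le> \<kappa> / 2 * (A / 2 * n)" using \<kappa> pos by (intro mult_left_mono) auto
  moreover have "\<kappa> / 2 * (A / 2 * n) < n / (2 * (1 + t))"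
  proof -
    have "\<kappa> * A / 2 < 1 / (1 + t)" using tq \<kappa> A by (smt (verit) divide_right_mono mult_right_mono)
    then have "n / 2 * (\<kappa> * A / 2) < n / 2 * (1 / (1 + t))" using n0 by (intro mult_strict_left_mono) auto
    then show ?thesis by (simp add: mult.commute mult.left_commute)
  qed
  ultimately have "0 < energy W \<kappa> r" unfolding energy_def by linarith
  moreover have "free_energy W r \<kappa> \<le> free_energy W uniform_density \<kappa>"
    using gm uniform_Pac_plus by (auto simp: global_minimizer_def)
  ultimately show False
    using uniform_finite_energy[OF W] f by (simp add: free_energy_finite zero_ereal_def)
qed

section \<open>Weak compactness of densities of bounded entropy\<close>

lemma bounded_diagonal_subsequence:
  fixes F :: "nat \<Rightarrow> nat \<Rightarrow> real"
  assumes b: "\<And>i n. \<bar>F i n\<bar> \<le> B i"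
  obtains r :: "nat \<Rightarrow> nat" where "strict_mono r" "\<And>i. convergent (\<lambda>n. F i (r n))"
proof -
  interpret subseqs "\<lambda>i s. convergent (\<lambda>n. F i (s n))"
  proof
    fix i :: nat and s :: "nat \<Rightarrow> nat" assume "strict_mono s"
    have "\<forall>n. F i (s n) \<in> {- B i..B i}" using b by (auto simp: abs_le_iff minus_le_iff)
    then obtain l r where "strict_mono r" "((\<lambda>n. F i (s n)) \<circ> r) \<longlonglongrightarrow> l"
      using compact_Icc[of "- B i" "B i", unfolded compact_def, rule_format, of "\<lambda>n. F i (s n)"] by auto
    then show "\<exists>r'. strict_mono r' \<and> convergent (\<lambda>n. F i ((s \<circ> r') n))"
      by (auto simp: o_def convergent_def)
  qed
  have "convergent (\<lambda>n. F i (diagseq n))" for i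
  proof -
    have "convergent (\<lambda>n. F i ((diagseq \<circ> (+) (Suc i)) n))"
    proof (rule diagseq_holds)
      fix r s :: "nat \<Rightarrow> nat" and n
      assume "strict_mono r" "convergent (\<lambda>k. F n (s k))"
      then show "convergent (\<lambda>k. F n ((s \<circ> r) k))"
        using convergent_subseq_convergent[of "\<lambda>k. F n (s k)" r] by (simp add: o_def)
    qed
    then have "convergent (\<lambda>n. F i (diagseq (n + Suc i)))" by (simp add: o_def add.commute)
    then show ?thesis by (rule convergent_ignore_initial_segment[THEN iffD1])
  qed
  then show thesis using that subseq_diagseq by blast
qed

text \<open>
  Averages of two functions are all that the parallelogram law needs, and with them a property
  that is stable under averaging passes from the functions \<open>f j\<close>, \<open>j \<ge> k\<close>, to the hull by
  induction.
\<close>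

inductive_set midhull :: "(nat \<Rightarrow> 'a \<Rightarrow> real) \<Rightarrow> nat \<Rightarrow> ('a \<Rightarrow> real) set"
  for f :: "nat \<Rightarrow> 'a \<Rightarrow> real" and k :: nat where
  base: "k \<le> j \<Longrightarrow> f j \<in> midhull f k"
| mid: "g \<in> midhull f k \<Longrightarrow> h \<in> midhull f k \<Longrightarrow> (\<lambda>x. (g x + h x) / 2) \<in> midhull f k"

lemma midhull_antimono:
  assumes "k \<le> j" "g \<in> midhull f j" shows "g \<in> midhull f k"
  using assms(2) by induction (use assms(1) in \<open>auto intro: midhull.intros\<close>)

lemma midhull_unit_interval:
  assumes "g \<in> midhull f k" "\<And>n. f n \<in> borel_measurable M" "\<And>n x. f n x \<in> {0..1}"
  shows "g \<in> borel_measurable M \<and> (\<forall>x. g x \<in> {0..1})"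
  using assms(1)
proof induction
  case (mid g h)
  have "(g x + h x) / 2 \<in> {0..1}" for x
  proof -
    have "0 \<le> g x" "g x \<le> 1" "0 \<le> h x" "h x \<le> 1" using mid.IH by auto
    then show ?thesis by simp
  qed
  then show ?case using mid.IH by auto
qed (use assms in auto)

text \<open>
  A form of Mazur's lemma that needs no weak topology. Almost minimal mean squares in the hulls
  of the tails make a Cauchy sequence: the average of two such functions lies in a hull again, so
  its mean square is not much smaller, and the parallelogram law bounds the difference.
\<close>

theorem midhull_AE_convergent:
  fixes f :: "nat \<Rightarrow> 'a \<Rightarrow> real"
  assumes M: "finite_measure M" and fm: "\<And>n. f n \<in> borel_measurable M" and f01: "\<And>n x. f n x \<in> {0..1}"
  obtains g h where "\<And>k. g k \<in> midhull f k" "h \<in> borel_measurable M" "AE x in M. (\<lambda>k. g k x) \<longlonglongrightarrow> h x"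
proof -
  have hull: "sqint M g" "(\<integral>x. (g x)\<^sup>2 \<partial>M) \<le> measure M (space M)" if "g \<in> midhull f k" for g k
  proof -
    have g: "g \<in> borel_measurable M" "\<And>x. g x \<in> {0..1}" using midhull_unit_interval[OF that fm f01] by auto
    show s: "sqint M g" by (rule sqint_bounded[OF M g(1), of 1]) (use g(2) in auto)
    have "(\<integral>x. (g x)\<^sup>2 \<partial>M) \<le> (\<integral>x. 1 \<partial>M)"
      using g(2) sqint_square[OF s] finite_measure.integrable_const[OF M]
      by (intro integral_mono) (auto simp: power_le_one)
    then show "(\<integral>x. (g x)\<^sup>2 \<partial>M) \<le> measure M (space M)" by simp
  qed
  define E where "E g = (\<integral>x. (g x)\<^sup>2 \<partial>M)" for g :: "'a \<Rightarrow> real"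
  define J where "J k = Inf (E ` midhull f k)" for k
  have E0: "0 \<le> E g" for g by (simp add: E_def)
  have bdd: "bdd_below (E ` midhull f k)" for k by (rule bdd_belowI[of _ 0]) (auto simp: E0)
  have ne: "f k \<in> midhull f k" for k by (rule midhull.base) simp
  have Jle: "J k \<le> E g" if "g \<in> midhull f k" for k g
    unfolding J_def using that bdd by (intro cInf_lower) auto
  have Jmono: "incseq J"
    unfolding incseq_def J_def
  proof (intro allI impI)
    fix i j :: nat assume "i \<le> j"
    then show "Inf (E ` midhull f i) \<le> Inf (E ` midhull f j)"
      using ne[of j] bdd[of i] midhull_antimono by (intro cInf_superset_mono) (auto intro!: imageI)
  qed
  have "J k \<le> measure M (space M)" for k
    using Jle[OF ne[of k]] hull(2)[OF ne[of k]] by (simp add: E_def)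
  from incseq_convergent[OF Jmono] this obtain L where L: "J \<longlonglongrightarrow> L" "\<And>k. J k \<le> L" by blast
  have "\<exists>g. g \<in> midhull f k \<and> E g < J k + 1 / real (Suc k)" for k
    using cInf_lessD[of "E ` midhull f k" "J k + 1 / real (Suc k)"] ne[of k] unfolding J_def by fastforce
  then obtain g where g: "\<And>k. g k \<in> midhull f k" "\<And>k. E (g k) < J k + 1 / real (Suc k)" by metis
  define d where "d k = 1 / real (Suc k)" for k
  have gd: "E (g k) < J k + d k" for k using g(2) by (simp add: d_def)
  have para: "(\<integral>x. (g i x - g j x)\<^sup>2 \<partial>M) \<le> 2 * (L - J i) + 4 * d i" if "i \<le> j" for i j
  proof -
    have gi: "g i \<in> midhull f i" and gj: "g j \<in> midhull f i" using g midhull_antimono[OF that] by auto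
    have m: "J i \<le> E (\<lambda>x. (g i x + g j x) / 2)" by (intro Jle midhull.mid gi gj)
    have s: "sqint M (\<lambda>x. (g i x + g j x) / 2)" by (rule hull(1)[OF midhull.mid[OF gi gj]])
    have "(\<integral>x. (g i x - g j x)\<^sup>2 \<partial>M) = (\<integral>x. 2 * (g i x)\<^sup>2 + 2 * (g j x)\<^sup>2 - 4 * ((g i x + g j x) / 2)\<^sup>2 \<partial>M)"
      by (intro Bochner_Integration.integral_cong) (auto simp: power2_eq_square algebra_simps)
    also have "\<dots> = 2 * E (g i) + 2 * E (g j) - 4 * E (\<lambda>x. (g i x + g j x) / 2)"
      using sqint_square[OF hull(1)[OF gi]] sqint_square[OF hull(1)[OF gj]] sqint_square[OF s]
      unfolding E_def by simp
    also have "\<dots> \<le> 2 * (J i + d i) + 2 * (J j + d j) - 4 * J i"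
      by (intro diff_mono add_mono mult_left_mono m less_imp_le[OF gd]) auto
    also have "\<dots> \<le> 2 * (L - J i) + 4 * d i"
    proof -
      have "d j \<le> d i" unfolding d_def using that by (intro divide_left_mono) auto
      then have "2 * d j \<le> 2 * d i" "2 * J j \<le> 2 * L" using L(2)[of j] by simp_all
      then show ?thesis by (simp add: algebra_simps)
    qed
    finally show ?thesis .
  qed
  have "\<exists>N. \<forall>i\<ge>N. \<forall>j\<ge>N. (\<integral>x. (g i x - g j x)\<^sup>2 \<partial>M) < e" if e: "0 < e" for e
  proof -
    have "d \<longlonglongrightarrow> 0" unfolding d_def by (rule LIMSEQ_Suc[OF lim_1_over_n])
    then have "(\<lambda>i. 2 * (L - J i) + 4 * d i) \<longlonglongrightarrow> 2 * (L - L) + 4 * 0"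
      by (intro tendsto_intros L(1))
    then have "eventually (\<lambda>i. 2 * (L - J i) + 4 * d i < e) sequentially"
      using e by (intro order_tendstoD) auto
    then obtain N where N: "\<And>i. i \<ge> N \<Longrightarrow> 2 * (L - J i) + 4 * d i < e"
      by (auto simp: eventually_sequentially)
    have "(\<integral>x. (g i x - g j x)\<^sup>2 \<partial>M) < e" if "i \<ge> N" "j \<ge> N" for i j
    proof (cases "i \<le> j")
      case True
      then show ?thesis using para[OF True] N[OF that(1)] by linarith
    next
      case False
      have "(\<integral>x. (g i x - g j x)\<^sup>2 \<partial>M) = (\<integral>x. (g j x - g i x)\<^sup>2 \<partial>M)" by (simp add: power2_commute)
      also have "\<dots> < e" using para[of j i] N[OF that(2)] False by linarith
      finally show ?thesis .
    qed
    then show ?thesis by blast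
  qed
  then obtain h r where h: "sqint M h" "strict_mono (r :: nat \<Rightarrow> nat)" "AE x in M. (\<lambda>n. g (r n) x) \<longlonglongrightarrow> h x"
    by (rule sqint_complete[OF M hull(1)[OF g(1)]]) auto
  have "g (r k) \<in> midhull f k" for k
    by (rule midhull_antimono[OF seq_suble[OF h(2)] g(1)])
  then show thesis using that[of "\<lambda>k. g (r k)" h] h by (simp add: sqint_def)
qed

text \<open>
  A finite measure that charges every natural number. A function on the product of \<open>weights\<close> with
  the circle is a family of functions indexed by truncation levels, and one choice of averages
  serves all levels at once. Separate choices would destroy the monotonicity in the level.
\<close>

definition weights :: "nat measure" where
  "weights = density (count_space UNIV) (\<lambda>n. ennreal ((1/2) ^ n))"

lemma space_weights[simp]: "space weights = UNIV" and sets_weights[simp]: "sets weights = UNIV"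
  by (auto simp: weights_def)

lemma finite_measure_weights: "finite_measure weights"
proof (rule finite_measureI)
  have "emeasure weights (space weights) = (\<integral>\<^sup>+n. ennreal ((1/2) ^ n) \<partial>count_space UNIV)"
    by (simp add: weights_def emeasure_density)
  also have "\<dots> = (\<Sum>n. ennreal ((1/2) ^ n))" by (rule nn_integral_count_space_nat)
  also have "\<dots> = ennreal (\<Sum>n. (1/2) ^ n)"
    by (rule suminf_ennreal2) (auto intro: summable_geometric)
  finally show "emeasure weights (space weights) \<noteq> \<infinity>" by simp
qed

lemma AE_weights: "(AE n in weights. P n) \<longleftrightarrow> (\<forall>n. P n)"
  unfolding weights_def by (subst AE_density) (auto simp: AE_count_space)

text \<open>
  The level is \<open>M + 1\<close> rather than \<open>M\<close>: it is positive, so one may divide by it, and at least \<open>1\<close>,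
  so cutting at it does not increase \<open>psi\<close>.
\<close>

definition trunc :: "nat \<Rightarrow> real \<Rightarrow> real" where
  "trunc M x = max 0 (min x (real M + 1))"

lemma trunc_measurable[measurable]: "trunc M \<in> borel_measurable borel"
  by (simp add: trunc_def[abs_def])

lemma trunc_bounds: "0 \<le> trunc M x" "trunc M x \<le> real M + 1"
  by (auto simp: trunc_def)

lemma trunc_mono: "trunc M x \<le> trunc (Suc M) x"
  by (auto simp: trunc_def)

lemma trunc_le: "0 \<le> x \<Longrightarrow> trunc M x \<le> x"
  by (auto simp: trunc_def)

lemma trunc_rest_abs: "\<bar>x - trunc M x\<bar> \<le> \<bar>x\<bar>"
  by (auto simp: trunc_def)

lemma psi_mono: "1 \<le> x \<Longrightarrow> x \<le> y \<Longrightarrow> psi x \<le> psi y"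
  using psi_tangent[of x y] by (smt (verit) ln_ge_zero mult_nonneg_nonneg)

lemma psi_trunc_le: "0 \<le> x \<Longrightarrow> psi (trunc M x) \<le> psi x"
  by (cases "x \<le> real M + 1") (auto simp: trunc_def intro: psi_mono)

text \<open>
  The tangent of \<open>psi\<close> at the level has the slope \<open>ln (M + 1)\<close>.
\<close>

lemma trunc_rest_le_psi:
  assumes "0 \<le> x"
  shows "(x - trunc M x) * ln (real M + 1) \<le> psi x"
proof (cases "x \<le> real M + 1")
  case True
  then show ?thesis using assms psi_nonneg by (simp add: trunc_def)
next
  case False
  then show ?thesis
    using psi_tangent[of "real M + 1" x] psi_nonneg[of "real M + 1"] assms
    by (simp add: trunc_def mult.commute)
qed

text \<open>
  The bound \<open>ln (1 / sqrt x) \<le> 1 / sqrt x\<close> gives continuity of \<open>x * ln x\<close> at \<open>0\<close>.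
\<close>

lemma abs_x_ln_x_le:
  fixes x :: real
  assumes "0 \<le> x" "x \<le> 1" shows "\<bar>x * ln x\<bar> \<le> 2 * sqrt x"
proof (cases "x = 0")
  case False
  then have x: "0 < x" using assms by simp
  have "- (sqrt x * ln (sqrt x)) \<le> 1"
    using psi_nonneg[of "sqrt x"] real_sqrt_ge_zero[of x] x unfolding psi_def by linarith
  then have "2 * sqrt x * (- (sqrt x * ln (sqrt x))) \<le> 2 * sqrt x * 1" using x by (intro mult_left_mono) auto
  moreover have "2 * sqrt x * (- (sqrt x * ln (sqrt x))) = - (x * ln x)"
    using x by (simp add: ln_sqrt)
  moreover have "x * ln x \<le> 0" using x assms by (simp add: mult_nonneg_nonpos)
  ultimately show ?thesis by linarith
qed simp

lemma psi_continuous: "continuous_on {0..} psi"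
  unfolding continuous_on
proof
  fix x :: real assume "x \<in> {0..}"
  then consider "x > 0" | "x = 0" by fastforce
  then show "(psi \<longlongrightarrow> psi x) (at x within {0..})"
  proof cases
    case 1
    then have "isCont psi x" unfolding psi_def[abs_def] by (intro continuous_intros) auto
    then show ?thesis using continuous_at_imp_continuous_at_within[of x psi] by (simp add: continuous_within)
  next
    case 2
    have "((\<lambda>y. y * ln y) \<longlongrightarrow> 0) (at (0::real) within {0..})"
    proof (rule Lim_null_comparison)
      have "eventually (\<lambda>y. y < 1) (at (0::real) within {0..})"
        by (rule order_tendstoD[OF tendsto_ident_at]) simp
      moreover have "eventually (\<lambda>y. y \<in> {0..}) (at (0::real) within {0..})" by (simp add: eventually_at_filter)
      ultimately show "eventually (\<lambda>y. norm (y * ln y) \<le> 2 * sqrt y) (at (0::real) within {0..})"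
        by eventually_elim (simp add: abs_x_ln_x_le)
      have "((\<lambda>y. 2 * sqrt y) \<longlongrightarrow> 2 * sqrt 0) (at (0::real) within {0..})" by (intro tendsto_intros)
      then show "((\<lambda>y. 2 * sqrt y) \<longlongrightarrow> 0) (at (0::real) within {0..})" by simp
    qed
    then have "((\<lambda>y. y * ln y - y + 1) \<longlongrightarrow> 0 - 0 + 1) (at (0::real) within {0..})" by (intro tendsto_intros)
    then show ?thesis using 2 by (simp add: psi_def[abs_def])
  qed
qed

lemma psi_tendsto: "x \<longlonglongrightarrow> l \<Longrightarrow> (\<And>n::nat. 0 \<le> x n) \<Longrightarrow> (\<lambda>n. psi (x n)) \<longlonglongrightarrow> psi l"
  using continuous_on_tendsto_compose[OF psi_continuous, of x l sequentially] LIMSEQ_le_const[of x l 0] by auto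

text \<open>
  De la Vallee Poussin's criterion for the entropy: bounded entropy makes the mass above the level
  \<open>M + 1\<close> of order \<open>1 / ln (M + 1)\<close>, uniformly over the densities.
\<close>

lemma trunc_rest_mass:
  assumes d: "prob_density \<rho>" and i: "integrable circ (\<lambda>x. \<rho> x * ln (\<rho> x))"
  shows "(\<integral>x. \<bar>\<rho> x - trunc M (\<rho> x)\<bar> \<partial>circ) * ln (real M + 1) \<le> 2*pi * entropy \<rho>"
proof -
  have \<rho>: "integrable circ \<rho>" and nn: "AE x in circ. 0 \<le> \<rho> x" using d by (auto simp: prob_density_def)
  have [measurable]: "\<rho> \<in> borel_measurable circ" using \<rho> by auto
  have vi: "integrable circ (\<lambda>x. \<rho> x - trunc M (\<rho> x))"
    by (rule Bochner_Integration.integrable_bound[OF \<rho>]) (auto simp: trunc_rest_abs)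
  have "(\<integral>x. \<bar>\<rho> x - trunc M (\<rho> x)\<bar> * ln (real M + 1) \<partial>circ) \<le> (\<integral>x. psi (\<rho> x) \<partial>circ)"
  proof (rule integral_mono_AE)
    show "integrable circ (\<lambda>x. psi (\<rho> x))" using integrable_psi_iff[OF \<rho>] i by simp
    show "AE x in circ. \<bar>\<rho> x - trunc M (\<rho> x)\<bar> * ln (real M + 1) \<le> psi (\<rho> x)"
      using nn by eventually_elim (use trunc_rest_le_psi trunc_le in \<open>auto simp: abs_of_nonneg\<close>)
  qed (use vi in auto)
  then show ?thesis using entropy_psi[OF d i] by simp
qed

text \<open>
  Induction over the hull for a single truncation level \<open>M\<close>, with the normalisation \<open>c\<close> undone.
\<close>

lemma midhull_slice_induct:
  assumes g: "g \<in> midhull F k"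
    and base: "\<And>j. k \<le> j \<Longrightarrow> P (\<lambda>x. c * F j (M, x))"
    and mid: "\<And>u v. P u \<Longrightarrow> P v \<Longrightarrow> P (\<lambda>x. (u x + v x) / 2)"
  shows "P (\<lambda>x. c * g (M, x) :: real)"
  using g
proof induction
  case (mid g h)
  have "(\<lambda>x. c * ((g (M, x) + h (M, x)) / 2)) = (\<lambda>x. (c * g (M, x) + c * h (M, x)) / 2)"
    by (simp add: distrib_left)
  then show ?case using assms(3)[OF mid.IH] by simp
qed (rule base)

lemma bounded_integrable_circ:
  assumes "u \<in> borel_measurable circ" "\<And>x. 0 \<le> u x" "\<And>x. u x \<le> (B::real)"
  shows "integrable circ u"
  by (rule circ.integrable_const_bound[of _ B]) (use assms in auto)

lemma psi_le_bound: "0 \<le> x \<Longrightarrow> x \<le> B \<Longrightarrow> psi x \<le> 1 + B\<^sup>2"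
proof -
  assume x: "0 \<le> x" "x \<le> B"
  have "x * ln x \<le> x * x" using x ln_bound[of x] by (cases "x = 0") (auto intro!: mult_left_mono)
  also have "\<dots> \<le> B\<^sup>2" using x by (simp add: power2_eq_square mult_mono)
  finally show ?thesis using x by (simp add: psi_def)
qed

lemma bounded_integrable_psi:
  assumes "u \<in> borel_measurable circ" "\<And>x. 0 \<le> u x" "\<And>x. u x \<le> (B::real)"
  shows "integrable circ (\<lambda>x. psi (u x))"
  by (rule bounded_integrable_circ[where B="1 + B\<^sup>2"]) (use assms psi_nonneg psi_le_bound in auto)

text \<open>
  Weak sequential compactness in \<open>L\<^sup>1\<close> and lower semicontinuity of the entropy, with convergence
  expressed by coefficients. Along a diagonal subsequence the coefficients of all truncations converge.
  Averages of the truncations that converge almost everywhere give functions \<open>U M\<close> with the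
  limiting coefficients; averages preserve the monotonicity in \<open>M\<close> and, by convexity, the entropy
  bound. The increasing limit of the \<open>U M\<close> is the limit density, and uniformly small tails keep
  its mass equal to \<open>1\<close>. The \<open>U M\<close> are part of the conclusion because the interaction passes
  to the limit only for truncated densities.
\<close>

theorem entropy_compactness:
  fixes \<rho> :: "nat \<Rightarrow> real \<Rightarrow> real"
  assumes d: "\<And>n. prob_density (\<rho> n)" and i: "\<And>n. integrable circ (\<lambda>x. \<rho> n x * ln (\<rho> n x))"
    and lim: "(\<lambda>n. entropy (\<rho> n)) \<longlonglongrightarrow> s"
  obtains r \<rho>' U where "strict_mono (r :: nat \<Rightarrow> nat)" "prob_density \<rho>'" "integrable circ (\<lambda>x. \<rho>' x * ln (\<rho>' x))" "entropy \<rho>' \<le> s"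
    "\<And>M::nat. U M \<in> borel_measurable circ"
    "AE x in circ. \<forall>M. 0 \<le> U M x \<and> U M x \<le> real M + 1 \<and> U M x \<le> U (Suc M) x"
    "AE x in circ. (\<lambda>M. U M x) \<longlonglongrightarrow> \<rho>' x"
    "\<And>M l. (\<lambda>n. hcoef (\<lambda>x. trunc M (\<rho> (r n) x)) l) \<longlonglongrightarrow> hcoef (U M) l"
    "\<And>l. (\<lambda>n. hcoef (\<rho> (r n)) l) \<longlonglongrightarrow> hcoef \<rho>' l"
proof -
  have \<rho>i: "integrable circ (\<rho> n)" and nn: "AE x in circ. 0 \<le> \<rho> n x" for n
    using d[of n] by (auto simp: prob_density_def)
  have \<rho>m[measurable]: "\<rho> n \<in> borel_measurable circ" for n using \<rho>i by auto
  have tm[measurable]: "(\<lambda>x. trunc M (\<rho> n x)) \<in> borel_measurable circ" for M n by measurable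
  have ti: "integrable circ (\<lambda>x. trunc M (\<rho> n x))" for M n
    by (rule bounded_integrable_circ[OF tm trunc_bounds])
  have tmass: "(\<integral>x. trunc M (\<rho> n x) \<partial>circ) \<le> 2*pi" for M n
  proof -
    have "(\<integral>x. trunc M (\<rho> n x) \<partial>circ) \<le> (\<integral>x. \<rho> n x \<partial>circ)"
      by (rule integral_mono_AE[OF ti \<rho>i]) (use nn[of n] trunc_le in \<open>auto elim!: eventually_mono\<close>)
    then show ?thesis using prob_density_integral[OF d] by simp
  qed
  have ch: "\<bar>hcoef (\<lambda>x. trunc M (\<rho> n x)) l\<bar> \<le> 2" for M n l
  proof -
    have "\<bar>hcoef (\<lambda>x. trunc M (\<rho> n x)) l\<bar> \<le> 1 / pi * (\<integral>x. trunc M (\<rho> n x) \<partial>circ)"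
      using abs_hcoef_le[OF ti[of M n], of l] by (simp add: trunc_bounds(1))
    also have "\<dots> \<le> 1 / pi * (2*pi)" by (rule mult_left_mono[OF tmass]) simp
    finally show ?thesis by simp
  qed
  define F where "F j n = hcoef (\<lambda>x. trunc (fst (from_nat j :: nat \<times> int)) (\<rho> n x)) (snd (from_nat j :: nat \<times> int))" for j n
  obtain r where r: "strict_mono r" "\<And>j. convergent (\<lambda>n. F j (r n))"
    by (rule bounded_diagonal_subsequence[of F "\<lambda>_. 2"]) (auto simp: F_def ch)
  have "convergent (\<lambda>n. hcoef (\<lambda>x. trunc M (\<rho> (r n) x)) l)" for M l
    using r(2)[of "to_nat (M, l)"] by (simp add: F_def)
  then obtain c where c: "\<And>M l. (\<lambda>n. hcoef (\<lambda>x. trunc M (\<rho> (r n) x)) l) \<longlonglongrightarrow> c M l"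
    unfolding convergent_def by metis
  define \<sigma> where "\<sigma> n = \<rho> (r n)" for n
  have \<sigma>m[measurable]: "\<sigma> n \<in> borel_measurable circ" for n unfolding \<sigma>_def by measurable
  have \<sigma>lim: "(\<lambda>n. entropy (\<sigma> n)) \<longlonglongrightarrow> s"
    using LIMSEQ_subseq_LIMSEQ[OF lim r(1)] by (simp add: \<sigma>_def o_def)
  define f where "f n z = trunc (fst z) (\<sigma> n (snd z)) / (real (fst z) + 1)" for n :: nat and z :: "nat \<times> real"
  have f_slice: "(\<lambda>x. (real M + 1) * f n (M, x)) = (\<lambda>x. trunc M (\<sigma> n x))" for M n
    by (auto simp: f_def)
  have f_slice': "(real M + 1) * f n (M, x) = trunc M (\<sigma> n x)" for M n x
    by (auto simp: f_def)
  have fin: "finite_measure (weights \<Otimes>\<^sub>M circ)"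
    by (intro finite_measure_pair_measure finite_measure_weights finite_measure_circ)
  have sets_eq: "sets (weights \<Otimes>\<^sub>M circ) = sets (count_space UNIV \<Otimes>\<^sub>M circ)"
    by (rule sets_pair_measure_cong) auto
  have fm: "f n \<in> borel_measurable (weights \<Otimes>\<^sub>M circ)" for n
  proof -
    have "f n \<in> borel_measurable (count_space UNIV \<Otimes>\<^sub>M circ)"
    proof (rule measurable_pair_measure_countable1)
      show "(\<lambda>y. f n (x, y)) \<in> borel_measurable circ" for x by (simp add: f_def)
    qed auto
    then show ?thesis using sets_eq by (simp cong: measurable_cong_sets)
  qed
  have f01: "f n z \<in> {0..1}" for n z
    using trunc_bounds[of "fst z" "\<sigma> n (snd z)"] by (auto simp: f_def field_simps)
  obtain G h where G: "\<And>k. G k \<in> midhull f k" and hm: "h \<in> borel_measurable (weights \<Otimes>\<^sub>M circ)"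
    and GL: "AE z in weights \<Otimes>\<^sub>M circ. (\<lambda>k. G k z) \<longlonglongrightarrow> h z"
    using midhull_AE_convergent[OF fin, of f] fm f01 by blast
  interpret W: pair_sigma_finite weights circ
    using finite_measure_weights finite_measure_circ
    by (simp add: finite_measure_def pair_sigma_finite_def)
  define g where "g k M x = (real M + 1) * G k (M, x)" for k M x
  define U where "U M x = (real M + 1) * h (M, x)" for M x
  have slice_m: "(\<lambda>x. w (M, x)) \<in> borel_measurable circ" if "w \<in> borel_measurable (weights \<Otimes>\<^sub>M circ)" for w :: "nat \<times> real \<Rightarrow> real" and M
    using measurable_compose[OF measurable_Pair1' that, of M] by simp
  have Um[measurable]: "U M \<in> borel_measurable circ" for M
    unfolding U_def[abs_def] using slice_m[OF hm, of M] by measurable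
  have gm: "g k M \<in> borel_measurable circ" for k M
    unfolding g_def[abs_def] using slice_m[of "G k" M] midhull_unit_interval[OF G fm f01] by auto
  have gb: "0 \<le> g k M x" "g k M x \<le> real M + 1" for k M x
    using midhull_unit_interval[OF G fm f01, of k] unfolding g_def
    by (auto intro!: mult_nonneg_nonneg mult_left_le)
  have gmono: "g k M x \<le> g k (Suc M) x" for k M x
  proof -
    have "\<forall>M x. (real M + 1) * w (M, x) \<le> (real (Suc M) + 1) * w (Suc M, x)" if "w \<in> midhull f k" for w
      using that
    proof induction
      case (base j)
      show ?case using trunc_mono by (auto simp: f_def)
    next
      case (mid w v)
      have "(real M + 1) * w (M, x) + (real M + 1) * v (M, x)
         \<le> (real (Suc M) + 1) * w (Suc M, x) + (real (Suc M) + 1) * v (Suc M, x)" for M x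
        by (rule add_mono) (use mid.IH in blast)+
      then have "((real M + 1) * w (M, x) + (real M + 1) * v (M, x)) / 2
         \<le> ((real (Suc M) + 1) * w (Suc M, x) + (real (Suc M) + 1) * v (Suc M, x)) / 2" for M x
        by (rule divide_right_mono) simp
      then show ?case by (simp only: times_divide_eq_right distrib_left) blast
    qed
    then show ?thesis using G[of k] unfolding g_def by blast
  qed
  have gL: "AE x in circ. \<forall>M. (\<lambda>k. g k M x) \<longlonglongrightarrow> U M x"
  proof -
    have "AE M in weights. AE x in circ. (\<lambda>k. G k (M, x)) \<longlonglongrightarrow> h (M, x)"
      using W.AE_pair[OF GL] by simp
    then have "AE x in circ. \<forall>M. (\<lambda>k. G k (M, x)) \<longlonglongrightarrow> h (M, x)"
      by (simp add: AE_weights AE_all_countable)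
    then show ?thesis
      by eventually_elim (auto simp: g_def U_def intro!: tendsto_intros)
  qed
  have Ub: "AE x in circ. \<forall>M. 0 \<le> U M x \<and> U M x \<le> real M + 1 \<and> U M x \<le> U (Suc M) x"
    using gL
  proof eventually_elim
    case (elim x)
    then have l: "\<And>M. (\<lambda>k. g k M x) \<longlonglongrightarrow> U M x" by blast
    show ?case using LIMSEQ_le_const[OF l] LIMSEQ_le_const2[OF l] LIMSEQ_le[OF l l] gb gmono by blast
  qed
  have Ui: "integrable circ (U M)" for M
    by (rule circ.integrable_const_bound[of _ "real M + 1"]) (use Ub in \<open>auto elim!: eventually_mono\<close>)
  \<comment> \<open>Distance of a coefficient from \<open>c M l\<close> is stable under averaging, so the averages inherit the limits.\<close>
  have hU: "hcoef (U M) l = c M l" for M l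
  proof -
    have "(\<lambda>k. hcoef (g k M) l) \<longlonglongrightarrow> hcoef (U M) l"
      unfolding hcoef_def
    proof (intro tendsto_intros integral_dominated_convergence[where w="\<lambda>_. (real M + 1) * 2"])
      show "AE x in circ. (\<lambda>k. g k M x * cas l x) \<longlonglongrightarrow> U M x * cas l x"
        using gL by eventually_elim (auto intro!: tendsto_intros)
      have "\<bar>g k M x\<bar> * \<bar>cas l x\<bar> \<le> (real M + 1) * 2" for k x
        by (rule mult_mono) (use gb cas_bound in auto)
      then show "AE x in circ. norm (g k M x * cas l x) \<le> (real M + 1) * 2" for k
        by (simp add: abs_mult)
    qed (use gm in auto)
    moreover have "(\<lambda>k. hcoef (g k M) l) \<longlonglongrightarrow> c M l"
    proof (rule LIMSEQ_I)
      fix e :: real assume e: "0 < e"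
      have "(\<lambda>n. hcoef (\<lambda>x. trunc M (\<sigma> n x)) l) \<longlonglongrightarrow> c M l" using c by (simp add: \<sigma>_def)
      then obtain N where N: "\<And>n. n \<ge> N \<Longrightarrow> \<bar>hcoef (\<lambda>x. trunc M (\<sigma> n x)) l - c M l\<bar> < e"
        using e unfolding LIMSEQ_iff by auto
      have "\<bar>hcoef (g k M) l - c M l\<bar> < e" if "k \<ge> N" for k
      proof -
        let ?P = "\<lambda>u. integrable circ u \<and> \<bar>hcoef u l - c M l\<bar> < e"
        have "?P (\<lambda>x. (real M + 1) * G k (M, x))"
        proof (rule midhull_slice_induct[OF G])
          show "?P (\<lambda>x. (real M + 1) * f j (M, x))" if "k \<le> j" for j
            unfolding f_slice using N[of j] \<open>k \<ge> N\<close> that ti by (auto simp: \<sigma>_def)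
        next
          fix u v assume uv: "?P u" "?P v"
          have "hcoef (\<lambda>x. (u x + v x) / 2) l = (hcoef u l + hcoef v l) / 2"
            using hcoef_cmult[of "1/2" "\<lambda>x. u x + v x" l] hcoef_add[of u v l] conjunct1[OF uv(1)] conjunct1[OF uv(2)] by simp
          moreover have "\<bar>hcoef u l - c M l\<bar> < e" "\<bar>hcoef v l - c M l\<bar> < e" using uv by auto
          then have "\<bar>(hcoef u l + hcoef v l) / 2 - c M l\<bar> < e" by argo
          ultimately show "?P (\<lambda>x. (u x + v x) / 2)" using uv by auto
        qed
        then show ?thesis by (simp add: g_def[abs_def])
      qed
      then show "\<exists>N. \<forall>k\<ge>N. norm (hcoef (g k M) l - c M l) < e" by auto
    qed
    ultimately show ?thesis by (rule LIMSEQ_unique)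
  qed
  \<comment> \<open>Cutting and averaging do not increase the entropy, and for bounded functions it passes to the limit.\<close>
  have psiU: "integrable circ (\<lambda>x. psi (U M x))" "(\<integral>x. psi (U M x) \<partial>circ) \<le> 2*pi * s" for M
  proof -
    have dom: "AE x in circ. norm (psi (g k M x)) \<le> 1 + (real M + 1)\<^sup>2" for k
      using psi_nonneg[OF gb(1)] psi_le_bound[OF gb] by (auto intro!: AE_I2)
    have cv: "AE x in circ. (\<lambda>k. psi (g k M x)) \<longlonglongrightarrow> psi (U M x)"
      using gL by eventually_elim (auto intro!: psi_tendsto gb)
    have pm: "(\<lambda>x. psi (g k M x)) \<in> borel_measurable circ" for k using gm by measurable
    show "integrable circ (\<lambda>x. psi (U M x))"
      by (rule integrable_dominated_convergence[OF _ pm _ cv dom]) auto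
    have L: "(\<lambda>k. \<integral>x. psi (g k M x) \<partial>circ) \<longlonglongrightarrow> (\<integral>x. psi (U M x) \<partial>circ)"
      by (rule integral_dominated_convergence[OF _ pm _ cv dom]) auto
    have "(\<integral>x. psi (U M x) \<partial>circ) \<le> 2*pi * (s + e)" if e: "0 < e" for e
    proof (rule LIMSEQ_le_const2[OF L])
      obtain N where N: "\<And>n. n \<ge> N \<Longrightarrow> entropy (\<sigma> n) < s + e"
        using order_tendstoD(2)[OF \<sigma>lim, of "s + e"] e by (auto simp: eventually_sequentially)
      have "(\<integral>x. psi (g k M x) \<partial>circ) \<le> 2*pi * (s + e)" if "k \<ge> N" for k
      proof -
        let ?P = "\<lambda>u. u \<in> borel_measurable circ \<and> (\<forall>x. 0 \<le> u x \<and> u x \<le> real M + 1) \<and> (\<integral>x. psi (u x) \<partial>circ) \<le> 2*pi * (s + e)"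
        have "?P (\<lambda>x. (real M + 1) * G k (M, x))"
        proof (rule midhull_slice_induct[OF G])
          fix j assume "k \<le> j"
          have pj: "integrable circ (\<lambda>x. psi (\<sigma> j x))" unfolding \<sigma>_def using integrable_psi_iff[OF \<rho>i] i by simp
          have "(\<integral>x. psi (trunc M (\<sigma> j x)) \<partial>circ) \<le> (\<integral>x. psi (\<sigma> j x) \<partial>circ)"
          proof (rule integral_mono_AE[OF bounded_integrable_psi pj])
            show "AE x in circ. psi (trunc M (\<sigma> j x)) \<le> psi (\<sigma> j x)"
              using nn[of "r j"] unfolding \<sigma>_def by eventually_elim (rule psi_trunc_le)
          qed (auto intro: trunc_bounds)
          also have "\<dots> = 2*pi*entropy (\<sigma> j)" unfolding \<sigma>_def entropy_psi[OF d i] by simp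
          also have "\<dots> \<le> 2*pi * (s + e)" using N[of j] \<open>k \<le> j\<close> \<open>k \<ge> N\<close> by (intro mult_left_mono) auto
          finally show "?P (\<lambda>x. (real M + 1) * f j (M, x))"
            by (simp only: f_slice') (auto simp: trunc_bounds)
        next
          fix u v assume u: "?P u" and v: "?P v"
          have iu: "integrable circ (\<lambda>x. psi (u x))" "integrable circ (\<lambda>x. psi (v x))"
            using u v bounded_integrable_psi[of _ "real M + 1"] by blast+
          have "(\<integral>x. psi ((u x + v x) / 2) \<partial>circ) \<le> (\<integral>x. (psi (u x) + psi (v x)) / 2 \<partial>circ)"
          proof (rule integral_mono[OF bounded_integrable_psi[where B="real M + 1"]])
            show "psi ((u x + v x) / 2) \<le> (psi (u x) + psi (v x)) / 2" for x
              using psi_convex[of "u x" "v x" "1/2"] u v by (simp add: field_simps)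
            show "0 \<le> (u x + v x) / 2" "(u x + v x) / 2 \<le> real M + 1" for x
              using u v by (auto simp: field_simps add_mono intro: order_trans[OF add_mono])
          qed (use u v iu in auto)
          also have "\<dots> \<le> 2*pi * (s + e)" using iu u v by simp
          finally have le: "(\<integral>x. psi ((u x + v x) / 2) \<partial>circ) \<le> 2*pi * (s + e)" .
          have bd: "0 \<le> (u x + v x) / 2 \<and> (u x + v x) / 2 \<le> real M + 1" for x
          proof -
            have "0 \<le> u x" "u x \<le> real M + 1" "0 \<le> v x" "v x \<le> real M + 1" using u v by auto
            then show ?thesis by simp
          qed
          have "u \<in> borel_measurable circ" "v \<in> borel_measurable circ" using u v by auto
          then have m: "(\<lambda>x. (u x + v x) / 2) \<in> borel_measurable circ" by measurable
          show "?P (\<lambda>x. (u x + v x) / 2)" by (rule conjI[OF m conjI[OF allI[OF bd] le]])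
        qed
        then show ?thesis unfolding g_def by (elim conjE)
      qed
      then show "\<exists>N. \<forall>n\<ge>N. (\<integral>x. psi (g n M x) \<partial>circ) \<le> 2*pi * (s + e)" by blast
    qed
    then have "(\<integral>x. psi (U M x) \<partial>circ) / (2*pi) \<le> 2*pi * (s + e) / (2*pi)" if "0 < e" for e
      using that by (intro divide_right_mono) auto
    then have "(\<integral>x. psi (U M x) \<partial>circ) / (2*pi) \<le> s + e" if "0 < e" for e
      using that by simp
    then have "(\<integral>x. psi (U M x) \<partial>circ) / (2*pi) \<le> s" by (rule field_le_epsilon)
    then show "(\<integral>x. psi (U M x) \<partial>circ) \<le> 2*pi * s" by (simp add: field_simps)
  qed
  \<comment> \<open>Bounded entropy bounds the tails uniformly in \<open>n\<close>, so no mass is lost when \<open>M\<close> tends to infinity.\<close>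
  obtain B where B: "\<And>n. entropy (\<rho> n) \<le> B" "0 \<le> B"
  proof -
    obtain K where K: "\<And>n. norm (entropy (\<rho> n)) \<le> K"
      using convergent_imp_Bseq[of "\<lambda>n. entropy (\<rho> n)"] lim by (auto simp: convergent_def Bseq_def)
    have "entropy (\<rho> n) \<le> \<bar>K\<bar>" for n
      using order_trans[OF abs_ge_self order_trans[OF K[of n, unfolded real_norm_def] abs_ge_self]] .
    then show thesis using that[of "\<bar>K\<bar>"] by simp
  qed
  define \<delta> where "\<delta> M = 2 * B / ln (real M + 1)" for M :: nat
  have \<delta>0: "\<delta> \<longlonglongrightarrow> 0"
  proof -
    have "filterlim (\<lambda>M. real M + 1) at_top sequentially"
      by (rule filterlim_at_top_mono[OF filterlim_real_sequentially]) simp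
    then have "filterlim (\<lambda>M. ln (real M + 1)) at_infinity sequentially"
      by (intro filterlim_at_top_imp_at_infinity filterlim_compose[OF ln_at_top])
    then show ?thesis unfolding \<delta>_def by (intro tendsto_divide_0[OF tendsto_const])
  qed
  have tail: "\<bar>hcoef (\<rho> n) l - hcoef (\<lambda>x. trunc M (\<rho> n x)) l\<bar> \<le> \<delta> M" if "1 \<le> M" for n l M
  proof -
    have lp: "0 < ln (real M + 1)" using that by simp
    have vi: "integrable circ (\<lambda>x. \<rho> n x - trunc M (\<rho> n x))" using \<rho>i ti by auto
    have "hcoef (\<rho> n) l - hcoef (\<lambda>x. trunc M (\<rho> n x)) l = hcoef (\<lambda>x. \<rho> n x - trunc M (\<rho> n x)) l"
      using hcoef_diff[OF \<rho>i ti] by simp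
    then have "\<bar>hcoef (\<rho> n) l - hcoef (\<lambda>x. trunc M (\<rho> n x)) l\<bar> \<le> 1/pi * (\<integral>x. \<bar>\<rho> n x - trunc M (\<rho> n x)\<bar> \<partial>circ)"
      using abs_hcoef_le[OF vi] by simp
    also have "\<dots> \<le> 1/pi * (2*pi*B / ln (real M + 1))"
    proof (rule mult_left_mono)
      have "(\<integral>x. \<bar>\<rho> n x - trunc M (\<rho> n x)\<bar> \<partial>circ) * ln (real M + 1) \<le> 2*pi*B"
        using order_trans[OF trunc_rest_mass[OF d i, of n M] mult_left_mono[OF B(1)[of n], of "2*pi"]] by simp
      then show "(\<integral>x. \<bar>\<rho> n x - trunc M (\<rho> n x)\<bar> \<partial>circ) \<le> 2*pi*B / ln (real M + 1)"
        using lp by (simp add: field_simps)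
    qed simp
    also have "\<dots> = \<delta> M" by (simp add: \<delta>_def)
    finally show ?thesis .
  qed
  have mass: "(\<integral>x. U M x \<partial>circ) = 2*pi * c M 0" for M
    using hU[of M 0] by (simp add: hcoef_def field_simps)
  have c1: "(\<lambda>M. c M 0) \<longlonglongrightarrow> 1"
  proof -
    have "\<bar>c M 0 - 1\<bar> \<le> \<delta> M" if "1 \<le> M" for M
    proof (rule LIMSEQ_le_const2)
      show "(\<lambda>n. \<bar>hcoef (\<lambda>x. trunc M (\<rho> (r n) x)) 0 - 1\<bar>) \<longlonglongrightarrow> \<bar>c M 0 - 1\<bar>" by (intro tendsto_intros c)
      show "\<exists>N. \<forall>n\<ge>N. \<bar>hcoef (\<lambda>x. trunc M (\<rho> (r n) x)) 0 - 1\<bar> \<le> \<delta> M"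
        using tail[OF that, of _ 0] prob_density_hcoef_0[OF d] by (auto simp: abs_minus_commute)
    qed
    then have "(\<lambda>M. c M 0 - 1) \<longlonglongrightarrow> 0"
      by (intro Lim_null_comparison[OF _ \<delta>0] eventually_sequentiallyI[of 1]) auto
    then show ?thesis by (simp add: LIM_zero_iff)
  qed
  define \<rho>' where "\<rho>' x = lim (\<lambda>M. U M x)" for x
  have \<rho>'m[measurable]: "\<rho>' \<in> borel_measurable circ" unfolding \<rho>'_def[abs_def] by measurable
  have inc: "AE x in circ. incseq (\<lambda>M. U M x)"
    using Ub by eventually_elim (auto intro: incseq_SucI)
  have conv: "AE x in circ. (\<lambda>M. U M x) \<longlonglongrightarrow> \<rho>' x"
  proof -
    have nnU: "(\<integral>\<^sup>+x. ennreal (U M x) \<partial>circ) \<le> ennreal (2*pi)" for M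
    proof -
      have "(\<integral>\<^sup>+x. ennreal (U M x) \<partial>circ) = ennreal (2*pi * c M 0)"
        using Ub by (subst nn_integral_eq_integral[OF Ui]) (auto simp: mass elim!: eventually_mono)
      also have "c M 0 \<le> 1"
      proof (rule LIMSEQ_le_const2[OF c])
        have "hcoef (\<lambda>x. trunc M (\<rho> n x)) 0 \<le> 1" for n
          using tmass[of M n] by (simp add: hcoef_def field_simps)
        then show "\<exists>N. \<forall>n\<ge>N. hcoef (\<lambda>x. trunc M (\<rho> (r n) x)) 0 \<le> 1" by blast
      qed
      then have "ennreal (2*pi * c M 0) \<le> ennreal (2*pi)" by (intro ennreal_leI) simp
      finally show ?thesis .
    qed
    have "(\<integral>\<^sup>+x. (SUP M. ennreal (U M x)) \<partial>circ) = (SUP M. \<integral>\<^sup>+x. ennreal (U M x) \<partial>circ)"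
      by (rule nn_integral_monotone_convergence_SUP_AE)
        (use Ub in \<open>auto elim!: eventually_mono intro: ennreal_leI\<close>)
    also have "\<dots> \<le> ennreal (2*pi)" by (rule SUP_least) (rule nnU)
    finally have "(\<integral>\<^sup>+x. (SUP M. ennreal (U M x)) \<partial>circ) \<noteq> \<infinity>" by (auto simp: top_unique)
    then have "AE x in circ. (SUP M. ennreal (U M x)) \<noteq> \<infinity>"
      by (intro nn_integral_PInf_AE) auto
    then show ?thesis using inc
    proof eventually_elim
      case (elim x)
      obtain b where b: "(SUP M. ennreal (U M x)) = ennreal b" "0 \<le> b"
        using elim(1) by (cases "SUP M. ennreal (U M x)") auto
      have "U M x \<le> b" for M
        using SUP_upper[of M UNIV "\<lambda>M. ennreal (U M x)"] b by simp
      then obtain l where "(\<lambda>M. U M x) \<longlonglongrightarrow> l" using incseq_convergent[OF elim(2)] by blast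
      then show ?case by (simp add: \<rho>'_def limI)
    qed
  qed
  have Ulim: "(\<lambda>M. \<integral>x. U M x \<partial>circ) \<longlonglongrightarrow> 2*pi"
  proof -
    have "(\<lambda>M. 2*pi * c M 0) \<longlonglongrightarrow> 2*pi * 1" by (intro tendsto_intros c1)
    then show ?thesis by (simp add: mass)
  qed
  have \<rho>'i: "integrable circ \<rho>'" and \<rho>'mass: "(\<integral>x. \<rho>' x \<partial>circ) = 2*pi"
    using integrable_monotone_convergence[OF Ui inc conv Ulim \<rho>'m]
      integral_monotone_convergence[OF Ui inc conv Ulim \<rho>'m] by auto
  have \<rho>'nn: "AE x in circ. 0 \<le> \<rho>' x" and U_le: "AE x in circ. \<forall>M. U M x \<le> \<rho>' x"
  proof -
    show "AE x in circ. 0 \<le> \<rho>' x"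
      using conv Ub by eventually_elim (auto intro: LIMSEQ_le_const)
    show "AE x in circ. \<forall>M. U M x \<le> \<rho>' x"
      using conv inc by eventually_elim (auto intro: incseq_le)
  qed
  have pd: "prob_density \<rho>'" using \<rho>'i \<rho>'nn \<rho>'mass by (simp add: prob_density_def)
  have psi': "integrable circ (\<lambda>x. psi (\<rho>' x))" "(\<integral>x. psi (\<rho>' x) \<partial>circ) \<le> 2*pi * s"
  proof -
    have s0: "0 \<le> 2*pi * s"
    proof (rule order_trans[OF _ psiU(2)[of 0]], rule integral_nonneg_AE)
      show "AE x in circ. 0 \<le> psi (U 0 x)" using Ub by eventually_elim (auto intro: psi_nonneg)
    qed
    have "(\<integral>\<^sup>+x. ennreal (psi (\<rho>' x)) \<partial>circ) = (\<integral>\<^sup>+x. liminf (\<lambda>M. ennreal (psi (U M x))) \<partial>circ)"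
    proof (rule nn_integral_cong_AE)
      show "AE x in circ. ennreal (psi (\<rho>' x)) = liminf (\<lambda>M. ennreal (psi (U M x)))"
        using conv Ub
      proof eventually_elim
        case (elim x)
        then have "(\<lambda>M. ennreal (psi (U M x))) \<longlonglongrightarrow> ennreal (psi (\<rho>' x))"
          by (intro tendsto_ennrealI psi_tendsto) auto
        from lim_imp_Liminf[OF _ this] show ?case by simp
      qed
    qed
    also have "\<dots> \<le> liminf (\<lambda>M. \<integral>\<^sup>+x. ennreal (psi (U M x)) \<partial>circ)" by (rule nn_integral_liminf) auto
    also have "\<dots> \<le> liminf (\<lambda>M::nat. ennreal (2*pi * s))"
    proof (rule Liminf_mono, intro always_eventually allI)
      fix M
      have "(\<integral>\<^sup>+x. ennreal (psi (U M x)) \<partial>circ) = ennreal (\<integral>x. psi (U M x) \<partial>circ)"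
        using Ub by (intro nn_integral_eq_integral psiU(1)) (auto elim!: eventually_mono intro: psi_nonneg)
      then show "(\<integral>\<^sup>+x. ennreal (psi (U M x)) \<partial>circ) \<le> ennreal (2*pi * s)"
        using psiU(2)[of M] by (simp add: ennreal_leI)
    qed
    finally have le: "(\<integral>\<^sup>+x. ennreal (psi (\<rho>' x)) \<partial>circ) \<le> ennreal (2*pi * s)" by (simp add: Liminf_const)
    have nnp: "AE x in circ. 0 \<le> psi (\<rho>' x)" using \<rho>'nn by eventually_elim (rule psi_nonneg)
    show ii: "integrable circ (\<lambda>x. psi (\<rho>' x))"
      by (rule integrableI_nonneg[OF _ nnp]) (use le in \<open>auto simp: order_le_less_trans\<close>)
    show "(\<integral>x. psi (\<rho>' x) \<partial>circ) \<le> 2*pi * s"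
      using le nn_integral_eq_integral[OF ii nnp] s0 by simp
  qed
  have i': "integrable circ (\<lambda>x. \<rho>' x * ln (\<rho>' x))" using integrable_psi_iff[OF \<rho>'i] psi'(1) by simp
  have "2*pi * entropy \<rho>' \<le> 2*pi * s" using psi'(2) entropy_psi[OF pd i'] by simp
  then have "entropy \<rho>' \<le> s" by simp
  moreover have "(\<lambda>n. hcoef (\<rho> (r n)) l) \<longlonglongrightarrow> hcoef \<rho>' l" for l
  proof (rule LIMSEQ_I)
    fix e :: real assume e: "0 < e"
    have "(\<lambda>M. hcoef (U M) l) \<longlonglongrightarrow> hcoef \<rho>' l"
      unfolding hcoef_def
    proof (intro tendsto_intros integral_dominated_convergence[where w="\<lambda>x. 2 * \<rho>' x"])
      show "AE x in circ. (\<lambda>M. U M x * cas l x) \<longlonglongrightarrow> \<rho>' x * cas l x"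
        using conv by eventually_elim (auto intro!: tendsto_intros)
      show "AE x in circ. norm (U M x * cas l x) \<le> 2 * \<rho>' x" for M
        using Ub U_le
      proof eventually_elim
        case (elim x)
        have "0 \<le> U M x" "U M x \<le> \<rho>' x" using elim by auto
        then have "\<bar>U M x\<bar> * \<bar>cas l x\<bar> \<le> \<rho>' x * 2" by (intro mult_mono cas_bound) auto
        then show ?case by (simp add: abs_mult)
      qed
    qed (use \<rho>'i in auto)
    then have "(\<lambda>M. c M l) \<longlonglongrightarrow> hcoef \<rho>' l" by (simp add: hU)
    then have "eventually (\<lambda>M. dist (c M l) (hcoef \<rho>' l) < e/3) sequentially" using e by (intro tendstoD) auto
    moreover have "eventually (\<lambda>M. \<delta> M < e/3) sequentially" using e by (intro order_tendstoD[OF \<delta>0]) auto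
    ultimately have "eventually (\<lambda>M. dist (c M l) (hcoef \<rho>' l) < e/3 \<and> \<delta> M < e/3 \<and> 1 \<le> M) sequentially"
      using eventually_ge_at_top[of 1] by eventually_elim auto
    then obtain M where M: "\<bar>c M l - hcoef \<rho>' l\<bar> < e/3" "\<delta> M < e/3" "1 \<le> M"
      by (auto simp: eventually_sequentially dist_real_def)
    obtain N where N: "\<And>n. n \<ge> N \<Longrightarrow> \<bar>hcoef (\<lambda>x. trunc M (\<rho> (r n) x)) l - c M l\<bar> < e/3"
      using LIMSEQ_D[OF c[of M l], of "e/3"] e by auto
    have "norm (hcoef (\<rho> (r n)) l - hcoef \<rho>' l) < e" if "n \<ge> N" for n
      using N[OF that] M tail[OF M(3), of "r n" l] unfolding real_norm_def by linarith
    then show "\<exists>N. \<forall>n\<ge>N. norm (hcoef (\<rho> (r n)) l - hcoef \<rho>' l) < e" by blast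
  qed
  moreover have "(\<lambda>n. hcoef (\<lambda>x. trunc M (\<rho> (r n) x)) l) \<longlonglongrightarrow> hcoef (U M) l" for M l
    using c[of M l] by (simp add: hU)
  ultimately show thesis using that[OF r(1) pd i' _ Um Ub conv] by blast
qed

section \<open>Existence of minimizers\<close>

definition finite_interaction :: "(real \<Rightarrow> real) \<Rightarrow> (real \<Rightarrow> real) \<Rightarrow> (real \<Rightarrow> real) \<Rightarrow> bool" where
  "finite_interaction W u r \<longleftrightarrow> integrable (circ \<Otimes>\<^sub>M circ) (\<lambda>(x, y). W (x - y) * u x * r y)"

lemma finite_interaction_sqint: "kernel_ok W \<Longrightarrow> sqint circ u \<Longrightarrow> integrable circ r \<Longrightarrow> finite_interaction W u r"
  unfolding finite_interaction_def by (rule interaction_integrable)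

lemma finite_interaction_swap:
  assumes "finite_interaction W u r" and W: "kernel_ok W"
  shows "finite_interaction W r u"
proof -
  have ev: "W (y - x) = W (x - y)" for x y using W by (metis kernel_ok_def minus_diff_eq)
  have "integrable (circ \<Otimes>\<^sub>M circ) (\<lambda>(x, y). W (y - x) * u y * r x)"
    using circ2.integrable_product_swap[OF assms(1)[unfolded finite_interaction_def]] by simp
  then show ?thesis by (simp add: finite_interaction_def ev mult.assoc mult.commute mult.left_commute)
qed

lemma finite_interaction_add_left:
  assumes "finite_interaction W u r" "finite_interaction W v r"
  shows "finite_interaction W (\<lambda>x. u x + v x) r" "interaction W (\<lambda>x. u x + v x) r = interaction W u r + interaction W v r"
proof -
  have e: "(\<lambda>(x, y). W (x - y) * (u x + v x) * r y)
    = (\<lambda>z. (case z of (x, y) \<Rightarrow> W (x - y) * u x * r y) + (case z of (x, y) \<Rightarrow> W (x - y) * v x * r y))"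
    by (auto simp: algebra_simps)
  show "finite_interaction W (\<lambda>x. u x + v x) r" "interaction W (\<lambda>x. u x + v x) r = interaction W u r + interaction W v r"
    using assms unfolding finite_interaction_def interaction_def e by (simp_all add: distrib_left)
qed

lemma finite_interaction_add_right:
  assumes "finite_interaction W u r" "finite_interaction W u s"
  shows "finite_interaction W u (\<lambda>x. r x + s x)" "interaction W u (\<lambda>x. r x + s x) = interaction W u r + interaction W u s"
proof -
  have e: "(\<lambda>(x, y). W (x - y) * u x * (r y + s y))
    = (\<lambda>z. (case z of (x, y) \<Rightarrow> W (x - y) * u x * r y) + (case z of (x, y) \<Rightarrow> W (x - y) * u x * s y))"
    by (auto simp: algebra_simps)
  show "finite_interaction W u (\<lambda>x. r x + s x)" "interaction W u (\<lambda>x. r x + s x) = interaction W u r + interaction W u s"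
    using assms unfolding finite_interaction_def interaction_def e by (simp_all add: distrib_left)
qed

lemma finite_interaction_cmult:
  assumes "finite_interaction W u r"
  shows "finite_interaction W (\<lambda>x. c * u x) (\<lambda>x. d * r x)" "interaction W (\<lambda>x. c * u x) (\<lambda>x. d * r x) = c * d * interaction W u r"
proof -
  have e: "(\<lambda>(x, y). W (x - y) * (c * u x) * (d * r y)) = (\<lambda>z. c * d * (case z of (x, y) \<Rightarrow> W (x - y) * u x * r y))"
    by (auto simp: algebra_simps)
  show "finite_interaction W (\<lambda>x. c * u x) (\<lambda>x. d * r x)" "interaction W (\<lambda>x. c * u x) (\<lambda>x. d * r x) = c * d * interaction W u r"
    using assms unfolding finite_interaction_def interaction_def e by simp_all
qed

text \<open>Both coordinate projections of the product pull null sets back to null sets.\<close>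

lemma AE_circ_product:
  assumes "AE x in circ. P x"
  shows "AE z in circ \<Otimes>\<^sub>M circ. P (fst z) \<and> P (snd z)"
proof -
  obtain N where N: "{x \<in> space circ. \<not> P x} \<subseteq> N" "emeasure circ N = 0" "N \<in> sets circ"
    using assms by (rule AE_E)
  let ?Z = "N \<times> space circ \<union> space circ \<times> N"
  have "N \<times> space circ \<in> null_sets (circ \<Otimes>\<^sub>M circ)" "space circ \<times> N \<in> null_sets (circ \<Otimes>\<^sub>M circ)"
    using N by (auto simp: null_sets_def circ.emeasure_pair_measure_Times simp del: space_circ)
  then have "?Z \<in> null_sets (circ \<Otimes>\<^sub>M circ)" by (rule null_sets.Un)
  then show ?thesis
    by (rule AE_I') (use N(1) in \<open>auto simp: space_pair_measure simp del: space_circ\<close>)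
qed

lemma interaction_AE_zero:
  assumes W: "kernel_ok W" and v: "v \<in> borel_measurable circ" and z: "AE x in circ. v x = 0"
  shows "interaction W v v = 0"
proof -
  have m: "(\<lambda>(x, y). W (x - y) * v x * v y) \<in> borel_measurable (circ \<Otimes>\<^sub>M circ)"
    using interaction_integrand_measurable[OF _ v v] W by (simp add: kernel_ok_def)
  have "(\<integral>z. (case z of (x, y) \<Rightarrow> W (x - y) * v x * v y) \<partial>(circ \<Otimes>\<^sub>M circ)) = (\<integral>z. 0 \<partial>(circ \<Otimes>\<^sub>M circ))"
    by (rule integral_cong_AE[OF m]) (use AE_circ_product[OF z] in \<open>auto elim!: eventually_mono\<close>)
  then show ?thesis by (simp add: interaction_def)
qed

text \<open>
  Convexity of \<open>psi\<close> between \<open>w\<close> and \<open>1\<close>, where \<open>psi\<close> vanishes. Mixing with the uniform density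
  makes a density strictly positive without increasing the entropy.
\<close>

lemma mix_Pac_plus:
  assumes w: "prob_density w" and i: "integrable circ (\<lambda>x. w x * ln (w x))" and t: "0 < t" "t \<le> 1"
  defines "\<sigma> \<equiv> \<lambda>x. (1 - t) * w x + t"
  shows "\<sigma> \<in> Pac_plus" "integrable circ (\<lambda>x. \<sigma> x * ln (\<sigma> x))" "entropy \<sigma> \<le> (1 - t) * entropy w"
proof -
  have wi: "integrable circ w" and nn: "AE x in circ. 0 \<le> w x" using w by (auto simp: prob_density_def)
  have [measurable]: "w \<in> borel_measurable circ" using wi by auto
  have \<sigma>i: "integrable circ \<sigma>" unfolding \<sigma>_def using wi by simp
  have mass: "(\<integral>x. \<sigma> x \<partial>circ) = 2*pi"
  proof -
    have "(\<integral>x. \<sigma> x \<partial>circ) = (1 - t) * (\<integral>x. w x \<partial>circ) + t * (2*pi)" unfolding \<sigma>_def using wi by simp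
    then show ?thesis unfolding prob_density_integral[OF w] by (simp add: left_diff_distrib)
  qed
  have pos: "AE x in circ. 0 < \<sigma> x"
    using nn unfolding \<sigma>_def by eventually_elim (use t in \<open>simp add: add_nonneg_pos\<close>)
  show P: "\<sigma> \<in> Pac_plus"
    using pos \<sigma>i mass by (auto simp: Pac_plus_def prob_density_def elim!: eventually_mono)
  have psw: "integrable circ (\<lambda>x. psi (w x))" using integrable_psi_iff[OF wi] i by simp
  have le: "AE x in circ. psi (\<sigma> x) \<le> (1 - t) * psi (w x)"
    using nn
  proof eventually_elim
    case (elim x)
    then show ?case using psi_convex[of "w x" 1 t] t by (simp add: \<sigma>_def)
  qed
  have ps: "integrable circ (\<lambda>x. psi (\<sigma> x))"
  proof (rule Bochner_Integration.integrable_bound)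
    show "integrable circ (\<lambda>x. (1 - t) * psi (w x))" using psw by simp
    show "(\<lambda>x. psi (\<sigma> x)) \<in> borel_measurable circ"
      by (rule measurable_compose[OF borel_measurable_integrable[OF \<sigma>i] psi_measurable])
    show "AE x in circ. norm (psi (\<sigma> x)) \<le> norm ((1 - t) * psi (w x))"
      using le pos
    proof eventually_elim
      case (elim x)
      then have "0 \<le> psi (\<sigma> x)" by (intro psi_nonneg) simp
      then show ?case using elim(1) unfolding real_norm_def by linarith
    qed
  qed
  then show ii: "integrable circ (\<lambda>x. \<sigma> x * ln (\<sigma> x))" using integrable_psi_iff[OF \<sigma>i] by simp
  have "(\<integral>x. psi (\<sigma> x) \<partial>circ) \<le> (\<integral>x. (1 - t) * psi (w x) \<partial>circ)"
    by (rule integral_mono_AE[OF ps _ le]) (use psw in simp)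
  then have "1 / (2*pi) * (\<integral>x. psi (\<sigma> x) \<partial>circ) \<le> 1 / (2*pi) * ((1 - t) * (\<integral>x. psi (w x) \<partial>circ))"
    by (intro mult_left_mono) auto
  then show "entropy \<sigma> \<le> (1 - t) * entropy w"
    using entropy_psi[OF Pac_plusD(1)[OF P] ii] entropy_psi[OF w i] by simp
qed

text \<open>The uniform part of the mixture interacts with nothing.\<close>

lemma mix_interaction:
  assumes W: "potential a W" and wi: "integrable circ w" and k: "finite_interaction W w w"
  shows "finite_interaction W (\<lambda>x. (1 - t) * w x + t) (\<lambda>x. (1 - t) * w x + t)"
    "interaction W (\<lambda>x. (1 - t) * w x + t) (\<lambda>x. (1 - t) * w x + t) = (1 - t)\<^sup>2 * interaction W w w"
proof -
  note Wk = potential_kernel_ok[OF W]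
  have m: "w \<in> borel_measurable circ" using wi by auto
  let ?c = "\<lambda>x::real. t * (1::real)" and ?w = "\<lambda>x. (1 - t) * w x"
  have c1: "finite_interaction W (\<lambda>_. 1) w" by (rule finite_interaction_sqint[OF Wk sqint_const wi])
  have c2: "finite_interaction W (\<lambda>_. 1) (\<lambda>_. 1)" by (rule finite_interaction_sqint[OF Wk sqint_const]) auto
  have c3: "finite_interaction W w (\<lambda>_. 1)" by (rule finite_interaction_swap[OF c1 Wk])
  have z1: "interaction W (\<lambda>_. 1) w = 0" by (rule interaction_uniform_left[OF W wi])
  have z2: "interaction W (\<lambda>_. 1) (\<lambda>_. 1) = 0" by (rule interaction_uniform_left[OF W]) auto
  have z3: "interaction W w (\<lambda>_. 1) = 0" using interaction_commute[OF Wk m, of "\<lambda>_. 1"] z1 by simp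
  have k1: "finite_interaction W ?w ?w" "interaction W ?w ?w = (1 - t)\<^sup>2 * interaction W w w"
    using finite_interaction_cmult[OF k, of "1 - t" "1 - t"] by (auto simp: power2_eq_square)
  have k2: "finite_interaction W ?w ?c" "interaction W ?w ?c = 0" using finite_interaction_cmult[OF c3, of "1 - t" t] z3 by auto
  have k3: "finite_interaction W ?c ?w" "interaction W ?c ?w = 0" using finite_interaction_cmult[OF c1, of t "1 - t"] z1 by auto
  have k4: "finite_interaction W ?c ?c" "interaction W ?c ?c = 0" using finite_interaction_cmult[OF c2, of t t] z2 by auto
  note r1 = finite_interaction_add_right[OF k1(1) k2(1)] and r2 = finite_interaction_add_right[OF k3(1) k4(1)]
  from finite_interaction_add_left[OF r1(1) r2(1)] r1(2) r2(2) k1 k2 k3 k4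
  show "finite_interaction W (\<lambda>x. (1 - t) * w x + t) (\<lambda>x. (1 - t) * w x + t)"
    "interaction W (\<lambda>x. (1 - t) * w x + t) (\<lambda>x. (1 - t) * w x + t) = (1 - t)\<^sup>2 * interaction W w w"
    by auto
qed

lemma mix_finite_energy:
  assumes W: "potential a W" and w: "prob_density w" and i: "integrable circ (\<lambda>x. w x * ln (w x))"
    and k: "finite_interaction W w w" and t: "0 < t" "t \<le> 1"
  shows "finite_energy W (\<lambda>x. (1 - t) * w x + t)"
  using mix_Pac_plus(1,2)[OF w i t] mix_interaction(1)[OF W _ k, of t] w
  by (simp add: finite_energy_def finite_interaction_def prob_density_def)

lemma finite_energyD:
  assumes "finite_energy W \<rho>"
  shows "prob_density \<rho>" "integrable circ \<rho>" "\<rho> \<in> borel_measurable circ" "AE x in circ. 0 < \<rho> x"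
    "integrable circ (\<lambda>x. \<rho> x * ln (\<rho> x))" "finite_interaction W \<rho> \<rho>" "\<rho> \<in> Pac_plus" "0 \<le> entropy \<rho>"
  using assms Pac_plusD[of \<rho>] entropy_nonneg[of \<rho>] by (auto simp: finite_energy_def finite_interaction_def)

lemma finite_interaction_rest:
  assumes W: "kernel_ok W" and \<rho>: "\<rho> \<in> borel_measurable circ" and k: "finite_interaction W \<rho> \<rho>"
  shows "finite_interaction W (\<lambda>x. \<rho> x - trunc M (\<rho> x)) (\<lambda>x. \<rho> x - trunc M (\<rho> x))"
  unfolding finite_interaction_def
proof (rule Bochner_Integration.integrable_bound[OF k[unfolded finite_interaction_def]])
  have v: "(\<lambda>x. \<rho> x - trunc M (\<rho> x)) \<in> borel_measurable circ" using \<rho> by measurable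
  show "(\<lambda>(x, y). W (x - y) * (\<rho> x - trunc M (\<rho> x)) * (\<rho> y - trunc M (\<rho> y))) \<in> borel_measurable (circ \<Otimes>\<^sub>M circ)"
    using interaction_integrand_measurable[OF _ v v] W by (simp add: kernel_ok_def)
  have "\<bar>W (x - y)\<bar> * \<bar>\<rho> x - trunc M (\<rho> x)\<bar> * \<bar>\<rho> y - trunc M (\<rho> y)\<bar> \<le> \<bar>W (x - y)\<bar> * \<bar>\<rho> x\<bar> * \<bar>\<rho> y\<bar>" for x y
    by (intro mult_mono trunc_rest_abs) auto
  then show "AE z in circ \<Otimes>\<^sub>M circ. norm (case z of (x, y) \<Rightarrow> W (x - y) * (\<rho> x - trunc M (\<rho> x)) * (\<rho> y - trunc M (\<rho> y)))
    \<le> norm (case z of (x, y) \<Rightarrow> W (x - y) * \<rho> x * \<rho> y)"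
    by (intro AE_I2) (auto simp: abs_mult)
qed

text \<open>
  Let \<open>v\<close> be the part of \<open>\<rho>\<close> above the level, of mass \<open>m\<close>. The density \<open>v / m\<close>, mixed half and
  half with the uniform density to make it positive, has interaction of order \<open>1 / m\<^sup>2\<close> times that
  of \<open>v\<close>, but entropy of order \<open>1 / m\<close> only, because \<open>v \<le> \<rho>\<close>. The lower bound of the energy
  compares the two and leaves a bound of order \<open>m\<close>. It is one-sided: only a large positive
  interaction could spoil upper semicontinuity.
\<close>

lemma rest_interaction_bound:
  fixes M :: nat
  assumes W: "potential a W" and \<kappa>: "0 < \<kappa>" and C: "0 \<le> C" "\<And>\<sigma>. finite_energy W \<sigma> \<Longrightarrow> - C \<le> energy W \<kappa> \<sigma>"
    and \<rho>: "finite_energy W \<rho>" "entropy \<rho> \<le> B"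
  defines "v \<equiv> \<lambda>x. \<rho> x - trunc M (\<rho> x)"
  defines "m \<equiv> 1 / (2*pi) * (\<integral>x. \<bar>v x\<bar> \<partial>circ)"
  shows "interaction W v v \<le> 4 / \<kappa> * (B + 2 + 2 * C) * m"
proof -
  note Wk = potential_kernel_ok[OF W] and R = finite_energyD[OF \<rho>(1)]
  have [measurable]: "\<rho> \<in> borel_measurable circ" by (rule R)
  have vm[measurable]: "v \<in> borel_measurable circ" unfolding v_def by measurable
  have vi: "integrable circ v" unfolding v_def
    by (rule Bochner_Integration.integrable_bound[OF R(2)]) (auto simp: trunc_rest_abs)
  have vb: "AE x in circ. 0 \<le> v x \<and> v x \<le> \<rho> x"
    using R(4) unfolding v_def by eventually_elim (use trunc_le trunc_bounds in auto)
  have B: "0 \<le> B" using R(8) \<rho>(2) by linarith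
  have m0: "0 \<le> m" unfolding m_def by (intro mult_nonneg_nonneg integral_nonneg_AE) auto
  have vmass: "(\<integral>x. v x \<partial>circ) = 2*pi * m"
  proof -
    have "(\<integral>x. v x \<partial>circ) = (\<integral>x. \<bar>v x\<bar> \<partial>circ)"
      by (rule integral_cong_AE) (use vb in \<open>auto elim!: eventually_mono\<close>)
    then show ?thesis by (simp add: m_def)
  qed
  have m1: "m \<le> 1"
  proof -
    have "(\<integral>x. v x \<partial>circ) \<le> (\<integral>x. \<rho> x \<partial>circ)"
      by (rule integral_mono_AE[OF vi R(2)]) (use vb in \<open>auto elim!: eventually_mono\<close>)
    then have "2*pi * m \<le> 2*pi * 1" using prob_density_integral[OF R(1)] vmass by simp
    then show ?thesis by simp
  qed
  have kv: "finite_interaction W v v" unfolding v_def by (rule finite_interaction_rest[OF Wk R(3) R(6)])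
  show ?thesis
  proof (cases "m = 0")
    case True
    then have "(\<integral>x. \<bar>v x\<bar> \<partial>circ) = 0" by (simp add: m_def)
    then have "AE x in circ. \<bar>v x\<bar> = 0"
      using integral_nonneg_eq_0_iff_AE[OF integrable_abs[OF vi]] by simp
    then have "AE x in circ. v x = 0" by simp
    from interaction_AE_zero[OF Wk vm this] True show ?thesis by simp
  next
    case False
    then have mp: "0 < m" using m0 by simp
    define w where "w x = 1 / m * v x" for x
    have wpd: "prob_density w"
      unfolding prob_density_def w_def
      using vi vmass mp vb by (auto elim!: eventually_mono)
    have wi: "integrable circ w" unfolding w_def[abs_def] using vi by simp
    have psw: "AE x in circ. 0 \<le> psi (w x) \<and> psi (w x) \<le> (psi (\<rho> x) + \<rho> x) / m + (ln (1 / m) - 1) * w x + 1"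
      using vb
    proof eventually_elim
      case (elim x)
      then have v: "0 \<le> v x" "v x \<le> \<rho> x" by auto
      have a: "v x * ln (v x) \<le> psi (\<rho> x) + \<rho> x"
      proof (cases "v x \<le> 1")
        case True
        then have "v x * ln (v x) \<le> 0" using v by (cases "v x = 0") (auto intro!: mult_nonneg_nonpos)
        also have "0 \<le> psi (\<rho> x) + \<rho> x" using v psi_nonneg[of "\<rho> x"] by linarith
        finally show ?thesis .
      next
        case False
        then have "v x * ln (v x) \<le> \<rho> x * ln (\<rho> x)" using v by (intro mult_mono) auto
        then show ?thesis by (simp add: psi_def)
      qed
      have "psi (w x) = v x * ln (v x) / m + (ln (1 / m) - 1) * w x + 1"
        using mp v by (cases "v x = 0") (auto simp: psi_def w_def ln_div field_simps)
      also have "v x * ln (v x) / m \<le> (psi (\<rho> x) + \<rho> x) / m" using a mp by (intro divide_right_mono) auto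
      finally show ?case using psi_nonneg[of "w x"] v mp by (simp add: w_def)
    qed
    have ub: "integrable circ (\<lambda>x. (psi (\<rho> x) + \<rho> x) / m + (ln (1 / m) - 1) * w x + 1)"
      using R(2) integrable_psi_iff[OF R(2)] R(5) wi by simp
    have psi_i: "integrable circ (\<lambda>x. psi (w x))"
    proof (rule Bochner_Integration.integrable_bound[OF ub])
      show "(\<lambda>x. psi (w x)) \<in> borel_measurable circ"
        by (rule measurable_compose[OF borel_measurable_integrable[OF wi] psi_measurable])
      show "AE x in circ. norm (psi (w x)) \<le> norm ((psi (\<rho> x) + \<rho> x) / m + (ln (1 / m) - 1) * w x + 1)"
        using psw unfolding real_norm_def by eventually_elim linarith
    qed
    then have wlog: "integrable circ (\<lambda>x. w x * ln (w x))" using integrable_psi_iff[OF wi] by simp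
    have wmass: "(\<integral>x. w x \<partial>circ) = 2*pi" using prob_density_integral[OF wpd] .
    have "(\<integral>x. psi (w x) \<partial>circ) \<le> (\<integral>x. (psi (\<rho> x) + \<rho> x) / m + (ln (1 / m) - 1) * w x + 1 \<partial>circ)"
      by (rule integral_mono_AE[OF psi_i ub]) (use psw in \<open>auto elim!: eventually_mono\<close>)
    also have "\<dots> = ((\<integral>x. psi (\<rho> x) \<partial>circ) + (\<integral>x. \<rho> x \<partial>circ)) / m + (ln (1 / m) - 1) * (\<integral>x. w x \<partial>circ) + 2*pi"
      using R(2) integrable_psi_iff[OF R(2)] R(5) wi by simp
    also have "\<dots> = 2*pi * ((entropy \<rho> + 1) / m + ln (1 / m))"
      using entropy_psi[OF R(1,5)] prob_density_integral[OF R(1)] by (simp add: wmass field_simps)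
    finally have "1 / (2*pi) * (\<integral>x. psi (w x) \<partial>circ) \<le> 1 / (2*pi) * (2*pi * ((entropy \<rho> + 1) / m + ln (1 / m)))"
      by (rule mult_left_mono) simp
    then have "entropy w \<le> (entropy \<rho> + 1) / m + ln (1 / m)"
      unfolding entropy_psi[OF wpd wlog] by simp
    moreover have "ln (1 / m) \<le> 1 / m" using ln_le_minus_one[of "1 / m"] mp by simp
    moreover have "(entropy \<rho> + 1) / m \<le> (B + 1) / m" using \<rho>(2) mp by (intro divide_right_mono) auto
    ultimately have entw: "entropy w \<le> (B + 2) / m" by (simp add: add_divide_distrib)
    have kw: "finite_interaction W w w" and Iw: "interaction W w w = 1 / m\<^sup>2 * interaction W v v"
      using finite_interaction_cmult[OF kv, of "1/m" "1/m"] unfolding w_def[abs_def] by (auto simp: power2_eq_square)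
    \<comment> \<open>\<open>w\<close> vanishes where \<open>\<rho>\<close> is below the level, and lower bounds are known for positive densities only.\<close>
    define \<sigma> where "\<sigma> x = (1 - 1/2) * w x + 1/2" for x
    have f\<sigma>: "finite_energy W \<sigma>" unfolding \<sigma>_def[abs_def] by (rule mix_finite_energy[OF W wpd wlog kw]) auto
    have e\<sigma>: "entropy \<sigma> \<le> 1/2 * entropy w" using mix_Pac_plus(3)[OF wpd wlog, of "1/2"] unfolding \<sigma>_def[abs_def] by simp
    have I\<sigma>: "interaction W \<sigma> \<sigma> = 1/4 * (1 / m\<^sup>2 * interaction W v v)"
      using mix_interaction(2)[OF W wi kw, of "1/2"] Iw unfolding \<sigma>_def[abs_def] by (simp add: power2_eq_square)
    have "\<kappa> / 2 * interaction W \<sigma> \<sigma> \<le> 1/2 * ((B + 2) / m) + C"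
      using C(2)[OF f\<sigma>] e\<sigma> entw unfolding energy_def by linarith
    then have "8 * m\<^sup>2 / \<kappa> * (\<kappa> / 2 * interaction W \<sigma> \<sigma>) \<le> 8 * m\<^sup>2 / \<kappa> * (1/2 * ((B + 2) / m) + C)"
      using \<kappa> by (intro mult_left_mono) auto
    also have "8 * m\<^sup>2 / \<kappa> * (\<kappa> / 2 * interaction W \<sigma> \<sigma>) = interaction W v v"
      using \<kappa> mp by (simp add: I\<sigma>)
    also have "8 * m\<^sup>2 / \<kappa> * (1/2 * ((B + 2) / m) + C) = 4 / \<kappa> * ((B + 2) + 2 * C * m) * m"
      using \<kappa> mp by (simp add: field_simps power2_eq_square)
    also have "\<dots> \<le> 4 / \<kappa> * ((B + 2) + 2 * C) * m"
      using \<kappa> mp m1 C(1) by (intro mult_right_mono mult_left_mono add_left_mono) (auto simp: mult_left_le)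
    finally show ?thesis by simp
  qed
qed

text \<open>
  A truncated interaction sum involves finitely many coefficients and converges; the truncation
  error is uniform because \<open>u n\<close> is bounded and \<open>r n\<close> is bounded in \<open>L\<^sup>1\<close>.
\<close>

lemma interaction_weak_limit:
  assumes W: "potential a W"
    and u: "\<And>n. u n \<in> borel_measurable circ" "\<And>n x. \<bar>u n x\<bar> \<le> K"
    and r: "\<And>n. integrable circ (r n)" "\<And>n. (\<integral>x. \<bar>r n x\<bar> \<partial>circ) \<le> R"
    and u': "sqint circ u'" and r': "integrable circ r'"
    and hu: "\<And>l. (\<lambda>n. hcoef (u n) l) \<longlonglongrightarrow> hcoef u' l" and hr: "\<And>l. (\<lambda>n. hcoef (r n) l) \<longlonglongrightarrow> hcoef r' l"
  shows "(\<lambda>n. interaction W (u n) (r n)) \<longlonglongrightarrow> interaction W u' r'"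
proof (rule LIMSEQ_I)
  fix e :: real assume e: "0 < e"
  note Wk = potential_kernel_ok[OF W]
  have us: "sqint circ (u n)" for n by (rule sqint_bounded[where B=K, OF _ u(1)]) (use u(2) in auto)
  have K: "0 \<le> K" by (rule order_trans[OF abs_ge_zero u(2)])
  have R: "0 \<le> R" by (rule order_trans[OF integral_nonneg_AE r(2)]) auto
  define K' where "K' = sqrt (2*pi) * K"
  have un: "L2norm (u n) \<le> K'" for n
  proof -
    have "(\<integral>x. (u n x)\<^sup>2 \<partial>circ) \<le> (\<integral>x. K\<^sup>2 \<partial>circ)"
    proof (rule integral_mono[OF sqint_square[OF us]])
      show "(u n x)\<^sup>2 \<le> K\<^sup>2" for x using power_mono[OF u(2)[of n x] abs_ge_zero, of 2] by simp
    qed simp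
    then have "L2norm (u n) \<le> sqrt (2*pi * K\<^sup>2)" unfolding L2norm_def by (intro real_sqrt_le_mono) simp
    then show ?thesis using K by (simp add: K'_def real_sqrt_mult)
  qed
  define \<tau> where "\<tau> N = L2norm (\<lambda>x. W x - trunc_kernel a N x)" for N
  have \<tau>0: "0 \<le> \<tau> N" for N unfolding \<tau>_def L2norm_def by (intro real_sqrt_ge_zero integral_nonneg_AE) auto
  have \<tau>: "\<tau> \<longlonglongrightarrow> 0" unfolding \<tau>_def by (rule potential_trunc_limit[OF W])
  have "(\<lambda>N. 1 / (4*pi\<^sup>2) * (\<tau> N * K' * R)) \<longlonglongrightarrow> 1 / (4*pi\<^sup>2) * (0 * K' * R)" by (intro tendsto_intros \<tau>)
  then have "(\<lambda>N. 1 / (4*pi\<^sup>2) * (\<tau> N * K' * R)) \<longlonglongrightarrow> 0" by (simp only: mult_zero_left mult_zero_right)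
  from order_tendstoD(2)[OF this, of "e/3"]
  have "eventually (\<lambda>N. 1 / (4*pi\<^sup>2) * (\<tau> N * K' * R) < e/3) sequentially"
    using e by simp
  moreover have "eventually (\<lambda>N. dist (interaction_sum a N u' r') (interaction W u' r') < e/3) sequentially"
    using e by (intro tendstoD[OF interaction_sum_limit[OF W u' r']]) auto
  ultimately have "eventually (\<lambda>N. 1 / (4*pi\<^sup>2) * (\<tau> N * K' * R) < e/3 \<and> dist (interaction_sum a N u' r') (interaction W u' r') < e/3) sequentially"
    by eventually_elim simp
  then obtain N where N: "1 / (4*pi\<^sup>2) * (\<tau> N * K' * R) < e/3" "\<bar>interaction_sum a N u' r' - interaction W u' r'\<bar> < e/3"
    by (auto simp: eventually_sequentially dist_real_def)
  have qN: "(\<lambda>n. interaction_sum a N (u n) (r n)) \<longlonglongrightarrow> interaction_sum a N u' r'"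
    unfolding interaction_sum_def by (intro tendsto_intros hu hr)
  from LIMSEQ_D[OF qN, of "e/3"] e
  obtain n0 where n0: "\<forall>n\<ge>n0. norm (interaction_sum a N (u n) (r n) - interaction_sum a N u' r') < e/3" by auto
  have "norm (interaction W (u n) (r n) - interaction W u' r') < e" if "n \<ge> n0" for n
  proof -
    have "\<bar>interaction W (u n) (r n) - interaction_sum a N (u n) (r n)\<bar> \<le> 1 / (4*pi\<^sup>2) * (\<tau> N * L2norm (u n) * (\<integral>x. \<bar>r n x\<bar> \<partial>circ))"
      unfolding \<tau>_def by (rule interaction_sum_error[OF Wk us r(1)])
    also have "\<dots> \<le> 1 / (4*pi\<^sup>2) * (\<tau> N * K' * R)"
      using un[of n] r(2)[of n] \<tau>0[of N] R
      by (intro mult_left_mono mult_mono) (auto simp: K'_def K intro!: mult_nonneg_nonneg integral_nonneg_AE)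
    finally show ?thesis using N n0[rule_format, OF that] unfolding real_norm_def by linarith
  qed
  then show "\<exists>n0. \<forall>n\<ge>n0. norm (interaction W (u n) (r n) - interaction W u' r') < e" by blast
qed

text \<open>
  With \<open>\<rho> n = u + v\<close> cut at a level, symmetry of the form gives
  \<open>Q (\<rho> n) = interaction u (\<rho> n + v) + interaction v v\<close>. The first term has a bounded argument and
  passes to the limit; the second is at most of the order of the mass of \<open>v\<close>, hence small
  uniformly in \<open>n\<close>. It remains to let the level tend to infinity in the limit, where tameness
  controls the positive part of the integrand, and the lower bound just obtained the negative
  part.
\<close>

theorem interaction_upper_semicontinuous:
  fixes \<rho> :: "nat \<Rightarrow> real \<Rightarrow> real" and U :: "nat \<Rightarrow> real \<Rightarrow> real"
  assumes W: "potential a W" and tame: "tame W" and \<kappa>: "0 < \<kappa>"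
    and C: "0 \<le> C" "\<And>\<sigma>. finite_energy W \<sigma> \<Longrightarrow> - C \<le> energy W \<kappa> \<sigma>"
    and \<rho>: "\<And>n. finite_energy W (\<rho> n)" "\<And>n. entropy (\<rho> n) \<le> B" and q: "(\<lambda>n. interaction W (\<rho> n) (\<rho> n)) \<longlonglongrightarrow> q"
    and \<rho>': "prob_density \<rho>'" "integrable circ (\<lambda>x. \<rho>' x * ln (\<rho>' x))"
    and Um: "\<And>M. U M \<in> borel_measurable circ"
    and Ub: "AE x in circ. \<forall>M. 0 \<le> U M x \<and> U M x \<le> real M + 1 \<and> U M x \<le> U (Suc M) x"
    and conv: "AE x in circ. (\<lambda>M. U M x) \<longlonglongrightarrow> \<rho>' x"
    and hU: "\<And>M l. (\<lambda>n. hcoef (\<lambda>x. trunc M (\<rho> n x)) l) \<longlonglongrightarrow> hcoef (U M) l"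
    and h\<rho>: "\<And>l. (\<lambda>n. hcoef (\<rho> n) l) \<longlonglongrightarrow> hcoef \<rho>' l"
  shows "finite_interaction W \<rho>' \<rho>'" "q \<le> interaction W \<rho>' \<rho>'"
proof -
  note Wk = potential_kernel_ok[OF W] and R = finite_energyD[OF \<rho>(1)]
  have Wm: "W \<in> borel_measurable borel" using Wk by (simp add: kernel_ok_def)
  have \<rho>m[measurable]: "\<rho> n \<in> borel_measurable circ" for n by (rule R)
  note Um[measurable]
  have \<rho>'i: "integrable circ \<rho>'" and nn: "AE x in circ. 0 \<le> \<rho>' x" using \<rho>'(1) by (auto simp: prob_density_def)
  have [measurable]: "\<rho>' \<in> borel_measurable circ" using \<rho>'i by auto
  have Us: "sqint circ (U M)" for M
    by (rule sqint_bounded[of _ _ "real M + 1"]) (use Ub in \<open>auto elim!: eventually_mono\<close>)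
  define V where "V M x = \<rho>' x - U M x" for M x
  have Vi: "integrable circ (V M)" for M unfolding V_def[abs_def] using \<rho>'i L2_integrable[OF Us] by auto
  have Vm[measurable]: "V M \<in> borel_measurable circ" for M using Vi by auto
  have Vb: "AE x in circ. \<forall>M. 0 \<le> V M x \<and> V M x \<le> \<rho>' x"
    using Ub conv
  proof eventually_elim
    case (elim x)
    then have "incseq (\<lambda>M. U M x)" by (auto intro: incseq_SucI)
    then have "U M x \<le> \<rho>' x" for M using incseq_le[of "\<lambda>M. U M x" "\<rho>' x" M] elim by blast
    then show ?case using elim by (simp add: V_def)
  qed
  \<comment> \<open>The bounded part \<open>u\<close> takes one slot of the form, so that only \<open>interaction W v v\<close> is left over.\<close>
  define u where "u M n x = trunc M (\<rho> n x)" for M n x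
  define v where "v M n x = \<rho> n x - u M n x" for M n x
  have um[measurable]: "u M n \<in> borel_measurable circ" for M n unfolding u_def by measurable
  have us: "sqint circ (u M n)" for M n
    by (rule sqint_bounded[of _ _ "real M + 1"]) (auto simp: u_def trunc_bounds)
  have vabs: "\<bar>v M n x\<bar> \<le> \<bar>\<rho> n x\<bar>" for M n x unfolding v_def u_def by (rule trunc_rest_abs)
  have vm: "v M n \<in> borel_measurable circ" for M n unfolding v_def[abs_def] by measurable
  have vi: "integrable circ (v M n)" for M n
    by (rule Bochner_Integration.integrable_bound[OF R(2)[of n] vm]) (auto simp: vabs)
  have \<rho>L1: "(\<integral>x. \<bar>\<rho> n x\<bar> \<partial>circ) = 2*pi" for n
  proof -
    have "(\<integral>x. \<bar>\<rho> n x\<bar> \<partial>circ) = (\<integral>x. \<rho> n x \<partial>circ)"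
      by (rule integral_cong_AE) (use R(4)[of n] in \<open>auto elim!: eventually_mono\<close>)
    then show ?thesis using prob_density_integral[OF R(1)] by simp
  qed
  have vL1: "(\<integral>x. \<bar>v M n x\<bar> \<partial>circ) \<le> 2*pi" for M n
  proof -
    have "(\<integral>x. \<bar>v M n x\<bar> \<partial>circ) \<le> (\<integral>x. \<bar>\<rho> n x\<bar> \<partial>circ)"
      by (rule integral_mono) (use vabs vi R(2) in auto)
    then show ?thesis using \<rho>L1 by simp
  qed
  have split: "interaction W (\<rho> n) (\<rho> n) = interaction W (u M n) (\<lambda>x. \<rho> n x + v M n x) + interaction W (v M n) (v M n)" for M n
  proof -
    have k1: "finite_interaction W (u M n) (\<rho> n)" by (rule finite_interaction_sqint[OF Wk us R(2)])
    have k2: "finite_interaction W (u M n) (v M n)" by (rule finite_interaction_sqint[OF Wk us vi])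
    have k3: "finite_interaction W (v M n) (u M n)" by (rule finite_interaction_swap[OF k2 Wk])
    have k4: "finite_interaction W (v M n) (v M n)" unfolding v_def[abs_def] u_def by (rule finite_interaction_rest[OF Wk R(3) R(6)])
    have e: "(\<lambda>x. u M n x + v M n x) = \<rho> n" by (simp add: v_def)
    have "interaction W (v M n) (\<rho> n) = interaction W (v M n) (u M n) + interaction W (v M n) (v M n)"
      using finite_interaction_add_right[OF k3 k4] by (simp add: e)
    moreover have "interaction W (\<rho> n) (\<rho> n) = interaction W (u M n) (\<rho> n) + interaction W (v M n) (\<rho> n)"
      using finite_interaction_add_left[OF k1, of "v M n"] finite_interaction_add_right(1)[OF k3 k4] by (simp add: e)
    moreover have "interaction W (v M n) (u M n) = interaction W (u M n) (v M n)"
      by (rule interaction_commute[OF Wk vm um])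
    ultimately show ?thesis using finite_interaction_add_right[OF k1 k2] by simp
  qed
  define D where "D M = interaction W (U M) (\<lambda>x. \<rho>' x + V M x)" for M
  have lim: "(\<lambda>n. interaction W (u M n) (\<lambda>x. \<rho> n x + v M n x)) \<longlonglongrightarrow> D M" for M
    unfolding D_def
  proof (rule interaction_weak_limit[OF W um _ _ _ Us])
    show "\<bar>u M n x\<bar> \<le> real M + 1" for n x by (simp add: u_def trunc_bounds)
    show "integrable circ (\<lambda>x. \<rho> n x + v M n x)" for n using R(2) vi by auto
    show "(\<integral>x. \<bar>\<rho> n x + v M n x\<bar> \<partial>circ) \<le> 4*pi" for n
    proof -
      have "(\<integral>x. \<bar>\<rho> n x + v M n x\<bar> \<partial>circ) \<le> (\<integral>x. \<bar>\<rho> n x\<bar> + \<bar>v M n x\<bar> \<partial>circ)"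
        by (rule integral_mono) (use R(2) vi abs_triangle_ineq in auto)
      also have "\<dots> = (\<integral>x. \<bar>\<rho> n x\<bar> \<partial>circ) + (\<integral>x. \<bar>v M n x\<bar> \<partial>circ)"
        using R(2) vi by (intro Bochner_Integration.integral_add) auto
      finally show ?thesis using \<rho>L1[of n] vL1[of M n] by linarith
    qed
    show "integrable circ (\<lambda>x. \<rho>' x + V M x)" using \<rho>'i Vi by auto
    show hu: "(\<lambda>n. hcoef (u M n) l) \<longlonglongrightarrow> hcoef (U M) l" for l unfolding u_def by (rule hU)
    show "(\<lambda>n. hcoef (\<lambda>x. \<rho> n x + v M n x) l) \<longlonglongrightarrow> hcoef (\<lambda>x. \<rho>' x + V M x) l" for l
    proof -
      have "hcoef (\<lambda>x. \<rho> n x + v M n x) l = hcoef (\<rho> n) l + (hcoef (\<rho> n) l - hcoef (u M n) l)" for n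
      proof -
        have "hcoef (v M n) l = hcoef (\<rho> n) l - hcoef (u M n) l"
          unfolding v_def[abs_def] by (rule hcoef_diff[OF R(2) L2_integrable[OF us]])
        then show ?thesis by (subst hcoef_add[OF R(2) vi]) simp
      qed
      moreover have "hcoef (\<lambda>x. \<rho>' x + V M x) l = hcoef \<rho>' l + (hcoef \<rho>' l - hcoef (U M) l)"
      proof -
        have "hcoef (V M) l = hcoef \<rho>' l - hcoef (U M) l"
          unfolding V_def[abs_def] by (rule hcoef_diff[OF \<rho>'i L2_integrable[OF Us]])
        then show ?thesis by (subst hcoef_add[OF \<rho>'i Vi]) simp
      qed
      ultimately show ?thesis using h\<rho> hu by (auto intro!: tendsto_intros)
    qed
  qed
  define K where "K = 4 / \<kappa> * (B + 2 + 2 * C) * B"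
  have B: "0 \<le> B" using R(8)[of 0] \<rho>(2)[of 0] by linarith
  have qD: "q - K / ln (real M + 1) \<le> D M" if M: "1 \<le> M" for M
  proof -
    have lp: "0 < ln (real M + 1)" using M by simp
    have "interaction W (v M n) (v M n) \<le> K / ln (real M + 1)" for n
    proof -
      let ?m = "1 / (2*pi) * (\<integral>x. \<bar>v M n x\<bar> \<partial>circ)"
      have "(\<integral>x. \<bar>v M n x\<bar> \<partial>circ) * ln (real M + 1) \<le> 2*pi * entropy (\<rho> n)"
        unfolding v_def u_def by (rule trunc_rest_mass[OF R(1) R(5)])
      also have "\<dots> \<le> 2*pi * B" using \<rho>(2) by (intro mult_left_mono) auto
      finally have "?m \<le> B / ln (real M + 1)" using lp by (simp add: field_simps)
      then have "4 / \<kappa> * (B + 2 + 2 * C) * ?m \<le> 4 / \<kappa> * (B + 2 + 2 * C) * (B / ln (real M + 1))"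
        using \<kappa> B C(1) by (intro mult_left_mono) auto
      then show ?thesis using rest_interaction_bound[OF W \<kappa> C \<rho>(1)[of n] \<rho>(2)[of n], of M]
        by (simp add: v_def[abs_def] u_def K_def)
    qed
    then have "interaction W (\<rho> n) (\<rho> n) - K / ln (real M + 1) \<le> interaction W (u M n) (\<lambda>x. \<rho> n x + v M n x)" for n
      using split[of n M] by (simp add: algebra_simps)
    then show ?thesis by (intro LIMSEQ_le[OF tendsto_diff[OF q tendsto_const] lim]) auto
  qed
  \<comment> \<open>\<open>T M\<close> increases to \<open>\<rho>' x * \<rho>' y\<close>, and its integral against \<open>W\<close> is \<open>D M\<close> up to the factor
     \<open>4 * pi\<^sup>2\<close>. The positive part \<open>P\<close> is integrable by tameness, applied to the strictly positive
     density \<open>\<sigma> \<ge> \<rho>' / 2\<close>. As \<open>D M\<close> is bounded below, Fatou's lemma then bounds the negative part \<open>N\<close>.\<close>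
  define P where "P z = (case z of (x, y) \<Rightarrow> max 0 (W (x - y)) * \<rho>' x * \<rho>' y)" for z
  define N where "N z = (case z of (x, y) \<Rightarrow> max 0 (- W (x - y)) * \<rho>' x * \<rho>' y)" for z
  define T where "T M z = (case z of (x, y) \<Rightarrow> \<rho>' x * \<rho>' y - V M x * V M y)" for M z
  define WT where "WT M z = (case z of (x, y) \<Rightarrow> W (x - y) * T M z)" for M z
  let ?CC = "circ \<Otimes>\<^sub>M circ"
  have good: "AE z in ?CC. 0 \<le> \<rho>' (fst z) \<and> 0 \<le> \<rho>' (snd z) \<and> (\<forall>M. 0 \<le> T M z \<and> T M z \<le> \<rho>' (fst z) * \<rho>' (snd z))
     \<and> (\<lambda>M. T M z) \<longlonglongrightarrow> \<rho>' (fst z) * \<rho>' (snd z)"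
  proof -
    have "AE x in circ. (\<forall>M. 0 \<le> V M x \<and> V M x \<le> \<rho>' x) \<and> (\<lambda>M. V M x) \<longlonglongrightarrow> 0 \<and> 0 \<le> \<rho>' x"
      using Vb conv nn
    proof eventually_elim
      case (elim x)
      have "(\<lambda>M. \<rho>' x - U M x) \<longlonglongrightarrow> \<rho>' x - \<rho>' x" by (intro tendsto_intros elim)
      then show ?case using elim by (simp add: V_def[abs_def])
    qed
    from AE_circ_product[OF this] show ?thesis
    proof eventually_elim
      case (elim z)
      have "0 \<le> V M (fst z) * V M (snd z)" "V M (fst z) * V M (snd z) \<le> \<rho>' (fst z) * \<rho>' (snd z)" for M
        using elim by (auto intro!: mult_nonneg_nonneg mult_mono)
      moreover have "(\<lambda>M. \<rho>' (fst z) * \<rho>' (snd z) - V M (fst z) * V M (snd z)) \<longlonglongrightarrow> \<rho>' (fst z) * \<rho>' (snd z) - 0 * 0"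
        using elim by (intro tendsto_intros) auto
      ultimately show ?case using elim by (auto simp: T_def case_prod_beta)
    qed
  qed
  have \<rho>'m: "\<rho>' \<in> borel_measurable circ" using \<rho>'i by auto
  have Wp: "(\<lambda>x. max 0 (W x)) \<in> borel_measurable borel" "(\<lambda>x. max 0 (- W x)) \<in> borel_measurable borel"
    using Wm by simp_all
  have Pm[measurable]: "P \<in> borel_measurable ?CC" and Nm[measurable]: "N \<in> borel_measurable ?CC"
    unfolding P_def N_def
    by (rule interaction_integrand_measurable[OF Wp(1) \<rho>'m \<rho>'m], rule interaction_integrand_measurable[OF Wp(2) \<rho>'m \<rho>'m])
  have Wdm[measurable]: "(\<lambda>z. W (fst z - snd z)) \<in> borel_measurable ?CC" by (rule kernel_measurable[OF Wm])
  have Tm[measurable]: "T M \<in> borel_measurable ?CC" for M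
    unfolding T_def case_prod_beta' by measurable
  have Pi: "integrable ?CC P"
  proof (rule integrableI_bounded[OF Pm])
    define \<sigma> where "\<sigma> x = (1 - 1/2) * \<rho>' x + 1/2" for x
    have "\<not> infinite_attraction W \<sigma>"
      using tame mix_Pac_plus(1)[OF \<rho>', of "1/2"] by (simp add: tame_def \<sigma>_def[abs_def])
    moreover have "integrable circ (\<lambda>x. \<sigma> x * ln (\<sigma> x))"
      using mix_Pac_plus(2)[OF \<rho>', of "1/2"] by (simp add: \<sigma>_def[abs_def])
    ultimately have fin: "(\<integral>\<^sup>+z. ennreal (case z of (x, y) \<Rightarrow> W (x - y) * \<sigma> x * \<sigma> y) \<partial>?CC) < top"
      by (simp add: infinite_attraction_def less_top)
    have "(\<integral>\<^sup>+z. ennreal (norm (P z)) \<partial>?CC) \<le> (\<integral>\<^sup>+z. ennreal 4 * ennreal (case z of (x, y) \<Rightarrow> W (x - y) * \<sigma> x * \<sigma> y) \<partial>?CC)"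
    proof (rule nn_integral_mono_AE)
      show "AE z in ?CC. ennreal (norm (P z)) \<le> ennreal 4 * ennreal (case z of (x, y) \<Rightarrow> W (x - y) * \<sigma> x * \<sigma> y)"
        using good
      proof eventually_elim
        case (elim z)
        then have nz: "0 \<le> \<rho>' (fst z)" "0 \<le> \<rho>' (snd z)" by auto
        let ?w = "W (fst z - snd z)"
        show ?case
        proof (cases "0 \<le> ?w")
          case True
          have "\<rho>' (fst z) * \<rho>' (snd z) \<le> (2 * \<sigma> (fst z)) * (2 * \<sigma> (snd z))"
            using nz by (intro mult_mono) (auto simp: \<sigma>_def)
          then have "?w * (\<rho>' (fst z) * \<rho>' (snd z)) \<le> ?w * ((2 * \<sigma> (fst z)) * (2 * \<sigma> (snd z)))"
            using True by (rule mult_left_mono)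
          then have "norm (P z) \<le> 4 * (?w * \<sigma> (fst z) * \<sigma> (snd z))"
            using True nz by (simp add: P_def case_prod_beta abs_mult mult.assoc mult.left_commute)
          then have "ennreal (norm (P z)) \<le> ennreal (4 * (?w * \<sigma> (fst z) * \<sigma> (snd z)))" by (rule ennreal_leI)
          then show ?thesis by (simp add: ennreal_mult' case_prod_beta)
        next
          case False
          then show ?thesis by (simp add: P_def case_prod_beta)
        qed
      qed
    qed
    also have "\<dots> = ennreal 4 * (\<integral>\<^sup>+z. ennreal (case z of (x, y) \<Rightarrow> W (x - y) * \<sigma> x * \<sigma> y) \<partial>?CC)"
    proof (rule nn_integral_cmult)
      have "\<sigma> \<in> borel_measurable circ" unfolding \<sigma>_def by measurable
      from interaction_integrand_measurable[OF Wm this this]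
      show "(\<lambda>z. ennreal (case z of (x, y) \<Rightarrow> W (x - y) * \<sigma> x * \<sigma> y)) \<in> borel_measurable ?CC" by measurable
    qed
    also have "\<dots> < \<infinity>" using fin by (simp add: ennreal_mult_less_top)
    finally show "(\<integral>\<^sup>+z. ennreal (norm (P z)) \<partial>?CC) < \<infinity>" .
  qed
  have WTi: "integrable ?CC (WT M)" and WTD: "(\<integral>z. WT M z \<partial>?CC) = 4*pi\<^sup>2 * D M" for M
  proof -
    have k1: "finite_interaction W (U M) \<rho>'" by (rule finite_interaction_sqint[OF Wk Us \<rho>'i])
    have k2: "finite_interaction W (U M) (V M)" by (rule finite_interaction_sqint[OF Wk Us Vi])
    have k3: "finite_interaction W (V M) (U M)" by (rule finite_interaction_swap[OF k2 Wk])
    have e: "WT M = (\<lambda>z. (case z of (x, y) \<Rightarrow> W (x - y) * U M x * \<rho>' y) + (case z of (x, y) \<Rightarrow> W (x - y) * V M x * U M y))"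
      by (auto simp: WT_def T_def V_def algebra_simps)
    show "integrable ?CC (WT M)" unfolding e using k1 k3 unfolding finite_interaction_def by (rule Bochner_Integration.integrable_add)
    have "(\<integral>z. WT M z \<partial>?CC) = 4*pi\<^sup>2 * (interaction W (U M) \<rho>' + interaction W (V M) (U M))"
      unfolding e using k1 k3 unfolding finite_interaction_def interaction_def
      by (subst Bochner_Integration.integral_add) (auto simp: field_simps)
    also have "interaction W (V M) (U M) = interaction W (U M) (V M)" by (rule interaction_commute[OF Wk Vm Um])
    also have "interaction W (U M) \<rho>' + interaction W (U M) (V M) = D M"
      unfolding D_def using finite_interaction_add_right(2)[OF k1 k2] by simp
    finally show "(\<integral>z. WT M z \<partial>?CC) = 4*pi\<^sup>2 * D M" .
  qed
  define Nt where "Nt M z = max 0 (- W (fst z - snd z)) * T M z" for M z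
  define Pt where "Pt M z = max 0 (W (fst z - snd z)) * T M z" for M z
  have Ntm[measurable]: "Nt M \<in> borel_measurable ?CC" and Ptm[measurable]: "Pt M \<in> borel_measurable ?CC" for M
    unfolding Nt_def Pt_def by measurable
  have bounds: "AE z in ?CC. \<forall>M. 0 \<le> Nt M z \<and> 0 \<le> Pt M z \<and> Pt M z \<le> P z \<and> Pt M z - Nt M z = WT M z"
    using good
  proof eventually_elim
    case (elim z)
    have "Pt M z \<le> P z" for M
      using elim by (auto simp: Pt_def P_def case_prod_beta mult.assoc intro!: mult_left_mono)
    moreover have "Pt M z - Nt M z = WT M z" for M
      by (auto simp: Pt_def Nt_def WT_def case_prod_beta max_def)
    ultimately show ?case using elim by (auto simp: Nt_def Pt_def)
  qed
  have Pti: "integrable ?CC (Pt M)" and Nti: "integrable ?CC (Nt M)" for M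
  proof -
    show p: "integrable ?CC (Pt M)"
    proof (rule Bochner_Integration.integrable_bound[OF Pi Ptm])
      show "AE z in ?CC. norm (Pt M z) \<le> norm (P z)"
        using bounds
      proof eventually_elim
        case (elim z)
        then have "0 \<le> Pt M z" "Pt M z \<le> P z" by auto
        then show ?case by simp
      qed
    qed
    have "integrable ?CC (\<lambda>z. Pt M z - WT M z)" using p WTi by auto
    then show "integrable ?CC (Nt M)"
      by (rule integrable_cong_AE_imp) (use bounds in \<open>auto elim!: eventually_mono simp: algebra_simps\<close>)
  qed
  define c0 where "c0 = (\<integral>z. P z \<partial>?CC) + 4*pi\<^sup>2 * (K / ln 2 - q)"
  have K0: "0 \<le> K" using \<kappa> B C(1) by (simp add: K_def)
  have Nb: "(\<integral>z. Nt M z \<partial>?CC) \<le> c0" if M: "1 \<le> M" for M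
  proof -
    have "(\<integral>z. Nt M z \<partial>?CC) = (\<integral>z. Pt M z - WT M z \<partial>?CC)"
      by (rule integral_cong_AE) (use bounds WTi[of M] in \<open>auto elim!: eventually_mono simp: algebra_simps\<close>)
    also have "\<dots> = (\<integral>z. Pt M z \<partial>?CC) - 4*pi\<^sup>2 * D M" using Pti WTi by (simp add: WTD)
    finally have 1: "(\<integral>z. Nt M z \<partial>?CC) = (\<integral>z. Pt M z \<partial>?CC) - 4*pi\<^sup>2 * D M" .
    have 2: "(\<integral>z. Pt M z \<partial>?CC) \<le> (\<integral>z. P z \<partial>?CC)"
      by (rule integral_mono_AE[OF Pti Pi]) (use bounds in \<open>auto elim!: eventually_mono\<close>)
    have 3: "4*pi\<^sup>2 * (q - K / ln 2) \<le> 4*pi\<^sup>2 * D M"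
    proof (rule mult_left_mono)
      have "K / ln (real M + 1) \<le> K / ln 2"
        using M K0 by (intro divide_left_mono) (auto intro!: ln_mono)
      then show "q - K / ln 2 \<le> D M" using qD[OF M] by linarith
    qed simp
    have "c0 = (\<integral>z. P z \<partial>?CC) - 4*pi\<^sup>2 * (q - K / ln 2)" by (simp add: c0_def algebra_simps)
    then show ?thesis using diff_mono[OF 2 3] 1 by (simp only:)
  qed
  have Ni: "integrable ?CC N"
  proof (rule integrableI_nonneg[OF Nm])
    show "AE z in ?CC. 0 \<le> N z" using good by eventually_elim (auto simp: N_def case_prod_beta)
    have "(\<integral>\<^sup>+z. ennreal (N z) \<partial>?CC) = (\<integral>\<^sup>+z. liminf (\<lambda>M. ennreal (Nt M z)) \<partial>?CC)"
    proof (rule nn_integral_cong_AE)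
      show "AE z in ?CC. ennreal (N z) = liminf (\<lambda>M. ennreal (Nt M z))"
        using good
      proof eventually_elim
        case (elim z)
        have "(\<lambda>M. Nt M z) \<longlonglongrightarrow> max 0 (- W (fst z - snd z)) * (\<rho>' (fst z) * \<rho>' (snd z))"
          unfolding Nt_def using elim by (intro tendsto_intros) auto
        then have "(\<lambda>M. ennreal (Nt M z)) \<longlonglongrightarrow> ennreal (N z)"
          by (intro tendsto_ennrealI) (simp add: N_def case_prod_beta mult.assoc)
        from lim_imp_Liminf[OF _ this] show ?case by simp
      qed
    qed
    also have "\<dots> \<le> liminf (\<lambda>M. \<integral>\<^sup>+z. ennreal (Nt M z) \<partial>?CC)" by (rule nn_integral_liminf) auto
    also have "\<dots> \<le> liminf (\<lambda>M::nat. ennreal c0)"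
    proof (rule Liminf_mono, rule eventually_sequentiallyI[of 1])
      fix M :: nat assume M: "1 \<le> M"
      have "(\<integral>\<^sup>+z. ennreal (Nt M z) \<partial>?CC) = ennreal (\<integral>z. Nt M z \<partial>?CC)"
        by (rule nn_integral_eq_integral[OF Nti]) (use bounds in \<open>auto elim!: eventually_mono\<close>)
      then show "(\<integral>\<^sup>+z. ennreal (Nt M z) \<partial>?CC) \<le> ennreal c0" using Nb[OF M] by (simp add: ennreal_leI)
    qed
    finally show "(\<integral>\<^sup>+z. ennreal (N z) \<partial>?CC) < \<infinity>" by (simp add: Liminf_const order_le_less_trans)
  qed
  have e: "(\<lambda>(x, y). W (x - y) * \<rho>' x * \<rho>' y) = (\<lambda>z. P z - N z)"
    by (auto simp: P_def N_def max_def)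
  show "finite_interaction W \<rho>' \<rho>'" unfolding finite_interaction_def e using Pi Ni by auto
  have "(\<lambda>M. \<integral>z. WT M z \<partial>?CC) \<longlonglongrightarrow> (\<integral>z. P z - N z \<partial>?CC)"
  proof (rule integral_dominated_convergence[where w="\<lambda>z. P z + N z"])
    show "AE z in ?CC. (\<lambda>M. WT M z) \<longlonglongrightarrow> P z - N z"
      using good
    proof eventually_elim
      case (elim z)
      have "(\<lambda>M. W (fst z - snd z) * T M z) \<longlonglongrightarrow> W (fst z - snd z) * (\<rho>' (fst z) * \<rho>' (snd z))"
        using elim by (intro tendsto_intros) auto
      moreover have "P z - N z = W (fst z - snd z) * (\<rho>' (fst z) * \<rho>' (snd z))"
        using fun_cong[OF e, of z] by (simp add: case_prod_beta mult.assoc)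
      ultimately show ?case by (simp add: WT_def case_prod_beta)
    qed
    show "AE z in ?CC. norm (WT M z) \<le> P z + N z" for M
      using good
    proof eventually_elim
      case (elim z)
      have "norm (WT M z) = \<bar>W (fst z - snd z)\<bar> * T M z" using elim by (simp add: WT_def case_prod_beta abs_mult)
      also have "\<dots> \<le> \<bar>W (fst z - snd z)\<bar> * (\<rho>' (fst z) * \<rho>' (snd z))" using elim by (intro mult_left_mono) auto
      also have "\<dots> = P z + N z" by (auto simp: P_def N_def case_prod_beta max_def)
      finally show ?case .
    qed
  qed (use Pi Ni WTi in auto)
  then have "(\<lambda>M. 1 / (4*pi\<^sup>2) * (\<integral>z. WT M z \<partial>?CC)) \<longlonglongrightarrow> 1 / (4*pi\<^sup>2) * (\<integral>z. P z - N z \<partial>?CC)" by (intro tendsto_intros)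
  then have DL: "D \<longlonglongrightarrow> interaction W \<rho>' \<rho>'"
    unfolding interaction_def e by (simp add: WTD)
  have "(\<lambda>M. q - K / ln (real M + 1)) \<longlonglongrightarrow> q - 0"
  proof (intro tendsto_intros tendsto_divide_0[OF tendsto_const] filterlim_at_top_imp_at_infinity filterlim_compose[OF ln_at_top])
    show "filterlim (\<lambda>M. real M + 1) at_top sequentially"
      by (rule filterlim_at_top_mono[OF filterlim_real_sequentially]) simp
  qed
  then have "(\<lambda>M. q - K / ln (real M + 1)) \<longlonglongrightarrow> q" by simp
  then show "q \<le> interaction W \<rho>' \<rho>'" by (rule LIMSEQ_le[OF _ DL]) (use qD in blast)
qed

text \<open>
  The direct method. The difference between the energies at \<open>\<kappa>\<close> and \<open>2 * \<kappa>\<close> turns the lower bound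
  at \<open>2 * \<kappa>\<close> into a bound of the entropy along a minimizing sequence. The entropy is lower
  semicontinuous and the interaction upper semicontinuous along a weakly convergent subsequence.
  Minimizers must be strictly positive densities; if the limit vanished on a set of positive measure,
  mixing in a fraction \<open>t\<close> of the uniform density would change the energy by a negative multiple
  of \<open>t * ln (1 / t)\<close>, up to terms of order \<open>t\<close>.
\<close>

theorem minimizer_exists:
  assumes W: "potential a W" and tame: "tame W"
    and low: "\<And>\<kappa>. 0 < \<kappa> \<Longrightarrow> \<exists>C. \<forall>\<sigma>. finite_energy W \<sigma> \<longrightarrow> - C \<le> energy W \<kappa> \<sigma>"
    and \<kappa>: "0 < \<kappa>"
  shows "\<exists>\<rho>. global_minimizer W \<kappa> \<rho>"
proof -
  note Wk = potential_kernel_ok[OF W]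
  have low': "\<exists>C\<ge>0. \<forall>\<sigma>. finite_energy W \<sigma> \<longrightarrow> - C \<le> energy W \<kappa> \<sigma>" if "0 < \<kappa>" for \<kappa>
  proof -
    obtain C where "\<forall>\<sigma>. finite_energy W \<sigma> \<longrightarrow> - C \<le> energy W \<kappa> \<sigma>" using low[OF \<open>0 < \<kappa>\<close>] by blast
    then show ?thesis by (intro exI[of _ "\<bar>C\<bar>"]) (auto intro: order_trans[of "- \<bar>C\<bar>" "- C"])
  qed
  obtain C where C: "0 \<le> C" "\<And>\<sigma>. finite_energy W \<sigma> \<Longrightarrow> - C \<le> energy W \<kappa> \<sigma>" using low'[OF \<kappa>] by blast
  obtain C2 where C2: "0 \<le> C2" "\<And>\<sigma>. finite_energy W \<sigma> \<Longrightarrow> - C2 \<le> energy W (2 * \<kappa>) \<sigma>" using low'[of "2 * \<kappa>"] \<kappa> by auto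
  define S where "S = {energy W \<kappa> \<sigma> |\<sigma>. finite_energy W \<sigma>}"
  define m where "m = Inf S"
  have Sne: "S \<noteq> {}" using uniform_finite_energy(1)[OF W] by (auto simp: S_def)
  have Sbdd: "bdd_below S" by (rule bdd_belowI[of _ "- C"]) (use C(2) in \<open>auto simp: S_def\<close>)
  have mle: "m \<le> energy W \<kappa> \<sigma>" if "finite_energy W \<sigma>" for \<sigma>
    unfolding m_def by (rule cInf_lower[OF _ Sbdd]) (use that in \<open>auto simp: S_def\<close>)
  have "\<exists>\<sigma>. finite_energy W \<sigma> \<and> energy W \<kappa> \<sigma> < m + 1 / real (Suc n)" for n
    using cInf_lessD[OF Sne, of "m + 1 / real (Suc n)"] unfolding m_def[symmetric] by (auto simp: S_def)
  then obtain \<rho>0 where \<rho>0: "\<And>n. finite_energy W (\<rho>0 n)" "\<And>n. energy W \<kappa> (\<rho>0 n) < m + 1 / real (Suc n)" by metis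
  have E0: "(\<lambda>n. energy W \<kappa> (\<rho>0 n)) \<longlonglongrightarrow> m"
  proof (rule tendsto_sandwich[OF _ _ tendsto_const])
    show "(\<lambda>n. m + 1 / real (Suc n)) \<longlonglongrightarrow> m"
      using tendsto_add[OF tendsto_const LIMSEQ_Suc[OF lim_1_over_n], of m] by simp
  qed (use mle[OF \<rho>0(1)] \<rho>0(2) in \<open>auto intro!: always_eventually less_imp_le\<close>)
  define B where "B = 2 * (m + 1) + C2"
  have entB: "entropy (\<rho>0 n) \<le> B" for n
  proof -
    have "energy W \<kappa> (\<rho>0 n) \<le> m + 1"
      using \<rho>0(2)[of n] by (rule order_trans[OF less_imp_le]) simp
    then show ?thesis using C2(2)[OF \<rho>0(1)[of n]] unfolding B_def energy_def by simp
  qed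
  have ent0: "0 \<le> entropy (\<rho>0 n)" for n by (rule finite_energyD(8)[OF \<rho>0(1)])
  have "\<forall>n. entropy (\<rho>0 n) \<in> {0..B}" using entB ent0 by auto
  then obtain s r0 where r0: "strict_mono r0" "((\<lambda>n. entropy (\<rho>0 n)) \<circ> r0) \<longlonglongrightarrow> s"
    using compact_Icc[of 0 B, unfolded compact_def, rule_format, of "\<lambda>n. entropy (\<rho>0 n)"] by auto
  define \<rho>1 where "\<rho>1 n = \<rho>0 (r0 n)" for n
  have \<rho>1: "finite_energy W (\<rho>1 n)" "entropy (\<rho>1 n) \<le> B" for n using \<rho>0 entB by (auto simp: \<rho>1_def)
  note R = finite_energyD[OF \<rho>1(1)]
  have s1: "(\<lambda>n. entropy (\<rho>1 n)) \<longlonglongrightarrow> s" using r0(2) by (simp add: \<rho>1_def o_def)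
  have E1: "(\<lambda>n. energy W \<kappa> (\<rho>1 n)) \<longlonglongrightarrow> m"
    using LIMSEQ_subseq_LIMSEQ[OF E0 r0(1)] by (simp add: \<rho>1_def o_def)
  obtain r \<rho> U where r: "strict_mono r" and \<rho>: "prob_density \<rho>" "integrable circ (\<lambda>x. \<rho> x * ln (\<rho> x))" "entropy \<rho> \<le> s"
    and Um: "\<And>M. U M \<in> borel_measurable circ"
    and Ub: "AE x in circ. \<forall>M. 0 \<le> U M x \<and> U M x \<le> real M + 1 \<and> U M x \<le> U (Suc M) x"
    and conv: "AE x in circ. (\<lambda>M. U M x) \<longlonglongrightarrow> \<rho> x"
    and hU: "\<And>M l. (\<lambda>n. hcoef (\<lambda>x. trunc M (\<rho>1 (r n) x)) l) \<longlonglongrightarrow> hcoef (U M) l"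
    and h\<rho>: "\<And>l. (\<lambda>n. hcoef (\<rho>1 (r n)) l) \<longlonglongrightarrow> hcoef \<rho> l"
    by (rule entropy_compactness[OF R(1) R(5) s1]) blast
  define q where "q = 2 / \<kappa> * (s - m)"
  have "(\<lambda>n. 2 / \<kappa> * (entropy (\<rho>1 n) - energy W \<kappa> (\<rho>1 n))) \<longlonglongrightarrow> q"
    unfolding q_def by (intro tendsto_intros s1 E1)
  moreover have "2 / \<kappa> * (entropy (\<rho>1 n) - energy W \<kappa> (\<rho>1 n)) = interaction W (\<rho>1 n) (\<rho>1 n)" for n
    using \<kappa> by (simp add: energy_def)
  ultimately have q1: "(\<lambda>n. interaction W (\<rho>1 n) (\<rho>1 n)) \<longlonglongrightarrow> q" by simp
  have q: "(\<lambda>n. interaction W (\<rho>1 (r n)) (\<rho>1 (r n))) \<longlonglongrightarrow> q"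
    using LIMSEQ_subseq_LIMSEQ[OF q1 r] by (simp add: o_def)
  note usc = interaction_upper_semicontinuous[OF W tame \<kappa> C \<rho>1(1) \<rho>1(2) q \<rho>(1,2) Um Ub conv hU h\<rho>]
  have k: "finite_interaction W \<rho> \<rho>" by (rule usc(1))
  have Eq: "entropy \<rho> - \<kappa> / 2 * interaction W \<rho> \<rho> \<le> m"
  proof -
    have "\<kappa> / 2 * q \<le> \<kappa> / 2 * interaction W \<rho> \<rho>" using usc(2) \<kappa> by (intro mult_left_mono) auto
    moreover have "\<kappa> / 2 * q = s - m" using \<kappa> by (simp add: q_def)
    ultimately show ?thesis using \<rho>(3) by linarith
  qed
  \<comment> \<open>Owing to the zero set \<open>Z\<close>, of measure \<open>z\<close>, mixing lowers the entropy by at least \<open>t * b\<close>. The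
     number \<open>t\<close> is chosen to make \<open>b\<close> exceed \<open>\<kappa> * \<bar>Q\<bar>\<close>, so that the loss of at most \<open>t * \<kappa> * \<bar>Q\<bar>\<close> from the interaction is smaller.\<close>
  have \<rho>i: "integrable circ \<rho>" and nn: "AE x in circ. 0 \<le> \<rho> x" using \<rho>(1) by (auto simp: prob_density_def)
  have [measurable]: "\<rho> \<in> borel_measurable circ" using \<rho>i by auto
  let ?I = "interaction W \<rho> \<rho>"
  define Z where "Z = {x \<in> space circ. \<rho> x \<le> 0}"
  have Zm[measurable]: "Z \<in> sets circ" unfolding Z_def by measurable
  define z where "z = measure circ Z"
  have "z = 0"
  proof (rule ccontr)
    assume "z \<noteq> 0"
    then have z: "0 < z" using measure_nonneg[of circ Z] by (simp add: z_def less_le)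
    define b where "b = \<kappa> * \<bar>?I\<bar> + 1"
    have b: "0 < b" using \<kappa> by (simp add: b_def add_nonneg_pos)
    define t where "t = exp (- (b * (2*pi) / z))"
    have t: "0 < t" "t \<le> 1" using b z by (auto simp: t_def)
    have lnt: "z / (2*pi) * ln t = - b" using z by (simp add: t_def)
    define \<sigma> where "\<sigma> x = (1 - t) * \<rho> x + t" for x
    have f\<sigma>: "finite_energy W \<sigma>" unfolding \<sigma>_def[abs_def] by (rule mix_finite_energy[OF W \<rho>(1,2) k t])
    note S = finite_energyD[OF f\<sigma>]
    have I\<sigma>: "interaction W \<sigma> \<sigma> = (1 - t)\<^sup>2 * ?I" unfolding \<sigma>_def[abs_def] by (rule mix_interaction(2)[OF W \<rho>i k])
    have psiS: "integrable circ (\<lambda>x. psi (\<sigma> x))" using integrable_psi_iff[OF S(2)] S(5) by simp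
    have psiR: "integrable circ (\<lambda>x. psi (\<rho> x))" using integrable_psi_iff[OF \<rho>i] \<rho>(2) by simp
    have indi: "integrable circ (indicator Z :: real \<Rightarrow> real)" by (rule circ.integrable_const_bound[of _ 1]) auto
    have "(\<integral>x. psi (\<sigma> x) \<partial>circ) \<le> (\<integral>x. (1 - t) * psi (\<rho> x) + t * ln t * indicator Z x \<partial>circ)"
    proof (rule integral_mono_AE[OF psiS])
      show "integrable circ (\<lambda>x. (1 - t) * psi (\<rho> x) + t * ln t * indicator Z x)" using psiR indi by simp
      have "AE x in circ. x \<in> space circ" by (rule AE_space)
      then show "AE x in circ. psi (\<sigma> x) \<le> (1 - t) * psi (\<rho> x) + t * ln t * indicator Z x"
        using nn
      proof eventually_elim
        case (elim x)
        show ?case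
        proof (cases "x \<in> Z")
          case True
          then have "\<rho> x = 0" using elim by (simp add: Z_def)
          then show ?thesis using True by (simp add: \<sigma>_def psi_def)
        next
          case False
          then show ?thesis using psi_convex[of "\<rho> x" 1 t] t elim by (simp add: \<sigma>_def)
        qed
      qed
    qed
    also have "\<dots> = (1 - t) * (\<integral>x. psi (\<rho> x) \<partial>circ) + t * ln t * z"
    proof -
      have "Z \<inter> {0..<2*pi} = Z" by (auto simp: Z_def)
      then show ?thesis using psiR indi by (simp add: z_def)
    qed
    finally have "1 / (2*pi) * (\<integral>x. psi (\<sigma> x) \<partial>circ)
      \<le> 1 / (2*pi) * ((1 - t) * (\<integral>x. psi (\<rho> x) \<partial>circ) + t * ln t * z)" by (rule mult_left_mono) simp
    also have "\<dots> = (1 - t) * (1 / (2*pi) * (\<integral>x. psi (\<rho> x) \<partial>circ)) + t * (z / (2*pi) * ln t)"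
      by (simp add: field_simps)
    finally have "entropy \<sigma> \<le> (1 - t) * entropy \<rho> - t * b"
      unfolding entropy_psi[OF S(1,5)] entropy_psi[OF \<rho>(1,2)] lnt by simp
    moreover have "m \<le> entropy \<sigma> - \<kappa> / 2 * ((1 - t)\<^sup>2 * ?I)" using mle[OF f\<sigma>] by (simp add: energy_def I\<sigma>)
    ultimately have "entropy \<rho> - \<kappa> / 2 * ?I \<le> (1 - t) * entropy \<rho> - t * b - \<kappa> / 2 * ((1 - t)\<^sup>2 * ?I)"
      using Eq by linarith
    moreover have "t * (\<kappa> / 2 * ((2 - t) * ?I)) = \<kappa> / 2 * ?I - \<kappa> / 2 * ((1 - t)\<^sup>2 * ?I)"
      by (simp add: power2_eq_square algebra_simps)
    moreover have "t * (entropy \<rho> + b) = entropy \<rho> - ((1 - t) * entropy \<rho> - t * b)" by (simp add: algebra_simps)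
    ultimately have "t * (entropy \<rho> + b) \<le> t * (\<kappa> / 2 * ((2 - t) * ?I))" by argo
    then have "entropy \<rho> + b \<le> \<kappa> / 2 * ((2 - t) * ?I)" using t by simp
    also have "\<dots> \<le> \<kappa> / 2 * (2 * \<bar>?I\<bar>)"
    proof (rule mult_left_mono)
      have "(2 - t) * ?I \<le> (2 - t) * \<bar>?I\<bar>" using t by (intro mult_left_mono) auto
      also have "\<dots> \<le> 2 * \<bar>?I\<bar>" using t by (intro mult_right_mono) auto
      finally show "(2 - t) * ?I \<le> 2 * \<bar>?I\<bar>" .
    qed (use \<kappa> in simp)
    finally show False using entropy_nonneg[OF \<rho>(1,2)] by (simp add: b_def)
  qed
  then have "emeasure circ Z = 0" by (simp add: z_def circ.emeasure_eq_measure)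
  then have "AE x in circ. x \<notin> Z" by (intro AE_not_in) (simp add: null_sets_def Zm)
  moreover have "AE x in circ. x \<in> space circ" by (rule AE_space)
  ultimately have "AE x in circ. 0 < \<rho> x" by eventually_elim (auto simp: Z_def not_le)
  then have f: "finite_energy W \<rho>" using \<rho> k by (simp add: finite_energy_def Pac_plus_def finite_interaction_def)
  have "energy W \<kappa> \<rho> \<le> energy W \<kappa> \<sigma>" if "finite_energy W \<sigma>" for \<sigma>
    using Eq mle[OF that] by (simp add: energy_def)
  then have "global_minimizer W \<kappa> \<rho>" using minimizer_iff[OF W tame \<kappa>] f by blast
  then show ?thesis by blast
qed

section \<open>The logarithm of a stationary solution\<close>

lemma sqint_limit_mult2:
  assumes f: "\<And>n. sqint M (f n)" and f': "sqint M f'" and g: "\<And>n. sqint M (g n)" and g': "sqint M g'"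
    and limf: "(\<lambda>n::nat. \<integral>x. (f n x - f' x)\<^sup>2 \<partial>M) \<longlonglongrightarrow> 0"
    and limg: "(\<lambda>n::nat. \<integral>x. (g n x - g' x)\<^sup>2 \<partial>M) \<longlonglongrightarrow> 0"
  shows "(\<lambda>n. \<integral>x. f n x * g n x \<partial>M) \<longlonglongrightarrow> (\<integral>x. f' x * g' x \<partial>M)"
proof -
  have df: "sqint M (\<lambda>x. f n x - f' x)" and dg: "sqint M (\<lambda>x. g n x - g' x)" for n
    using f f' g g' by (auto intro: sqint_diff)
  have "(\<lambda>n. sqrt (\<integral>x. (f n x - f' x)\<^sup>2 \<partial>M) * sqrt (\<integral>x. (g n x - g' x)\<^sup>2 \<partial>M)) \<longlonglongrightarrow> sqrt 0 * sqrt 0"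
    by (intro tendsto_intros limf limg)
  then have z: "(\<lambda>n. \<integral>x. (f n x - f' x) * (g n x - g' x) \<partial>M) \<longlonglongrightarrow> 0"
    using sqint_Cauchy_Schwarz'[OF df dg]
    by (rule_tac Lim_null_comparison[OF always_eventually]) auto
  have "(\<lambda>n. (\<integral>x. (f n x - f' x) * (g n x - g' x) \<partial>M) + (\<integral>x. f n x * g' x \<partial>M) + (\<integral>x. g n x * f' x \<partial>M) - (\<integral>x. f' x * g' x \<partial>M))
     \<longlonglongrightarrow> 0 + (\<integral>x. f' x * g' x \<partial>M) + (\<integral>x. g' x * f' x \<partial>M) - (\<integral>x. f' x * g' x \<partial>M)"
    by (intro tendsto_intros z sqint_limit_mult[OF f f' g' limf] sqint_limit_mult[OF g g' f' limg])
  moreover have "(\<integral>x. (f n x - f' x) * (g n x - g' x) \<partial>M) + (\<integral>x. f n x * g' x \<partial>M) + (\<integral>x. g n x * f' x \<partial>M) - (\<integral>x. f' x * g' x \<partial>M)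
    = (\<integral>x. f n x * g n x \<partial>M)" for n
  proof -
    have "f n x * g n x = (f n x - f' x) * (g n x - g' x) + f n x * g' x + g n x * f' x - f' x * g' x" for x
      by (simp add: algebra_simps)
    then have "(\<integral>x. f n x * g n x \<partial>M) = (\<integral>x. (f n x - f' x) * (g n x - g' x) + f n x * g' x + g n x * f' x - f' x * g' x \<partial>M)"
      by presburger
    also have "\<dots> = (\<integral>x. (f n x - f' x) * (g n x - g' x) \<partial>M) + (\<integral>x. f n x * g' x \<partial>M) + (\<integral>x. g n x * f' x \<partial>M) - (\<integral>x. f' x * g' x \<partial>M)"
      using sqint_mult[OF df dg] sqint_mult[OF f g'] sqint_mult[OF g f'] sqint_mult[OF f' g'] by simp
    finally show ?thesis by simp
  qed
  ultimately show ?thesis by (simp add: mult.commute)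
qed

lemma hsum_has_derivative:
  assumes pg: "hderiv p g"
  shows "(hsum p N has_real_derivative hsum g N x) (at x)"
proof -
  have "(hsum p N has_real_derivative (\<Sum>k\<in>{- int N..int N}. hcoef p k * (of_int k * cas (-k) x))) (at x)"
    unfolding hsum_def[abs_def]
    by (auto intro!: derivative_eq_intros cas_has_derivative sum.cong simp: mult.commute mult.left_commute)
  also have "(\<Sum>k\<in>{- int N..int N}. hcoef p k * (of_int k * cas (-k) x)) = hsum g N x"
    unfolding hsum_def
    by (rule sum.reindex_bij_witness[of _ uminus uminus]) (use pg in \<open>auto simp: hderiv_def\<close>)
  finally show ?thesis .
qed

lemma abs_minus_1_le_half: "\<bar>t - 1\<bar> \<le> 1/2 \<Longrightarrow> 1/2 \<le> t \<and> t \<le> (3/2 :: real)"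
  by linarith

lemma hsum_periodic: "hsum p N (x + 2*pi) = hsum p N x"
  by (simp add: hsum_def cas_periodic)

lemma ln_Lipschitz:
  fixes x y :: real
  assumes "1/2 \<le> x" "1/2 \<le> y"
  shows "\<bar>ln x - ln y\<bar> \<le> 2 * \<bar>x - y\<bar>"
proof -
  have *: "ln u - ln v \<le> 2 * \<bar>u - v\<bar>" if "1/2 \<le> u" "1/2 \<le> v" for u v :: real
  proof -
    have "ln u - ln v = ln (u / v)" using that by (simp add: ln_div)
    also have "\<dots> \<le> u / v - 1" using that by (intro ln_le_minus_one) auto
    also have "\<dots> = (u - v) * (1 / v)" using that by (simp add: field_simps)
    also have "\<dots> \<le> \<bar>u - v\<bar> * 2" using that by (intro mult_mono) (auto simp: field_simps)
    finally show ?thesis by simp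
  qed
  show ?thesis using *[OF assms] *[OF assms(2,1)] by (auto simp: abs_minus_commute)
qed

lemma inverse_Lipschitz:
  fixes x y :: real
  assumes "1/2 \<le> x" "1/2 \<le> y"
  shows "\<bar>1 / x - 1 / y\<bar> \<le> 4 * \<bar>x - y\<bar>"
proof -
  have "1 / x - 1 / y = (y - x) * ((1 / x) * (1 / y))" using assms by (simp add: field_simps)
  then have "\<bar>1 / x - 1 / y\<bar> = \<bar>x - y\<bar> * ((1 / x) * (1 / y))" using assms by (simp add: abs_mult abs_minus_commute)
  also have "\<dots> \<le> \<bar>x - y\<bar> * (2 * 2)" using assms by (intro mult_left_mono mult_mono) (auto simp: field_simps)
  finally show ?thesis by simp
qed

lemma L2_squeeze:
  assumes "\<And>n. sqint circ (f n)" "\<And>n. sqint circ (g n)"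
    and le: "\<And>n. AE x in circ. \<bar>f n x\<bar> \<le> c * \<bar>g n x\<bar>"
    and lim: "(\<lambda>n::nat. \<integral>x. (g n x)\<^sup>2 \<partial>circ) \<longlonglongrightarrow> 0"
  shows "(\<lambda>n. \<integral>x. (f n x)\<^sup>2 \<partial>circ) \<longlonglongrightarrow> 0"
proof (rule Lim_null_comparison[OF always_eventually])
  show "(\<lambda>n. c\<^sup>2 * (\<integral>x. (g n x)\<^sup>2 \<partial>circ)) \<longlonglongrightarrow> 0" using tendsto_mult[OF tendsto_const lim, of "c\<^sup>2"] by simp
  show "\<forall>n. norm (\<integral>x. (f n x)\<^sup>2 \<partial>circ) \<le> c\<^sup>2 * (\<integral>x. (g n x)\<^sup>2 \<partial>circ)"
  proof
    fix n
    have "(\<integral>x. (f n x)\<^sup>2 \<partial>circ) \<le> (\<integral>x. c\<^sup>2 * (g n x)\<^sup>2 \<partial>circ)"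
    proof (rule integral_mono_AE)
      show "AE x in circ. (f n x)\<^sup>2 \<le> c\<^sup>2 * (g n x)\<^sup>2"
        using le[of n]
      proof eventually_elim
        case (elim x)
        from power_mono[OF elim abs_ge_zero, of 2] show ?case by (simp add: power_mult_distrib)
      qed
    qed (use assms in \<open>auto simp: sqint_def\<close>)
    moreover have "0 \<le> (\<integral>x. (f n x)\<^sup>2 \<partial>circ)" by (rule integral_nonneg_AE) auto
    ultimately show "norm (\<integral>x. (f n x)\<^sup>2 \<partial>circ) \<le> c\<^sup>2 * (\<integral>x. (g n x)\<^sup>2 \<partial>circ)" by simp
  qed
qed

text \<open>
  The weak form of \<open>(ln p)' = p' / p\<close>. The partial sums of \<open>p\<close> are smooth and, by the bound on the
  coefficients, take values in \<open>[1/2, 3/2]\<close>. For them it is the fundamental theorem of calculus, and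
  on this range the logarithm and the reciprocal are Lipschitz, so both sides pass to the limit.
\<close>

lemma log_chain_rule:
  assumes pg: "hderiv p g" and h0: "hcoef p 0 = 1"
    and small: "\<And>N. (\<Sum>k\<in>{- int N..int N} - {0}. \<bar>hcoef p k\<bar>) \<le> 1/4"
  shows "(\<integral>x. g x / p x * cas k x \<partial>circ) = - of_int k * (\<integral>x. ln (p x) * cas (-k) x \<partial>circ)"
proof -
  have ps: "sqint circ p" and gs: "sqint circ g" using pg by (auto simp: hderiv_def)
  have [measurable]: "p \<in> borel_measurable circ" "g \<in> borel_measurable circ" using ps gs by (auto simp: sqint_def)
  have hb: "\<bar>hsum p N x - 1\<bar> \<le> 1/2" for N x
    using hsum_minus_mean_bound[of p N x] small[of N] h0 by simp
  then have hlo: "1/2 \<le> hsum p N x" and hhi: "hsum p N x \<le> 3/2" for N x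
    using abs_le_D1[OF hb[of N x]] abs_le_D2[OF hb[of N x]] by linarith+
  have pb: "AE x in circ. 1/2 \<le> p x \<and> p x \<le> 3/2"
    using hcoef_sum_sup_bound[OF ps small] by eventually_elim (rule abs_minus_1_le_half, simp add: h0)
  have hm[measurable]: "hsum p N \<in> borel_measurable borel" "hsum g N \<in> borel_measurable borel" for N
    unfolding hsum_def[abs_def] by measurable
  have lnhm[measurable]: "(\<lambda>x. ln (hsum p N x)) \<in> borel_measurable circ" for N
    by (rule measurable_circ) measurable
  have lims: "(\<lambda>N. \<integral>x. (hsum p N x - p x)\<^sup>2 \<partial>circ) \<longlonglongrightarrow> 0" "(\<lambda>N. \<integral>x. (hsum g N x - g x)\<^sup>2 \<partial>circ) \<longlonglongrightarrow> 0"
    using hsum_L2_convergence ps gs by auto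
  have dsq: "sqint circ (\<lambda>x. hsum p N x - p x)" for N by (intro sqint_diff sqint_hsum ps)
  have lnb: "\<bar>ln u\<bar> \<le> 1" if "1/2 \<le> u" "u \<le> 3/2" for u :: real
  proof -
    have "\<bar>u - 1\<bar> \<le> 1/2" using that by linarith
    then show ?thesis using ln_Lipschitz[OF that(1), of 1] by simp
  qed
  have ln_sq: "sqint circ (\<lambda>x. ln (hsum p N x))" "sqint circ (\<lambda>x. ln (p x))" for N
  proof -
    show "sqint circ (\<lambda>x. ln (hsum p N x))" by (rule sqint_bounded[of _ _ 1]) (use lnb[OF hlo hhi] in auto)
    have "AE x in circ. \<bar>ln (p x)\<bar> \<le> 1" using pb by eventually_elim (use lnb in blast)
    then show "sqint circ (\<lambda>x. ln (p x))" by (intro sqint_bounded[of _ _ 1]) auto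
  qed
  have ln_lim: "(\<lambda>N. \<integral>x. (ln (hsum p N x) - ln (p x))\<^sup>2 \<partial>circ) \<longlonglongrightarrow> 0"
  proof (rule L2_squeeze[OF _ dsq _ lims(1)])
    show "sqint circ (\<lambda>x. ln (hsum p N x) - ln (p x))" for N by (intro sqint_diff ln_sq)
    show "AE x in circ. \<bar>ln (hsum p N x) - ln (p x)\<bar> \<le> 2 * \<bar>hsum p N x - p x\<bar>" for N
      using pb by eventually_elim (use ln_Lipschitz hlo in auto)
  qed
  define \<psi> where "\<psi> N x = 1 / hsum p N x * cas k x" for N x
  define \<psi>' where "\<psi>' x = 1 / p x * cas k x" for x
  have \<psi>_sq: "sqint circ (\<psi> N)" for N unfolding \<psi>_def[abs_def]
  proof (rule sqint_bounded_mult[OF sqint_cas, of _ 2])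
    show "(\<lambda>x. 1 / hsum p N x) \<in> borel_measurable circ" by (rule measurable_circ) measurable
    show "AE x in circ. \<bar>1 / hsum p N x\<bar> \<le> 2" using hlo by (intro AE_I2) (simp add: field_simps abs_of_pos order_less_le_trans[OF _ hlo])
  qed
  have \<psi>'_sq: "sqint circ \<psi>'" unfolding \<psi>'_def[abs_def]
  proof (rule sqint_bounded_mult[OF sqint_cas, of _ 2])
    show "AE x in circ. \<bar>1 / p x\<bar> \<le> 2" using pb by eventually_elim (simp add: field_simps)
  qed measurable
  have \<psi>_lim: "(\<lambda>N. \<integral>x. (\<psi> N x - \<psi>' x)\<^sup>2 \<partial>circ) \<longlonglongrightarrow> 0"
  proof (rule L2_squeeze[OF _ dsq _ lims(1)])
    show "sqint circ (\<lambda>x. \<psi> N x - \<psi>' x)" for N by (intro sqint_diff \<psi>_sq \<psi>'_sq)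
    show "AE x in circ. \<bar>\<psi> N x - \<psi>' x\<bar> \<le> 8 * \<bar>hsum p N x - p x\<bar>" for N
      using pb
    proof eventually_elim
      case (elim x)
      have "\<bar>\<psi> N x - \<psi>' x\<bar> = \<bar>1 / hsum p N x - 1 / p x\<bar> * \<bar>cas k x\<bar>"
        by (simp add: \<psi>_def \<psi>'_def left_diff_distrib abs_mult[symmetric])
      also have "\<dots> \<le> (4 * \<bar>hsum p N x - p x\<bar>) * 2"
        using elim hlo by (intro mult_mono inverse_Lipschitz cas_bound) auto
      finally show ?case by simp
    qed
  qed
  have FTC: "(\<integral>x. hsum g N x * \<psi> N x \<partial>circ) = - of_int k * (\<integral>x. ln (hsum p N x) * cas (-k) x \<partial>circ)" for N
  proof -
    have pos: "0 < hsum p N x" for x using hlo[of N x] by linarith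
    have cont: "continuous_on UNIV (hsum f N)" for f unfolding hsum_def[abs_def] cas_def
      by (intro continuous_intros)
    have "(\<integral>x. hsum g N x * \<psi> N x + of_int k * (ln (hsum p N x) * cas (-k) x) \<partial>circ)
      = ln (hsum p N (2*pi)) * cas k (2*pi) - ln (hsum p N 0) * cas k 0"
    proof (rule integral_circ_FTC[of "\<lambda>x. ln (hsum p N x) * cas k x"])
      show "((\<lambda>x. ln (hsum p N x) * cas k x) has_real_derivative
          hsum g N x * \<psi> N x + of_int k * (ln (hsum p N x) * cas (-k) x)) (at x)" for x
        using pos[of x]
        by (auto intro!: derivative_eq_intros cas_has_derivative hsum_has_derivative[OF pg] simp: \<psi>_def field_simps)
      show "continuous_on UNIV (\<lambda>x. hsum g N x * \<psi> N x + of_int k * (ln (hsum p N x) * cas (-k) x))"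
        unfolding \<psi>_def cas_def
        by (intro continuous_intros cont) (use pos in \<open>auto simp: less_imp_neq[symmetric]\<close>)
    qed
    also have "\<dots> = 0" using hsum_periodic[of p N 0] cas_periodic[of k 0] by simp
    finally show ?thesis
      using sqint_mult[OF sqint_hsum \<psi>_sq, of g N N] sqint_mult[OF ln_sq(1) sqint_cas, of N "-k"] by simp
  qed
  have "(\<lambda>N. \<integral>x. hsum g N x * \<psi> N x \<partial>circ) \<longlonglongrightarrow> (\<integral>x. g x * \<psi>' x \<partial>circ)"
    by (rule sqint_limit_mult2[OF sqint_hsum gs \<psi>_sq \<psi>'_sq lims(2) \<psi>_lim])
  moreover have "(\<lambda>N. - of_int k * (\<integral>x. ln (hsum p N x) * cas (-k) x \<partial>circ)) \<longlonglongrightarrow> - of_int k * (\<integral>x. ln (p x) * cas (-k) x \<partial>circ)"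
    by (intro tendsto_mult tendsto_const sqint_limit_mult[OF ln_sq sqint_cas ln_lim])
  ultimately have "(\<integral>x. g x * \<psi>' x \<partial>circ) = - of_int k * (\<integral>x. ln (p x) * cas (-k) x \<partial>circ)"
    unfolding FTC by (rule LIMSEQ_unique)
  then show ?thesis by (simp add: \<psi>'_def)
qed

text \<open>
  The equation says that the flux \<open>p' - \<kappa> * p * (W \<star> p)'\<close> has derivative zero, so it is
  constant. By evenness of \<open>p\<close> the constant is zero, whence \<open>(ln p)' = p' / p = \<kappa> * (W \<star> p)'\<close>, and
  the coefficients of \<open>W \<star> p\<close> are known.
\<close>

theorem stationary_log_coefficients:
  assumes W: "potential a W" and p: "prob_density p" "even_on_circ p" and st: "stationary W \<kappa> p"
    and small: "\<And>N. (\<Sum>k\<in>{- int N..int N} - {0}. \<bar>hcoef p k\<bar>) \<le> 1/4" and k: "k \<noteq> 0"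
  shows "hcoef (\<lambda>x. ln (p x)) k = \<kappa> * (a (nat \<bar>k\<bar>) / 2 * hcoef p k)"
proof -
  obtain g h where gh: "weak_deriv p g" "weak_deriv (conv W p) h"
    "\<And>\<phi>. smooth_periodic \<phi> \<Longrightarrow> (\<integral>\<theta>. g \<theta> * deriv \<phi> \<theta> \<partial>circ) = \<kappa> * (\<integral>\<theta>. p \<theta> * h \<theta> * deriv \<phi> \<theta> \<partial>circ)"
    using st unfolding stationary_def by blast
  have pg: "hderiv p g" and ch: "hderiv (conv W p) h" using gh weak_deriv_imp_hderiv by auto
  have ps: "sqint circ p" and gs: "sqint circ g" and hs: "sqint circ h" using pg ch by (auto simp: hderiv_def)
  have pm: "p \<in> borel_measurable circ" using ps by (simp add: sqint_def)
  have pi: "integrable circ p" using p by (simp add: prob_density_def)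
  have h0: "hcoef p 0 = 1" by (rule prob_density_hcoef_0[OF p(1)])
  have pb: "AE x in circ. 1/2 \<le> p x \<and> p x \<le> 3/2"
    using hcoef_sum_sup_bound[OF ps small] by eventually_elim (rule abs_minus_1_le_half, simp add: h0)
  have phs: "sqint circ (\<lambda>x. p x * h x)"
  proof (rule sqint_bounded_mult[OF hs pm])
    show "AE x in circ. \<bar>p x\<bar> \<le> 3/2" using pb by eventually_elim simp
  qed
  have hh: "hcoef h j = - of_int j * (a (nat \<bar>j\<bar>) / 2 * hcoef p j)" for j
    using ch hcoef_conv[OF W pi, of "-j"] hcoef_even[OF pi p(2), of j] by (auto simp: hderiv_def)
  \<comment> \<open>Test functions give the coefficients of the flux \<open>G\<close> at \<open>j \<noteq> 0\<close>. At \<open>j = 0\<close>, \<open>p\<close> has even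
     coefficients and \<open>h\<close> odd ones, and their product has mean zero by Parseval's identity.\<close>
  define G where "G x = g x - \<kappa> * (p x * h x)" for x
  have Gs: "sqint circ G" unfolding G_def[abs_def] by (intro sqint_diff sqint_cmult gs phs)
  have Gc: "hcoef G j = hcoef g j - \<kappa> * hcoef (\<lambda>x. p x * h x) j" for j
    unfolding G_def[abs_def] using L2_integrable[OF gs] L2_integrable[OF phs]
    by (subst hcoef_diff) (auto simp: hcoef_cmult)
  have "hcoef G j = 0" for j
  proof (cases "j = 0")
    case False
    have "of_int (-j) * (\<integral>x. g x * cas j x \<partial>circ) = \<kappa> * (of_int (-j) * (\<integral>x. p x * h x * cas j x \<partial>circ))"
      using gh(3)[OF smooth_periodic_cas[of "-j"]] by (simp add: deriv_cas mult.left_commute)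
    then have "(\<integral>x. g x * cas j x \<partial>circ) = \<kappa> * (\<integral>x. p x * h x * cas j x \<partial>circ)"
      using False by simp
    then show ?thesis unfolding Gc by (simp add: hcoef_def)
  next
    case True
    have "(\<Sum>j\<in>{- int N..int N}. hcoef p j * hcoef h j) = 0" for N
    proof -
      have "(\<Sum>j\<in>{- int N..int N}. hcoef p j * hcoef h j) = hcoef p 0 * hcoef h 0 + (\<Sum>j\<in>{- int N..int N} - {0}. hcoef p j * hcoef h j)"
        by (rule sum.remove) auto
      also have "\<dots> = 0" unfolding sum_int_split
        by (simp add: hh hcoef_even[OF pi p(2)])
      finally show ?thesis .
    qed
    then have "(\<integral>x. p x * h x \<partial>circ) = 0" using Parseval[OF ps hs] LIMSEQ_unique[OF _ tendsto_const] by simp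
    then have "hcoef (\<lambda>x. p x * h x) 0 = 0" by (simp add: hcoef_def)
    moreover have "hcoef g 0 = 0" using pg by (simp add: hderiv_def)
    ultimately show ?thesis unfolding Gc True by simp
  qed
  then have "AE x in circ. G x = 0" using hcoef_zero_imp_zero[OF L2_integrable[OF Gs]] by blast
  then have gp: "AE x in circ. g x / p x = \<kappa> * h x"
    using pb by eventually_elim (auto simp: G_def field_simps)
  have "\<kappa> * (2*pi * hcoef h (-k)) = (\<integral>x. \<kappa> * h x * cas (-k) x \<partial>circ)"
    by (simp add: hcoef_def mult.assoc)
  also have "\<dots> = (\<integral>x. g x / p x * cas (-k) x \<partial>circ)"
  proof (rule integral_cong_AE)
    note [measurable] = pm sqint_measurable[OF hs] sqint_measurable[OF gs]
    show "(\<lambda>x. \<kappa> * h x * cas (-k) x) \<in> borel_measurable circ" "(\<lambda>x. g x / p x * cas (-k) x) \<in> borel_measurable circ"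
      by measurable
    show "AE x in circ. \<kappa> * h x * cas (-k) x = g x / p x * cas (-k) x" using gp by eventually_elim simp
  qed
  also have "\<dots> = of_int k * (\<integral>x. ln (p x) * cas k x \<partial>circ)"
    using log_chain_rule[OF pg h0 small, of "-k"] by simp
  also have "\<dots> = of_int k * (2*pi * hcoef (\<lambda>x. ln (p x)) k)" by (simp add: hcoef_def)
  finally have "2*pi * (\<kappa> * hcoef h (-k)) = 2*pi * (of_int k * hcoef (\<lambda>x. ln (p x)) k)"
    by (simp only: mult.assoc mult.left_commute)
  then have "\<kappa> * hcoef h (-k) = of_int k * hcoef (\<lambda>x. ln (p x)) k" by simp
  then have "of_int k * (\<kappa> * (a (nat \<bar>k\<bar>) / 2 * hcoef p k)) = of_int k * hcoef (\<lambda>x. ln (p x)) k"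
    using hcoef_even[OF pi p(2), of k] by (simp add: hh)
  then show ?thesis using k by simp
qed

section \<open>The weighted sequence space\<close>

lemma l2w_norm_nonneg: "0 \<le> l2w_norm x"
  unfolding l2w_norm_def by (intro real_sqrt_ge_zero infsum_nonneg) auto

lemma l2w_partial_sum:
  assumes "x \<in> l2w" "finite F" "F \<subseteq> {1..}"
  shows "(\<Sum>l\<in>F. (1 + (real l)\<^sup>2) * (x l)\<^sup>2) \<le> (l2w_norm x)\<^sup>2"
proof -
  have "(\<Sum>l\<in>F. (1 + (real l)\<^sup>2) * (x l)\<^sup>2) \<le> infsum (\<lambda>l. (1 + (real l)\<^sup>2) * (x l)\<^sup>2) {1..}"
    using assms by (intro finite_sum_le_infsum) (auto simp: l2w_def)
  also have "\<dots> = (l2w_norm x)\<^sup>2" unfolding l2w_norm_def by (subst real_sqrt_pow2) (auto intro: infsum_nonneg)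
  finally show ?thesis .
qed

lemma l2w_add: "x \<in> l2w \<Longrightarrow> y \<in> l2w \<Longrightarrow> (\<lambda>l. x l + y l) \<in> l2w"
  unfolding l2w_def mem_Collect_eq
proof (rule summable_on_comparison_test[where g="\<lambda>l. (1 + (real l)\<^sup>2) * (x l + y l)\<^sup>2" and f="\<lambda>l. 2 * ((1 + (real l)\<^sup>2) * (x l)\<^sup>2) + 2 * ((1 + (real l)\<^sup>2) * (y l)\<^sup>2)"])
  fix l :: nat
  have "(x l + y l)\<^sup>2 \<le> 2 * (x l)\<^sup>2 + 2 * (y l)\<^sup>2"
    using zero_le_power2[of "x l - y l"] by (simp add: power2_eq_square algebra_simps)
  then have "(1 + (real l)\<^sup>2) * (x l + y l)\<^sup>2 \<le> (1 + (real l)\<^sup>2) * (2 * (x l)\<^sup>2 + 2 * (y l)\<^sup>2)"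
    by (rule mult_left_mono) simp
  then show "(1 + (real l)\<^sup>2) * (x l + y l)\<^sup>2 \<le> 2 * ((1 + (real l)\<^sup>2) * (x l)\<^sup>2) + 2 * ((1 + (real l)\<^sup>2) * (y l)\<^sup>2)"
    by (simp add: algebra_simps)
qed (auto intro!: summable_on_add summable_on_cmult_right)

lemma l2w_cmult: "x \<in> l2w \<Longrightarrow> (\<lambda>l. c * x l) \<in> l2w"
  unfolding l2w_def mem_Collect_eq
  using summable_on_cmult_right[of "\<lambda>l. (1 + (real l)\<^sup>2) * (x l)\<^sup>2" "{1..}" "c\<^sup>2"]
  by (simp add: power_mult_distrib mult.left_commute)

lemma l2w_diff: "x \<in> l2w \<Longrightarrow> y \<in> l2w \<Longrightarrow> (\<lambda>l. x l - y l) \<in> l2w"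
  using l2w_add[OF _ l2w_cmult[of y "-1"]] by simp

lemma l2w_finite_support: "finite {l. x l \<noteq> 0} \<Longrightarrow> x \<in> l2w"
  unfolding l2w_def mem_Collect_eq
  by (rule finite_nonzero_values_imp_summable_on) (auto elim!: rev_finite_subset)

text \<open>
  The symmetric form of which \<open>bil a x x\<close> is the interaction of an even density with the modes
  \<open>x\<close>. The index is shifted because sequences start at \<open>1\<close>.
\<close>

definition bil :: "(nat \<Rightarrow> real) \<Rightarrow> (nat \<Rightarrow> real) \<Rightarrow> (nat \<Rightarrow> real) \<Rightarrow> real" where
  "bil a x z = (\<Sum>l. a (Suc l) * x (Suc l) * z (Suc l))"

lemma bil_partial_bound:
  assumes a: "\<And>l. 1 \<le> l \<Longrightarrow> \<bar>a l\<bar> \<le> B" and x: "x \<in> l2w" and z: "z \<in> l2w"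
  shows "(\<Sum>l<n. \<bar>a (Suc l) * x (Suc l) * z (Suc l)\<bar>) \<le> B * (l2w_norm x * l2w_norm z)"
proof -
  have B: "0 \<le> B" using a[of 1] by linarith
  have sq: "(\<Sum>l<n. (y (Suc l))\<^sup>2) \<le> (l2w_norm y)\<^sup>2" if y: "y \<in> l2w" for y
  proof -
    have "(\<Sum>l<n. (y (Suc l))\<^sup>2) = (\<Sum>l\<in>Suc ` {..<n}. (y l)\<^sup>2)" by (subst sum.reindex) auto
    also have "\<dots> \<le> (\<Sum>l\<in>Suc ` {..<n}. (1 + (real l)\<^sup>2) * (y l)\<^sup>2)"
      by (intro sum_mono) (simp add: distrib_right)
    also have "\<dots> \<le> (l2w_norm y)\<^sup>2" by (rule l2w_partial_sum[OF y]) auto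
    finally show ?thesis .
  qed
  have "(\<Sum>l<n. \<bar>x (Suc l)\<bar> * \<bar>z (Suc l)\<bar>)\<^sup>2 \<le> (\<Sum>l<n. \<bar>x (Suc l)\<bar>\<^sup>2) * (\<Sum>l<n. \<bar>z (Suc l)\<bar>\<^sup>2)"
    by (rule Cauchy_Schwarz_ineq_sum)
  also have "\<dots> \<le> (l2w_norm x)\<^sup>2 * (l2w_norm z)\<^sup>2"
    using sq[OF x] sq[OF z] by (intro mult_mono) (auto intro: sum_nonneg)
  finally have "(\<Sum>l<n. \<bar>x (Suc l)\<bar> * \<bar>z (Suc l)\<bar>) \<le> l2w_norm x * l2w_norm z"
    by (intro power2_le_imp_le[OF _ mult_nonneg_nonneg[OF l2w_norm_nonneg l2w_norm_nonneg]]) (simp add: power_mult_distrib)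
  then have "B * (\<Sum>l<n. \<bar>x (Suc l)\<bar> * \<bar>z (Suc l)\<bar>) \<le> B * (l2w_norm x * l2w_norm z)" using B by (rule mult_left_mono)
  moreover have "(\<Sum>l<n. \<bar>a (Suc l) * x (Suc l) * z (Suc l)\<bar>) \<le> (\<Sum>l<n. B * (\<bar>x (Suc l)\<bar> * \<bar>z (Suc l)\<bar>))"
    using a by (intro sum_mono) (auto simp: abs_mult mult.assoc intro!: mult_right_mono)
  ultimately show ?thesis by (simp add: sum_distrib_left)
qed

lemma bil_summable:
  assumes a: "\<And>l. 1 \<le> l \<Longrightarrow> \<bar>a l\<bar> \<le> B" and x: "x \<in> l2w" and z: "z \<in> l2w"
  shows "summable (\<lambda>l. a (Suc l) * x (Suc l) * z (Suc l))"
  by (rule summable_rabs_cancel, rule summableI_nonneg_bounded[OF _ bil_partial_bound[OF assms]]) auto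

lemma bil_bound:
  assumes a: "\<And>l. 1 \<le> l \<Longrightarrow> \<bar>a l\<bar> \<le> B" and x: "x \<in> l2w" and z: "z \<in> l2w"
  shows "\<bar>bil a x z\<bar> \<le> B * (l2w_norm x * l2w_norm z)"
proof -
  have s: "summable (\<lambda>l. \<bar>a (Suc l) * x (Suc l) * z (Suc l)\<bar>)"
    by (rule summableI_nonneg_bounded[OF _ bil_partial_bound[OF assms]]) auto
  have "\<bar>bil a x z\<bar> \<le> (\<Sum>l. \<bar>a (Suc l) * x (Suc l) * z (Suc l)\<bar>)"
    unfolding bil_def by (rule summable_rabs[OF s])
  also have "\<dots> \<le> B * (l2w_norm x * l2w_norm z)"
    by (rule suminf_le_const[OF s bil_partial_bound[OF assms]])
  finally show ?thesis .
qed

lemma bil_linear: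
  assumes a: "\<And>l. 1 \<le> l \<Longrightarrow> \<bar>a l\<bar> \<le> B" and x: "x \<in> l2w" and y: "y \<in> l2w" and z: "z \<in> l2w"
  shows "bil a (\<lambda>l. x l + y l) z = bil a x z + bil a y z"
    and "bil a (\<lambda>l. c * x l) z = c * bil a x z" and "bil a x z = bil a z x"
proof -
  have s: "summable (\<lambda>l. a (Suc l) * x (Suc l) * z (Suc l))" "summable (\<lambda>l. a (Suc l) * y (Suc l) * z (Suc l))"
    using bil_summable[of a B x z] bil_summable[of a B y z] assms by blast+
  show "bil a (\<lambda>l. x l + y l) z = bil a x z + bil a y z"
    unfolding bil_def using suminf_add[OF s] by (simp add: algebra_simps)
  show "bil a (\<lambda>l. c * x l) z = c * bil a x z"
    unfolding bil_def using suminf_mult[OF s(1), of c] by (simp add: algebra_simps)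
  show "bil a x z = bil a z x" unfolding bil_def by (simp add: mult.assoc mult.commute mult.left_commute)
qed

lemma bil_LIMSEQ:
  assumes a: "\<And>l. 1 \<le> l \<Longrightarrow> \<bar>a l\<bar> \<le> B" and x: "x \<in> l2w" and z: "z \<in> l2w"
  shows "(\<lambda>N. \<Sum>l=1..N. a l * x l * z l) \<longlonglongrightarrow> bil a x z"
proof -
  have "(\<lambda>N. \<Sum>l<N. a (Suc l) * x (Suc l) * z (Suc l)) \<longlonglongrightarrow> bil a x z"
    unfolding bil_def by (rule summable_LIMSEQ[OF bil_summable[OF assms]])
  moreover have "(\<Sum>l<N. a (Suc l) * x (Suc l) * z (Suc l)) = (\<Sum>l=1..N. a l * x l * z l)" for N
    by (rule sum.reindex_bij_witness[of _ "\<lambda>l. l - 1" Suc]) auto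
  ultimately show ?thesis by simp
qed

text \<open>
  Cauchy and Schwarz with the weights \<open>1 / l\<close>: the weighted norm controls the uniform distance of a
  density from \<open>1\<close>.
\<close>

lemma l2w_sum_abs:
  assumes "x \<in> l2w"
  shows "(\<Sum>l=1..N. \<bar>x l\<bar>) \<le> 2 * l2w_norm x"
proof -
  have "(\<Sum>l=1..N. \<bar>x l\<bar>) = (\<Sum>l=1..N. (1 / real l) * (real l * \<bar>x l\<bar>))" by (intro sum.cong) auto
  also have "(\<dots>)\<^sup>2 \<le> (\<Sum>l=1..N. (1 / real l)\<^sup>2) * (\<Sum>l=1..N. (real l * \<bar>x l\<bar>)\<^sup>2)" by (rule Cauchy_Schwarz_ineq_sum)
  also have "\<dots> \<le> 4 * (l2w_norm x)\<^sup>2"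
  proof (rule mult_mono)
    show "(\<Sum>l=1..N. (1 / real l)\<^sup>2) \<le> 4" using sum_inverse_squares_le[of N] by (simp add: power_divide)
    have "(\<Sum>l=1..N. (real l * \<bar>x l\<bar>)\<^sup>2) \<le> (\<Sum>l=1..N. (1 + (real l)\<^sup>2) * (x l)\<^sup>2)"
      by (intro sum_mono) (simp add: power_mult_distrib distrib_right)
    also have "\<dots> \<le> (l2w_norm x)\<^sup>2" by (rule l2w_partial_sum[OF assms]) auto
    finally show "(\<Sum>l=1..N. (real l * \<bar>x l\<bar>)\<^sup>2) \<le> (l2w_norm x)\<^sup>2" .
  qed (auto intro: sum_nonneg)
  also have "\<dots> = (2 * l2w_norm x)\<^sup>2" by (simp add: power_mult_distrib)
  finally show ?thesis by (rule power2_le_imp_le) (simp add: l2w_norm_nonneg)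
qed

section \<open>The energy along the branch\<close>

locale branch =
  fixes a :: "nat \<Rightarrow> real" and W :: "real \<Rightarrow> real" and A \<kappa>s \<delta> :: real
    and L' :: "nat set" and y :: "nat \<Rightarrow> real"
    and P P' :: "real \<Rightarrow> nat \<Rightarrow> real" and K :: "real \<Rightarrow> real"
  assumes W: "potential a W"
    and A: "0 < A" and \<kappa>s: "0 < \<kappa>s"
    and L': "L' \<noteq> {}" "L' \<subseteq> {l. 1 \<le> l \<and> a l = A}"
    and y: "\<forall>i\<in>L'. y i \<noteq> 0"
    and \<delta>: "0 < \<delta>"
    and br: "nontrivial_branch W \<kappa>s \<delta> P K" and C1: "C1_curve \<delta> P P' K"
    and asymP: "(\<lambda>s. l2w_norm (\<lambda>l. P s l - s * (\<Sum>i\<in>L'. y i * unit_seq i l))) \<in> O[at 0](\<lambda>s. s\<^sup>2)"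
    and asymP': "(\<lambda>s. l2w_norm (\<lambda>l. P' s l - (\<Sum>i\<in>L'. y i * unit_seq i l))) \<in> O[at 0](\<lambda>s. s)"
    and K: "\<forall>s\<in>{0<..<\<delta>}. K s \<in> {0<..<\<kappa>s}"
begin

definition coeff_bound :: real where "coeff_bound = (SOME C. \<forall>l. \<bar>a l\<bar> \<le> C)"

lemma coeff_bound: "\<bar>a l\<bar> \<le> coeff_bound"
proof -
  have "convergent a" using potential_tendsto_0[OF W] by (auto simp: convergent_def)
  then have "Bseq a" by (rule convergent_imp_Bseq)
  then have "\<exists>C. \<forall>l. \<bar>a l\<bar> \<le> C" by (auto simp: Bseq_def)
  then show ?thesis unfolding coeff_bound_def by (rule someI2_ex) blast
qed

lemma coeff_bound_nonneg: "0 \<le> coeff_bound" using coeff_bound[of 0] by linarith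

lemmas bil_bound' = bil_bound[of a coeff_bound, OF coeff_bound] and bil_LIMSEQ' = bil_LIMSEQ[of a coeff_bound, OF coeff_bound]

lemma bil_add: "x \<in> l2w \<Longrightarrow> u \<in> l2w \<Longrightarrow> z \<in> l2w \<Longrightarrow> bil a (\<lambda>l. x l + u l) z = bil a x z + bil a u z"
  by (rule bil_linear(1)[of a coeff_bound]) (auto simp: coeff_bound)

lemma bil_scale: "x \<in> l2w \<Longrightarrow> z \<in> l2w \<Longrightarrow> bil a (\<lambda>l. c * x l) z = c * bil a x z"
  by (rule bil_linear(2)[of a coeff_bound x x]) (auto simp: coeff_bound)

lemma bil_sym: "bil a x z = bil a z x"
  unfolding bil_def by (simp add: mult.assoc mult.commute mult.left_commute)

lemma bil_sub: "x \<in> l2w \<Longrightarrow> u \<in> l2w \<Longrightarrow> z \<in> l2w \<Longrightarrow> bil a (\<lambda>l. x l - u l) z = bil a x z - bil a u z"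
  using bil_add[OF _ l2w_cmult[of u "-1"]] bil_scale[of u z "-1"] by simp

lemma bil_limit:
  assumes x: "eventually (\<lambda>t. x t \<in> l2w) F" "x' \<in> l2w" and z: "eventually (\<lambda>t. z t \<in> l2w) F" "z' \<in> l2w"
    and lx: "((\<lambda>t. l2w_norm (\<lambda>l. x t l - x' l)) \<longlongrightarrow> 0) F" and lz: "((\<lambda>t. l2w_norm (\<lambda>l. z t l - z' l)) \<longlongrightarrow> 0) F"
  shows "((\<lambda>t. bil a (x t) (z t)) \<longlongrightarrow> bil a x' z') F"
proof -
  let ?nx = "\<lambda>t. l2w_norm (\<lambda>l. x t l - x' l)" and ?nz = "\<lambda>t. l2w_norm (\<lambda>l. z t l - z' l)"
  have "((\<lambda>t. coeff_bound * (?nx t * ?nz t) + coeff_bound * (?nx t * l2w_norm z') + coeff_bound * (l2w_norm x' * ?nz t)) \<longlongrightarrow>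
    coeff_bound * (0 * 0) + coeff_bound * (0 * l2w_norm z') + coeff_bound * (l2w_norm x' * 0)) F"
    by (intro tendsto_intros lx lz)
  then have lim: "((\<lambda>t. coeff_bound * (?nx t * ?nz t) + coeff_bound * (?nx t * l2w_norm z') + coeff_bound * (l2w_norm x' * ?nz t)) \<longlongrightarrow> 0) F" by simp
  have "((\<lambda>t. bil a (x t) (z t) - bil a x' z') \<longlongrightarrow> 0) F"
  proof (rule Lim_null_comparison[OF _ lim])
    show "eventually (\<lambda>t. norm (bil a (x t) (z t) - bil a x' z')
      \<le> coeff_bound * (?nx t * ?nz t) + coeff_bound * (?nx t * l2w_norm z') + coeff_bound * (l2w_norm x' * ?nz t)) F"
      using x(1) z(1)
    proof eventually_elim
      case (elim t)
      let ?dx = "\<lambda>l. x t l - x' l" and ?dz = "\<lambda>l. z t l - z' l"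
      have dx: "?dx \<in> l2w" and dz: "?dz \<in> l2w" using elim x z by (auto intro: l2w_diff)
      have 1: "bil a ?dx ?dz = bil a (x t) ?dz - bil a x' ?dz" by (rule bil_sub[OF elim(1) x(2) dz])
      have 2: "bil a ?dx z' = bil a (x t) z' - bil a x' z'" by (rule bil_sub[OF elim(1) x(2) z(2)])
      have 3: "bil a (x t) ?dz = bil a (x t) (z t) - bil a (x t) z'"
        using bil_sub[OF elim(2) z(2) elim(1)] bil_sym by simp
      have "bil a (x t) (z t) - bil a x' z' = bil a ?dx ?dz + bil a ?dx z' + bil a x' ?dz"
        using 1 2 3 by linarith
      then show ?case
        using bil_bound'[OF dx dz] bil_bound'[OF dx z(2)] bil_bound'[OF x(2) dz] unfolding real_norm_def by linarith
    qed
  qed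
  then show ?thesis by (simp add: LIM_zero_iff)
qed

lemma P_l2w: "s \<in> {-\<delta><..<\<delta>} \<Longrightarrow> P s \<in> l2w" and P'_l2w: "s \<in> {-\<delta><..<\<delta>} \<Longrightarrow> P' s \<in> l2w"
  using br C1 by (auto simp: nontrivial_branch_def C1_curve_def)

definition p :: "real \<Rightarrow> real \<Rightarrow> real" where
  "p s = (SOME p. prob_density p \<and> even_on_circ p \<and> stationary W (K s) p \<and> (\<forall>l\<ge>1. mode p l = P s l))"

lemma p:
  assumes "s \<in> {-\<delta><..<\<delta>}"
  shows "prob_density (p s)" "even_on_circ (p s)" "stationary W (K s) (p s)" "\<And>l. 1 \<le> l \<Longrightarrow> mode (p s) l = P s l"
proof -
  have "\<exists>p. prob_density p \<and> even_on_circ p \<and> stationary W (K s) p \<and> (\<forall>l\<ge>1. mode p l = P s l)"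
    using br assms by (auto simp: nontrivial_branch_def)
  from someI_ex[OF this] show "prob_density (p s)" "even_on_circ (p s)" "stationary W (K s) (p s)" "\<And>l. 1 \<le> l \<Longrightarrow> mode (p s) l = P s l"
    unfolding p_def by auto
qed

lemma p_int: "s \<in> {-\<delta><..<\<delta>} \<Longrightarrow> integrable circ (p s)"
  using p(1) by (simp add: prob_density_def)

lemma hcoef_p:
  assumes "s \<in> {-\<delta><..<\<delta>}" "k \<noteq> 0"
  shows "hcoef (p s) k = P s (nat \<bar>k\<bar>)"
  using mode_eq_hcoef[OF p_int[OF assms(1)] p(2)[OF assms(1)], of k] p(4)[OF assms(1), of "nat \<bar>k\<bar>"] assms(2) by simp

lemma p_sqint: "s \<in> {-\<delta><..<\<delta>} \<Longrightarrow> sqint circ (p s)"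
  using p(3) by (auto simp: stationary_def weak_deriv_def L2_iff_sqint)

text \<open>
  The bound \<open>1/16\<close> makes the absolute coefficients sum up to at most \<open>1/4\<close>, which keeps the density
  between \<open>1/2\<close> and \<open>3/2\<close>, where its logarithm is under control.
\<close>

definition near_uniform :: "real \<Rightarrow> bool" where
  "near_uniform s \<longleftrightarrow> s \<in> {-\<delta><..<\<delta>} \<and> l2w_norm (P s) \<le> 1/16"

lemma near_uniform_coefficients:
  assumes "near_uniform s"
  shows "(\<Sum>k\<in>{- int N..int N} - {0}. \<bar>hcoef (p s) k\<bar>) \<le> 1/4"
proof -
  have s: "s \<in> {-\<delta><..<\<delta>}" "l2w_norm (P s) \<le> 1/16" using assms by (auto simp: near_uniform_def)
  have "(\<Sum>k\<in>{- int N..int N} - {0}. \<bar>hcoef (p s) k\<bar>) = (\<Sum>l=1..N. \<bar>P s l\<bar> + \<bar>P s l\<bar>)"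
    unfolding sum_int_split by (intro sum.cong) (auto simp: hcoef_p[OF s(1)])
  also have "\<dots> = 2 * (\<Sum>l=1..N. \<bar>P s l\<bar>)" by (simp add: sum_distrib_left)
  also have "\<dots> \<le> 2 * (2 * l2w_norm (P s))" using l2w_sum_abs[OF P_l2w[OF s(1)]] by (intro mult_left_mono) auto
  finally show ?thesis using s(2) by linarith
qed

lemma p_bounds:
  assumes "near_uniform s"
  shows "AE x in circ. 1/2 \<le> p s x \<and> p s x \<le> 3/2"
proof -
  have s: "s \<in> {-\<delta><..<\<delta>}" using assms by (simp add: near_uniform_def)
  show ?thesis using hcoef_sum_sup_bound[OF p_sqint[OF s] near_uniform_coefficients[OF assms]]
    by eventually_elim (rule abs_minus_1_le_half, simp add: prob_density_hcoef_0[OF p(1)[OF s]])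
qed

lemma p_fin:
  assumes "near_uniform s"
  shows "p s \<in> Pac_plus" "finite_energy W (p s)"
proof -
  have s: "s \<in> {-\<delta><..<\<delta>}" using assms by (simp add: near_uniform_def)
  have "AE x in circ. 0 < p s x" using p_bounds[OF assms] by eventually_elim simp
  then show P: "p s \<in> Pac_plus" using p(1)[OF s] by (simp add: Pac_plus_def)
  have "AE x in circ. p s x \<le> 3/2" using p_bounds[OF assms] by eventually_elim simp
  then show "finite_energy W (p s)" by (rule bounded_finite_energy(1)[OF potential_kernel_ok[OF W] P])
qed

text \<open>
  Parseval's identity with the known coefficients of \<open>ln (p t)\<close>; the constant in \<open>ln (p t)\<close> does not
  count, as the difference of two densities has mean zero.
\<close>

lemma log_pairing:
  assumes t: "near_uniform t" and s: "s \<in> {-\<delta><..<\<delta>}"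
  shows "1 / (2*pi) * (\<integral>x. ln (p t x) * (p t x - p s x) \<partial>circ) = K t * bil a (P t) (\<lambda>l. P t l - P s l)"
proof -
  have t': "t \<in> {-\<delta><..<\<delta>}" using t by (simp add: near_uniform_def)
  have pm: "p t \<in> borel_measurable circ" using p_int[OF t'] by auto
  have lnsq: "sqint circ (\<lambda>x. ln (p t x))"
  proof (rule sqint_bounded)
    show "(\<lambda>x. ln (p t x)) \<in> borel_measurable circ" using pm by measurable
    show "AE x in circ. \<bar>ln (p t x)\<bar> \<le> 1"
      using p_bounds[OF t]
    proof eventually_elim
      case (elim x)
      then have "\<bar>p t x - 1\<bar> \<le> 1/2" by linarith
      then show ?case using ln_Lipschitz[of "p t x" 1] elim by simp
    qed
  qed simp
  have dsq: "sqint circ (\<lambda>x. p t x - p s x)" by (intro sqint_diff p_sqint t' s)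
  have dh: "hcoef (\<lambda>x. p t x - p s x) k = (if k = 0 then 0 else P t (nat \<bar>k\<bar>) - P s (nat \<bar>k\<bar>))" for k
    using hcoef_diff[OF p_int[OF t'] p_int[OF s]] prob_density_hcoef_0 p(1) t' s hcoef_p by auto
  have "(\<Sum>k\<in>{- int N..int N}. hcoef (\<lambda>x. ln (p t x)) k * hcoef (\<lambda>x. p t x - p s x) k)
    = K t * (\<Sum>l=1..N. a l * P t l * (P t l - P s l))" for N
  proof -
    have "(\<Sum>k\<in>{- int N..int N}. hcoef (\<lambda>x. ln (p t x)) k * hcoef (\<lambda>x. p t x - p s x) k)
      = hcoef (\<lambda>x. ln (p t x)) 0 * hcoef (\<lambda>x. p t x - p s x) 0
        + (\<Sum>k\<in>{- int N..int N} - {0}. hcoef (\<lambda>x. ln (p t x)) k * hcoef (\<lambda>x. p t x - p s x) k)"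
      by (rule sum.remove) auto
    also have "\<dots> = (\<Sum>l=1..N. K t * (a l * P t l * (P t l - P s l)))"
      unfolding sum_int_split
      by (auto intro!: sum.cong simp: dh hcoef_p[OF t'] stationary_log_coefficients[OF W p(1,2,3)[OF t'] near_uniform_coefficients[OF t]])
    finally show ?thesis by (simp add: sum_distrib_left)
  qed
  then have "(\<lambda>N. 1 / (2*pi) * (2*pi * (K t * (\<Sum>l=1..N. a l * P t l * (P t l - P s l)))))
     \<longlonglongrightarrow> 1 / (2*pi) * (\<integral>x. ln (p t x) * (p t x - p s x) \<partial>circ)"
    using tendsto_mult[OF tendsto_const Parseval[OF lnsq dsq], of "1 / (2*pi)"] by simp
  moreover have "(\<lambda>N. K t * (\<Sum>l=1..N. a l * P t l * (P t l - P s l))) \<longlonglongrightarrow> K t * bil a (P t) (\<lambda>l. P t l - P s l)"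
    by (intro tendsto_intros bil_LIMSEQ' P_l2w t' l2w_diff s)
  ultimately show ?thesis using LIMSEQ_unique by simp
qed

text \<open>
  For an even density the indices \<open>k\<close> and \<open>- k\<close> contribute equally.
\<close>

lemma interaction_bil:
  assumes s: "s \<in> {-\<delta><..<\<delta>}"
  shows "interaction W (p s) (p s) = bil a (P s) (P s)"
proof -
  have "interaction_sum a N (p s) (p s) = (\<Sum>l=1..N. a l * P s l * P s l)" for N
    unfolding interaction_sum_def sum_int_split sum_distrib_left by (intro sum.cong) (auto simp: hcoef_p[OF s])
  then show ?thesis
    using LIMSEQ_unique[OF interaction_sum_limit[OF W p_sqint[OF s] p_int[OF s]]] bil_LIMSEQ'[OF P_l2w[OF s] P_l2w[OF s]] by simp
qed

text \<open>
  The tangent inequality of the convex function \<open>psi\<close> at \<open>p t\<close>. Exchanging \<open>s\<close> and \<open>t\<close> gives the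
  bound from the other side, so the difference quotient of the entropy is enclosed
  without differentiating under the integral.
\<close>

lemma entropy_increment:
  assumes s: "near_uniform s" and t: "near_uniform t"
  shows "entropy (p t) - entropy (p s) \<le> K t * bil a (P t) (\<lambda>l. P t l - P s l)"
proof -
  have s': "s \<in> {-\<delta><..<\<delta>}" and t': "t \<in> {-\<delta><..<\<delta>}" using s t by (auto simp: near_uniform_def)
  note S = finite_energyD[OF p_fin(2)[OF s]] and T = finite_energyD[OF p_fin(2)[OF t]]
  have psS: "integrable circ (\<lambda>x. psi (p s x))" and psT: "integrable circ (\<lambda>x. psi (p t x))"
    using integrable_psi_iff S(2,5) T(2,5) by auto
  have [measurable]: "p t \<in> borel_measurable circ" "p s \<in> borel_measurable circ" using S T by auto
  have i: "integrable circ (\<lambda>x. ln (p t x) * (p t x - p s x))"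
  proof (rule Bochner_Integration.integrable_bound)
    show "integrable circ (\<lambda>x. p t x - p s x)" using S T by auto
    show "AE x in circ. norm (ln (p t x) * (p t x - p s x)) \<le> norm (p t x - p s x)"
      using p_bounds[OF t]
    proof eventually_elim
      case (elim x)
      then have "\<bar>p t x - 1\<bar> \<le> 1/2" by linarith
      then have "\<bar>ln (p t x)\<bar> \<le> 1" using ln_Lipschitz[of "p t x" 1] elim by simp
      from mult_right_mono[OF this abs_ge_zero[of "p t x - p s x"]] show ?case by (simp add: abs_mult)
    qed
  qed measurable
  have "(\<integral>x. psi (p t x) - psi (p s x) \<partial>circ) \<le> (\<integral>x. ln (p t x) * (p t x - p s x) \<partial>circ)"
  proof (rule integral_mono_AE[OF _ i])
    show "integrable circ (\<lambda>x. psi (p t x) - psi (p s x))" using psS psT by auto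
    show "AE x in circ. psi (p t x) - psi (p s x) \<le> ln (p t x) * (p t x - p s x)"
      using p_bounds[OF t] p_bounds[OF s]
    proof eventually_elim
      case (elim x)
      then have "psi (p t x) + ln (p t x) * (p s x - p t x) \<le> psi (p s x)" by (intro psi_tangent) auto
      then show ?case by (simp add: algebra_simps)
    qed
  qed
  then have "1 / (2*pi) * (\<integral>x. psi (p t x) - psi (p s x) \<partial>circ) \<le> 1 / (2*pi) * (\<integral>x. ln (p t x) * (p t x - p s x) \<partial>circ)"
    by (rule mult_left_mono) simp
  moreover have "1 / (2*pi) * (\<integral>x. psi (p t x) - psi (p s x) \<partial>circ) = entropy (p t) - entropy (p s)"
    using psS psT entropy_psi[OF S(1,5)] entropy_psi[OF T(1,5)] by (simp add: right_diff_distrib diff_divide_distrib)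
  ultimately show ?thesis using log_pairing[OF t s'] by simp
qed

lemma l2w_norm_cong: "(\<And>l. 1 \<le> l \<Longrightarrow> x l = z l) \<Longrightarrow> l2w_norm x = l2w_norm z"
  unfolding l2w_norm_def by (intro arg_cong[where f=sqrt] infsum_cong) auto

lemma l2w_norm_zero: "(\<And>l. 1 \<le> l \<Longrightarrow> x l = 0) \<Longrightarrow> l2w_norm x = 0"
  unfolding l2w_norm_def by (subst infsum_0) auto

lemma P_0: "1 \<le> l \<Longrightarrow> P 0 l = 0"
  using br by (auto simp: nontrivial_branch_def)

lemma near_uniform_nearby: "\<exists>\<delta>1>0. \<delta>1 \<le> \<delta> \<and> (\<forall>s. \<bar>s\<bar> < \<delta>1 \<longrightarrow> near_uniform s)"
proof -
  have "((\<lambda>t. l2w_norm (\<lambda>l. P t l - P 0 l)) \<longlongrightarrow> 0) (at 0)"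
    using br \<delta> by (auto simp: nontrivial_branch_def)
  then have "eventually (\<lambda>t. l2w_norm (\<lambda>l. P t l - P 0 l) < 1/16) (at 0)" by (rule order_tendstoD) simp
  then obtain d where d: "0 < d" "\<And>t. t \<noteq> 0 \<Longrightarrow> \<bar>t\<bar> < d \<Longrightarrow> l2w_norm (\<lambda>l. P t l - P 0 l) < 1/16"
    unfolding eventually_at by (auto simp: dist_real_def)
  have "near_uniform s" if "\<bar>s\<bar> < min d \<delta>" for s
  proof (cases "s = 0")
    case True
    then show ?thesis using \<delta> l2w_norm_zero[of "P 0"] P_0 by (simp add: near_uniform_def)
  next
    case False
    have "l2w_norm (P s) = l2w_norm (\<lambda>l. P s l - P 0 l)" by (rule l2w_norm_cong) (simp add: P_0)
    also have "\<dots> < 1/16" using d(2)[OF False] that by simp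
    finally show ?thesis using that by (auto simp: near_uniform_def abs_less_iff)
  qed
  then show ?thesis using d(1) \<delta> by (intro exI[of _ "min d \<delta>"]) auto
qed

definition diff_quot :: "real \<Rightarrow> real \<Rightarrow> nat \<Rightarrow> real" where
  "diff_quot s t l = (P t l - P s l) / (t - s)"

text \<open>
  Up to limits, the entropy has the derivative \<open>K s * bil a (P s) (P' s)\<close>, and the
  interaction \<open>2 * bil a (P s) (P' s)\<close>.
\<close>

lemma energy_derivative:
  assumes \<delta>1: "0 < \<delta>1" "\<delta>1 \<le> \<delta>" "\<And>s. \<bar>s\<bar> < \<delta>1 \<Longrightarrow> near_uniform s" and s: "\<bar>s\<bar> < \<delta>1"
  shows "((\<lambda>t. energy W \<kappa>s (p t)) has_real_derivative (K s - \<kappa>s) * bil a (P s) (P' s)) (at s)"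
proof -
  have sm: "near_uniform s" and s': "s \<in> {-\<delta><..<\<delta>}" using \<delta>1(3)[OF s] by (auto simp: near_uniform_def)
  have "eventually (\<lambda>t. t \<in> {-\<delta>1<..<\<delta>1}) (nhds s)"
    using s by (intro eventually_nhds_in_open) (auto simp: abs_less_iff)
  then have ev: "eventually (\<lambda>t. t \<in> {-\<delta>1<..<\<delta>1} \<and> t \<noteq> s) (at s)"
    unfolding eventually_at_filter by (rule eventually_mono) auto
  have evs: "eventually (\<lambda>t. near_uniform t \<and> t \<noteq> s) (at s)"
    using ev by eventually_elim (auto intro!: \<delta>1(3) simp: abs_less_iff)
  have ev1: "eventually (\<lambda>t. P t \<in> l2w) (at s)" using evs by eventually_elim (auto simp: near_uniform_def intro: P_l2w)
  have qin: "diff_quot s t \<in> l2w" if "near_uniform t" for t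
  proof -
    have "(\<lambda>l. 1 / (t - s) * (P t l - P s l)) \<in> l2w"
      using that s' by (intro l2w_cmult l2w_diff P_l2w) (auto simp: near_uniform_def)
    then show ?thesis by (simp add: diff_quot_def[abs_def])
  qed
  have ev2: "eventually (\<lambda>t. diff_quot s t \<in> l2w) (at s)" using evs by eventually_elim (auto intro: qin)
  have lP: "((\<lambda>t. l2w_norm (\<lambda>l. P t l - P s l)) \<longlongrightarrow> 0) (at s)" using br s' by (auto simp: nontrivial_branch_def)
  have lQ: "((\<lambda>t. l2w_norm (\<lambda>l. diff_quot s t l - P' s l)) \<longlongrightarrow> 0) (at s)" using C1 s' by (auto simp: C1_curve_def diff_quot_def)
  have lc: "((\<lambda>t. l2w_norm (\<lambda>l. P s l - P s l)) \<longlongrightarrow> 0) (at s)" by (simp add: l2w_norm_zero)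
  note Ps = P_l2w[OF s'] and Ps' = P'_l2w[OF s']
  have b1: "((\<lambda>t. bil a (P t) (diff_quot s t)) \<longlongrightarrow> bil a (P s) (P' s)) (at s)"
    by (rule bil_limit[OF ev1 Ps ev2 Ps' lP lQ])
  have b2: "((\<lambda>t. bil a (P s) (diff_quot s t)) \<longlongrightarrow> bil a (P s) (P' s)) (at s)"
    by (rule bil_limit[OF _ Ps ev2 Ps' lc lQ]) (simp add: Ps)
  have "isCont K s" using br s' by (auto simp: nontrivial_branch_def continuous_on_eq_continuous_at)
  then have Kl: "(K \<longlongrightarrow> K s) (at s)" by (simp add: isCont_def)
  have scale: "bil a x (\<lambda>l. P t l - P s l) = (t - s) * bil a x (diff_quot s t)" if "near_uniform t" "t \<noteq> s" "x \<in> l2w" for x t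
  proof -
    have "bil a (\<lambda>l. (t - s) * diff_quot s t l) x = (t - s) * bil a (diff_quot s t) x" by (rule bil_scale[OF qin[OF that(1)] that(3)])
    moreover have "(\<lambda>l. (t - s) * diff_quot s t l) = (\<lambda>l. P t l - P s l)" using that by (auto simp: diff_quot_def)
    ultimately show ?thesis by (simp add: bil_sym)
  qed
  let ?L = "bil a (P s) (P' s)"
  let ?A = "\<lambda>t. K s * bil a (P s) (diff_quot s t)" and ?B = "\<lambda>t. K t * bil a (P t) (diff_quot s t)"
  have lA: "(?A \<longlongrightarrow> K s * ?L) (at s)" and lB: "(?B \<longlongrightarrow> K s * ?L) (at s)"
    by (intro tendsto_intros Kl b1 b2)+
  have ent_lim: "((\<lambda>t. (entropy (p t) - entropy (p s)) / (t - s)) \<longlongrightarrow> K s * ?L) (at s)"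
  proof -
    have "((\<lambda>t. (entropy (p t) - entropy (p s)) / (t - s) - K s * ?L) \<longlongrightarrow> 0) (at s)"
    proof (rule Lim_null_comparison)
      have "((\<lambda>t. \<bar>?A t - K s * ?L\<bar> + \<bar>?B t - K s * ?L\<bar>) \<longlongrightarrow> \<bar>K s * ?L - K s * ?L\<bar> + \<bar>K s * ?L - K s * ?L\<bar>) (at s)"
        by (intro tendsto_intros lA lB)
      then show "((\<lambda>t. \<bar>?A t - K s * ?L\<bar> + \<bar>?B t - K s * ?L\<bar>) \<longlongrightarrow> 0) (at s)" by simp
      show "eventually (\<lambda>t. norm ((entropy (p t) - entropy (p s)) / (t - s) - K s * ?L)
        \<le> \<bar>?A t - K s * ?L\<bar> + \<bar>?B t - K s * ?L\<bar>) (at s)"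
        using evs
      proof eventually_elim
        case (elim t)
        then have t: "near_uniform t" "t \<noteq> s" and Pt: "P t \<in> l2w" by (auto simp: near_uniform_def intro: P_l2w)
        let ?q = "(entropy (p t) - entropy (p s)) / (t - s)"
        have up: "entropy (p t) - entropy (p s) \<le> (t - s) * ?B t"
          using entropy_increment[OF sm t(1)] scale[OF t Pt] by (simp add: mult.left_commute)
        have "(\<lambda>l. P s l - P t l) = (\<lambda>l. (-1) * (P t l - P s l))" by auto
        then have "bil a (P s) (\<lambda>l. P s l - P t l) = - bil a (P s) (\<lambda>l. P t l - P s l)"
          using bil_scale[of "\<lambda>l. P t l - P s l" "P s" "-1"] l2w_diff[OF Pt Ps] Ps by (simp add: bil_sym[of "P s"])
        then have lo: "(t - s) * ?A t \<le> entropy (p t) - entropy (p s)"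
          using entropy_increment[OF t(1) sm] scale[OF t Ps] by (simp add: mult.left_commute)
        have "(?A t \<le> ?q \<and> ?q \<le> ?B t) \<or> (?B t \<le> ?q \<and> ?q \<le> ?A t)"
        proof (cases "s < t")
          case True
          then show ?thesis using up lo by (simp add: pos_divide_le_eq pos_le_divide_eq mult.commute)
        next
          case False
          then have "t - s < 0" using t by simp
          then show ?thesis using up lo by (simp add: neg_divide_le_eq neg_le_divide_eq mult.commute)
        qed
        then show ?case unfolding real_norm_def by linarith
      qed
    qed
    then show ?thesis by (simp add: LIM_zero_iff)
  qed
  have Q_lim: "((\<lambda>t. (bil a (P t) (P t) - bil a (P s) (P s)) / (t - s)) \<longlongrightarrow> ?L + ?L) (at s)"
  proof (rule Lim_transform_eventually[OF tendsto_add[OF b1 b2]])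
    show "eventually (\<lambda>t. bil a (P t) (diff_quot s t) + bil a (P s) (diff_quot s t) = (bil a (P t) (P t) - bil a (P s) (P s)) / (t - s)) (at s)"
      using evs
    proof eventually_elim
      case (elim t)
      then have t: "near_uniform t" "t \<noteq> s" and Pt: "P t \<in> l2w" by (auto simp: near_uniform_def intro: P_l2w)
      have "bil a (P t) (\<lambda>l. P t l - P s l) = bil a (P t) (P t) - bil a (P s) (P t)"
        using bil_sub[OF Pt Ps Pt] by (simp add: bil_sym[of "P t" "\<lambda>l. P t l - P s l"])
      moreover have "bil a (P s) (\<lambda>l. P t l - P s l) = bil a (P s) (P t) - bil a (P s) (P s)"
        using bil_sub[OF Pt Ps Ps] by (simp add: bil_sym[of "P s" "\<lambda>l. P t l - P s l"] bil_sym[of "P t" "P s"])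
      ultimately have "bil a (P t) (P t) - bil a (P s) (P s) = (t - s) * (bil a (P t) (diff_quot s t) + bil a (P s) (diff_quot s t))"
        using scale[OF t Pt] scale[OF t Ps] by (simp add: distrib_left)
      then show ?case using t by simp
    qed
  qed
  have E: "energy W \<kappa>s (p t) = entropy (p t) - \<kappa>s / 2 * bil a (P t) (P t)" if "near_uniform t" for t
    unfolding energy_def using interaction_bil[of t] that by (simp add: near_uniform_def)
  have "((\<lambda>t. (entropy (p t) - entropy (p s)) / (t - s) - \<kappa>s / 2 * ((bil a (P t) (P t) - bil a (P s) (P s)) / (t - s)))
     \<longlongrightarrow> K s * ?L - \<kappa>s / 2 * (?L + ?L)) (at s)"
    by (intro tendsto_intros ent_lim Q_lim)
  then have "((\<lambda>t. (energy W \<kappa>s (p t) - energy W \<kappa>s (p s)) / (t - s)) \<longlongrightarrow> K s * ?L - \<kappa>s / 2 * (?L + ?L)) (at s)"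
  proof (rule Lim_transform_eventually)
    show "eventually (\<lambda>t. (entropy (p t) - entropy (p s)) / (t - s) - \<kappa>s / 2 * ((bil a (P t) (P t) - bil a (P s) (P s)) / (t - s))
       = (energy W \<kappa>s (p t) - energy W \<kappa>s (p s)) / (t - s)) (at s)"
      using evs by eventually_elim (simp add: E sm diff_divide_distrib right_diff_distrib)
  qed
  moreover have "K s * ?L - \<kappa>s / 2 * (?L + ?L) = (K s - \<kappa>s) * ?L" by (simp add: algebra_simps)
  ultimately show ?thesis by (simp add: has_field_derivative_iff)
qed

text \<open>The tangent of the branch at the bifurcation.\<close>

definition direction :: "nat \<Rightarrow> real" where "direction l = (\<Sum>i\<in>L'. y i * unit_seq i l)"

lemma L'_finite: "finite L'"
proof -
  have "eventually (\<lambda>l. a l < A) sequentially" using order_tendstoD(2)[OF potential_tendsto_0[OF W] A] .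
  then obtain N where "\<And>l. l \<ge> N \<Longrightarrow> a l < A" by (auto simp: eventually_sequentially)
  then have "L' \<subseteq> {..<N}" using L'(2) by (force simp: not_le[symmetric])
  then show ?thesis by (rule finite_subset) simp
qed

lemma direction_eq: "direction l = (if l \<in> L' then y l else 0)"
proof -
  have "direction l = (\<Sum>i\<in>L'. if l = i then y l else 0)" unfolding direction_def by (intro sum.cong) (auto simp: unit_seq_def)
  then show ?thesis using L'_finite by simp
qed

lemma direction_l2w: "direction \<in> l2w"
  by (rule l2w_finite_support, rule finite_subset[OF _ L'_finite]) (auto simp: direction_eq split: if_splits)

lemma bil_direction_pos: "0 < bil a direction direction"
proof -
  obtain i where i: "i \<in> L'" using L' by auto
  show ?thesis
    unfolding bil_def
  proof (rule suminf_pos2)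
    show "summable (\<lambda>l. a (Suc l) * direction (Suc l) * direction (Suc l))"
      using bil_summable[of a coeff_bound direction direction] coeff_bound direction_l2w by blast
    show "0 \<le> a (Suc l) * direction (Suc l) * direction (Suc l)" for l
      using L' A by (cases "Suc l \<in> L'") (auto simp: direction_eq mult.assoc)
    have "1 \<le> i" "a i = A" "y i \<noteq> 0" using i L' y by auto
    then show "0 < a (Suc (i - 1)) * direction (Suc (i - 1)) * direction (Suc (i - 1))"
      using i A by (auto simp: direction_eq mult.assoc zero_less_mult_iff)
  qed
qed

text \<open>
  Since \<open>P s = s * direction + O(s\<^sup>2)\<close> and \<open>P' s = direction + O(s)\<close>, the form is
  \<open>s * bil a direction direction + O(s\<^sup>2)\<close>.
\<close>

lemma bil_pos: "\<exists>\<delta>2>0. \<forall>s. 0 < s \<and> s < \<delta>2 \<longrightarrow> 0 < bil a (P s) (P' s)"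
proof -
  obtain c1 where c1: "eventually (\<lambda>s. l2w_norm (\<lambda>l. P s l - s * direction l) \<le> c1 * s\<^sup>2) (at 0)" "0 < c1"
    using landau_o.bigE[OF asymP] by (auto simp: l2w_norm_nonneg direction_def)
  obtain c2 where c2: "eventually (\<lambda>s. l2w_norm (\<lambda>l. P' s l - direction l) \<le> c2 * \<bar>s\<bar>) (at 0)" "0 < c2"
    using landau_o.bigE[OF asymP'] by (auto simp: l2w_norm_nonneg direction_def)
  define nY where "nY = l2w_norm direction"
  have nY: "0 \<le> nY" by (simp add: nY_def l2w_norm_nonneg)
  define C where "C = coeff_bound * (c1 * nY) + coeff_bound * (nY * c2) + coeff_bound * (c1 * c2)"
  have C: "0 \<le> C" unfolding C_def using coeff_bound_nonneg nY c1 c2 by (intro add_nonneg_nonneg mult_nonneg_nonneg) auto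
  obtain d where d: "0 < d" "\<And>s. s \<noteq> 0 \<Longrightarrow> \<bar>s\<bar> < d \<Longrightarrow> l2w_norm (\<lambda>l. P s l - s * direction l) \<le> c1 * s\<^sup>2 \<and> l2w_norm (\<lambda>l. P' s l - direction l) \<le> c2 * \<bar>s\<bar>"
    using eventually_conj[OF c1(1) c2(1)] unfolding eventually_at by (auto simp: dist_real_def)
  define \<delta>2 where "\<delta>2 = min (min d \<delta>) (min 1 (bil a direction direction / (C + 1)))"
  have "0 < \<delta>2" using d \<delta> bil_direction_pos C by (simp add: \<delta>2_def)
  moreover have "0 < bil a (P s) (P' s)" if s: "0 < s" "s < \<delta>2" for s
  proof -
    have s1: "s < d" "s < \<delta>" "s < 1" "s < bil a direction direction / (C + 1)" using s by (auto simp: \<delta>2_def)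
    have sd: "s \<in> {-\<delta><..<\<delta>}" using s s1 by auto
    let ?X = "\<lambda>l. P s l - s * direction l" and ?Z = "\<lambda>l. P' s l - direction l" and ?sY = "\<lambda>l. s * direction l"
    have nX: "l2w_norm ?X \<le> c1 * s\<^sup>2" and nZ: "l2w_norm ?Z \<le> c2 * s" using d(2)[of s] s s1 by auto
    have X: "?X \<in> l2w" and Z: "?Z \<in> l2w" and sY: "?sY \<in> l2w"
      using P_l2w[OF sd] P'_l2w[OF sd] direction_l2w by (auto intro: l2w_diff l2w_cmult)
    note P'in = P'_l2w[OF sd]
    have e1: "bil a ?X (P' s) = bil a (P s) (P' s) - s * bil a direction (P' s)"
      using bil_sub[OF P_l2w[OF sd] sY P'in] bil_scale[OF direction_l2w P'in] by simp
    have e2: "bil a direction ?Z = bil a direction (P' s) - bil a direction direction"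
      using bil_sub[OF P'in direction_l2w direction_l2w] bil_sym[of direction ?Z] bil_sym[of direction "P' s"] by linarith
    have e3: "bil a ?X ?Z = bil a ?X (P' s) - bil a ?X direction"
      using bil_sub[OF P'in direction_l2w X] bil_sym[of ?X ?Z] bil_sym[of ?X "P' s"] bil_sym[of ?X direction] by linarith
    have "bil a (P s) (P' s) = s * bil a direction direction + s * bil a direction ?Z + bil a ?X ?Z + bil a ?X direction"
    proof -
      have "s * bil a direction ?Z = s * bil a direction (P' s) - s * bil a direction direction" unfolding e2 by (rule right_diff_distrib)
      then show ?thesis using e1 e3 by linarith
    qed
    moreover have "\<bar>bil a ?X direction\<bar> \<le> coeff_bound * (c1 * nY) * s\<^sup>2"
    proof -
      have "\<bar>bil a ?X direction\<bar> \<le> coeff_bound * (l2w_norm ?X * l2w_norm direction)" by (rule bil_bound'[OF X direction_l2w])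
      also have "\<dots> \<le> coeff_bound * ((c1 * s\<^sup>2) * nY)" unfolding nY_def
        using coeff_bound_nonneg nX by (intro mult_left_mono mult_right_mono l2w_norm_nonneg)
      finally show ?thesis by (simp add: mult_ac)
    qed
    moreover have "\<bar>s * bil a direction ?Z\<bar> \<le> coeff_bound * (nY * c2) * s\<^sup>2"
    proof -
      have "\<bar>bil a direction ?Z\<bar> \<le> coeff_bound * (l2w_norm direction * l2w_norm ?Z)" by (rule bil_bound'[OF direction_l2w Z])
      also have "\<dots> \<le> coeff_bound * (nY * (c2 * s))" unfolding nY_def
        using coeff_bound_nonneg nZ by (intro mult_left_mono l2w_norm_nonneg)
      finally have "s * \<bar>bil a direction ?Z\<bar> \<le> s * (coeff_bound * (nY * (c2 * s)))" using s by (intro mult_left_mono) auto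
      then show ?thesis using s by (simp add: abs_mult power2_eq_square mult_ac)
    qed
    moreover have "\<bar>bil a ?X ?Z\<bar> \<le> coeff_bound * (c1 * c2) * s\<^sup>2"
    proof -
      have "\<bar>bil a ?X ?Z\<bar> \<le> coeff_bound * (l2w_norm ?X * l2w_norm ?Z)" by (rule bil_bound'[OF X Z])
      also have "\<dots> \<le> coeff_bound * ((c1 * s\<^sup>2) * (c2 * 1))"
      proof (intro mult_left_mono mult_mono nX coeff_bound_nonneg l2w_norm_nonneg)
        have "c2 * s \<le> c2 * 1" using s1 c2(2) by (intro mult_left_mono) auto
        then show "l2w_norm ?Z \<le> c2 * 1" using nZ by linarith
      qed (use c1 in auto)
      finally show ?thesis by (simp add: mult_ac)
    qed
    moreover have "coeff_bound * (c1 * nY) * s\<^sup>2 + coeff_bound * (nY * c2) * s\<^sup>2 + coeff_bound * (c1 * c2) * s\<^sup>2 = C * s\<^sup>2"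
      by (simp add: C_def algebra_simps)
    moreover have "C * s\<^sup>2 < s * bil a direction direction"
    proof -
      have "s * (C + 1) < bil a direction direction" using s1(4) C by (simp add: pos_less_divide_eq)
      moreover have "C * s \<le> s * (C + 1)" using s by (simp add: algebra_simps)
      ultimately have "C * s < bil a direction direction" by linarith
      then have "s * (C * s) < s * bil a direction direction" using s by (intro mult_strict_left_mono) auto
      then show ?thesis by (simp add: power2_eq_square mult_ac)
    qed
    ultimately show ?thesis by linarith
  qed
  ultimately show ?thesis by blast
qed

text \<open>At the bifurcation all modes vanish, so the density is the uniform one.\<close>

lemma p_0_energy: "energy W \<kappa>s (p 0) = 0"
proof -
  have z: "0 \<in> {-\<delta><..<\<delta>}" using \<delta> by simp
  have P: "prob_density (p 0)" "integrable circ (p 0)" using p(1)[OF z] p_int[OF z] by auto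
  have "hcoef (\<lambda>x. p 0 x - 1) k = 0" for k
    using hcoef_p[OF z, of k] prob_density_hcoef_0[OF P(1)] P_0 P(2) by (subst hcoef_diff) (auto simp: hcoef_1)
  then have "AE x in circ. p 0 x - 1 = 0" using P by (intro hcoef_zero_imp_zero) auto
  then have one: "AE x in circ. p 0 x = 1" by eventually_elim simp
  have m: "p 0 \<in> borel_measurable circ" using P by auto
  have "(\<integral>x. p 0 x * ln (p 0 x) \<partial>circ) = (\<integral>x. 0 \<partial>circ)"
    by (rule integral_cong_AE) (use one m in \<open>auto elim!: eventually_mono\<close>)
  then show ?thesis using interaction_AE_1[OF W m one] by (simp add: energy_def entropy_def)
qed

text \<open>
  The derivative of the energy at the fixed parameter \<open>\<kappa>s\<close> is negative for small \<open>s > 0\<close>, where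
  \<open>K s < \<kappa>s\<close>, and the energy starts at \<open>0\<close>.
\<close>

theorem branch_lowers_energy: "\<exists>\<rho>. finite_energy W \<rho> \<and> energy W \<kappa>s \<rho> < 0"
proof -
  obtain \<delta>1 where \<delta>1: "0 < \<delta>1" "\<delta>1 \<le> \<delta>" "\<And>s. \<bar>s\<bar> < \<delta>1 \<Longrightarrow> near_uniform s" using near_uniform_nearby by blast
  obtain \<delta>2 where \<delta>2: "0 < \<delta>2" "\<And>s. 0 < s \<Longrightarrow> s < \<delta>2 \<Longrightarrow> 0 < bil a (P s) (P' s)" using bil_pos by blast
  define s where "s = min \<delta>1 \<delta>2 / 2"
  have s: "0 < s" "s < \<delta>1" "s < \<delta>2" using \<delta>1 \<delta>2 by (auto simp: s_def)
  have D: "((\<lambda>t. energy W \<kappa>s (p t)) has_real_derivative (K s - \<kappa>s) * bil a (P s) (P' s)) (at s)" if "\<bar>s\<bar> < \<delta>1" for s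
    by (rule energy_derivative[OF \<delta>1(1,2) _ that]) (rule \<delta>1(3))
  have "energy W \<kappa>s (p s) < energy W \<kappa>s (p 0)"
  proof (rule DERIV_neg_imp_decreasing_open[OF s(1)])
    fix t assume t: "0 < t" "t < s"
    have "K t < \<kappa>s" using K t s \<delta>1 by auto
    then have "(K t - \<kappa>s) * bil a (P t) (P' t) < 0" using \<delta>2(2)[of t] t s by (intro mult_neg_pos) auto
    then show "\<exists>y. ((\<lambda>t. energy W \<kappa>s (p t)) has_real_derivative y) (at t) \<and> y < 0"
      using D[of t] t s by auto
  next
    show "continuous_on {0..s} (\<lambda>t. energy W \<kappa>s (p t))"
    proof (intro continuous_at_imp_continuous_on ballI)
      fix x assume "x \<in> {0..s}"
      then have x: "\<bar>x\<bar> < \<delta>1" using s by auto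
      show "isCont (\<lambda>t. energy W \<kappa>s (p t)) x" by (rule DERIV_isCont[OF D[OF x]])
    qed
  qed
  then have "energy W \<kappa>s (p s) < 0" by (simp add: p_0_energy)
  moreover have "finite_energy W (p s)" using \<delta>1(3)[of s] s by (intro p_fin) auto
  ultimately show ?thesis by blast
qed

end

section \<open>Perturbation of the potential\<close>

lemma transition_point_imp_tame:
  assumes W: "potential a W" and tp: "transition_point W \<kappa>c"
  shows "tame W"
  unfolding tame_def
proof (intro ballI notI)
  fix \<rho> assume \<rho>: "\<rho> \<in> Pac_plus" and inf: "infinite_attraction W \<rho>"
  have pos: "0 < \<kappa>c" and gm: "global_minimizer W \<kappa>c uniform_density" using tp by (auto simp: transition_point_def)
  have "free_energy W uniform_density \<kappa>c \<le> free_energy W \<rho> \<kappa>c" using gm \<rho> by (simp add: global_minimizer_def)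
  then show False
    using free_energy_infinite_attraction[OF inf pos] uniform_finite_energy[OF W] by (simp add: free_energy_finite)
qed

lemma transition_point_nonneg:
  assumes W: "potential a W" and tp: "transition_point W \<kappa>c" and \<sigma>: "finite_energy W \<sigma>"
  shows "0 \<le> energy W \<kappa>c \<sigma>"
proof -
  have pos: "0 < \<kappa>c" and gm: "global_minimizer W \<kappa>c uniform_density" using tp by (auto simp: transition_point_def)
  show ?thesis
    using minimizer_iff[OF W transition_point_imp_tame[OF W tp] pos] gm \<sigma> uniform_finite_energy(2)[OF W] by simp
qed

text \<open>
  Up to the transition point the energy is nonnegative by interpolation, and beyond it the minimum
  is attained, hence finite.
\<close>

lemma transition_point_lower_bound:
  assumes W: "potential a W" and tp: "transition_point W \<kappa>c" and \<kappa>: "0 < \<kappa>"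
  shows "\<exists>C. \<forall>\<sigma>. finite_energy W \<sigma> \<longrightarrow> - C \<le> energy W \<kappa> \<sigma>"
proof (cases "\<kappa> \<le> \<kappa>c")
  case True
  have pos: "0 < \<kappa>c" using tp by (simp add: transition_point_def)
  have "0 \<le> energy W \<kappa> \<sigma>" if f: "finite_energy W \<sigma>" for \<sigma>
    unfolding energy_interpolate[OF pos, of W \<kappa> \<sigma>]
    using True \<kappa> pos finite_energyD(8)[OF f] transition_point_nonneg[OF W tp f]
    by (intro add_nonneg_nonneg mult_nonneg_nonneg) auto
  then show ?thesis by (intro exI[of _ 0]) simp
next
  case False
  then obtain \<rho> where "global_minimizer W \<kappa> \<rho>" using tp by (auto simp: transition_point_def not_le)
  then have "\<forall>\<sigma>. finite_energy W \<sigma> \<longrightarrow> energy W \<kappa> \<rho> \<le> energy W \<kappa> \<sigma>"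
    using minimizer_iff[OF W transition_point_imp_tame[OF W tp] \<kappa>] by simp
  then show ?thesis by (intro exI[of _ "- energy W \<kappa> \<rho>"]) simp
qed

lemma potential_diff:
  assumes W: "potential a W" and W': "potential a' W'"
  shows "potential (\<lambda>l. a' l - a l) (\<lambda>x. W' x - W x)"
proof -
  note k = potential_kernel_ok[OF W] and k' = potential_kernel_ok[OF W']
  have kd: "kernel_ok (\<lambda>x. W' x - W x)" by (rule kernel_ok_diff[OF k' k])
  let ?V = "\<lambda>N x. W' x - W x - (\<Sum>l=1..N. (a' l - a l) * cos (real l * x))"
  have sq: "sqint circ (\<lambda>x. W x - trunc_kernel a N x)" "sqint circ (\<lambda>x. W' x - trunc_kernel a' N x)" for N
    using kernel_ok_diff[OF k kernel_ok_trunc] kernel_ok_diff[OF k' kernel_ok_trunc] by (auto simp: kernel_ok_def)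
  have V: "?V N x = (W' x - trunc_kernel a' N x) - (W x - trunc_kernel a N x)" for N x
    by (simp add: trunc_kernel_def sum_subtractf left_diff_distrib)
  have "(\<lambda>N. \<integral>x. (?V N x)\<^sup>2 \<partial>circ) \<longlonglongrightarrow> 0"
  proof (rule Lim_null_comparison[OF always_eventually])
    let ?b = "\<lambda>N. 2 * (\<integral>x. (W' x - trunc_kernel a' N x)\<^sup>2 \<partial>circ) + 2 * (\<integral>x. (W x - trunc_kernel a N x)\<^sup>2 \<partial>circ)"
    have "?b \<longlonglongrightarrow> 2 * 0 + 2 * 0"
      using W W' by (intro tendsto_intros) (auto simp: potential_def trunc_kernel_def)
    then show "?b \<longlonglongrightarrow> 0" by simp
    show "\<forall>N. norm (\<integral>x. (?V N x)\<^sup>2 \<partial>circ) \<le> ?b N"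
    proof
      fix N
      have "(\<integral>x. (?V N x)\<^sup>2 \<partial>circ) \<le> (\<integral>x. 2 * (W' x - trunc_kernel a' N x)\<^sup>2 + 2 * (W x - trunc_kernel a N x)\<^sup>2 \<partial>circ)"
      proof (rule integral_mono)
        show "integrable circ (\<lambda>x. (?V N x)\<^sup>2)"
          unfolding V using sqint_square[OF sqint_diff[OF sq(2) sq(1)]] .
        show "(?V N x)\<^sup>2 \<le> 2 * (W' x - trunc_kernel a' N x)\<^sup>2 + 2 * (W x - trunc_kernel a N x)\<^sup>2" for x
          unfolding V using zero_le_power2[of "(W' x - trunc_kernel a' N x) + (W x - trunc_kernel a N x)"]
          by (simp add: power2_sum power2_diff)
      qed (use sqint_square[OF sq(1)] sqint_square[OF sq(2)] in auto)
      also have "\<dots> = ?b N" using sqint_square[OF sq(1)] sqint_square[OF sq(2)] by simp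
      finally have "(\<integral>x. (?V N x)\<^sup>2 \<partial>circ) \<le> ?b N" .
      moreover have "0 \<le> (\<integral>x. (?V N x)\<^sup>2 \<partial>circ)" by (rule integral_nonneg_AE) auto
      ultimately show "norm (\<integral>x. (?V N x)\<^sup>2 \<partial>circ) \<le> ?b N" by simp
    qed
  qed
  then show ?thesis using kd by (simp add: potential_def kernel_ok_def sqint_def)
qed

text \<open>
  The sum of the absolute coefficients bounds all partial sums, and an almost everywhere bound survives
  the mean-square limit.
\<close>

lemma potential_bounded:
  assumes V: "potential b V" and sum: "(\<lambda>l. \<bar>b l\<bar>) summable_on {1..}" "infsum (\<lambda>l. \<bar>b l\<bar>) {1..} \<le> \<epsilon>"
  shows "AE x in circ. \<bar>V x\<bar> \<le> \<epsilon>"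
proof (rule AE_bound_L2_limit)
  show "sqint circ (trunc_kernel b N)" for N using kernel_ok_trunc by (simp add: kernel_ok_def)
  show "sqint circ V" using potential_kernel_ok[OF V] by (simp add: kernel_ok_def)
  show "(\<lambda>N. \<integral>x. (trunc_kernel b N x - V x)\<^sup>2 \<partial>circ) \<longlonglongrightarrow> 0"
    using V by (simp add: potential_def trunc_kernel_def power2_commute)
  show "\<bar>trunc_kernel b N x\<bar> \<le> \<epsilon>" for N x
  proof -
    have "\<bar>trunc_kernel b N x\<bar> \<le> (\<Sum>l=1..N. \<bar>b l * cos (real l * x)\<bar>)" unfolding trunc_kernel_def by (rule sum_abs)
    also have "\<dots> \<le> (\<Sum>l=1..N. \<bar>b l\<bar>)"
      by (intro sum_mono) (simp add: abs_mult mult_left_le)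
    also have "\<dots> \<le> infsum (\<lambda>l. \<bar>b l\<bar>) {1..}" by (rule finite_sum_le_infsum[OF sum(1)]) auto
    finally show ?thesis using sum(2) by linarith
  qed
qed

text \<open>Translation invariance of null sets, section by section.\<close>

lemma kernel_bound_product:
  assumes V: "kernel_ok V" and b: "AE x in circ. \<bar>V x\<bar> \<le> \<epsilon>"
  shows "AE z in circ \<Otimes>\<^sub>M circ. \<bar>V (fst z - snd z)\<bar> \<le> \<epsilon>"
proof (rule circ2.AE_pair_measure)
  have Vm[measurable]: "V \<in> borel_measurable borel" and per: "\<And>x. V (x + 2*pi) = V x" and ev: "\<And>x. V (- x) = V x"
    using V by (auto simp: kernel_ok_def)
  note km[measurable] = kernel_measurable[OF Vm]
  show "{z \<in> space (circ \<Otimes>\<^sub>M circ). \<bar>V (fst z - snd z)\<bar> \<le> \<epsilon>} \<in> sets (circ \<Otimes>\<^sub>M circ)" by measurable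
  show "AE x in circ. AE y in circ. \<bar>V (fst (x, y) - snd (x, y))\<bar> \<le> \<epsilon>"
  proof (rule AE_I2)
    fix x assume "x \<in> space circ"
    then have x: "x \<in> {0..<2*pi}" by simp
    let ?f = "\<lambda>y. indicator {y. \<epsilon> < \<bar>V y\<bar>} y :: ennreal"
    have fm: "?f \<in> borel_measurable borel" by measurable
    have "(\<integral>\<^sup>+y. ?f y \<partial>circ) = 0"
      using b fm by (subst nn_integral_0_iff_AE) (auto elim!: eventually_mono simp: indicator_def)
    then have "(\<integral>\<^sup>+y. ?f (y - x) \<partial>circ) = 0"
      using nn_integral_circ_shift[OF fm _ x] per by (simp add: indicator_def)
    moreover have "(\<lambda>y. ?f (y - x)) \<in> borel_measurable circ" using fm by measurable
    ultimately have "AE y in circ. ?f (y - x) = 0" by (simp add: nn_integral_0_iff_AE)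
    then have "AE y in circ. \<bar>V (y - x)\<bar> \<le> \<epsilon>" by eventually_elim (auto simp: indicator_def split: if_splits)
    moreover have "V (y - x) = V (x - y)" for y using ev[of "x - y"] by simp
    ultimately show "AE y in circ. \<bar>V (fst (x, y) - snd (x, y))\<bar> \<le> \<epsilon>" by simp
  qed
qed

lemma bounded_kernel_interaction:
  assumes V: "kernel_ok V" and b: "AE x in circ. \<bar>V x\<bar> \<le> \<epsilon>" and u: "integrable circ u" and r: "integrable circ r"
  shows "finite_interaction V u r" "\<bar>interaction V u r\<bar> \<le> 1 / (4*pi\<^sup>2) * (\<epsilon> * ((\<integral>x. \<bar>u x\<bar> \<partial>circ) * (\<integral>x. \<bar>r x\<bar> \<partial>circ)))"
proof -
  have Vm: "V \<in> borel_measurable borel" using V by (simp add: kernel_ok_def)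
  have m: "(\<lambda>(x, y). V (x - y) * u x * r y) \<in> borel_measurable (circ \<Otimes>\<^sub>M circ)"
    using interaction_integrand_measurable[OF Vm, of u r] u r by auto
  note pr = integrable_product_circ[OF integrable_abs[OF u] integrable_abs[OF r]]
  have i: "integrable (circ \<Otimes>\<^sub>M circ) (\<lambda>z. \<epsilon> * (case z of (x, y) \<Rightarrow> \<bar>u x\<bar> * \<bar>r y\<bar>))" using pr(1) by simp
  have le: "AE z in circ \<Otimes>\<^sub>M circ. norm (case z of (x, y) \<Rightarrow> V (x - y) * u x * r y) \<le> \<epsilon> * (case z of (x, y) \<Rightarrow> \<bar>u x\<bar> * \<bar>r y\<bar>)"
    using kernel_bound_product[OF V b]
  proof eventually_elim
    case (elim z)
    from mult_right_mono[OF elim, of "\<bar>u (fst z)\<bar> * \<bar>r (snd z)\<bar>"]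
    show ?case by (simp add: case_prod_beta abs_mult mult.assoc)
  qed
  have k: "integrable (circ \<Otimes>\<^sub>M circ) (\<lambda>(x, y). V (x - y) * u x * r y)"
  proof (rule Bochner_Integration.integrable_bound[OF i m])
    show "AE z in circ \<Otimes>\<^sub>M circ. norm (case z of (x, y) \<Rightarrow> V (x - y) * u x * r y)
      \<le> norm (\<epsilon> * (case z of (x, y) \<Rightarrow> \<bar>u x\<bar> * \<bar>r y\<bar>))"
      using le by eventually_elim (erule order_trans, simp only: real_norm_def abs_ge_self)
  qed
  then show "finite_interaction V u r" by (simp add: finite_interaction_def)
  have "\<bar>\<integral>(x, y). V (x - y) * u x * r y \<partial>(circ \<Otimes>\<^sub>M circ)\<bar>
    \<le> (\<integral>z. norm (case z of (x, y) \<Rightarrow> V (x - y) * u x * r y) \<partial>(circ \<Otimes>\<^sub>M circ))"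
    using integral_norm_bound[of "circ \<Otimes>\<^sub>M circ" "\<lambda>(x, y). V (x - y) * u x * r y"] by simp
  also have "\<dots> \<le> (\<integral>z. \<epsilon> * (case z of (x, y) \<Rightarrow> \<bar>u x\<bar> * \<bar>r y\<bar>) \<partial>(circ \<Otimes>\<^sub>M circ))"
    by (rule integral_mono_AE[OF integrable_norm[OF k] i le])
  also have "\<dots> = \<epsilon> * ((\<integral>x. \<bar>u x\<bar> \<partial>circ) * (\<integral>x. \<bar>r x\<bar> \<partial>circ))" using pr(2) by simp
  finally show "\<bar>interaction V u r\<bar> \<le> 1 / (4*pi\<^sup>2) * (\<epsilon> * ((\<integral>x. \<bar>u x\<bar> \<partial>circ) * (\<integral>x. \<bar>r x\<bar> \<partial>circ)))"
    by (simp add: interaction_def abs_mult divide_right_mono)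
qed

text \<open>
  As the uniform density does not interact, the interaction of \<open>\<sigma>\<close> is that of \<open>\<sigma> - 1\<close>, which is at most
  \<open>\<epsilon>\<close> times the square of its mean absolute value, and Pinsker's inequality applies.
\<close>

lemma bounded_kernel_le_entropy:
  assumes V: "potential b V" and bd: "AE x in circ. \<bar>V x\<bar> \<le> \<epsilon>" "0 \<le> \<epsilon>"
    and \<sigma>: "prob_density \<sigma>" "integrable circ (\<lambda>x. \<sigma> x * ln (\<sigma> x))"
  shows "\<bar>interaction V \<sigma> \<sigma>\<bar> \<le> 4 * \<epsilon> * entropy \<sigma>" "\<bar>interaction V \<sigma> \<sigma>\<bar> \<le> \<epsilon>"
proof -
  note Vk = potential_kernel_ok[OF V]
  have i: "integrable circ \<sigma>" and nn: "AE x in circ. 0 \<le> \<sigma> x" using \<sigma>(1) by (auto simp: prob_density_def)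
  have m: "\<sigma> \<in> borel_measurable circ" using i by auto
  let ?z = "\<lambda>x. \<sigma> x - 1"
  have zi: "integrable circ ?z" using i by simp
  note K = bounded_kernel_interaction[OF Vk bd(1)]
  have z0: "interaction V (\<lambda>_. 1) r = 0" if "integrable circ r" for r by (rule interaction_uniform_left[OF V that])
  have one: "integrable circ (\<lambda>_. 1::real)" by simp
  have "interaction V \<sigma> \<sigma> = interaction V ?z \<sigma> + interaction V (\<lambda>_. 1) \<sigma>"
    using finite_interaction_add_left(2)[OF K(1)[OF zi i] K(1)[OF one i]] by simp
  also have "\<dots> = interaction V ?z \<sigma>" using z0[OF i] by simp
  also have "\<dots> = interaction V ?z ?z + interaction V ?z (\<lambda>_. 1)"
    using finite_interaction_add_right(2)[OF K(1)[OF zi zi] K(1)[OF zi one]] by simp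
  also have "interaction V ?z (\<lambda>_. 1) = 0"
    using interaction_commute[OF Vk, of ?z "\<lambda>_. 1"] z0[OF zi] m by simp
  finally have e: "interaction V \<sigma> \<sigma> = interaction V ?z ?z" by simp
  have "\<bar>interaction V ?z ?z\<bar> \<le> 1 / (4*pi\<^sup>2) * (\<epsilon> * ((\<integral>x. \<bar>?z x\<bar> \<partial>circ) * (\<integral>x. \<bar>?z x\<bar> \<partial>circ)))"
    by (rule K(2)[OF zi zi])
  also have "\<dots> \<le> 1 / (4*pi\<^sup>2) * (\<epsilon> * (16 * pi\<^sup>2 * entropy \<sigma>))"
    using Pinsker[OF \<sigma>] bd(2) by (intro mult_left_mono) (auto simp: power2_eq_square)
  finally show "\<bar>interaction V \<sigma> \<sigma>\<bar> \<le> 4 * \<epsilon> * entropy \<sigma>" by (simp add: e)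
  have "(\<integral>x. \<bar>\<sigma> x\<bar> \<partial>circ) = (\<integral>x. \<sigma> x \<partial>circ)"
    by (rule integral_cong_AE) (use nn m in \<open>auto elim!: eventually_mono\<close>)
  then have "(\<integral>x. \<bar>\<sigma> x\<bar> \<partial>circ) = 2*pi" using prob_density_integral[OF \<sigma>(1)] by simp
  then show "\<bar>interaction V \<sigma> \<sigma>\<bar> \<le> \<epsilon>" using K(2)[OF i i] by (simp add: power2_eq_square)
qed

text \<open>
  Potentials at bounded distance have the same densities of finite energy, and on them the interactions
  differ by at most a constant, and by at most a multiple of the entropy.
\<close>

locale perturbation =
  fixes a a' :: "nat \<Rightarrow> real" and W W' :: "real \<Rightarrow> real" and \<epsilon> :: real
  assumes W: "potential a W" and W': "potential a' W'"
    and close: "AE x in circ. \<bar>W' x - W x\<bar> \<le> \<epsilon>" and \<epsilon>: "0 \<le> \<epsilon>"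
begin

abbreviation "V \<equiv> \<lambda>x. W' x - W x"

lemma V: "potential (\<lambda>l. a' l - a l) V"
  by (rule potential_diff[OF W W'])

lemma finite_energy_perturb: "finite_energy W' \<sigma> \<longleftrightarrow> finite_energy W \<sigma>"
proof -
  have "finite_interaction W' \<sigma> \<sigma> \<longleftrightarrow> finite_interaction W \<sigma> \<sigma>" if "\<sigma> \<in> Pac_plus"
  proof -
    have kV: "finite_interaction V \<sigma> \<sigma>"
      using bounded_kernel_interaction(1)[OF potential_kernel_ok[OF V] close] Pac_plusD(2)[OF that] by simp
    have e: "(\<lambda>(x, y). W' (x - y) * \<sigma> x * \<sigma> y)
      = (\<lambda>z. (case z of (x, y) \<Rightarrow> W (x - y) * \<sigma> x * \<sigma> y) + (case z of (x, y) \<Rightarrow> (W' (x - y) - W (x - y)) * \<sigma> x * \<sigma> y))"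
      "(\<lambda>(x, y). W (x - y) * \<sigma> x * \<sigma> y)
      = (\<lambda>z. (case z of (x, y) \<Rightarrow> W' (x - y) * \<sigma> x * \<sigma> y) - (case z of (x, y) \<Rightarrow> (W' (x - y) - W (x - y)) * \<sigma> x * \<sigma> y))"
      by (auto simp: algebra_simps)
    show ?thesis
    proof
      assume "finite_interaction W' \<sigma> \<sigma>"
      then show "finite_interaction W \<sigma> \<sigma>" using kV unfolding finite_interaction_def e(2) by (rule Bochner_Integration.integrable_diff)
    next
      assume "finite_interaction W \<sigma> \<sigma>"
      then show "finite_interaction W' \<sigma> \<sigma>" using kV unfolding finite_interaction_def e(1) by (rule Bochner_Integration.integrable_add)
    qed
  qed
  then show ?thesis by (auto simp: finite_energy_def finite_interaction_def)
qed

lemma interaction_perturb: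
  assumes "finite_energy W \<sigma>"
  shows "interaction W' \<sigma> \<sigma> = interaction W \<sigma> \<sigma> + interaction V \<sigma> \<sigma>"
proof -
  have "finite_interaction W \<sigma> \<sigma>" "finite_interaction W' \<sigma> \<sigma>"
    using finite_energyD(6)[OF assms] finite_energyD(6)[of W' \<sigma>] finite_energy_perturb assms by auto
  then show ?thesis using interaction_kernel_diff[of W' \<sigma> \<sigma> W] by (simp add: finite_interaction_def)
qed

lemma interaction_perturb_bounds:
  assumes f: "finite_energy W \<sigma>"
  shows "\<bar>interaction W' \<sigma> \<sigma> - interaction W \<sigma> \<sigma>\<bar> \<le> 4 * \<epsilon> * entropy \<sigma>"
    "\<bar>interaction W' \<sigma> \<sigma> - interaction W \<sigma> \<sigma>\<bar> \<le> \<epsilon>"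
  using bounded_kernel_le_entropy[OF V close \<epsilon> finite_energyD(1,5)[OF f]] interaction_perturb[OF f] by auto

lemma tame_perturb:
  assumes t: "tame W"
  shows "tame W'"
  unfolding tame_def
proof (intro ballI notI)
  fix \<sigma> assume \<sigma>: "\<sigma> \<in> Pac_plus" and inf: "infinite_attraction W' \<sigma>"
  let ?C = "circ \<Otimes>\<^sub>M circ"
  have il: "integrable circ (\<lambda>x. \<sigma> x * ln (\<sigma> x))" using inf by (simp add: infinite_attraction_def)
  note P = Pac_plusD[OF \<sigma>]
  let ?w = "\<lambda>z. case z of (x, y) \<Rightarrow> W (x - y) * \<sigma> x * \<sigma> y"
  let ?w' = "\<lambda>z. case z of (x, y) \<Rightarrow> W' (x - y) * \<sigma> x * \<sigma> y"
  let ?s = "\<lambda>z. case z of (x, y) \<Rightarrow> \<sigma> x * \<sigma> y"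
  have si: "integrable ?C ?s" by (rule integrable_product_circ(1)[OF P(2) P(2)])
  have wm: "?w \<in> borel_measurable ?C"
    using interaction_integrand_measurable[OF _ P(3) P(3)] potential_kernel_ok[OF W] by (simp add: kernel_ok_def)
  have "(\<integral>\<^sup>+z. ennreal (?w' z) \<partial>?C) \<le> (\<integral>\<^sup>+z. ennreal (?w z) + ennreal (\<epsilon> * ?s z) \<partial>?C)"
  proof (rule nn_integral_mono_AE)
    show "AE z in ?C. ennreal (?w' z) \<le> ennreal (?w z) + ennreal (\<epsilon> * ?s z)"
      using kernel_bound_product[OF potential_kernel_ok[OF V] close] AE_circ_product[OF P(4)]
    proof eventually_elim
      case (elim z)
      have s: "0 < \<sigma> (fst z) * \<sigma> (snd z)" using elim by simp
      have "W' (fst z - snd z) \<le> W (fst z - snd z) + \<epsilon>" using elim(1) by linarith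
      then have "W' (fst z - snd z) * (\<sigma> (fst z) * \<sigma> (snd z)) \<le> (W (fst z - snd z) + \<epsilon>) * (\<sigma> (fst z) * \<sigma> (snd z))"
        using s by (intro mult_right_mono) auto
      then have "?w' z \<le> ?w z + \<epsilon> * ?s z" by (simp add: case_prod_beta algebra_simps)
      then have "ennreal (?w' z) \<le> ennreal (?w z + \<epsilon> * ?s z)" by (rule ennreal_leI)
      also have "\<dots> \<le> ennreal (?w z) + ennreal (\<epsilon> * ?s z)"
      proof (cases "0 \<le> ?w z")
        case True
        then show ?thesis using s \<epsilon> by (subst ennreal_plus[symmetric]) (auto simp: case_prod_beta)
      next
        case False
        then have "ennreal (?w z + \<epsilon> * ?s z) \<le> ennreal (\<epsilon> * ?s z)" by (intro ennreal_leI) simp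
        then show ?thesis by (simp add: add_increasing)
      qed
      finally show ?case .
    qed
  qed
  also have "\<dots> = (\<integral>\<^sup>+z. ennreal (?w z) \<partial>?C) + (\<integral>\<^sup>+z. ennreal (\<epsilon> * ?s z) \<partial>?C)"
    using wm si by (intro nn_integral_add) auto
  also have "\<dots> < top"
  proof -
    have "(\<integral>\<^sup>+z. ennreal (?w z) \<partial>?C) < top" using t \<sigma> il by (auto simp: tame_def infinite_attraction_def less_top)
    moreover have "(\<integral>\<^sup>+z. ennreal (\<epsilon> * ?s z) \<partial>?C) < top"
      using integrable_mult_right[OF si, of \<epsilon>] unfolding real_integrable_def infinity_ennreal_def less_top[symmetric] by blast
    ultimately show ?thesis by (simp add: less_top)
  qed
  finally show False using inf by (simp add: infinite_attraction_def)
qed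

text \<open>
  Adding a bounded function to the potential shifts the energy by at most a constant, so the lower
  bounds that yield minimizers persist. Comparison with the entropy keeps the energy
  nonnegative for small \<open>\<kappa>\<close>, and \<open>\<rho>\<close> makes it negative at \<open>\<kappa>1\<close>.
\<close>

theorem perturbed_transition:
  assumes tp: "transition_point W \<kappa>c"
    and \<rho>: "0 < \<kappa>1" "finite_energy W \<rho>" "energy W \<kappa>1 \<rho> + \<kappa>1 / 2 * \<epsilon> < 0"
  shows "\<exists>\<kappa>c'. transition_point W' \<kappa>c' \<and> \<kappa>c' \<le> \<kappa>1"
proof (rule transition_point_exists[OF W'])
  have pos: "0 < \<kappa>c" using tp by (simp add: transition_point_def)
  show t: "tame W'" by (rule tame_perturb[OF transition_point_imp_tame[OF W tp]])
  have Eb: "energy W \<kappa> \<sigma> - \<kappa> / 2 * \<epsilon> \<le> energy W' \<kappa> \<sigma>" "energy W' \<kappa> \<sigma> \<le> energy W \<kappa> \<sigma> + \<kappa> / 2 * \<epsilon>"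
    if "finite_energy W \<sigma>" "0 < \<kappa>" for \<sigma> \<kappa>
  proof -
    have "\<bar>\<kappa> / 2 * (interaction W' \<sigma> \<sigma> - interaction W \<sigma> \<sigma>)\<bar> \<le> \<kappa> / 2 * \<epsilon>"
      using interaction_perturb_bounds(2)[OF that(1)] that(2) by (simp add: abs_mult)
    moreover have "\<kappa> / 2 * (interaction W' \<sigma> \<sigma> - interaction W \<sigma> \<sigma>) = energy W \<kappa> \<sigma> - energy W' \<kappa> \<sigma>"
      by (simp add: energy_def right_diff_distrib)
    ultimately show "energy W \<kappa> \<sigma> - \<kappa> / 2 * \<epsilon> \<le> energy W' \<kappa> \<sigma>" "energy W' \<kappa> \<sigma> \<le> energy W \<kappa> \<sigma> + \<kappa> / 2 * \<epsilon>"
      by linarith+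
  qed
  show "\<exists>\<rho>. global_minimizer W' \<kappa> \<rho>" if \<kappa>: "0 < \<kappa>" for \<kappa>
  proof (rule minimizer_exists[OF W' t _ \<kappa>])
    fix \<kappa> :: real assume k: "0 < \<kappa>"
    obtain C where C: "\<And>\<sigma>. finite_energy W \<sigma> \<Longrightarrow> - C \<le> energy W \<kappa> \<sigma>"
      using transition_point_lower_bound[OF W tp k] by blast
    have "- (C + \<kappa> / 2 * \<epsilon>) \<le> energy W' \<kappa> \<sigma>" if "finite_energy W' \<sigma>" for \<sigma>
    proof -
      have f: "finite_energy W \<sigma>" using that finite_energy_perturb by simp
      show ?thesis using C[OF f] Eb(1)[OF f k] by linarith
    qed
    then show "\<exists>C. \<forall>\<sigma>. finite_energy W' \<sigma> \<longrightarrow> - C \<le> energy W' \<kappa> \<sigma>" by blast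
  qed
  \<comment> \<open>\<open>d\<close> times the entropy bounds the new interaction: \<open>2 / \<kappa>c\<close> is the bound for \<open>W\<close>, and \<open>4 * \<epsilon>\<close> the change.\<close>
  define d where "d = 2 / \<kappa>c + 4 * \<epsilon>"
  have d: "0 < d" using pos \<epsilon> by (simp add: d_def add_pos_nonneg)
  show "0 < 2 / d" using d by simp
  show "0 \<le> energy W' (2 / d) \<sigma>" if f': "finite_energy W' \<sigma>" for \<sigma>
  proof -
    have f: "finite_energy W \<sigma>" using f' finite_energy_perturb by simp
    have "2 / \<kappa>c * (\<kappa>c / 2 * interaction W \<sigma> \<sigma>) \<le> 2 / \<kappa>c * entropy \<sigma>"
      using transition_point_nonneg[OF W tp f] pos by (intro mult_left_mono) (auto simp: energy_def)
    then have "interaction W \<sigma> \<sigma> \<le> 2 / \<kappa>c * entropy \<sigma>" using pos by simp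
    then have "interaction W' \<sigma> \<sigma> \<le> 2 / \<kappa>c * entropy \<sigma> + 4 * \<epsilon> * entropy \<sigma>"
      using interaction_perturb_bounds(1)[OF f] by linarith
    also have "\<dots> = d * entropy \<sigma>" by (simp add: d_def distrib_right)
    finally have "1 / d * interaction W' \<sigma> \<sigma> \<le> 1 / d * (d * entropy \<sigma>)" using d by (intro mult_left_mono) auto
    then show ?thesis using d by (simp add: energy_def)
  qed
  show "0 < \<kappa>1" "finite_energy W' \<rho>" using \<rho> finite_energy_perturb by auto
  show "energy W' \<kappa>1 \<rho> < 0" using Eb(2)[OF \<rho>(2,1)] \<rho>(3) by linarith
qed

end

section \<open>Discontinuity of the transition and its stability\<close>

text \<open>
  Since the coefficients tend to zero, only finitely many of them reach \<open>a i\<close>.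
\<close>

lemma max_coefficient_exists:
  assumes a: "a \<longlonglongrightarrow> (0::real)" and i: "1 \<le> i" "0 < a i"
  shows "\<exists>A. is_max (a ` {1..}) A \<and> a i \<le> A"
proof -
  have "eventually (\<lambda>l. a l < a i) sequentially" using order_tendstoD(2)[OF a i(2)] .
  then obtain N where N: "\<And>l. l \<ge> N \<Longrightarrow> a l < a i" by (auto simp: eventually_sequentially)
  let ?S = "{l. 1 \<le> l \<and> a i \<le> a l}"
  have "?S \<subseteq> {..<N}" using N by (force simp: not_le[symmetric])
  then have fin: "finite ?S" by (rule finite_subset) simp
  have iS: "i \<in> ?S" using i by simp
  define A where "A = Max (a ` ?S)"
  have "A \<in> a ` ?S" unfolding A_def using fin iS by (intro Max_in) auto
  moreover have le: "a l \<le> A" if "l \<in> ?S" for l unfolding A_def using fin that by (intro Max_ge) auto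
  moreover have "a l \<le> A" if "1 \<le> l" for l
    using le[OF iS] le[of l] that by (cases "a i \<le> a l") auto
  ultimately have "is_max (a ` {1..}) A" by (auto simp: is_max_def)
  then show ?thesis using le[OF iS] by blast
qed

theorem theorem2p6:
  fixes a :: "nat \<Rightarrow> real" and W :: "real \<Rightarrow> real" and A \<kappa>s \<kappa>c \<delta> :: real
    and L L' :: "nat set" and y :: "nat \<Rightarrow> real"
    and P P' :: "real \<Rightarrow> nat \<Rightarrow> real" and K :: "real \<Rightarrow> real"
  assumes W: "potential a W"
    and A: "is_max (a ` {1..}) A" "0 < A"
    and L: "L = {l. 1 \<le> l \<and> a l = A}"
    and \<kappa>s: "\<kappa>s = 2 / A"
    and \<kappa>c: "transition_point W \<kappa>c"
    and L': "L' \<noteq> {}" "L' \<subseteq> L"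
    and y: "\<forall>i\<in>L'. y i \<noteq> 0"
    and \<delta>: "0 < \<delta>"
    and branch: "nontrivial_branch W \<kappa>s \<delta> P K" "C1_curve \<delta> P P' K"
    and P: "(\<lambda>s. l2w_norm (\<lambda>l. P s l - s * (\<Sum>i\<in>L'. y i * unit_seq i l))) \<in> O[at 0](\<lambda>s. s\<^sup>2)"
    and P': "(\<lambda>s. l2w_norm (\<lambda>l. P' s l - (\<Sum>i\<in>L'. y i * unit_seq i l))) \<in> O[at 0](\<lambda>s. s)"
    and K: "\<forall>s\<in>{0<..<\<delta>}. K s \<in> {0<..<\<kappa>s}"
  shows "\<kappa>c < \<kappa>s \<and> discontinuous_transition_point W \<kappa>c \<and>
    (\<exists>\<epsilon>>0. \<forall>a' W'. potential a' W' \<and>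
        (\<lambda>l. \<bar>a l - a' l\<bar>) summable_on {1..} \<and> infsum (\<lambda>l. \<bar>a l - a' l\<bar>) {1..} < \<epsilon> \<longrightarrow>
        (\<exists>A'. is_max (a' ` {1..}) A' \<and> 0 < A' \<and>
           (\<exists>\<kappa>c'. discontinuous_transition_point W' \<kappa>c' \<and> \<kappa>c' < 2 / A')))"
proof (intro conjI)
  have \<kappa>s0: "0 < \<kappa>s" using A \<kappa>s by simp
  have aA: "a l \<le> A" if "1 \<le> l" for l using A(1) that by (auto simp: is_max_def)
  interpret br: branch a W A \<kappa>s \<delta> L' y P P' K
    by standard (use W A \<kappa>s0 L L' y \<delta> branch P P' K in auto)
  obtain \<rho> where \<rho>: "finite_energy W \<rho>" "energy W \<kappa>s \<rho> < 0" using br.branch_lowers_energy by blast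
  note tame = transition_point_imp_tame[OF W \<kappa>c]
  have pos: "0 < \<kappa>c" using \<kappa>c by (simp add: transition_point_def)
  show lt: "\<kappa>c < \<kappa>s"
  proof (rule ccontr)
    assume "\<not> \<kappa>c < \<kappa>s"
    then consider "\<kappa>s < \<kappa>c" | "\<kappa>s = \<kappa>c" by linarith
    then have "global_minimizer W \<kappa>s uniform_density"
      using \<kappa>c \<kappa>s0 by cases (auto simp: transition_point_def unique_global_minimizer_def)
    then show False using minimizer_iff[OF W tame \<kappa>s0] uniform_finite_energy(2)[OF W] \<rho> by force
  qed
  have lt2: "\<kappa>c < 2 / A" using lt unfolding \<kappa>s .
  show "discontinuous_transition_point W \<kappa>c"
    by (rule early_transition_discontinuous[OF W aA A(2) \<kappa>c lt2])
  define \<eta> where "\<eta> = - energy W \<kappa>s \<rho>"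
  have \<eta>: "0 < \<eta>" using \<rho> by (simp add: \<eta>_def)
  define q where "q = \<bar>interaction W \<rho> \<rho>\<bar> + 1"
  have q: "0 < q" by (simp add: q_def add_nonneg_pos)
  \<comment> \<open>Below \<open>\<kappa>s\<close>, but so close that \<open>\<rho>\<close> keeps at least half of its negative energy.\<close>
  define \<kappa>1 where "\<kappa>1 = max (\<kappa>s / 2) (\<kappa>s - \<eta> / q)"
  have \<kappa>1: "0 < \<kappa>1" "\<kappa>1 < \<kappa>s" "\<kappa>s - \<kappa>1 \<le> \<eta> / q" using \<kappa>s0 \<eta> q by (auto simp: \<kappa>1_def)
  have E1: "energy W \<kappa>1 \<rho> \<le> - \<eta> / 2"
  proof -
    have "energy W \<kappa>1 \<rho> = - \<eta> + (\<kappa>s - \<kappa>1) / 2 * interaction W \<rho> \<rho>"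
      by (simp add: \<eta>_def energy_def algebra_simps diff_divide_distrib)
    moreover have "(\<kappa>s - \<kappa>1) / 2 * interaction W \<rho> \<rho> \<le> (\<kappa>s - \<kappa>1) / 2 * q"
      using \<kappa>1 by (intro mult_left_mono) (auto simp: q_def)
    moreover have "(\<kappa>s - \<kappa>1) / 2 * q \<le> (\<eta> / q) / 2 * q"
      using \<kappa>1 q by (intro mult_right_mono) auto
    moreover have "(\<eta> / q) / 2 * q = \<eta> / 2" using q by simp
    ultimately show ?thesis by linarith
  qed
  \<comment> \<open>The three bounds keep the largest coefficient positive, the energy of \<open>\<rho>\<close> at \<open>\<kappa>1\<close> negative, and
     \<open>\<kappa>1\<close> below \<open>2 / A'\<close> for the largest coefficient \<open>A'\<close> of the new potential.\<close>
  define \<epsilon> where "\<epsilon> = min (A / 2) (min (\<eta> / (2 * \<kappa>1)) ((2 / \<kappa>1 - A) / 2))"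
  have A\<kappa>1: "A < 2 / \<kappa>1" using \<kappa>1 A \<kappa>s by (simp add: field_simps)
  have \<epsilon>: "0 < \<epsilon>" "\<epsilon> < A" "\<kappa>1 / 2 * \<epsilon> < \<eta> / 2" "A + \<epsilon> < 2 / \<kappa>1"
  proof -
    show "0 < \<epsilon>" using A \<eta> \<kappa>1 A\<kappa>1 by (simp add: \<epsilon>_def)
    have "\<epsilon> \<le> A / 2" "\<epsilon> \<le> \<eta> / (2 * \<kappa>1)" "\<epsilon> \<le> (2 / \<kappa>1 - A) / 2"
      unfolding \<epsilon>_def by (rule min.cobounded1 min.coboundedI2[OF min.cobounded1] min.coboundedI2[OF min.cobounded2])+
    moreover from this(2) have "\<kappa>1 / 2 * \<epsilon> \<le> \<kappa>1 / 2 * (\<eta> / (2 * \<kappa>1))" using \<kappa>1 by (intro mult_left_mono) auto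
    moreover have "\<kappa>1 / 2 * (\<eta> / (2 * \<kappa>1)) = \<eta> / 4" using \<kappa>1 by simp
    ultimately show "\<epsilon> < A" "\<kappa>1 / 2 * \<epsilon> < \<eta> / 2" using A \<eta> by linarith+
    have "A + \<epsilon> \<le> A + (2 / \<kappa>1 - A) / 2" using \<open>\<epsilon> \<le> (2 / \<kappa>1 - A) / 2\<close> by (rule add_left_mono)
    also have "\<dots> = (A + 2 / \<kappa>1) / 2" by (simp add: field_simps)
    also have "\<dots> < 2 / \<kappa>1" using A\<kappa>1 by simp
    finally show "A + \<epsilon> < 2 / \<kappa>1" .
  qed
  show "\<exists>\<epsilon>>0. \<forall>a' W'. potential a' W' \<and>
        (\<lambda>l. \<bar>a l - a' l\<bar>) summable_on {1..} \<and> infsum (\<lambda>l. \<bar>a l - a' l\<bar>) {1..} < \<epsilon> \<longrightarrow>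
        (\<exists>A'. is_max (a' ` {1..}) A' \<and> 0 < A' \<and>
           (\<exists>\<kappa>c'. discontinuous_transition_point W' \<kappa>c' \<and> \<kappa>c' < 2 / A'))"
  proof (rule exI[of _ \<epsilon>], intro conjI allI impI \<epsilon>(1), elim conjE)
    fix a' W'
    assume W': "potential a' W'" and sm: "(\<lambda>l. \<bar>a l - a' l\<bar>) summable_on {1..}"
      and inf: "infsum (\<lambda>l. \<bar>a l - a' l\<bar>) {1..} < \<epsilon>"
    have cl: "\<bar>a l - a' l\<bar> < \<epsilon>" if "1 \<le> l" for l
      using finite_sum_le_infsum[OF sm, of "{l}"] inf that by simp
    have "AE x in circ. \<bar>W' x - W x\<bar> \<le> \<epsilon>"
      by (rule potential_bounded[OF potential_diff[OF W W']]) (use sm inf in \<open>simp_all add: abs_minus_commute\<close>)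
    then interpret pt: perturbation a a' W W' \<epsilon>
      by unfold_locales (use W W' \<epsilon> in auto)
    obtain i where i: "1 \<le> i" "a i = A" using A(1) by (auto simp: is_max_def)
    have "0 < a' i" using cl[OF i(1)] i(2) \<epsilon>(2) by linarith
    from max_coefficient_exists[OF potential_tendsto_0[OF W'] i(1) this]
    obtain A' where A': "is_max (a' ` {1..}) A'" "a' i \<le> A'" by blast
    have A'0: "0 < A'" using A'(2) \<open>0 < a' i\<close> by linarith
    have a'A': "a' l \<le> A'" if "1 \<le> l" for l using A'(1) that by (auto simp: is_max_def)
    obtain l where l: "1 \<le> l" "A' = a' l" using A'(1) by (auto simp: is_max_def)
    have "A' < 2 / \<kappa>1" using cl[OF l(1)] aA[OF l(1)] l(2) \<epsilon>(4) by linarith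
    then have \<kappa>1A': "\<kappa>1 < 2 / A'" using A'0 \<kappa>1 by (simp add: field_simps)
    obtain \<kappa>c' where tp': "transition_point W' \<kappa>c'" "\<kappa>c' \<le> \<kappa>1"
      using pt.perturbed_transition[OF \<kappa>c \<kappa>1(1) \<rho>(1)] E1 \<epsilon>(3) by auto
    have lt': "\<kappa>c' < 2 / A'" using tp'(2) \<kappa>1A' by linarith
    have "discontinuous_transition_point W' \<kappa>c'"
      by (rule early_transition_discontinuous[OF W' a'A' A'0 tp'(1) lt'])
    then show "\<exists>A'. is_max (a' ` {1..}) A' \<and> 0 < A' \<and>
           (\<exists>\<kappa>c'. discontinuous_transition_point W' \<kappa>c' \<and> \<kappa>c' < 2 / A')"
      using A'(1) A'0 lt' by blast
  qed
qed

end
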